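(* Let $K$ be a field, let $n\ge 1$, let $B_n$ be the boolean lattice and let $I$ be a rank-fixed dual order ideal of $B_n$. Then $\mathcal{R}_K[B_n\setminus I]$ is level.
   Context: $B_n$ is the lattice of all subsets of $[n]=\{1,\dots,n\}$ ordered by inclusion. A dual order ideal of a poset $Q$ is a subset $I\subset Q$ such that $t\in I$ and $s\ge t$ imply $s\in I$. A dual order ideal $I$ of a finite distributive lattice $L$ is rank-fixed if the set of minimal elements of $I$ is the set of all elements of $L$ of some fixed rank $r\ge 0$ ($I=\emptyset$ is allowed as rank-fixed, corresponding to $r>\mathrm{rank}(L)$); the rank of $x$ is the largest $r$ with a chain $x_0<\cdots<x_r=x$. A poset of distributive type is a finite poset $P$ with a unique minimal element $\hat 0$ such that every interval $[\hat 0,a]$, $a\in P$, is a distributive lattice; $L\setminus I$, for a proper dual order ideal $I$ of a distributive lattice $L$, is one. Let $K[\{x_\alpha\}_{\alpha\in P}]$ be the polynomial ring with each $\deg x_\alpha=1$. For $\alpha,\beta\in P$ put $f_{\alpha,\beta}=x_\alpha x_\beta$ if $\alpha$ and $\beta$ have no common upper bound in $P$, and otherwise $f_{\alpha,\beta}=x_\alpha x_\beta-x_{\alpha\wedge\beta}\big(\sum_\gamma x_\gamma\big)$, where $\gamma$ ranges over all minimal upper bounds of $\alpha,\beta$ in $P$. Let $J_P=(f_{\alpha,\beta}:\alpha,\beta\in P)$ and $\mathcal{R}_K[P]=K[\{x_\alpha\}_{\alpha\in P}]/J_P$; also $\mathcal{R}_K[\emptyset]=K$. A level ring is a Cohen--Macaulay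 (standard) graded ring whose canonical module is generated in one degree. *)

theory Defs
  imports
    "HOL-Library.Poly_Mapping"
    "HOL-Library.Extended_Nat"
    "Jordan_Normal_Form.Matrix"
    "HOL-Algebra.QuotRing"
begin

section \<open>Boolean lattices and rank-fixed dual order ideals\<close>

text \<open>Posets are subsets of a type of class \<open>order\<close>, with the induced order. For sets of
  natural numbers this order is inclusion.\<close>

definition boolean_lattice :: "nat \<Rightarrow> nat set set" where
  "boolean_lattice n = Pow {1..n}"

definition dual_order_ideal :: "'a::order set \<Rightarrow> 'a set \<Rightarrow> bool" where
  "dual_order_ideal Q I \<longleftrightarrow> I \<subseteq> Q \<and> (\<forall>t\<in>I. \<forall>s\<in>Q. t \<le> s \<longrightarrow> s \<in> I)"

definition minimal_elements :: "'a::order set \<Rightarrow> 'a set" where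
  "minimal_elements A = {a \<in> A. \<forall>b\<in>A. b \<le> a \<longrightarrow> b = a}"

definition poset_rank :: "'a::order set \<Rightarrow> 'a \<Rightarrow> nat" where
  "poset_rank Q x =
     (GREATEST r. \<exists>c :: nat \<Rightarrow> 'a.
        (\<forall>i\<le>r. c i \<in> Q) \<and> (\<forall>i<r. c i < c (Suc i)) \<and> c r = x)"

text \<open>For \<open>r\<close> exceeding the rank of a finite \<open>L\<close> the condition below says that \<open>I\<close> is empty.\<close>

definition rank_fixed :: "'a::order set \<Rightarrow> 'a set \<Rightarrow> bool" where
  "rank_fixed L I \<longleftrightarrow>
     dual_order_ideal L I \<and> (\<exists>r. minimal_elements I = {x \<in> L. poset_rank L x = r})"

section \<open>Polynomial rings\<close>

type_synonym ('v, 'k) mpoly = "('v \<Rightarrow>\<^sub>0 nat) \<Rightarrow>\<^sub>0 'k"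

definition Var :: "'v \<Rightarrow> ('v, 'k::field) mpoly" where
  "Var v = Poly_Mapping.single (Poly_Mapping.single v 1) 1"

text \<open>The ring \<open>K[x\<^sub>v : v \<in> V]\<close>, where \<open>K\<close> is the field on the type \<open>'k\<close>.\<close>

definition mpoly_ring :: "'v set \<Rightarrow> ('v, 'k::field) mpoly ring" where
  "mpoly_ring V =
     \<lparr>carrier = {p. \<forall>m \<in> Poly_Mapping.keys p. Poly_Mapping.keys m \<subseteq> V},
      mult = (*), one = 1, zero = 0, add = (+)\<rparr>"

definition monomial_degree :: "('v \<Rightarrow>\<^sub>0 nat) \<Rightarrow> nat" where
  "monomial_degree m = (\<Sum>v \<in> Poly_Mapping.keys m. Poly_Mapping.lookup m v)"

text \<open>Degrees are integers because of the degree shifts below; the zero polynomial is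
  homogeneous of every degree, and it is the only one of negative degree.\<close>

definition homogeneous :: "int \<Rightarrow> ('v, 'k::field) mpoly \<Rightarrow> bool" where
  "homogeneous d p \<longleftrightarrow> (\<forall>m \<in> Poly_Mapping.keys p. int (monomial_degree m) = d)"

section \<open>The ring of a poset of distributive type\<close>

definition upper_bounds :: "'a::order set \<Rightarrow> 'a \<Rightarrow> 'a \<Rightarrow> 'a set" where
  "upper_bounds P a b = {c \<in> P. a \<le> c \<and> b \<le> c}"

text \<open>If \<open>a, b\<close> have a common upper bound \<open>c\<close> in a poset \<open>P\<close> of distributive type, their meet in
  the lattice \<open>[0, c]\<close> is their greatest lower bound in \<open>P\<close>.\<close>

definition poset_meet :: "'a::order set \<Rightarrow> 'a \<Rightarrow> 'a \<Rightarrow> 'a" where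
  "poset_meet P a b = (GREATEST c. c \<in> P \<and> c \<le> a \<and> c \<le> b)"

definition poset_relation :: "'a::order set \<Rightarrow> 'a \<Rightarrow> 'a \<Rightarrow> ('a, 'k::field) mpoly" where
  "poset_relation P a b =
     (if upper_bounds P a b = {} then Var a * Var b
      else Var a * Var b
        - Var (poset_meet P a b) * (\<Sum>c \<in> minimal_elements (upper_bounds P a b). Var c))"

definition poset_ideal :: "'a::order set \<Rightarrow> ('a, 'k::field) mpoly set" where
  "poset_ideal P = Idl\<^bsub>mpoly_ring P\<^esub> {poset_relation P a b | a b. a \<in> P \<and> b \<in> P}"

section \<open>Cohen--Macaulay graded algebras\<close>

text \<open>A standard graded \<open>K\<close>-algebra is given by a presentation \<open>S / J\<close>, where
  \<open>S = K[x\<^sub>v : v \<in> V]\<close> with \<open>V\<close> finite and \<open>J\<close> is a proper homogeneous ideal of \<open>S\<close>.\<close>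

definition standard_graded_presentation :: "'v set \<Rightarrow> ('v, 'k::field) mpoly set \<Rightarrow> bool" where
  "standard_graded_presentation V J \<longleftrightarrow>
     finite V \<and> J \<noteq> carrier (mpoly_ring V) \<and>
     (\<exists>G \<subseteq> carrier (mpoly_ring V). (\<forall>g\<in>G. \<exists>d. homogeneous d g) \<and> J = Idl\<^bsub>mpoly_ring V\<^esub> G)"

definition irrelevant_ideal :: "'v set \<Rightarrow> ('v, 'k::field) mpoly set \<Rightarrow> ('v, 'k) mpoly set set" where
  "irrelevant_ideal V J =
     {J +>\<^bsub>mpoly_ring V\<^esub> p | p. p \<in> carrier (mpoly_ring V) \<and> Poly_Mapping.lookup p 0 = 0}"

definition krull_dim :: "('a, 'b) ring_scheme \<Rightarrow> enat" where
  "krull_dim R =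
     Sup {enat k | k. \<exists>p :: nat \<Rightarrow> 'a set.
            (\<forall>i\<le>k. primeideal (p i) R) \<and> (\<forall>i<k. p i \<subset> p (Suc i))}"

definition regular_sequence :: "('a, 'b) ring_scheme \<Rightarrow> 'a list \<Rightarrow> bool" where
  "regular_sequence R xs \<longleftrightarrow>
     set xs \<subseteq> carrier R \<and> Idl\<^bsub>R\<^esub> (set xs) \<noteq> carrier R \<and>
     (\<forall>i < length xs. \<forall>a \<in> carrier R.
        xs ! i \<otimes>\<^bsub>R\<^esub> a \<in> Idl\<^bsub>R\<^esub> (set (take i xs)) \<longrightarrow> a \<in> Idl\<^bsub>R\<^esub> (set (take i xs)))"

definition ideal_depth :: "('a, 'b) ring_scheme \<Rightarrow> 'a set \<Rightarrow> enat" where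
  "ideal_depth R M = Sup {enat (length xs) | xs. regular_sequence R xs \<and> set xs \<subseteq> M}"

text \<open>As usual for standard graded algebras over a field, the Cohen--Macaulay property is
  expressed by the depth of the irrelevant ideal.\<close>

definition cohen_macaulay :: "'v set \<Rightarrow> ('v, 'k::field) mpoly set \<Rightarrow> bool" where
  "cohen_macaulay V J \<longleftrightarrow>
     ideal_depth (mpoly_ring V Quot J) (irrelevant_ideal V J) = krull_dim (mpoly_ring V Quot J)"

section \<open>Canonical modules and level algebras\<close>

text \<open>The free \<open>S\<close>-module \<open>S\<^sup>b\<close>, \<open>S = K[x\<^sub>v : v \<in> V]\<close>.\<close>

definition free_module :: "'v set \<Rightarrow> nat \<Rightarrow> (('v, 'k::field) mpoly, ('v, 'k) mpoly vec) module" where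
  "free_module V b = (module_vec TYPE(('v, 'k) mpoly) b)
     \<lparr>carrier := {u \<in> carrier_vec b. \<forall>j<b. u $ j \<in> carrier (mpoly_ring V)}\<rparr>"

text \<open>Module analogue of \<^const>\<open>FactRing\<close>.\<close>

definition factor_module :: "('a, 'm) module \<Rightarrow> 'm set \<Rightarrow> ('a, 'm set) module" where
  "factor_module M N =
     \<lparr>carrier = a_rcosets\<^bsub>M\<^esub> N, mult = undefined, one = undefined, zero = N, add = set_add M,
      smult = (\<lambda>r X. \<Union>x\<in>X. N +>\<^bsub>M\<^esub> (r \<odot>\<^bsub>M\<^esub> x))\<rparr>"

text \<open>Data of a graded free resolution \<open>\<dots> \<rightarrow> F\<^sub>2 \<rightarrow> F\<^sub>1 \<rightarrow> F\<^sub>0 \<rightarrow> S / J \<rightarrow> 0\<close>: the free module \<open>F\<^sub>i\<close> has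
  rank \<open>res_rank i\<close> and its \<open>j\<close>-th basis element has degree \<open>res_degree i j\<close>; the matrix
  \<open>res_diff i\<close> represents \<open>F\<^sub>i\<^sub>+\<^sub>1 \<rightarrow> F\<^sub>i\<close>; the entries of \<open>res_aug\<close> are representatives in \<open>S\<close> of the
  images in \<open>S / J\<close> of the basis elements of \<open>F\<^sub>0\<close>.\<close>

record 'a resolution =
  res_rank :: "nat \<Rightarrow> nat"
  res_degree :: "nat \<Rightarrow> nat \<Rightarrow> int"
  res_aug :: "'a vec"
  res_diff :: "nat \<Rightarrow> 'a mat"

abbreviation res_module ::
  "'v set \<Rightarrow> ('v, 'k::field) mpoly resolution \<Rightarrow> nat \<Rightarrow> (('v, 'k) mpoly, ('v, 'k) mpoly vec) module" where
  "res_module V F i \<equiv> free_module V (res_rank F i)"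

definition graded_free_resolution ::
  "'v set \<Rightarrow> ('v, 'k::field) mpoly set \<Rightarrow> ('v, 'k) mpoly resolution \<Rightarrow> bool" where
  "graded_free_resolution V J F \<longleftrightarrow>
     res_aug F \<in> carrier (res_module V F 0) \<and>
     (\<forall>j < res_rank F 0. homogeneous (res_degree F 0 j) (res_aug F $ j)) \<and>
     (\<forall>i. res_diff F i \<in> carrier_mat (res_rank F i) (res_rank F (Suc i)) \<and>
        (\<forall>j < res_rank F i. \<forall>k < res_rank F (Suc i).
           res_diff F i $$ (j, k) \<in> carrier (mpoly_ring V) \<and>
           homogeneous (res_degree F (Suc i) k - res_degree F i j) (res_diff F i $$ (j, k)))) \<and>
     (\<forall>p \<in> carrier (mpoly_ring V). \<exists>u \<in> carrier (res_module V F 0). p - res_aug F \<bullet> u \<in> J) \<and>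
     {u \<in> carrier (res_module V F 0). res_aug F \<bullet> u \<in> J}
       = (\<lambda>w. res_diff F 0 *\<^sub>v w) ` carrier (res_module V F 1) \<and>
     (\<forall>i. {u \<in> carrier (res_module V F (Suc i)). res_diff F i *\<^sub>v u = 0\<^sub>v (res_rank F i)}
       = (\<lambda>w. res_diff F (Suc i) *\<^sub>v w) ` carrier (res_module V F (Suc (Suc i))))"

text \<open>Cocycles and coboundaries of \<open>Hom\<^sub>S(F, S)\<close>; here \<open>Hom\<^sub>S(F\<^sub>i, S)\<close> is identified with \<open>F\<^sub>i\<close>
  through the dual basis, so that the differentials become the transposed matrices.\<close>

definition cocycles :: "'v set \<Rightarrow> ('v, 'k::field) mpoly resolution \<Rightarrow> nat \<Rightarrow> ('v, 'k) mpoly vec set" where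
  "cocycles V F i =
     {u \<in> carrier (res_module V F i).
        transpose_mat (res_diff F i) *\<^sub>v u = 0\<^sub>v (res_rank F (Suc i))}"

definition coboundaries :: "'v set \<Rightarrow> ('v, 'k::field) mpoly resolution \<Rightarrow> nat \<Rightarrow> ('v, 'k) mpoly vec set" where
  "coboundaries V F i =
     (case i of 0 \<Rightarrow> {0\<^sub>v (res_rank F 0)}
      | Suc h \<Rightarrow> (\<lambda>w. transpose_mat (res_diff F h) *\<^sub>v w) ` carrier (res_module V F h))"

definition ext_module ::
  "'v set \<Rightarrow> ('v, 'k::field) mpoly resolution \<Rightarrow> nat \<Rightarrow> (('v, 'k) mpoly, ('v, 'k) mpoly vec set) module" where
  "ext_module V F i =
     factor_module ((res_module V F i)\<lparr>carrier := cocycles V F i\<rparr>) (coboundaries V F i)"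

text \<open>The component of degree \<open>e\<close> of \<open>Ext\<^sup>i\<^sub>S(S / J, S(-N))\<close>, \<open>N = |V|\<close>. The dual of a basis element
  of degree \<open>d\<close> has degree \<open>-d\<close> in \<open>Hom\<^sub>S(F\<^sub>i, S)\<close>, hence degree \<open>N - d\<close> after the twist.\<close>

definition ext_component ::
  "'v set \<Rightarrow> ('v, 'k::field) mpoly resolution \<Rightarrow> nat \<Rightarrow> int \<Rightarrow> ('v, 'k) mpoly vec set set" where
  "ext_component V F i e =
     {coboundaries V F i +>\<^bsub>res_module V F i\<^esub> u | u. u \<in> cocycles V F i \<and>
        (\<forall>j < res_rank F i. homogeneous (e + res_degree F i j - int (card V)) (u $ j))}"

definition codim :: "'v set \<Rightarrow> ('v, 'k::field) mpoly set \<Rightarrow> nat" where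
  "codim V J = card V - the_enat (krull_dim (mpoly_ring V Quot J))"

text \<open>For Cohen--Macaulay \<open>S / J\<close> the canonical module is \<open>Ext\<^sup>c\<^sub>S(S / J, S(-N))\<close>, \<open>c = N - dim (S / J)\<close>,
  computed here from a graded free resolution \<open>F\<close> of \<open>S / J\<close>. Such an \<open>F\<close> always exists, and up to
  isomorphism of graded modules the result does not depend on it.\<close>

definition canonical_module ::
  "'v set \<Rightarrow> ('v, 'k::field) mpoly set \<Rightarrow> ('v, 'k) mpoly resolution
     \<Rightarrow> (('v, 'k) mpoly, ('v, 'k) mpoly vec set) module" where
  "canonical_module V J F = ext_module V F (codim V J)"

definition canonical_component ::
  "'v set \<Rightarrow> ('v, 'k::field) mpoly set \<Rightarrow> ('v, 'k) mpoly resolution \<Rightarrow> int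
     \<Rightarrow> ('v, 'k) mpoly vec set set" where
  "canonical_component V J F e = ext_component V F (codim V J) e"

definition generates_module :: "('a, 'b) ring_scheme \<Rightarrow> ('a, 'm) module \<Rightarrow> 'm set \<Rightarrow> bool" where
  "generates_module R M X \<longleftrightarrow>
     X \<subseteq> carrier M \<and> (\<forall>H. submodule H R M \<and> X \<subseteq> H \<longrightarrow> H = carrier M)"

text \<open>\<open>J\<close> annihilates the canonical module, so that generation over \<open>S\<close> and over \<open>S / J\<close> agree.\<close>

definition level_algebra :: "'v set \<Rightarrow> ('v, 'k::field) mpoly set \<Rightarrow> bool" where
  "level_algebra V J \<longleftrightarrow>
     standard_graded_presentation V J \<and> cohen_macaulay V J \<and>
     (\<exists>F. graded_free_resolution V J F \<and>
        (\<exists>e. generates_module (mpoly_ring V) (canonical_module V J F) (canonical_component V J F e)))"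

end

(* Let P be the set of subsets of [n] with fewer than D elements. The map x_A |-> y_0 prod_{i in A} y_i,
   followed by killing the monomials that involve y_0 and at least D other variables, has kernel J_P: modulo
   the straightening relations every monomial is a product along a chain of P. The rank sums theta_i
   (i < D) are a system of parameters, and comparing leading monomials for a dominance order shows that
   R = R_K[P] is free over K[theta], with basis the descent monomials D_w of the permutations w of [n]
   whose descents are all below D. Hence R is Cohen-Macaulay, it is resolved by the Koszul complex of
   x - (matrix of multiplication by x), x running through the other variables, and the canonical module
   is the dual of the free K[theta]-module R. It is generated in one degree iff the socle of R/(theta)
   lies in its top degree k = min(D - 1, n - 1). This holds because, for every w, an alternating functional
   on the component of degree k vanishes on the ideal (theta) and equals 1 at C_w D_w, where C_w is the
   product of the variables of the initial segments of w at its non-descents up to k; these pairings are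
   unitriangular for a suitable order of the permutations. *)
theory Submission
  imports Defs "HOL-Algebra.Ring_Divisibility" "HOL-Combinatorics.Permutations"
begin

text \<open>The parameters \<open>\<theta> i\<close> are not variables, but each is the variable of
  \<open>{1..i}\<close> plus variables outside \<open>V0\<close>. So the substitution
  \<open>tf\<close> is a linear automorphism that makes \<open>K[theta]\<close> a polynomial ring on
  some of the variables; freeness, resolution and depth are treated for the preimage
  \<open>J'\<close> of \<open>J\<close> and carried back by \<tau>. The Koszul complex may fail to
  be minimal, but its length is the number of variables outside \<open>V0\<close>, which is the
  codimension. Hence its last module gives the canonical module as a cokernel of transposed
  matrices, generated by the dual basis. The functional is alternating in k + 1 indices, whose
  exponents are 0, ..., k in some order. It kills the parameters because an exponent vector of
  degree k - 1 repeats a value on these indices, and swapping the two indices cancels the terms of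
  \<open>\<theta> i\<close>. Unitriangularity is an extremal statement: the sum of squares of the
  exponents of \<open>C_w D_w'\<close> is computed from the level sets of the exponents and from the
  factors, each of which is bounded by a level set. This compares the descent sets, and equality
  forces every factor to be a level set.\<close>

section \<open>Polynomials\<close>

abbreviation lookup :: "('a \<Rightarrow>\<^sub>0 'b::zero) \<Rightarrow> 'a \<Rightarrow> 'b" where
  "lookup \<equiv> Poly_Mapping.lookup"

abbreviation keys :: "('a \<Rightarrow>\<^sub>0 'b::zero) \<Rightarrow> 'a set" where
  "keys \<equiv> Poly_Mapping.keys"

abbreviation single :: "'a \<Rightarrow> 'b \<Rightarrow> ('a \<Rightarrow>\<^sub>0 'b::zero)" where
  "single \<equiv> Poly_Mapping.single"

definition polys :: "'v set \<Rightarrow> ('v, 'k::field) mpoly set" where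
  "polys V = {p. \<forall>m\<in>keys p. keys m \<subseteq> V}"

lemma carrier_mpoly_ring [simp]: "carrier (mpoly_ring V) = polys V"
  by (simp add: mpoly_ring_def polys_def)

lemma mpoly_ring_simps [simp]:
  "mult (mpoly_ring V) = (*)" "one (mpoly_ring V) = 1" "zero (mpoly_ring V) = 0"
  "add (mpoly_ring V) = (+)"
  by (simp_all add: mpoly_ring_def)

lemma sum_single_keys: "(\<Sum>m\<in>keys p. single m (lookup p m)) = p"
  by (rule poly_mapping_eqI) (auto simp: lookup_sum lookup_single when_def sum.delta not_in_keys_iff_lookup_eq_zero)

lemma keys_plus_nat: "keys (m + m' :: 'v \<Rightarrow>\<^sub>0 nat) = keys m \<union> keys m'"
  by (auto simp: in_keys_iff lookup_add)

lemma keys_multE: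
  assumes "m \<in> keys (p * q)"
  obtains a b where "a \<in> keys p" "b \<in> keys q" "m = a + b"
  using keys_mult[of p q] assms by auto

lemma keys_diff_subset: "keys (p - q :: 'a \<Rightarrow>\<^sub>0 'b::ab_group_add) \<subseteq> keys p \<union> keys q"
  by (auto simp: in_keys_iff lookup_minus)

lemma keys_sumE:
  assumes "m \<in> keys (sum f A)" obtains a where "a \<in> A" "m \<in> keys (f a)"
proof -
  have "(\<Sum>a\<in>A. lookup (f a) m) \<noteq> 0" using assms by (simp add: in_keys_iff lookup_sum)
  then obtain a where "a \<in> A" "lookup (f a) m \<noteq> 0" by (meson sum.not_neutral_contains_not_neutral)
  then show ?thesis using that by (simp add: in_keys_iff)
qed

lemma polys_zero [simp, intro]: "0 \<in> polys V"
  and polys_one [simp, intro]: "1 \<in> polys V"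
  and polys_const [simp, intro]: "single 0 c \<in> polys V"
  by (auto simp: polys_def)

lemma polys_single: "keys m \<subseteq> V \<Longrightarrow> single m c \<in> polys V"
  by (auto simp: polys_def)

lemma polys_Var [simp, intro]: "v \<in> V \<Longrightarrow> Var v \<in> polys V"
  by (auto simp: polys_def Var_def)

lemma polys_add [simp, intro]: "p \<in> polys V \<Longrightarrow> q \<in> polys V \<Longrightarrow> p + q \<in> polys V"
  using keys_add[of p q] by (auto simp: polys_def)

lemma polys_uminus [simp, intro]: "p \<in> polys V \<Longrightarrow> - p \<in> polys V"
  by (auto simp: polys_def)

lemma polys_diff [simp, intro]: "p \<in> polys V \<Longrightarrow> q \<in> polys V \<Longrightarrow> p - q \<in> polys V"
  using keys_diff_subset[of p q] by (auto simp: polys_def)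

lemma polys_mult [simp, intro]: "p \<in> polys V \<Longrightarrow> q \<in> polys V \<Longrightarrow> p * q \<in> polys V"
  unfolding polys_def by (force elim!: keys_multE simp: keys_plus_nat)

lemma polys_sum [intro]: "(\<And>i. i \<in> A \<Longrightarrow> f i \<in> polys V) \<Longrightarrow> sum f A \<in> polys V"
  by (induction A rule: infinite_finite_induct) auto

lemma polys_prod [intro]: "(\<And>i. i \<in> A \<Longrightarrow> f i \<in> polys V) \<Longrightarrow> prod f A \<in> polys V"
  by (induction A rule: infinite_finite_induct) auto

lemma polys_power [intro]: "p \<in> polys V \<Longrightarrow> p ^ i \<in> polys V"
  by (induction i) auto

lemma polys_mono: "V \<subseteq> W \<Longrightarrow> polys V \<subseteq> polys W"
  by (auto simp: polys_def)

lemma polys_induct [consumes 1, case_names zero add single]: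
  assumes "p \<in> polys V" "P 0"
    "\<And>p q. p \<in> polys V \<Longrightarrow> q \<in> polys V \<Longrightarrow> P p \<Longrightarrow> P q \<Longrightarrow> P (p + q)"
    "\<And>m c. keys m \<subseteq> V \<Longrightarrow> P (single m c)"
  shows "P p"
proof -
  have "P (\<Sum>m\<in>X. single m (lookup p m))" if "finite X" "X \<subseteq> keys p" for X
    using that
  proof (induction X rule: finite_induct)
    case (insert m X)
    have m: "keys m \<subseteq> V" using insert.prems assms(1) by (auto simp: polys_def)
    have "(\<Sum>m\<in>X. single m (lookup p m)) \<in> polys V"
      using insert.prems assms(1) by (intro polys_sum polys_single) (auto simp: polys_def)
    then show ?case using insert m by (auto intro!: assms polys_single)
  qed (simp add: assms)
  from this[of "keys p"] show ?thesis by (simp add: sum_single_keys)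
qed

text \<open>Removing one variable lowers the total exponent, so every monomial is reached from 1 by
  one variable at a time.\<close>

lemma exponent_induct [consumes 1, case_names zero plus]:
  fixes m :: "'v \<Rightarrow>\<^sub>0 nat"
  assumes "keys m \<subseteq> V" "P 0"
    "\<And>m v. keys m \<subseteq> V \<Longrightarrow> P m \<Longrightarrow> v \<in> V \<Longrightarrow> P (m + single v 1)"
  shows "P m"
  using assms(1)
proof (induction "\<Sum>v\<in>keys m. lookup m v" arbitrary: m)
  case 0
  then have "m = 0" by (auto intro!: poly_mapping_eqI simp: in_keys_iff)
  then show ?case using assms by simp
next
  case (Suc n)
  then obtain v where v: "v \<in> keys m" by fastforce
  define m' where "m' = m - single v 1"
  have m: "m = m' + single v 1"
    using v by (intro poly_mapping_eqI) (auto simp: m'_def lookup_add lookup_minus lookup_single when_def in_keys_iff)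
  have k: "keys m' \<subseteq> keys m" by (auto simp: m keys_plus_nat)
  have "(\<Sum>v\<in>keys m. lookup m v) = (\<Sum>v\<in>keys m. lookup m' v) + (\<Sum>u\<in>keys m. lookup (single v 1) u)"
    using m by (simp only: lookup_add sum.distrib[symmetric] cong: sum.cong)
  also have "(\<Sum>u\<in>keys m. lookup (single v 1) u) = (1::nat)"
    using v by (simp add: lookup_single when_def)
  also have "(\<Sum>v\<in>keys m. lookup m' v) = (\<Sum>v\<in>keys m'. lookup m' v)"
    using k by (intro sum.mono_neutral_right) (auto simp: in_keys_iff)
  finally have "n = (\<Sum>v\<in>keys m'. lookup m' v)" using Suc.hyps by simp
  from Suc.hyps(1)[OF this] have "P m'" using k Suc.prems by blast
  then have "P (m' + single v 1)" using k v Suc.prems by (intro assms(3)) auto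
  then show ?case using m by simp
qed

lemma single_plus_exponent: "single (m + single v 1) c = Var v * single m (c::'k::field)"
  by (simp add: Var_def mult_single add.commute)

text \<open>Constants, sums and multiplication by single variables generate all polynomials. Facts
  about multiplication by a polynomial therefore only need to be checked for one variable.\<close>

lemma polys_Var_induct [consumes 1, case_names const add Var]:
  assumes "p \<in> polys V" "\<And>c. P (single 0 c)"
    "\<And>p q. p \<in> polys V \<Longrightarrow> q \<in> polys V \<Longrightarrow> P p \<Longrightarrow> P q \<Longrightarrow> P (p + q)"
    "\<And>p v. p \<in> polys V \<Longrightarrow> P p \<Longrightarrow> v \<in> V \<Longrightarrow> P (Var v * p)"
  shows "P p"
  using assms(1)
proof (induction rule: polys_induct)
  case zero then show ?case using assms(2)[of 0] by simp
next
  case (single m c)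
  then show ?case
  proof (induction rule: exponent_induct)
    case (plus m v)
    then show ?case using assms(4)[OF polys_single] by (auto simp only: single_plus_exponent)
  qed (simp add: assms)
qed (auto intro: assms)

lemma const_mult_const: "single 0 a * single 0 b = single 0 (a * b :: 'k::field)"
  by (simp add: mult_single)

lemma lookup_single_plus_mult:
  "lookup (single t c * p) (t + m) = (c::'k::field) * lookup p (m :: 'v \<Rightarrow>\<^sub>0 nat)"
proof -
  have "lookup (single t c * p) (t + m) =
      (\<Sum>q\<in>keys p. lookup (single (t + q) (c * lookup p q)) (t + m))"
    by (subst (1) sum_single_keys[of p, symmetric])
      (simp add: sum_distrib_left lookup_sum mult_single)
  also have "\<dots> = (\<Sum>q\<in>keys p. if q = m then c * lookup p q else 0)"
    by (intro sum.cong) (auto simp: lookup_single when_def)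
  also have "\<dots> = c * lookup p m"
    by (simp add: sum.delta not_in_keys_iff_lookup_eq_zero)
  finally show ?thesis .
qed

lemma lookup_const_mult: "lookup (single 0 c * p) m = (c::'k::field) * lookup p (m :: 'v \<Rightarrow>\<^sub>0 nat)"
  using lookup_single_plus_mult[of 0 c p m] by simp

lemma lookup_single_mult_outside:
  assumes "\<And>m'. m \<noteq> t + m'"
  shows "lookup (single t c * p) m = (0::'k::field)"
proof (rule ccontr)
  assume "lookup (single t c * p) m \<noteq> 0"
  then have "m \<in> keys (single t c * p)" by (simp add: in_keys_iff)
  then show False using assms by (elim keys_multE) (auto split: if_splits)
qed

subsection \<open>Homogeneous polynomials\<close>

lemma monomial_degree_superset:
  "finite X \<Longrightarrow> keys m \<subseteq> X \<Longrightarrow> monomial_degree m = (\<Sum>v\<in>X. lookup m v)"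
  unfolding monomial_degree_def by (rule sum.mono_neutral_left) (auto simp: in_keys_iff)

lemma monomial_degree_plus [simp]: "monomial_degree (a + b) = monomial_degree a + monomial_degree b"
  by (simp add: monomial_degree_superset[of "keys a \<union> keys b"] keys_plus_nat lookup_add sum.distrib)

lemma monomial_degree_zero [simp]: "monomial_degree 0 = 0"
  by (simp add: monomial_degree_def)

lemma monomial_degree_single [simp]: "monomial_degree (single v i) = i"
  by (simp add: monomial_degree_def)

lemma monomial_degree_eq_0: "monomial_degree m = 0 \<longleftrightarrow> m = 0"
  by (auto simp: monomial_degree_def in_keys_iff intro!: poly_mapping_eqI)

lemma lookup_le_monomial_degree: "lookup m v \<le> monomial_degree m"
proof (cases "v \<in> keys m")
  case True
  then show ?thesis unfolding monomial_degree_def by (intro member_le_sum) auto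
qed (simp add: in_keys_iff)

lemma homogeneous_zero [simp, intro]: "homogeneous d 0"
  by (simp add: homogeneous_def)

lemma homogeneous_single: "d = int (monomial_degree m) \<Longrightarrow> homogeneous d (single m c)"
  by (auto simp: homogeneous_def)

lemma homogeneous_const [simp, intro]: "homogeneous 0 (single 0 c)"
  by (rule homogeneous_single) simp

lemma homogeneous_one [simp, intro]: "homogeneous 0 1"
  using homogeneous_const[of 1] by simp

lemma homogeneous_Var [simp, intro]: "homogeneous 1 (Var v)"
  by (simp add: Var_def homogeneous_single)

lemma homogeneous_add [intro]: "homogeneous d p \<Longrightarrow> homogeneous d q \<Longrightarrow> homogeneous d (p + q)"
  using keys_add[of p q] by (auto simp: homogeneous_def)

lemma homogeneous_uminus [intro]: "homogeneous d p \<Longrightarrow> homogeneous d (- p)"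
  by (auto simp: homogeneous_def)

lemma homogeneous_diff [intro]: "homogeneous d p \<Longrightarrow> homogeneous d q \<Longrightarrow> homogeneous d (p - q)"
  using keys_diff_subset[of p q] by (auto simp: homogeneous_def)

lemma homogeneous_sum [intro]: "(\<And>i. i \<in> A \<Longrightarrow> homogeneous d (f i)) \<Longrightarrow> homogeneous d (sum f A)"
  by (induction A rule: infinite_finite_induct) auto

lemma homogeneous_mult: "homogeneous d p \<Longrightarrow> homogeneous e q \<Longrightarrow> homogeneous (d + e) (p * q)"
  unfolding homogeneous_def by (auto elim!: keys_multE)

lemma homogeneous_mult_eq:
  "homogeneous d p \<Longrightarrow> homogeneous e q \<Longrightarrow> f = d + e \<Longrightarrow> homogeneous f (p * q)"
  by (simp add: homogeneous_mult)

lemma homogeneous_prod: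
  "finite A \<Longrightarrow> (\<And>i. i \<in> A \<Longrightarrow> homogeneous (d i) (f i)) \<Longrightarrow> homogeneous (sum d A) (prod f A)"
  by (induction A rule: finite_induct) (auto intro: homogeneous_mult)

lemma homogeneous_negative: "homogeneous d p \<Longrightarrow> d < 0 \<Longrightarrow> p = 0"
  by (auto simp: homogeneous_def simp flip: keys_eq_empty)

text \<open>Together with \<open>homogeneous_negative\<close> this is how degree bookkeeping turns
  entries of multiplication matrices into scalars or 0 in \<open>dual_generated\<close>.\<close>

lemma homogeneous_degree_0:
  assumes "homogeneous 0 p" shows "p = single 0 (lookup p 0)"
proof (rule poly_mapping_eqI)
  fix m show "lookup p m = lookup (single 0 (lookup p 0)) m"
    using assms by (cases "m = 0")
      (auto simp: homogeneous_def monomial_degree_eq_0 lookup_single when_def in_keys_iff)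
qed

subsection \<open>Substitution\<close>

definition monomial_value :: "('v \<Rightarrow> 'a::comm_monoid_mult) \<Rightarrow> ('v \<Rightarrow>\<^sub>0 nat) \<Rightarrow> 'a" where
  "monomial_value f m = (\<Prod>v\<in>keys m. f v ^ lookup m v)"

definition psubst :: "('v \<Rightarrow> ('w, 'k::field) mpoly) \<Rightarrow> ('v, 'k) mpoly \<Rightarrow> ('w, 'k) mpoly" where
  "psubst f p = (\<Sum>m\<in>keys p. single 0 (lookup p m) * monomial_value f m)"

lemma monomial_value_superset:
  "finite X \<Longrightarrow> keys m \<subseteq> X \<Longrightarrow> monomial_value f m = (\<Prod>v\<in>X. f v ^ lookup m v)"
  unfolding monomial_value_def by (rule prod.mono_neutral_left) (auto simp: in_keys_iff)

lemma monomial_value_plus: "monomial_value f (a + b) = monomial_value f a * monomial_value f b"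
  by (simp add: monomial_value_superset[of "keys a \<union> keys b"] keys_plus_nat lookup_add power_add
      prod.distrib)

lemma monomial_value_zero [simp]: "monomial_value f 0 = 1"
  by (simp add: monomial_value_def)

lemma monomial_value_single [simp]: "monomial_value f (single v (Suc 0)) = f v"
  by (simp add: monomial_value_def lookup_single when_def)

lemma psubst_superset:
  "finite X \<Longrightarrow> keys p \<subseteq> X \<Longrightarrow>
    psubst f p = (\<Sum>m\<in>X. single 0 (lookup p m) * monomial_value f m)"
  unfolding psubst_def by (rule sum.mono_neutral_left) (auto simp: in_keys_iff)

lemma psubst_add [simp]: "psubst f (p + q) = psubst f p + psubst f q"
  using keys_add[of p q]
  by (simp add: psubst_superset[of "keys p \<union> keys q"] lookup_add single_add distrib_right
      sum.distrib)

lemma psubst_zero [simp]: "psubst f 0 = 0"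
  by (simp add: psubst_def)

lemma psubst_single: "psubst f (single m c) = single 0 c * monomial_value f m"
  by (simp add: psubst_def)

lemma psubst_const [simp]: "psubst f (single 0 c) = single 0 c"
  by (simp add: psubst_single)

lemma psubst_one [simp]: "psubst f 1 = 1"
  using psubst_const[of f 1] by simp

lemma psubst_Var [simp]: "psubst f (Var v) = f v"
  by (simp add: psubst_single Var_def)

lemma psubst_sum [simp]: "psubst f (sum g A) = (\<Sum>i\<in>A. psubst f (g i))"
  by (induction A rule: infinite_finite_induct) auto

lemma psubst_uminus [simp]: "psubst f (- p) = - psubst f p"
  by (metis add.right_inverse add_eq_0_iff psubst_add psubst_zero)

lemma psubst_diff [simp]: "psubst f (p - q) = psubst f p - psubst f q"
  by (metis diff_conv_add_uminus psubst_add psubst_uminus)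

lemma psubst_mult [simp]: "psubst f (p * q) = psubst f p * psubst f q"
proof -
  have "p * q = (\<Sum>m\<in>keys p. \<Sum>m'\<in>keys q. single (m + m') (lookup p m * lookup q m'))"
    by (subst (1) sum_single_keys[of p, symmetric], subst (1) sum_single_keys[of q, symmetric])
      (simp add: sum_product mult_single)
  then have "psubst f (p * q) = (\<Sum>m\<in>keys p. \<Sum>m'\<in>keys q.
      (single 0 (lookup p m) * monomial_value f m) * (single 0 (lookup q m') * monomial_value f m'))"
    by (simp add: psubst_single monomial_value_plus const_mult_const[symmetric] ac_simps)
  also have "\<dots> = psubst f p * psubst f q"
    by (simp add: psubst_def sum_product)
  finally show ?thesis .
qed

lemma psubst_prod [simp]: "psubst f (prod g A) = (\<Prod>i\<in>A. psubst f (g i))"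
  by (induction A rule: infinite_finite_induct) auto

lemma psubst_polys:
  assumes "p \<in> polys V" "\<And>v. v \<in> V \<Longrightarrow> f v \<in> polys W"
  shows "psubst f p \<in> polys W"
  using assms(1) by (induction rule: polys_Var_induct) (auto simp: assms)

lemma monomial_value_homogeneous:
  assumes "\<And>v. v \<in> keys m \<Longrightarrow> homogeneous 1 (f v)"
  shows "homogeneous (int (monomial_degree m)) (monomial_value f m)"
proof -
  have pw: "homogeneous (int i) (f v ^ i)" if "v \<in> keys m" for i v
    by (induction i) (auto intro!: homogeneous_mult_eq assms that)
  have "homogeneous (\<Sum>v\<in>keys m. int (lookup m v)) (\<Prod>v\<in>keys m. f v ^ lookup m v)"
    by (intro homogeneous_prod pw) auto
  then show ?thesis by (simp add: monomial_value_def monomial_degree_def)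
qed

lemma psubst_homogeneous:
  assumes "homogeneous d p" "p \<in> polys V" "\<And>v. v \<in> V \<Longrightarrow> homogeneous 1 (f v)"
  shows "homogeneous d (psubst f p)"
  unfolding psubst_def
proof (rule homogeneous_sum)
  fix m assume m: "m \<in> keys p"
  then have "d = int (monomial_degree m)" "keys m \<subseteq> V"
    using assms by (auto simp: homogeneous_def polys_def)
  then show "homogeneous d (single 0 (lookup p m) * monomial_value f m)"
    using assms(3) by (intro homogeneous_mult_eq[OF homogeneous_const monomial_value_homogeneous]) auto
qed

lemma psubst_psubst_id:
  assumes "p \<in> polys V" "\<And>v. v \<in> V \<Longrightarrow> psubst g (f v) = Var v"
  shows "psubst g (psubst f p) = p"
  using assms(1) by (induction rule: polys_Var_induct) (auto simp: assms)

section \<open>The Koszul complex as an iterated mapping cone\<close>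

section \<open>Koszul complexes of commuting matrices\<close>

definition vecs :: "'v set \<Rightarrow> nat \<Rightarrow> ('v, 'k::field) mpoly vec set" where
  "vecs V b = {u \<in> carrier_vec b. \<forall>j<b. u $ j \<in> polys V}"

definition mats :: "'v set \<Rightarrow> nat \<Rightarrow> nat \<Rightarrow> ('v, 'k::field) mpoly mat set" where
  "mats V r c = {A \<in> carrier_mat r c. \<forall>i<r. \<forall>j<c. A $$ (i, j) \<in> polys V}"

lemma carrier_free_module [simp]: "carrier (free_module V b) = vecs V b"
  by (simp add: free_module_def vecs_def)

lemma vecs_carrier: "u \<in> vecs V b \<Longrightarrow> u \<in> carrier_vec b"
  by (simp add: vecs_def)

lemma vecs_nth: "u \<in> vecs V b \<Longrightarrow> j < b \<Longrightarrow> u $ j \<in> polys V"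
  by (simp add: vecs_def)

lemma mats_carrier: "A \<in> mats V r c \<Longrightarrow> A \<in> carrier_mat r c"
  by (simp add: mats_def)

lemma vecs_add [intro]: "u \<in> vecs V b \<Longrightarrow> v \<in> vecs V b \<Longrightarrow> u + v \<in> vecs V b"
  by (auto simp: vecs_def)

lemma vecs_uminus [intro]: "u \<in> vecs V b \<Longrightarrow> - u \<in> vecs V b"
  by (auto simp: vecs_def)

lemma vecs_diff [intro]: "u \<in> vecs V b \<Longrightarrow> v \<in> vecs V b \<Longrightarrow> u - v \<in> vecs V b"
  by (auto simp: vecs_def)

lemma vecs_zero [simp, intro]: "0\<^sub>v b \<in> vecs V b"
  by (auto simp: vecs_def)

lemma vecs_smult [intro]: "p \<in> polys V \<Longrightarrow> u \<in> vecs V b \<Longrightarrow> p \<cdot>\<^sub>v u \<in> vecs V b"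
  by (auto simp: vecs_def)

lemma vecs_mult_mat [intro]: "A \<in> mats V r c \<Longrightarrow> u \<in> vecs V c \<Longrightarrow> A *\<^sub>v u \<in> vecs V r"
  by (auto simp: vecs_def mats_def scalar_prod_def intro!: polys_sum)

lemma vecs_append [intro]: "u \<in> vecs V a \<Longrightarrow> v \<in> vecs V b \<Longrightarrow> u @\<^sub>v v \<in> vecs V (a + b)"
  by (auto simp: vecs_def)

lemma vecs_splitE:
  assumes "u \<in> vecs V (a + b)"
  obtains u1 u2 where "u = u1 @\<^sub>v u2" "u1 \<in> vecs V a" "u2 \<in> vecs V b"
proof
  show "u = vec_first u a @\<^sub>v vec_last u b" using assms by (simp add: vecs_def)
  show "vec_first u a \<in> vecs V a" "vec_last u b \<in> vecs V b"
    using assms by (auto simp: vecs_def vec_first_def vec_last_def)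
qed

lemma mats_four_block [intro]:
  assumes "A \<in> mats V a c" "B \<in> mats V a d" "C \<in> mats V b c" "D \<in> mats V b d"
  shows "four_block_mat A B C D \<in> mats V (a + b) (c + d)"
  using assms by (auto simp: mats_def)

lemma mats_zero [simp, intro]: "0\<^sub>m r c \<in> mats V r c"
  by (auto simp: mats_def)

lemma mats_uminus [intro]: "A \<in> mats V r c \<Longrightarrow> - A \<in> mats V r c"
  by (auto simp: mats_def)

lemma mats_transpose [intro]: "A \<in> mats V r c \<Longrightarrow> transpose_mat A \<in> mats V c r"
  by (auto simp: mats_def)

lemma zero_mat_mult_vec [simp]: "u \<in> carrier_vec c \<Longrightarrow> 0\<^sub>m r c *\<^sub>v u = 0\<^sub>v r"
  by (intro eq_vecI) (auto simp: scalar_prod_def)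

lemma mult_mat_vec_uminus:
  "A \<in> carrier_mat r c \<Longrightarrow> v \<in> carrier_vec c \<Longrightarrow> A *\<^sub>v (- v) = - (A *\<^sub>v (v :: 'a::comm_ring_1 vec))"
  by (intro eq_vecI) (auto simp: scalar_prod_def sum_negf)

lemma append_vec_dim_0: "dim_vec w = 0 \<Longrightarrow> v @\<^sub>v w = v"
  by (intro eq_vecI) auto

lemma zero_vec_append_dims: "0\<^sub>v (a + b) = 0\<^sub>v a @\<^sub>v 0\<^sub>v b"
  by (intro eq_vecI) auto

lemma vec_add_eq_zeroD:
  fixes x y :: "'a::ab_group_add vec"
  assumes "x + y = 0\<^sub>v n" "x \<in> carrier_vec n" "y \<in> carrier_vec n"
  shows "y = - x"
proof (rule eq_vecI)
  fix i assume i: "i < dim_vec (- x)"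
  have "x $ i + y $ i = (x + y) $ i" using i assms(2,3) by simp
  also have "\<dots> = 0" unfolding assms(1) using i assms(2) by simp
  finally show "y $ i = (- x) $ i" using i assms(2,3) by (simp add: eq_neg_iff_add_eq_0 add.commute)
qed (use assms in simp)

lemma dim_0_append_vec: "dim_vec v = 0 \<Longrightarrow> v @\<^sub>v w = w"
  by (intro eq_vecI) auto

text \<open>The Koszul complex of \<open>k + 1\<close> matrices is the mapping cone of the last one, acting on
  the Koszul complex of the first \<open>k\<close>.\<close>

fun kz_rank :: "nat \<Rightarrow> nat \<Rightarrow> nat \<Rightarrow> nat" where
  "kz_rank b 0 0 = b"
| "kz_rank b 0 (Suc i) = 0"
| "kz_rank b (Suc k) 0 = kz_rank b k 0"
| "kz_rank b (Suc k) (Suc i) = kz_rank b k (Suc i) + kz_rank b k i"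

text \<open>The chain map that \<open>X\<close> induces on the complex of \<open>k\<close> other
  matrices: \<open>X\<close> on each of the \<open>binomial(k, i)\<close> copies of the base module.
  It is the connecting block of the mapping cone.\<close>

fun kz_lift :: "nat \<Rightarrow> 'a::comm_ring_1 mat \<Rightarrow> nat \<Rightarrow> nat \<Rightarrow> 'a mat" where
  "kz_lift b X 0 0 = X"
| "kz_lift b X 0 (Suc i) = 0\<^sub>m 0 0"
| "kz_lift b X (Suc k) 0 = kz_lift b X k 0"
| "kz_lift b X (Suc k) (Suc i) =
    four_block_mat (kz_lift b X k (Suc i)) (0\<^sub>m (kz_rank b k (Suc i)) (kz_rank b k i))
      (0\<^sub>m (kz_rank b k i) (kz_rank b k (Suc i))) (kz_lift b X k i)"

text \<open>\<open>kz_diff b Y k i\<close> goes from homological degree \<open>i + 1\<close> to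
  degree \<open>i\<close>. The minus sign in the last block makes consecutive cone differentials
  compose to 0. For \<open>i = 0\<close> the lower blocks have no rows, because the shifted copy
  starts in degree 1.\<close>

fun kz_diff :: "nat \<Rightarrow> (nat \<Rightarrow> 'a::comm_ring_1 mat) \<Rightarrow> nat \<Rightarrow> nat \<Rightarrow> 'a mat" where
  "kz_diff b Y 0 i = 0\<^sub>m (kz_rank b 0 i) 0"
| "kz_diff b Y (Suc k) 0 =
    four_block_mat (kz_diff b Y k 0) (kz_lift b (Y k) k 0)
      (0\<^sub>m 0 (kz_rank b k 1)) (0\<^sub>m 0 (kz_rank b k 0))"
| "kz_diff b Y (Suc k) (Suc i) =
    four_block_mat (kz_diff b Y k (Suc i)) (kz_lift b (Y k) k (Suc i))
      (0\<^sub>m (kz_rank b k i) (kz_rank b k (Suc (Suc i)))) (- kz_diff b Y k i)"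

text \<open>The matrices have degree one with respect to \<open>dg\<close>, so the shifted copy in a
  cone sits one degree higher.\<close>

fun kz_deg :: "nat \<Rightarrow> (nat \<Rightarrow> int) \<Rightarrow> nat \<Rightarrow> nat \<Rightarrow> nat \<Rightarrow> int" where
  "kz_deg b dg 0 i j = dg j"
| "kz_deg b dg (Suc k) 0 j = kz_deg b dg k 0 j"
| "kz_deg b dg (Suc k) (Suc i) j =
    (if j < kz_rank b k (Suc i) then kz_deg b dg k (Suc i) j
     else kz_deg b dg k i (j - kz_rank b k (Suc i)) + 1)"

lemma kz_rank_0 [simp]: "kz_rank b k 0 = b"
  by (induction k) auto

lemma kz_rank_beyond: "i > k \<Longrightarrow> kz_rank b k i = 0"
proof (induction k arbitrary: i)
  case 0 then show ?case by (cases i) auto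
next
  case (Suc k) then show ?case by (cases i) auto
qed

lemma kz_rank_top [simp]: "kz_rank b k k = b"
  by (induction k) (auto simp: kz_rank_beyond)

lemma kz_lift_0 [simp]: "kz_lift b X k 0 = X"
  by (induction k) auto

lemma kz_deg_0 [simp]: "kz_deg b dg k 0 j = dg j"
  by (induction k) auto

lemma kz_deg_top: "kz_deg b dg k k j = dg j + int k"
  by (induction k) (auto simp: kz_rank_beyond)

lemma kz_lift_carrier [simp]:
  "X \<in> carrier_mat b b \<Longrightarrow> kz_lift b X k i \<in> carrier_mat (kz_rank b k i) (kz_rank b k i)"
  by (induction b X k i rule: kz_lift.induct) auto

lemma kz_diff_carrier [simp]:
  assumes "\<And>l. l < k \<Longrightarrow> Y l \<in> carrier_mat b b"
  shows "kz_diff b Y k i \<in> carrier_mat (kz_rank b k i) (kz_rank b k (Suc i))"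
  using assms
proof (induction b Y k i rule: kz_diff.induct)
  case (2 b Y k)
  have Y: "Y l \<in> carrier_mat b b" if "l < k" for l using 2(2) that by simp
  have "Y k \<in> carrier_mat b b" using 2(2) by simp
  then have "four_block_mat (kz_diff b Y k 0) (kz_lift b (Y k) k 0) (0\<^sub>m 0 (kz_rank b k 1)) (0\<^sub>m 0 b)
      \<in> carrier_mat (kz_rank b k 0 + 0) (kz_rank b k (Suc 0) + b)"
    by (intro four_block_carrier_mat 2(1)[OF Y]) simp_all
  then show ?case by (simp only: kz_diff.simps kz_rank.simps kz_rank_0 add_0_right)
next
  case (3 b Y k i)
  have Y: "Y l \<in> carrier_mat b b" if "l < k" for l using 3(3) that by simp
  show ?case unfolding kz_diff.simps kz_rank.simps
    by (intro four_block_carrier_mat uminus_carrier_mat 3(1,2) Y)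
qed auto

lemma kz_lift_mats [intro]:
  "X \<in> mats V b b \<Longrightarrow> kz_lift b X k i \<in> mats V (kz_rank b k i) (kz_rank b k i)"
  by (induction b X k i rule: kz_lift.induct) auto

lemma kz_diff_mats:
  assumes "\<And>l. l < k \<Longrightarrow> Y l \<in> mats V b b"
  shows "kz_diff b Y k i \<in> mats V (kz_rank b k i) (kz_rank b k (Suc i))"
  using assms
proof (induction b Y k i rule: kz_diff.induct)
  case (2 b Y k)
  have "four_block_mat (kz_diff b Y k 0) (kz_lift b (Y k) k 0)
      (0\<^sub>m 0 (kz_rank b k 1)) (0\<^sub>m 0 (kz_rank b k 0)) \<in> mats V (kz_rank b k 0 + 0) (kz_rank b k 1 + kz_rank b k 0)"
    using 2 by (intro mats_four_block) auto
  then show ?case by simp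
next
  case (3 b Y k i)
  then show ?case by (auto simp del: kz_lift_0)
qed auto

lemma kz_lift_homogeneous:
  assumes "\<And>i j. i < b \<Longrightarrow> j < b \<Longrightarrow> homogeneous (dg j + 1 - dg i) (X $$ (i, j))"
    and "X \<in> carrier_mat b b"
    and "p < kz_rank b k i" "q < kz_rank b k i"
  shows "homogeneous (kz_deg b dg k i q + 1 - kz_deg b dg k i p) (kz_lift b X k i $$ (p, q))"
  using assms
proof (induction b X k i arbitrary: p q rule: kz_lift.induct)
  case (4 b X k i)
  have "kz_lift b X k i \<in> carrier_mat (kz_rank b k i) (kz_rank b k i)"
    "kz_lift b X k (Suc i) \<in> carrier_mat (kz_rank b k (Suc i)) (kz_rank b k (Suc i))"
    using 4 by auto
  note d = this[THEN carrier_matD(1)] this[THEN carrier_matD(2)]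
  show ?case using 4 by (auto simp: d)
qed auto

lemma kz_diff_homogeneous:
  assumes "\<And>l i j. l < k \<Longrightarrow> i < b \<Longrightarrow> j < b \<Longrightarrow> homogeneous (dg j + 1 - dg i) (Y l $$ (i, j))"
    and "\<And>l. l < k \<Longrightarrow> Y l \<in> carrier_mat b b"
    and "p < kz_rank b k i" "q < kz_rank b k (Suc i)"
  shows "homogeneous (kz_deg b dg k (Suc i) q - kz_deg b dg k i p) (kz_diff b Y k i $$ (p, q))"
  using assms
proof (induction b Y k i arbitrary: p q rule: kz_diff.induct)
  case (2 b Y k)
  have c: "kz_diff b Y k 0 \<in> carrier_mat b (kz_rank b k (Suc 0))" "Y k \<in> carrier_mat b b"
    using kz_diff_carrier[of k Y b 0] 2 by auto
  then show ?case using 2 by (auto simp: add.commute dest!: carrier_matD)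
next
  case (3 b Y k i)
  have c: "kz_diff b Y k i \<in> carrier_mat (kz_rank b k i) (kz_rank b k (Suc i))"
    "kz_diff b Y k (Suc i) \<in> carrier_mat (kz_rank b k (Suc i)) (kz_rank b k (Suc (Suc i)))"
    "kz_lift b (Y k) k (Suc i) \<in> carrier_mat (kz_rank b k (Suc i)) (kz_rank b k (Suc i))"
    using 3 by auto
  have l: "homogeneous (kz_deg b dg k (Suc i) q' + 1 - kz_deg b dg k (Suc i) p') (kz_lift b (Y k) k (Suc i) $$ (p', q'))"
    if "p' < kz_rank b k (Suc i)" "q' < kz_rank b k (Suc i)" for p' q'
    using 3 that by (intro kz_lift_homogeneous) auto
  have l': "homogeneous (1 + kz_deg b dg k (Suc i) q' - kz_deg b dg k (Suc i) p') (kz_lift b (Y k) k (Suc i) $$ (p', q'))"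
    if "p' < kz_rank b k (Suc i)" "q' < kz_rank b k (Suc i)" for p' q'
    using l[OF that] by (simp add: add.commute)
  have d1: "homogeneous (kz_deg b dg k (Suc (Suc i)) q' - kz_deg b dg k (Suc i) p') (kz_diff b Y k (Suc i) $$ (p', q'))"
    if "p' < kz_rank b k (Suc i)" "q' < kz_rank b k (Suc (Suc i))" for p' q'
    using 3 that by auto
  have d2: "homogeneous (kz_deg b dg k (Suc i) q' - kz_deg b dg k i p') (kz_diff b Y k i $$ (p', q'))"
    if "p' < kz_rank b k i" "q' < kz_rank b k (Suc i)" for p' q'
    using 3 that by auto
  show ?case using carrier_matD[OF c(1)] carrier_matD[OF c(2)] carrier_matD[OF c(3)] 3(5,6)
    by (auto intro!: homogeneous_uminus d1 d2 l' simp: algebra_simps)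
qed auto

lemma kz_lift_append:
  assumes "X \<in> carrier_mat b b" "u \<in> carrier_vec (kz_rank b k (Suc i))" "v \<in> carrier_vec (kz_rank b k i)"
  shows "kz_lift b X (Suc k) (Suc i) *\<^sub>v (u @\<^sub>v v) =
    kz_lift b X k (Suc i) *\<^sub>v u @\<^sub>v kz_lift b X k i *\<^sub>v v"
  using assms by (simp add: mult_mat_vec_split)

lemma kz_diff_append_0:
  assumes "\<And>l. l < Suc k \<Longrightarrow> Y l \<in> carrier_mat b b" "u \<in> carrier_vec (kz_rank b k 1)" "v \<in> carrier_vec b"
  shows "kz_diff b Y (Suc k) 0 *\<^sub>v (u @\<^sub>v v) = kz_diff b Y k 0 *\<^sub>v u + Y k *\<^sub>v v"
proof -
  have c: "kz_diff b Y k 0 \<in> carrier_mat b (kz_rank b k 1)" "Y k \<in> carrier_mat b b"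
    using kz_diff_carrier[of k Y b 0] assms by auto
  have "kz_diff b Y (Suc k) 0 *\<^sub>v (u @\<^sub>v v) = (kz_diff b Y k 0 *\<^sub>v u + Y k *\<^sub>v v) @\<^sub>v
      (0\<^sub>m 0 (kz_rank b k 1) *\<^sub>v u + 0\<^sub>m 0 b *\<^sub>v v)"
    unfolding kz_diff.simps kz_lift_0 kz_rank_0 using c assms(2,3) by (intro four_block_mat_mult_vec) auto
  then show ?thesis using c assms(2,3) by (simp add: append_vec_dim_0)
qed

lemma kz_diff_append_Suc:
  assumes "\<And>l. l < Suc k \<Longrightarrow> Y l \<in> carrier_mat b b" "u \<in> carrier_vec (kz_rank b k (Suc (Suc i)))"
    "v \<in> carrier_vec (kz_rank b k (Suc i))"
  shows "kz_diff b Y (Suc k) (Suc i) *\<^sub>v (u @\<^sub>v v) =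
    (kz_diff b Y k (Suc i) *\<^sub>v u + kz_lift b (Y k) k (Suc i) *\<^sub>v v) @\<^sub>v - (kz_diff b Y k i *\<^sub>v v)"
proof -
  have c: "kz_diff b Y k i \<in> carrier_mat (kz_rank b k i) (kz_rank b k (Suc i))"
    "kz_diff b Y k (Suc i) \<in> carrier_mat (kz_rank b k (Suc i)) (kz_rank b k (Suc (Suc i)))"
    "kz_lift b (Y k) k (Suc i) \<in> carrier_mat (kz_rank b k (Suc i)) (kz_rank b k (Suc i))"
    using assms(1) by auto
  have "kz_diff b Y (Suc k) (Suc i) *\<^sub>v (u @\<^sub>v v) =
    (kz_diff b Y k (Suc i) *\<^sub>v u + kz_lift b (Y k) k (Suc i) *\<^sub>v v) @\<^sub>v
    (0\<^sub>m (kz_rank b k i) (kz_rank b k (Suc (Suc i))) *\<^sub>v u + (- kz_diff b Y k i) *\<^sub>v v)"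
    unfolding kz_diff.simps using c assms(2,3) by (intro four_block_mat_mult_vec) auto
  also have "0\<^sub>m (kz_rank b k i) (kz_rank b k (Suc (Suc i))) *\<^sub>v u + (- kz_diff b Y k i) *\<^sub>v v =
    - (kz_diff b Y k i *\<^sub>v v)"
    using c assms(2,3) uminus_mult_mat_vec[of v "kz_diff b Y k i"] by auto
  finally show ?thesis .
qed

section \<open>Chain maps, differentials and exactness\<close>

lemma kz_lift_commute:
  assumes "X \<in> carrier_mat b b" "X' \<in> carrier_mat b b" "X * X' = X' * X"
    and "u \<in> carrier_vec (kz_rank b k i)"
  shows "kz_lift b X k i *\<^sub>v (kz_lift b X' k i *\<^sub>v u) = kz_lift b X' k i *\<^sub>v (kz_lift b X k i *\<^sub>v u)"
  using assms
proof (induction b X k i arbitrary: u rule: kz_lift.induct)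
  case (1 b X)
  then show ?case using assoc_mult_mat_vec[of X b b X' b u] assoc_mult_mat_vec[of X' b b X b u] by simp
next
  case (4 b X k i)
  have "u \<in> carrier_vec (kz_rank b k (Suc i) + kz_rank b k i)" using 4(6) by simp
  then obtain u1 u2 where u: "u = u1 @\<^sub>v u2" "u1 \<in> carrier_vec (kz_rank b k (Suc i))"
      "u2 \<in> carrier_vec (kz_rank b k i)"
    using vec_first_last_append vec_first_carrier vec_last_carrier by metis
  note m = mult_mat_vec_carrier[OF kz_lift_carrier]
  show ?case unfolding u(1)
    using kz_lift_append[OF 4(3) u(2,3)] kz_lift_append[OF 4(4) u(2,3)]
      kz_lift_append[OF 4(3) m[OF 4(4) u(2)] m[OF 4(4) u(3)]]
      kz_lift_append[OF 4(4) m[OF 4(3) u(2)] m[OF 4(3) u(3)]]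
      4(1)[OF 4(3-5) u(2)] 4(2)[OF 4(3-5) u(3)]
    by simp
qed auto

lemma vec_splitE:
  assumes "u \<in> carrier_vec (a + b)"
  obtains u1 u2 where "u = u1 @\<^sub>v u2" "u1 \<in> carrier_vec a" "u2 \<in> carrier_vec b"
  using assms vec_first_last_append vec_first_carrier vec_last_carrier by metis

text \<open>Because \<open>X\<close> commutes with every matrix of the complex, its lift commutes
  with the differentials, block by block.\<close>

lemma kz_diff_lift:
  assumes "X \<in> carrier_mat b b" "\<And>l. l < k \<Longrightarrow> Y l \<in> carrier_mat b b"
    and "\<And>l. l < k \<Longrightarrow> X * Y l = Y l * X"
    and "u \<in> carrier_vec (kz_rank b k (Suc i))"
  shows "kz_diff b Y k i *\<^sub>v (kz_lift b X k (Suc i) *\<^sub>v u) = kz_lift b X k i *\<^sub>v (kz_diff b Y k i *\<^sub>v u)"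
  using assms
proof (induction k arbitrary: i u)
  case 0
  have "kz_lift b X 0 i *\<^sub>v 0\<^sub>v (kz_rank b 0 i) = 0\<^sub>v (kz_rank b 0 i)"
    using kz_lift_carrier[OF 0(1), of 0 i] by (intro eq_vecI) (simp_all add: scalar_prod_def)
  moreover have "kz_diff b Y 0 i *\<^sub>v w = 0\<^sub>v (kz_rank b 0 i)" if "dim_vec w = 0" for w
    using zero_mat_mult_vec[OF carrier_vecI[OF that]] by simp
  moreover have "dim_vec u = 0" using 0(4) by simp
  moreover have "dim_vec (kz_lift b X 0 (Suc i) *\<^sub>v u) = 0" by simp
  ultimately show ?case by simp
next
  case (Suc k)
  have Y: "\<And>l. l < k \<Longrightarrow> Y l \<in> carrier_mat b b" and Yk: "Y k \<in> carrier_mat b b"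
    and XY: "\<And>l. l < k \<Longrightarrow> X * Y l = Y l * X" and XYk: "X * Y k = Y k * X"
    using Suc.prems by auto
  have "u \<in> carrier_vec (kz_rank b k (Suc i) + kz_rank b k i)" using Suc.prems(4) by simp
  then obtain u1 u2 where u: "u = u1 @\<^sub>v u2" "u1 \<in> carrier_vec (kz_rank b k (Suc i))"
      "u2 \<in> carrier_vec (kz_rank b k i)" by (rule vec_splitE)
  note lc = mult_mat_vec_carrier[OF kz_lift_carrier[OF Suc.prems(1)]]
  note lY = mult_mat_vec_carrier[OF kz_lift_carrier[OF Yk]]
  note dc = mult_mat_vec_carrier[OF kz_diff_carrier[OF Y]]
  note IH = Suc.IH[OF Suc.prems(1) Y XY]
  note comm = kz_lift_commute[OF Suc.prems(1) Yk XYk]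
  show ?case
  proof (cases i)
    case 0
    have u2: "u2 \<in> carrier_vec b" using u(3) 0 by simp
    have u1: "u1 \<in> carrier_vec (kz_rank b k 1)" using u(2) 0 by simp
    have X2: "X *\<^sub>v u2 \<in> carrier_vec b" using Suc.prems(1) u2 by simp
    have "kz_diff b Y (Suc k) 0 *\<^sub>v (kz_lift b X (Suc k) (Suc 0) *\<^sub>v u)
        = kz_diff b Y (Suc k) 0 *\<^sub>v (kz_lift b X k (Suc 0) *\<^sub>v u1 @\<^sub>v X *\<^sub>v u2)"
      using kz_lift_append[OF Suc.prems(1) u(2,3)] 0 u(1) by simp
    also have "\<dots> = kz_diff b Y k 0 *\<^sub>v (kz_lift b X k (Suc 0) *\<^sub>v u1) + Y k *\<^sub>v (X *\<^sub>v u2)"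
      using lc[OF u(2)] 0 X2 Suc.prems(2) by (intro kz_diff_append_0) auto
    also have "kz_diff b Y k 0 *\<^sub>v (kz_lift b X k (Suc 0) *\<^sub>v u1) = X *\<^sub>v (kz_diff b Y k 0 *\<^sub>v u1)"
      using IH[OF _ _ u(2)] 0 by simp
    also have "Y k *\<^sub>v (X *\<^sub>v u2) = X *\<^sub>v (Y k *\<^sub>v u2)"
      using comm[OF u(3)] 0 by simp
    also have "X *\<^sub>v (kz_diff b Y k 0 *\<^sub>v u1) + X *\<^sub>v (Y k *\<^sub>v u2) = X *\<^sub>v (kz_diff b Y k 0 *\<^sub>v u1 + Y k *\<^sub>v u2)"
      using dc[OF _ u(2)] 0 Yk u2 Suc.prems(1)
      by (intro mult_add_distrib_mat_vec[symmetric]) auto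
    also have "kz_diff b Y k 0 *\<^sub>v u1 + Y k *\<^sub>v u2 = kz_diff b Y (Suc k) 0 *\<^sub>v u"
      unfolding u(1) using u1 u2 Suc.prems(2) by (intro kz_diff_append_0[symmetric]) auto
    finally show ?thesis using 0 by simp
  next
    case (Suc i')
    have D2: "kz_diff b Y k i' *\<^sub>v u2 \<in> carrier_vec (kz_rank b k i')"
      using u(3) Suc by (intro mult_mat_vec_carrier[OF kz_diff_carrier[OF Y]]) auto
    have "kz_diff b Y (Suc k) i *\<^sub>v (kz_lift b X (Suc k) (Suc i) *\<^sub>v u)
        = kz_diff b Y (Suc k) i *\<^sub>v (kz_lift b X k (Suc i) *\<^sub>v u1 @\<^sub>v kz_lift b X k i *\<^sub>v u2)"
      using kz_lift_append[OF Suc.prems(1) u(2,3)] u(1) by simp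
    also have "\<dots> = (kz_diff b Y k i *\<^sub>v (kz_lift b X k (Suc i) *\<^sub>v u1) +
        kz_lift b (Y k) k i *\<^sub>v (kz_lift b X k i *\<^sub>v u2)) @\<^sub>v - (kz_diff b Y k i' *\<^sub>v (kz_lift b X k i *\<^sub>v u2))"
      unfolding Suc using lc[OF u(2)] lc[OF u(3)] Suc Suc.prems(2) by (intro kz_diff_append_Suc) auto
    also have "kz_diff b Y k i *\<^sub>v (kz_lift b X k (Suc i) *\<^sub>v u1) = kz_lift b X k i *\<^sub>v (kz_diff b Y k i *\<^sub>v u1)"
      using IH[OF _ _ u(2)] by simp
    also have "kz_diff b Y k i' *\<^sub>v (kz_lift b X k i *\<^sub>v u2) = kz_lift b X k i' *\<^sub>v (kz_diff b Y k i' *\<^sub>v u2)"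
      using IH[of u2 i'] u(3) Suc by simp
    also have "kz_lift b (Y k) k i *\<^sub>v (kz_lift b X k i *\<^sub>v u2) = kz_lift b X k i *\<^sub>v (kz_lift b (Y k) k i *\<^sub>v u2)"
      using comm[OF u(3)] by simp
    also have "kz_lift b X k i *\<^sub>v (kz_diff b Y k i *\<^sub>v u1) + kz_lift b X k i *\<^sub>v (kz_lift b (Y k) k i *\<^sub>v u2)
       = kz_lift b X k i *\<^sub>v (kz_diff b Y k i *\<^sub>v u1 + kz_lift b (Y k) k i *\<^sub>v u2)"
      using dc[OF _ u(2)] lY[OF u(3)] by (intro mult_add_distrib_mat_vec[symmetric, OF kz_lift_carrier[OF Suc.prems(1)]]) auto
    also have "- (kz_lift b X k i' *\<^sub>v (kz_diff b Y k i' *\<^sub>v u2)) = kz_lift b X k i' *\<^sub>v (- (kz_diff b Y k i' *\<^sub>v u2))"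
      by (rule mult_mat_vec_uminus[symmetric, OF kz_lift_carrier[OF Suc.prems(1)] D2])
    also have "kz_lift b X k i *\<^sub>v (kz_diff b Y k i *\<^sub>v u1 + kz_lift b (Y k) k i *\<^sub>v u2) @\<^sub>v
        kz_lift b X k i' *\<^sub>v (- (kz_diff b Y k i' *\<^sub>v u2)) =
      kz_lift b X (Suc k) i *\<^sub>v ((kz_diff b Y k i *\<^sub>v u1 + kz_lift b (Y k) k i *\<^sub>v u2) @\<^sub>v - (kz_diff b Y k i' *\<^sub>v u2))"
      unfolding Suc using dc[OF _ u(2)] D2 lY[OF u(3)] u(3) Suc
      by (intro kz_lift_append[symmetric, OF Suc.prems(1)]) auto
    also have "(kz_diff b Y k i *\<^sub>v u1 + kz_lift b (Y k) k i *\<^sub>v u2) @\<^sub>v - (kz_diff b Y k i' *\<^sub>v u2) = kz_diff b Y (Suc k) i *\<^sub>v u"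
      unfolding u(1) Suc using u(2,3) Suc Suc.prems(2) by (intro kz_diff_append_Suc[symmetric]) auto
    finally show ?thesis .
  qed
qed

text \<open>In the first block of the composite the two mixed terms cancel: the lift of
  \<open>Y k\<close> is a chain map and the shifted differential carries a sign. What remains are
  composites of the smaller complex.\<close>

lemma kz_diff_diff:
  assumes "\<And>l. l < k \<Longrightarrow> Y l \<in> carrier_mat b b"
    and "\<And>l m. l < k \<Longrightarrow> m < k \<Longrightarrow> Y l * Y m = Y m * Y l"
    and "u \<in> carrier_vec (kz_rank b k (Suc (Suc i)))"
  shows "kz_diff b Y k i *\<^sub>v (kz_diff b Y k (Suc i) *\<^sub>v u) = 0\<^sub>v (kz_rank b k i)"
  using assms
proof (induction k arbitrary: i u)
  case 0
  show ?case using zero_mat_mult_vec[OF carrier_vecI, of "kz_diff b Y 0 (Suc i) *\<^sub>v u" 0 "kz_rank b 0 i"] by simp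
next
  case (Suc k)
  have Y: "\<And>l. l < k \<Longrightarrow> Y l \<in> carrier_mat b b" and Yk: "Y k \<in> carrier_mat b b"
    and YY: "\<And>l m. l < k \<Longrightarrow> m < k \<Longrightarrow> Y l * Y m = Y m * Y l"
    and XY: "\<And>l. l < k \<Longrightarrow> Y k * Y l = Y l * Y k"
    using Suc.prems(1,2) by auto
  have "u \<in> carrier_vec (kz_rank b k (Suc (Suc i)) + kz_rank b k (Suc i))" using Suc.prems(3) by simp
  then obtain u1 u2 where u: "u = u1 @\<^sub>v u2" "u1 \<in> carrier_vec (kz_rank b k (Suc (Suc i)))"
      "u2 \<in> carrier_vec (kz_rank b k (Suc i))" by (rule vec_splitE)
  note dc = mult_mat_vec_carrier[OF kz_diff_carrier[OF Y]]
  note lY = mult_mat_vec_carrier[OF kz_lift_carrier[OF Yk]]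
  define a where "a = kz_diff b Y k (Suc i) *\<^sub>v u1"
  define l2 where "l2 = kz_lift b (Y k) k (Suc i) *\<^sub>v u2"
  define d2 where "d2 = kz_diff b Y k i *\<^sub>v u2"
  have c: "a \<in> carrier_vec (kz_rank b k (Suc i))" "l2 \<in> carrier_vec (kz_rank b k (Suc i))"
      "d2 \<in> carrier_vec (kz_rank b k i)"
    unfolding a_def l2_def d2_def using dc[OF _ u(2)] lY[OF u(3)] dc[OF _ u(3)] by auto
  have du: "kz_diff b Y (Suc k) (Suc i) *\<^sub>v u = (a + l2) @\<^sub>v - d2"
    unfolding u(1) a_def l2_def d2_def using Suc.prems(1) u(2,3) by (rule kz_diff_append_Suc)
  have key: "kz_diff b Y k i *\<^sub>v (a + l2) + kz_lift b (Y k) k i *\<^sub>v (- d2) = 0\<^sub>v (kz_rank b k i)"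
  proof -
    have "kz_diff b Y k i *\<^sub>v (a + l2) = kz_diff b Y k i *\<^sub>v a + kz_diff b Y k i *\<^sub>v l2"
      using c by (intro mult_add_distrib_mat_vec[OF kz_diff_carrier[OF Y]]) auto
    also have "kz_diff b Y k i *\<^sub>v a = 0\<^sub>v (kz_rank b k i)"
      unfolding a_def using Suc.IH[OF Y YY u(2)] by simp
    also have "kz_diff b Y k i *\<^sub>v l2 = kz_lift b (Y k) k i *\<^sub>v d2"
      unfolding l2_def d2_def using kz_diff_lift[OF Yk Y XY u(3)] by simp
    finally have 1: "kz_diff b Y k i *\<^sub>v (a + l2) = kz_lift b (Y k) k i *\<^sub>v d2"
      using lY[OF c(3)] by simp
    show ?thesis
      unfolding 1 mult_mat_vec_uminus[OF kz_lift_carrier[OF Yk] c(3)] using lY[OF c(3)] by simp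
  qed
  show ?case
  proof (cases i)
    case 0
    have "kz_diff b Y (Suc k) 0 *\<^sub>v ((a + l2) @\<^sub>v - d2) = kz_diff b Y k 0 *\<^sub>v (a + l2) + Y k *\<^sub>v (- d2)"
      using Suc.prems(1) c 0 by (intro kz_diff_append_0) auto
    then show ?thesis using key du 0 by simp
  next
    case (Suc i')
    have "kz_diff b Y (Suc k) i *\<^sub>v ((a + l2) @\<^sub>v - d2) =
       (kz_diff b Y k i *\<^sub>v (a + l2) + kz_lift b (Y k) k i *\<^sub>v (- d2)) @\<^sub>v - (kz_diff b Y k i' *\<^sub>v (- d2))"
      unfolding Suc using Suc.prems(1) c Suc by (intro kz_diff_append_Suc) auto
    also have "kz_diff b Y k i' *\<^sub>v (- d2) = - (kz_diff b Y k i' *\<^sub>v d2)"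
      using c(3) Suc by (intro mult_mat_vec_uminus[OF kz_diff_carrier[OF Y]]) auto
    also have "kz_diff b Y k i' *\<^sub>v d2 = 0\<^sub>v (kz_rank b k i')"
      unfolding d2_def Suc using u(3) Suc by (intro Suc.IH Y YY) auto
    finally have "kz_diff b Y (Suc k) i *\<^sub>v (kz_diff b Y (Suc k) (Suc i) *\<^sub>v u) =
        0\<^sub>v (kz_rank b k i) @\<^sub>v 0\<^sub>v (kz_rank b k i')"
      unfolding du key by (simp only: uminus_zero_vec)
    then show ?thesis by (simp only: Suc kz_rank.simps zero_vec_append_dims)
  qed
qed

text \<open>The submodule \<open>Y 0 S^b + ... + Y (k - 1) S^b\<close> of \<open>S^b\<close>, as
  \<open>kz_image_0\<close> and \<open>kz_image_Suc\<close> show.\<close>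

definition kz_image :: "'v set \<Rightarrow> nat \<Rightarrow> (nat \<Rightarrow> ('v, 'k::field) mpoly mat) \<Rightarrow> nat \<Rightarrow> ('v, 'k) mpoly vec set" where
  "kz_image V b Y k = (\<lambda>w. kz_diff b Y k 0 *\<^sub>v w) ` vecs V (kz_rank b k 1)"

lemma kz_image_0: "kz_image V b Y 0 = {0\<^sub>v b}"
proof -
  have "kz_diff b Y 0 0 *\<^sub>v w = 0\<^sub>v b" if "w \<in> vecs V 0" for w
    using zero_mat_mult_vec[OF vecs_carrier[OF that]] by simp
  moreover have "0\<^sub>v 0 \<in> vecs V 0" by (rule vecs_zero)
  ultimately show ?thesis by (auto simp: kz_image_def simp del: kz_diff.simps)
qed

lemma kz_image_Suc:
  fixes Y :: "nat \<Rightarrow> ('v, 'k::field) mpoly mat"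
  assumes "\<And>l. l < Suc k \<Longrightarrow> Y l \<in> mats V b b"
  shows "kz_image V b Y (Suc k) = {x + Y k *\<^sub>v v | x v. x \<in> kz_image V b Y k \<and> v \<in> vecs V b}"
proof -
  have app: "kz_diff b Y (Suc k) 0 *\<^sub>v (u @\<^sub>v v) = kz_diff b Y k 0 *\<^sub>v u + Y k *\<^sub>v v"
    if "u \<in> vecs V (kz_rank b k 1)" "v \<in> vecs V b" for u v
    using assms that by (intro kz_diff_append_0) (auto intro: mats_carrier vecs_carrier)
  have r: "kz_rank b (Suc k) 1 = kz_rank b k 1 + b" by simp
  show ?thesis
  proof safe
    fix x assume "x \<in> kz_image V b Y (Suc k)"
    then obtain w where w: "w \<in> vecs V (kz_rank b k 1 + b)" "x = kz_diff b Y (Suc k) 0 *\<^sub>v w"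
      unfolding kz_image_def r by blast
    from w(1) obtain u v where "w = u @\<^sub>v v" "u \<in> vecs V (kz_rank b k 1)" "v \<in> vecs V b"
      by (rule vecs_splitE)
    then show "\<exists>x' v. x = x' + Y k *\<^sub>v v \<and> x' \<in> kz_image V b Y k \<and> v \<in> vecs V b"
      using app w(2) unfolding kz_image_def by blast
  next
    fix x v :: "('v, 'k) mpoly vec" assume "x \<in> kz_image V b Y k" "v \<in> vecs V b"
    then obtain u where u: "u \<in> vecs V (kz_rank b k 1)" "x = kz_diff b Y k 0 *\<^sub>v u"
      unfolding kz_image_def by blast
    have "u @\<^sub>v v \<in> vecs V (kz_rank b (Suc k) 1)"
      unfolding r using u(1) \<open>v \<in> vecs V b\<close> by (rule vecs_append)
    then show "x + Y k *\<^sub>v v \<in> kz_image V b Y (Suc k)"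
      unfolding kz_image_def u(2) app[OF u(1) \<open>v \<in> vecs V b\<close>, symmetric] by (rule imageI)
  qed
qed

text \<open>The long exact sequence of the cone, carried out by hand. Exactness of the smaller
  complex settles all degrees but the lowest, where \<open>Y k\<close> has to be injective modulo
  the image of its predecessors: the matrices have to form a regular sequence on
  \<open>S^b\<close>.\<close>

lemma kz_exact:
  assumes "\<And>l. l < k \<Longrightarrow> Y l \<in> mats V b b"
    and "\<And>l m. l < k \<Longrightarrow> m < k \<Longrightarrow> Y l * Y m = Y m * Y l"
    and "\<And>l v. l < k \<Longrightarrow> v \<in> vecs V b \<Longrightarrow> Y l *\<^sub>v v \<in> kz_image V b Y l \<Longrightarrow> v \<in> kz_image V b Y l"
    and "u \<in> vecs V (kz_rank b k (Suc i))" "kz_diff b Y k i *\<^sub>v u = 0\<^sub>v (kz_rank b k i)"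
  shows "\<exists>w \<in> vecs V (kz_rank b k (Suc (Suc i))). u = kz_diff b Y k (Suc i) *\<^sub>v w"
  using assms
proof (induction k arbitrary: i u)
  case 0
  then have "u \<in> carrier_vec 0" by (auto dest: vecs_carrier)
  moreover have "kz_diff b Y 0 (Suc i) *\<^sub>v 0\<^sub>v 0 \<in> carrier_vec 0" by (intro carrier_vecI) simp
  ultimately have "u = kz_diff b Y 0 (Suc i) *\<^sub>v 0\<^sub>v 0" by (intro eq_vecI) auto
  moreover have "0\<^sub>v 0 \<in> vecs V (kz_rank b 0 (Suc (Suc i)))" by (simp only: kz_rank.simps vecs_zero)
  ultimately show ?case by blast
next
  case (Suc k)
  have Ym: "\<And>l. l < k \<Longrightarrow> Y l \<in> mats V b b" and Ykm: "Y k \<in> mats V b b"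
    and YY: "\<And>l m. l < k \<Longrightarrow> m < k \<Longrightarrow> Y l * Y m = Y m * Y l"
    and XY: "\<And>l. l < k \<Longrightarrow> Y k * Y l = Y l * Y k"
    and inj: "\<And>l v. l < k \<Longrightarrow> v \<in> vecs V b \<Longrightarrow> Y l *\<^sub>v v \<in> kz_image V b Y l \<Longrightarrow> v \<in> kz_image V b Y l"
    using Suc.prems(1-3) by auto
  have Y: "\<And>l. l < k \<Longrightarrow> Y l \<in> carrier_mat b b" and Yk: "Y k \<in> carrier_mat b b"
    and Y': "\<And>l. l < Suc k \<Longrightarrow> Y l \<in> carrier_mat b b"
    using Suc.prems(1) Ym Ykm by (blast intro: mats_carrier)+
  have "u \<in> vecs V (kz_rank b k (Suc i) + kz_rank b k i)" using Suc.prems(4) by simp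
  then obtain u1 u2 where u: "u = u1 @\<^sub>v u2" "u1 \<in> vecs V (kz_rank b k (Suc i))"
      "u2 \<in> vecs V (kz_rank b k i)" by (rule vecs_splitE)
  have IH: "\<exists>w \<in> vecs V (kz_rank b k (Suc (Suc j))). v = kz_diff b Y k (Suc j) *\<^sub>v w"
    if "v \<in> vecs V (kz_rank b k (Suc j))" "kz_diff b Y k j *\<^sub>v v = 0\<^sub>v (kz_rank b k j)" for v j
    by (rule Suc.IH[OF Ym YY inj that])
  note uc = u(2,3)[THEN vecs_carrier]
  note dv = vecs_mult_mat[OF kz_diff_mats[of k Y V b, OF Ym]]
  note lv = vecs_mult_mat[OF kz_lift_mats[OF Ykm]]
  have "\<exists>u2' \<in> vecs V (kz_rank b k (Suc i)). u2 = kz_diff b Y k i *\<^sub>v u2'"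
    and e1: "kz_diff b Y k i *\<^sub>v u1 + kz_lift b (Y k) k i *\<^sub>v u2 = 0\<^sub>v (kz_rank b k i)"
  proof -
    have "(\<exists>u2' \<in> vecs V (kz_rank b k (Suc i)). u2 = kz_diff b Y k i *\<^sub>v u2') \<and>
      kz_diff b Y k i *\<^sub>v u1 + kz_lift b (Y k) k i *\<^sub>v u2 = 0\<^sub>v (kz_rank b k i)"
    proof (cases i)
      case 0
      have "kz_diff b Y (Suc k) 0 *\<^sub>v u = kz_diff b Y k 0 *\<^sub>v u1 + Y k *\<^sub>v u2"
        unfolding u(1) using uc 0 by (intro kz_diff_append_0 Y') auto
      then have e: "kz_diff b Y k 0 *\<^sub>v u1 + Y k *\<^sub>v u2 = 0\<^sub>v b" using Suc.prems(5) 0 by simp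
      have c1: "kz_diff b Y k 0 *\<^sub>v u1 \<in> carrier_vec b" "Y k *\<^sub>v u2 \<in> carrier_vec b"
        using dv[OF _ u(2)] lv[OF u(3)] 0 by (auto dest: vecs_carrier)
      have "Y k *\<^sub>v u2 = - (kz_diff b Y k 0 *\<^sub>v u1)"
        by (rule vec_add_eq_zeroD[OF e c1])
      also have "\<dots> = kz_diff b Y k 0 *\<^sub>v (- u1)"
        using uc(1) 0 by (intro mult_mat_vec_uminus[symmetric, OF kz_diff_carrier[OF Y]]) auto
      finally have "Y k *\<^sub>v u2 \<in> kz_image V b Y k"
        unfolding kz_image_def using u(2) 0 by auto
      then have "u2 \<in> kz_image V b Y k" using Suc.prems(3)[of k u2] u(3) 0 by simp
      then show ?thesis using e 0 by (auto simp: kz_image_def)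
    next
      case (Suc i')
      have e: "(kz_diff b Y k i *\<^sub>v u1 + kz_lift b (Y k) k i *\<^sub>v u2) @\<^sub>v - (kz_diff b Y k i' *\<^sub>v u2)
          = 0\<^sub>v (kz_rank b k i) @\<^sub>v 0\<^sub>v (kz_rank b k i')"
      proof -
        have "kz_diff b Y (Suc k) i *\<^sub>v u = (kz_diff b Y k i *\<^sub>v u1 + kz_lift b (Y k) k i *\<^sub>v u2) @\<^sub>v - (kz_diff b Y k i' *\<^sub>v u2)"
          unfolding Suc u(1) using uc Suc by (intro kz_diff_append_Suc Y') auto
        moreover have "kz_diff b Y (Suc k) i *\<^sub>v u = 0\<^sub>v (kz_rank b k i) @\<^sub>v 0\<^sub>v (kz_rank b k i')"
          using Suc.prems(5) unfolding Suc by (simp only: kz_rank.simps zero_vec_append_dims)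
        ultimately show ?thesis by (simp only:)
      qed
      have c1: "kz_diff b Y k i *\<^sub>v u1 + kz_lift b (Y k) k i *\<^sub>v u2 \<in> carrier_vec (kz_rank b k i)"
        using dv[OF _ u(2)] lv[OF u(3)] by (auto intro!: add_carrier_vec dest: vecs_carrier)
      have 1: "kz_diff b Y k i *\<^sub>v u1 + kz_lift b (Y k) k i *\<^sub>v u2 = 0\<^sub>v (kz_rank b k i)"
        and 2: "- (kz_diff b Y k i' *\<^sub>v u2) = 0\<^sub>v (kz_rank b k i')"
        using append_vec_eq[OF c1 zero_carrier_vec, THEN iffD1, OF e] by blast+
      from 2 have "kz_diff b Y k i' *\<^sub>v u2 = 0\<^sub>v (kz_rank b k i')"
        using uminus_uminus_vec[of "kz_diff b Y k i' *\<^sub>v u2"] by simp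
      then have "\<exists>u2' \<in> vecs V (kz_rank b k (Suc (Suc i'))). u2 = kz_diff b Y k (Suc i') *\<^sub>v u2'"
        using u(3) Suc by (intro IH) simp_all
      then show ?thesis using 1 Suc by simp
    qed
    then show "\<exists>u2' \<in> vecs V (kz_rank b k (Suc i)). u2 = kz_diff b Y k i *\<^sub>v u2'"
      "kz_diff b Y k i *\<^sub>v u1 + kz_lift b (Y k) k i *\<^sub>v u2 = 0\<^sub>v (kz_rank b k i)" by auto
  qed
  then obtain u2' where u2': "u2' \<in> vecs V (kz_rank b k (Suc i))" "u2 = kz_diff b Y k i *\<^sub>v u2'" by blast
  \<comment> \<open>The component \<open>u2\<close> is the boundary of \<open>u2'\<close>; adding
    the lift of \<open>u2'\<close> makes \<open>u1\<close> a cycle of the smaller complex.\<close>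
  define l where "l = kz_lift b (Y k) k (Suc i) *\<^sub>v u2'"
  have l: "l \<in> vecs V (kz_rank b k (Suc i))" unfolding l_def by (rule lv[OF u2'(1)])
  have "kz_diff b Y k i *\<^sub>v (u1 + l) = kz_diff b Y k i *\<^sub>v u1 + kz_diff b Y k i *\<^sub>v l"
    using uc l by (intro mult_add_distrib_mat_vec[OF kz_diff_carrier[OF Y]]) (auto dest: vecs_carrier)
  also have "kz_diff b Y k i *\<^sub>v l = kz_lift b (Y k) k i *\<^sub>v u2"
    unfolding l_def u2'(2) using u2'(1) by (intro kz_diff_lift Yk Y XY) (auto dest: vecs_carrier)
  finally have "kz_diff b Y k i *\<^sub>v (u1 + l) = 0\<^sub>v (kz_rank b k i)" using e1 by simp
  then obtain w1 where w1: "w1 \<in> vecs V (kz_rank b k (Suc (Suc i)))" "u1 + l = kz_diff b Y k (Suc i) *\<^sub>v w1"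
    using IH[of "u1 + l" i] u(2) l by blast
  \<comment> \<open>The sign of \<open>u2'\<close> compensates the sign of the shifted
    differential.\<close>
  have "kz_diff b Y (Suc k) (Suc i) *\<^sub>v (w1 @\<^sub>v - u2') =
      (kz_diff b Y k (Suc i) *\<^sub>v w1 + kz_lift b (Y k) k (Suc i) *\<^sub>v (- u2')) @\<^sub>v - (kz_diff b Y k i *\<^sub>v (- u2'))"
    using w1(1) u2'(1) by (intro kz_diff_append_Suc Y') (auto dest: vecs_carrier)
  also have "kz_lift b (Y k) k (Suc i) *\<^sub>v (- u2') = - l"
    unfolding l_def using u2'(1) by (intro mult_mat_vec_uminus[OF kz_lift_carrier[OF Yk]]) (auto dest: vecs_carrier)
  also have "kz_diff b Y k i *\<^sub>v (- u2') = - u2"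
    unfolding u2'(2) using u2'(1) by (intro mult_mat_vec_uminus[OF kz_diff_carrier[OF Y]]) (auto dest: vecs_carrier)
  also have "kz_diff b Y k (Suc i) *\<^sub>v w1 + - l = u1"
    unfolding w1(2)[symmetric] using vecs_carrier[OF l] uc(1) by (intro eq_vecI) auto
  finally have "kz_diff b Y (Suc k) (Suc i) *\<^sub>v (w1 @\<^sub>v - u2') = u" using u(1) by simp
  moreover have "w1 @\<^sub>v - u2' \<in> vecs V (kz_rank b (Suc k) (Suc (Suc i)))"
    using w1(1) u2'(1) by auto
  ultimately show ?case by metis
qed

lemma kz_lift_top: "X \<in> carrier_mat b b \<Longrightarrow> kz_lift b X k k = X"
proof (induction k)
  case (Suc k)
  have "kz_lift b X k (Suc k) \<in> carrier_mat 0 0" using kz_lift_carrier[OF Suc.prems, of k "Suc k"]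
    by (simp add: kz_rank_beyond)
  then show ?case using Suc by (intro eq_matI) auto
qed simp

text \<open>Up to signs the last differential is the column of all the matrices \<open>Y l\<close>,
  so its transpose reaches the image of each transposed \<open>Y l\<close>. These are the relations
  of the top cohomology of the dual complex.\<close>

lemma kz_cobounds:
  assumes "\<And>l. l < k \<Longrightarrow> Y l \<in> mats V b b" "l < k" "v \<in> vecs V b"
  shows "\<exists>h. k = Suc h \<and> (\<exists>w\<in>vecs V (kz_rank b k h).
    transpose_mat (kz_diff b Y k h) *\<^sub>v w = transpose_mat (Y l) *\<^sub>v v)"
  using assms
proof (induction k)
  case (Suc k)
  have Ym: "\<And>l. l < k \<Longrightarrow> Y l \<in> mats V b b" and Ykm: "Y k \<in> mats V b b"
    using Suc.prems(1) by auto
  have Y: "\<And>l. l < k \<Longrightarrow> Y l \<in> carrier_mat b b" and Yk: "Y k \<in> carrier_mat b b"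
    using Ym Ykm by (auto intro: mats_carrier)
  show ?case
  proof (cases k)
    case 0
    have "kz_diff b Y (Suc 0) 0 = Y 0" using Yk 0 by (intro eq_matI) auto
    then show ?thesis using 0 Suc.prems by auto
  next
    case (Suc h)
    have c1: "kz_diff b Y k k \<in> carrier_mat b 0" "kz_diff b Y k h \<in> carrier_mat (kz_rank b k h) b"
      using kz_diff_carrier[of k Y b k, OF Y] kz_diff_carrier[of k Y b h, OF Y] Suc
      by (auto simp: kz_rank_beyond simp del: kz_diff.simps kz_rank.simps)
    \<comment> \<open>The first block has no columns, since the complex of \<open>k\<close> matrices
      ends in degree \<open>k\<close>.\<close>
    have diff: "kz_diff b Y (Suc k) k = four_block_mat (kz_diff b Y k k) (Y k) (0\<^sub>m (kz_rank b k h) 0) (- kz_diff b Y k h)"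
      using kz_lift_top[OF Yk, of k] Suc by (simp add: kz_rank_beyond)
    have tr: "transpose_mat (kz_diff b Y (Suc k) k) *\<^sub>v (w1 @\<^sub>v w2) =
        transpose_mat (Y k) *\<^sub>v w1 - transpose_mat (kz_diff b Y k h) *\<^sub>v w2"
      if w: "w1 \<in> carrier_vec b" "w2 \<in> carrier_vec (kz_rank b k h)" for w1 w2
    proof -
      have "transpose_mat (kz_diff b Y (Suc k) k) = four_block_mat (transpose_mat (kz_diff b Y k k))
          (transpose_mat (0\<^sub>m (kz_rank b k h) 0)) (transpose_mat (Y k)) (transpose_mat (- kz_diff b Y k h))"
        unfolding diff using c1 Yk by (intro transpose_four_block_mat) auto
      also have "\<dots> *\<^sub>v (w1 @\<^sub>v w2) = (transpose_mat (kz_diff b Y k k) *\<^sub>v w1 + transpose_mat (0\<^sub>m (kz_rank b k h) 0) *\<^sub>v w2)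
         @\<^sub>v (transpose_mat (Y k) *\<^sub>v w1 + transpose_mat (- kz_diff b Y k h) *\<^sub>v w2)"
        using c1 Yk w by (intro four_block_mat_mult_vec) auto
      also have "\<dots> = transpose_mat (Y k) *\<^sub>v w1 + transpose_mat (- kz_diff b Y k h) *\<^sub>v w2"
        using c1 by (intro dim_0_append_vec) auto
      also have "transpose_mat (- kz_diff b Y k h) *\<^sub>v w2 = - (transpose_mat (kz_diff b Y k h) *\<^sub>v w2)"
        using c1 w by (intro eq_vecI) (auto simp: scalar_prod_def sum_negf)
      finally show ?thesis using c1 Yk w by (intro eq_vecI) auto
    qed
    have rk: "kz_rank b (Suc k) k = b + kz_rank b k h" using Suc by simp
    show ?thesis
    proof (cases "l = k")
      case True
      have "v @\<^sub>v 0\<^sub>v (kz_rank b k h) \<in> vecs V (kz_rank b (Suc k) k)"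
        unfolding rk using Suc.prems(3) by auto
      moreover have "transpose_mat (kz_diff b Y (Suc k) k) *\<^sub>v (v @\<^sub>v 0\<^sub>v (kz_rank b k h)) = transpose_mat (Y l) *\<^sub>v v"
        using tr[of v "0\<^sub>v (kz_rank b k h)"] vecs_carrier[OF Suc.prems(3)] Yk True c1
        by (auto intro!: eq_vecI simp: scalar_prod_def)
      ultimately show ?thesis by blast
    next
      case False
      then obtain w where w: "w \<in> vecs V (kz_rank b k h)"
          "transpose_mat (kz_diff b Y k h) *\<^sub>v w = transpose_mat (Y l) *\<^sub>v v"
        using Suc.IH[OF Ym] Suc.prems(2,3) Suc by auto
      have wc: "w \<in> carrier_vec (kz_rank b k h)" using w(1) by (rule vecs_carrier)
      have "0\<^sub>v b @\<^sub>v - w \<in> vecs V (kz_rank b (Suc k) k)" unfolding rk using w(1) by auto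
      moreover have "transpose_mat (kz_diff b Y (Suc k) k) *\<^sub>v (0\<^sub>v b @\<^sub>v - w) = transpose_mat (Y l) *\<^sub>v v"
      proof -
        have "transpose_mat (kz_diff b Y (Suc k) k) *\<^sub>v (0\<^sub>v b @\<^sub>v - w) =
           transpose_mat (Y k) *\<^sub>v 0\<^sub>v b - transpose_mat (kz_diff b Y k h) *\<^sub>v (- w)"
          using wc by (intro tr) auto
        also have "transpose_mat (kz_diff b Y k h) *\<^sub>v (- w) = - (transpose_mat (kz_diff b Y k h) *\<^sub>v w)"
          using c1 wc by (intro mult_mat_vec_uminus) auto
        also have "transpose_mat (Y k) *\<^sub>v 0\<^sub>v b - - (transpose_mat (kz_diff b Y k h) *\<^sub>v w) = transpose_mat (kz_diff b Y k h) *\<^sub>v w"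
          using c1 Yk wc by (intro eq_vecI) (auto simp: scalar_prod_def)
        finally show ?thesis using w(2) by simp
      qed
      ultimately show ?thesis by blast
    qed
  qed
qed simp

section \<open>Polynomials in some variables with coefficients in the others\<close>

section \<open>Extraction of coefficients\<close>

text \<open>For \<open>keys \<mu> \<subseteq> U\<close> this is the coefficient of the monomial
  \<mu> when \<open>p\<close> is read as a polynomial in the variables \<open>U\<close> over the
  polynomials in the remaining ones.\<close>

definition coeff_in :: "'v set \<Rightarrow> ('v \<Rightarrow>\<^sub>0 nat) \<Rightarrow> ('v, 'k::field) mpoly \<Rightarrow> ('v, 'k) mpoly" where
  "coeff_in U \<mu> p =
     (\<Sum>m \<in> {m. \<mu> + m \<in> keys p \<and> keys m \<inter> U = {}}. single m (lookup p (\<mu> + m)))"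

lemma lookup_coeff_in:
  "lookup (coeff_in U \<mu> p) m = (if keys m \<inter> U = {} then lookup p (\<mu> + m) else 0)"
proof -
  let ?S = "{m. \<mu> + m \<in> keys p \<and> keys m \<inter> U = {}}"
  have "finite ((\<lambda>m. \<mu> + m) -` keys p)" by (intro finite_vimageI) (auto simp: inj_on_def)
  then have fin: "finite ?S" by (rule rev_finite_subset) auto
  have "lookup (coeff_in U \<mu> p) m = (\<Sum>m'\<in>?S. if m' = m then lookup p (\<mu> + m) else 0)"
    unfolding coeff_in_def lookup_sum by (intro sum.cong) (auto simp: lookup_single when_def)
  also have "\<dots> = (if m \<in> ?S then lookup p (\<mu> + m) else 0)" using fin by simp
  finally show ?thesis by (auto simp: in_keys_iff)
qed

lemma coeff_in_zero [simp]: "coeff_in U \<mu> 0 = 0"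
  by (rule poly_mapping_eqI) (simp add: lookup_coeff_in)

lemma coeff_in_add: "coeff_in U \<mu> (p + q) = coeff_in U \<mu> p + coeff_in U \<mu> q"
  by (rule poly_mapping_eqI) (simp add: lookup_coeff_in lookup_add)

lemma coeff_in_diff: "coeff_in U \<mu> (p - q) = coeff_in U \<mu> p - coeff_in U \<mu> q"
  by (rule poly_mapping_eqI) (simp add: lookup_coeff_in lookup_minus)

lemma coeff_in_sum: "coeff_in U \<mu> (sum f A) = (\<Sum>i\<in>A. coeff_in U \<mu> (f i))"
  by (induction A rule: infinite_finite_induct) (auto simp: coeff_in_add)

lemma coeff_in_empty [simp]: "coeff_in {} 0 p = p"
  by (rule poly_mapping_eqI) (simp add: lookup_coeff_in)

lemma exponent_split_var: "v \<in> keys m \<Longrightarrow> \<exists>m'. m = single v (1::nat) + m'"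
  by (rule exI[of _ "m - single v 1"], rule poly_mapping_eqI)
    (auto simp: lookup_add lookup_minus lookup_single when_def in_keys_iff)

lemma coeff_in_Var_mult:
  assumes "x \<notin> U" "keys \<mu> \<subseteq> U"
  shows "coeff_in U \<mu> (Var x * p) = Var x * coeff_in U \<mu> (p :: ('v, 'k::field) mpoly)"
proof (rule poly_mapping_eqI)
  fix m
  show "lookup (coeff_in U \<mu> (Var x * p)) m = lookup (Var x * coeff_in U \<mu> p) m"
  proof (cases "x \<in> keys m")
    case True
    then obtain m' where m: "m = single x (1::nat) + m'" using exponent_split_var by metis
    have "lookup (Var x * p) (\<mu> + m) = lookup p (\<mu> + m')"
      unfolding m Var_def using lookup_single_plus_mult[of "single x 1" 1 p "\<mu> + m'"]
      by (simp add: ac_simps)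
    moreover have "lookup (Var x * coeff_in U \<mu> p) m = lookup (coeff_in U \<mu> p) m'"
      unfolding m Var_def using lookup_single_plus_mult[of "single x 1" 1 _ m'] by simp
    moreover have "keys m \<inter> U = {} \<longleftrightarrow> keys m' \<inter> U = {}"
      using assms(1) by (auto simp: m keys_plus_nat)
    ultimately show ?thesis by (simp add: lookup_coeff_in)
  next
    case False
    have 1: "lookup (Var x * q) n = 0" if "x \<notin> keys n" for q :: "('v, 'k) mpoly" and n
      unfolding Var_def using that by (intro lookup_single_mult_outside) (auto simp: keys_plus_nat)
    have "x \<notin> keys (\<mu> + m)" using False assms by (auto simp: keys_plus_nat)
    then show ?thesis using 1 False by (simp add: lookup_coeff_in)
  qed
qed

lemma coeff_in_const_mult: "coeff_in U \<mu> (single 0 c * p) = single 0 c * coeff_in U \<mu> p"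
  by (rule poly_mapping_eqI) (simp add: lookup_coeff_in lookup_const_mult)

lemma coeff_in_mult:
  assumes "q \<in> polys W" "W \<inter> U = {}" "keys \<mu> \<subseteq> U"
  shows "coeff_in U \<mu> (q * p) = q * coeff_in U \<mu> p"
  using assms(1)
proof (induction rule: polys_Var_induct)
  case (Var q v)
  then have "v \<notin> U" using assms by auto
  then show ?case using Var assms(3) by (simp add: mult.assoc coeff_in_Var_mult)
qed (auto simp: coeff_in_const_mult coeff_in_add distrib_right)

lemma coeff_in_polys:
  assumes "p \<in> polys W" shows "coeff_in U \<mu> p \<in> polys (W - U)"
proof -
  have "keys m \<subseteq> W - U" if "m \<in> keys (coeff_in U \<mu> p)" for m
  proof -
    have "keys m \<inter> U = {}" "\<mu> + m \<in> keys p"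
      using that by (auto simp: in_keys_iff lookup_coeff_in split: if_splits)
    moreover have "keys (\<mu> + m) \<subseteq> W" using assms calculation(2) unfolding polys_def by blast
    ultimately show ?thesis by (auto simp: keys_plus_nat)
  qed
  then show ?thesis by (auto simp: polys_def)
qed

lemma exponent_split:
  fixes m :: "'v \<Rightarrow>\<^sub>0 nat"
  shows "\<exists>\<mu> m'. m = \<mu> + m' \<and> keys \<mu> \<subseteq> U \<and> keys m' \<inter> U = {}"
proof -
  have "keys m \<subseteq> UNIV" by simp
  then show ?thesis
  proof (induction rule: exponent_induct)
    case (plus m v)
    then obtain \<mu> m' where *: "m = \<mu> + m'" "keys \<mu> \<subseteq> U" "keys m' \<inter> U = {}" by blast
    show ?case
    proof (cases "v \<in> U")
      case True
      then show ?thesis using * by (intro exI[of _ "\<mu> + single v 1"] exI[of _ m']) (auto simp: ac_simps keys_plus_nat)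
    next
      case False
      then show ?thesis using * by (intro exI[of _ \<mu>] exI[of _ "m' + single v 1"]) (auto simp: ac_simps keys_plus_nat)
    qed
  qed (auto intro!: exI[of _ 0])
qed

lemma eq_zero_if_coeff_in:
  fixes p :: "('v, 'k::field) mpoly"
  assumes "\<And>\<mu>. keys \<mu> \<subseteq> U \<Longrightarrow> coeff_in U \<mu> p = 0" shows "p = 0"
proof (rule poly_mapping_eqI)
  fix m :: "'v \<Rightarrow>\<^sub>0 nat"
  obtain \<mu> m' where m: "m = \<mu> + m'" "keys \<mu> \<subseteq> U" "keys m' \<inter> U = {}" using exponent_split[of m U] by blast
  have "lookup (coeff_in U \<mu> p) m' = 0" unfolding assms[OF m(2)] by simp
  moreover have "lookup (coeff_in U \<mu> p) m' = lookup p (\<mu> + m')"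
    by (simp only: lookup_coeff_in m(3) if_True simp_thms)
  ultimately show "lookup p m = lookup 0 m" using m(1) by (simp only: lookup_zero)
qed

section \<open>Unit vectors\<close>

lemma vec_diff_eq_zeroD:
  fixes x y :: "'a::ab_group_add vec"
  assumes "x - y = 0\<^sub>v n" "x \<in> carrier_vec n" "y \<in> carrier_vec n"
  shows "x = y"
proof (rule eq_vecI)
  fix i assume i: "i < dim_vec y"
  have "x $ i - y $ i = (x - y) $ i" using i assms(2,3) by simp
  also have "\<dots> = 0" unfolding assms(1) using i assms(3) by simp
  finally show "x $ i = y $ i" by simp
qed (use assms in simp)

lemma mult_mat_vec_smult:
  fixes A :: "'a::comm_ring_1 mat"
  assumes "A \<in> carrier_mat r c" "v \<in> carrier_vec c"
  shows "A *\<^sub>v (a \<cdot>\<^sub>v v) = a \<cdot>\<^sub>v (A *\<^sub>v v)"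
  using assms by (intro eq_vecI) (auto simp: scalar_prod_def sum_distrib_left ac_simps)

lemma vecs_unit [simp, intro]: "unit_vec b j \<in> vecs V b"
  by (auto simp: vecs_def unit_vec_def)

lemma mult_mat_unit_vec:
  fixes A :: "'a::comm_ring_1 mat"
  shows "A \<in> carrier_mat r c \<Longrightarrow> i < r \<Longrightarrow> j < c \<Longrightarrow> (A *\<^sub>v unit_vec c j) $ i = A $$ (i, j)"
  by (simp add: scalar_prod_right_unit[of _ c])

lemma mat_eqI_unit:
  fixes A B :: "'a::comm_ring_1 mat"
  assumes "A \<in> carrier_mat r c" "B \<in> carrier_mat r c"
    and "\<And>j. j < c \<Longrightarrow> A *\<^sub>v unit_vec c j = B *\<^sub>v unit_vec c j"
  shows "A = B"
proof (rule eq_matI)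
  fix i j assume "i < dim_row B" "j < dim_col B"
  then have ij: "i < r" "j < c" using assms(2) by auto
  show "A $$ (i, j) = B $$ (i, j)"
    using mult_mat_unit_vec[OF assms(1) ij] mult_mat_unit_vec[OF assms(2) ij] assms(3)[OF ij(2)] by simp
qed (use assms in auto)

text \<open>The condition concerns nonzero coordinates only. This matters in
  \<open>dual_generated\<close>, where nothing is known about the unit vectors at vanishing
  coordinates.\<close>

lemma vecs_unit_closed:
  assumes "u \<in> vecs W b" "0\<^sub>v b \<in> H"
    and "\<And>x y. x \<in> H \<Longrightarrow> y \<in> H \<Longrightarrow> x + y \<in> H"
    and "\<And>j. j < b \<Longrightarrow> u $ j \<noteq> 0 \<Longrightarrow> u $ j \<cdot>\<^sub>v unit_vec b j \<in> H"
  shows "u \<in> H"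
proof -
  have "vec b (\<lambda>j. if j < n then u $ j else 0) \<in> H" if "n \<le> b" for n
    using that
  proof (induction n)
    case 0
    have "vec b (\<lambda>j. if j < 0 then u $ j else 0) = 0\<^sub>v b" by (intro eq_vecI) auto
    then show ?case using assms(2) by simp
  next
    case (Suc n)
    have e: "vec b (\<lambda>j. if j < Suc n then u $ j else 0) =
        vec b (\<lambda>j. if j < n then u $ j else 0) + u $ n \<cdot>\<^sub>v unit_vec b n"
      using Suc.prems by (intro eq_vecI) (auto simp: unit_vec_def less_Suc_eq)
    show ?case
    proof (cases "u $ n = 0")
      case True
      then have "vec b (\<lambda>j. if j < Suc n then u $ j else 0) = vec b (\<lambda>j. if j < n then u $ j else 0)"
        by (intro eq_vecI) (auto simp: less_Suc_eq)
      then show ?thesis using Suc by simp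
    next
      case False
      then show ?thesis unfolding e using Suc by (intro assms(3,4)) auto
    qed
  qed
  from this[of b] have "vec b (\<lambda>j. if j < b then u $ j else 0) \<in> H" by simp
  also have "vec b (\<lambda>j. if j < b then u $ j else 0) = u" using assms(1) by (intro eq_vecI) (auto simp: vecs_def)
  finally show ?thesis .
qed

lemma smult_zero_unit: "(0 :: 'a::comm_ring_1) \<cdot>\<^sub>v unit_vec b j = 0\<^sub>v b"
  by (intro eq_vecI) auto

section \<open>Resolving a graded quotient that is free over some of its variables\<close>

section \<open>Algebras that are free over a polynomial subring\<close>

text \<open>\<open>S / J\<close> is a graded free module over \<open>K[V0]\<close> with basis
  \<open>mb\<close> in the degrees \<open>dg\<close>. The parameters have to be variables here,
  which is why the ring of the poset enters only after a linear change of coordinates.\<close>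

locale free_basis =
  fixes V V0 :: "'v set" and J :: "('v, 'k::field) mpoly set" and b :: nat
    and mb :: "nat \<Rightarrow> ('v, 'k) mpoly" and dg :: "nat \<Rightarrow> int"
  assumes finite_V: "finite V" and V0_subset: "V0 \<subseteq> V"
    and J_subset: "J \<subseteq> polys V" and J_zero: "0 \<in> J"
    and J_add: "p \<in> J \<Longrightarrow> q \<in> J \<Longrightarrow> p + q \<in> J"
    and J_mult: "p \<in> polys V \<Longrightarrow> q \<in> J \<Longrightarrow> p * q \<in> J"
    and mb_polys: "j < b \<Longrightarrow> mb j \<in> polys V"
    and mb_homogeneous: "j < b \<Longrightarrow> homogeneous (dg j) (mb j)"
    and span: "p \<in> polys V \<Longrightarrow> homogeneous m p \<Longrightarrow>
      \<exists>a. (\<forall>j<b. a j \<in> polys V0 \<and> homogeneous (m - dg j) (a j)) \<and> p - (\<Sum>j<b. a j * mb j) \<in> J"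
    and indep: "(\<And>j. j < b \<Longrightarrow> a j \<in> polys V0) \<Longrightarrow> (\<Sum>j<b. a j * mb j) \<in> J \<Longrightarrow> j < b \<Longrightarrow> a j = 0"
begin

lemma J_uminus: "p \<in> J \<Longrightarrow> - p \<in> J"
  using J_mult[of "-1" p] by (simp add: polys_uminus)

lemma J_diff: "p \<in> J \<Longrightarrow> q \<in> J \<Longrightarrow> p - q \<in> J"
  using J_add[of p "- q"] J_uminus by simp

lemma J_trans: "p - q \<in> J \<Longrightarrow> q - r \<in> J \<Longrightarrow> p - r \<in> J"
  using J_add[of "p - q" "q - r"] by simp

lemma J_sum: "(\<And>i. i \<in> A \<Longrightarrow> f i \<in> J) \<Longrightarrow> sum f A \<in> J"
  by (induction A rule: infinite_finite_induct) (auto intro: J_zero J_add)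

definition zs :: "'v list" where
  "zs = (SOME xs. set xs = V - V0 \<and> distinct xs)"

text \<open>The coordinates over \<open>K[V0]\<close> of the \<open>l\<close>-th remaining variable
  times the \<open>j\<close>-th basis element.\<close>

definition coef :: "nat \<Rightarrow> nat \<Rightarrow> nat \<Rightarrow> ('v, 'k) mpoly" where
  "coef l j = (SOME a. (\<forall>i<b. a i \<in> polys V0 \<and> homogeneous (1 + dg j - dg i) (a i)) \<and>
     Var (zs ! l) * mb j - (\<Sum>i<b. a i * mb i) \<in> J)"

definition Z :: "nat \<Rightarrow> ('v, 'k) mpoly mat" where
  "Z l = mat b b (\<lambda>(i, j). coef l j i)"

text \<open>A variable minus the matrix \<open>Z l\<close> of its action on the free
  \<open>K[V0]\<close>-module. By \<open>lin_Z\<close>, the map \<open>lin\<close> sends the image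
  of \<open>Y l\<close> into \<open>J\<close>.\<close>

definition Y :: "nat \<Rightarrow> ('v, 'k) mpoly mat" where
  "Y l = mat b b (\<lambda>(i, j). (if i = j then Var (zs ! l) else 0) - coef l j i)"

definition lin :: "('v, 'k) mpoly vec \<Rightarrow> ('v, 'k) mpoly" where
  "lin u = (\<Sum>j<b. u $ j * mb j)"

lemma zs: "set zs = V - V0" "distinct zs"
proof -
  have "\<exists>xs. set xs = V - V0 \<and> distinct xs" using finite_V by (intro finite_distinct_list) simp
  from someI_ex[OF this] show "set zs = V - V0" "distinct zs" by (auto simp: zs_def)
qed

lemma zs_nth: "l < length zs \<Longrightarrow> zs ! l \<in> V - V0"
  using zs nth_mem by metis

lemma length_zs: "length zs = card (V - V0)"
  using zs distinct_card by metis

lemma coef: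
  assumes "l < length zs" "j < b"
  shows "i < b \<Longrightarrow> coef l j i \<in> polys V0" "i < b \<Longrightarrow> homogeneous (1 + dg j - dg i) (coef l j i)"
    "Var (zs ! l) * mb j - (\<Sum>i<b. coef l j i * mb i) \<in> J"
proof -
  have "\<exists>a. (\<forall>i<b. a i \<in> polys V0 \<and> homogeneous (1 + dg j - dg i) (a i)) \<and>
     Var (zs ! l) * mb j - (\<Sum>i<b. a i * mb i) \<in> J"
    using assms zs_nth[OF assms(1)] by (intro span) (auto intro!: homogeneous_mult mb_polys mb_homogeneous)
  from someI_ex[OF this, folded coef_def]
  show "i < b \<Longrightarrow> coef l j i \<in> polys V0" "i < b \<Longrightarrow> homogeneous (1 + dg j - dg i) (coef l j i)"
    "Var (zs ! l) * mb j - (\<Sum>i<b. coef l j i * mb i) \<in> J" by blast+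
qed

lemma Z_mats: "l < length zs \<Longrightarrow> Z l \<in> mats V0 b b"
  by (auto simp: Z_def mats_def coef)

lemma Z_carrier [simp]: "Z l \<in> carrier_mat b b"
  by (simp add: Z_def)

lemma Y_carrier [simp]: "Y l \<in> carrier_mat b b"
  by (simp add: Y_def)

lemma Y_mats:
  assumes "l < length zs" "V0 \<subseteq> W" "zs ! l \<in> W" shows "Y l \<in> mats W b b"
  using coef(1)[OF assms(1)] polys_mono[OF assms(2)] assms(3) by (auto simp: Y_def mats_def)

lemma Y_mats_V: "l < length zs \<Longrightarrow> Y l \<in> mats V b b"
  using zs_nth V0_subset by (intro Y_mats) auto

lemma Y_homogeneous:
  "l < length zs \<Longrightarrow> i < b \<Longrightarrow> j < b \<Longrightarrow> homogeneous (dg j + 1 - dg i) (Y l $$ (i, j))"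
  using coef(2)[of l j i] by (auto simp: Y_def add.commute intro!: homogeneous_diff)

lemma Y_mult:
  assumes "v \<in> carrier_vec b"
  shows "Y l *\<^sub>v v = Var (zs ! l) \<cdot>\<^sub>v v - Z l *\<^sub>v v"
proof (rule eq_vecI)
  fix i assume i: "i < dim_vec (Var (zs ! l) \<cdot>\<^sub>v v - Z l *\<^sub>v v)"
  then have ib: "i < b" by (simp add: Z_def)
  have "(Y l *\<^sub>v v) $ i = (\<Sum>j<b. ((if i = j then Var (zs ! l) else 0) - coef l j i) * v $ j)"
    using ib assms by (simp add: Y_def scalar_prod_def atLeast0LessThan)
  also have "\<dots> = (\<Sum>j<b. if i = j then Var (zs ! l) * v $ j else 0) - (\<Sum>j<b. coef l j i * v $ j)"
    by (simp add: left_diff_distrib sum_subtractf if_distrib[of "\<lambda>x. x * _"] cong: if_cong)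
  also have "(\<Sum>j<b. if i = j then Var (zs ! l) * v $ j else 0) = Var (zs ! l) * v $ i"
    using ib by simp
  finally show "(Y l *\<^sub>v v) $ i = (Var (zs ! l) \<cdot>\<^sub>v v - Z l *\<^sub>v v) $ i"
    using ib assms by (simp add: Z_def scalar_prod_def atLeast0LessThan)
qed (simp add: Y_def Z_def)

lemma lin_polys: "u \<in> vecs V b \<Longrightarrow> lin u \<in> polys V"
  unfolding lin_def by (intro polys_sum polys_mult) (auto simp: vecs_def mb_polys)

lemma lin_add: "u \<in> carrier_vec b \<Longrightarrow> v \<in> carrier_vec b \<Longrightarrow> lin (u + v) = lin u + lin v"
  by (simp add: lin_def distrib_right sum.distrib)

lemma lin_diff: "u \<in> carrier_vec b \<Longrightarrow> v \<in> carrier_vec b \<Longrightarrow> lin (u - v) = lin u - lin v"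
  by (simp add: lin_def left_diff_distrib sum_subtractf)

lemma lin_Z:
  assumes "l < length zs" "u \<in> vecs V b"
  shows "Var (zs ! l) * lin u - lin (Z l *\<^sub>v u) \<in> J"
proof -
  have "lin (Z l *\<^sub>v u) = (\<Sum>i<b. \<Sum>j<b. coef l j i * u $ j * mb i)"
    using vecs_carrier[OF assms(2)]
    by (simp add: lin_def Z_def scalar_prod_def atLeast0LessThan sum_distrib_right)
  also have "\<dots> = (\<Sum>j<b. u $ j * (\<Sum>i<b. coef l j i * mb i))"
    by (subst sum.swap) (simp add: sum_distrib_left ac_simps)
  finally have "Var (zs ! l) * lin u - lin (Z l *\<^sub>v u) =
      (\<Sum>j<b. u $ j * (Var (zs ! l) * mb j - (\<Sum>i<b. coef l j i * mb i)))"
    by (simp add: lin_def sum_distrib_left right_diff_distrib sum_subtractf ac_simps)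
  also have "\<dots> \<in> J" using assms by (intro J_sum J_mult coef) (auto simp: vecs_def)
  finally show ?thesis .
qed

lemma lin_indep:
  assumes "u \<in> vecs V0 b" "lin u \<in> J" shows "u = 0\<^sub>v b"
proof (rule eq_vecI)
  fix i assume "i < dim_vec (0\<^sub>v b :: ('v, 'k) mpoly vec)"
  then have i: "i < b" by simp
  have "u $ i = 0"
    by (rule indep[where a = "\<lambda>j. u $ j"]) (use assms i in \<open>simp_all add: vecs_def lin_def\<close>)
  then show "u $ i = 0\<^sub>v b $ i" using i by simp
qed (use assms in \<open>simp add: vecs_def\<close>)

lemma vecs_V0: "u \<in> vecs V0 b \<Longrightarrow> u \<in> vecs V b"
  using polys_mono[OF V0_subset] by (auto simp: vecs_def)

text \<open>Both products describe multiplication by the same product of two variables, and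
  coordinates over \<open>K[V0]\<close> are unique.\<close>

lemma Z_commute:
  assumes "l < length zs" "m < length zs" "u \<in> vecs V0 b"
  shows "Z l *\<^sub>v (Z m *\<^sub>v u) = Z m *\<^sub>v (Z l *\<^sub>v u)"
proof -
  have *: "Var (zs ! l) * (Var (zs ! m) * lin u) - lin (Z l *\<^sub>v (Z m *\<^sub>v u)) \<in> J"
    if l: "l < length zs" "m < length zs" for l m
  proof (rule J_trans)
    show "Var (zs ! l) * (Var (zs ! m) * lin u) - Var (zs ! l) * lin (Z m *\<^sub>v u) \<in> J"
      unfolding right_diff_distrib[symmetric] using zs_nth[OF l(1)]
      by (intro J_mult lin_Z l vecs_V0 assms) auto
    show "Var (zs ! l) * lin (Z m *\<^sub>v u) - lin (Z l *\<^sub>v (Z m *\<^sub>v u)) \<in> J"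
      by (intro lin_Z l vecs_V0 vecs_mult_mat[OF Z_mats] assms)
  qed
  define d where "d = Z l *\<^sub>v (Z m *\<^sub>v u) - Z m *\<^sub>v (Z l *\<^sub>v u)"
  have v: "Z l *\<^sub>v (Z m *\<^sub>v u) \<in> vecs V0 b" "Z m *\<^sub>v (Z l *\<^sub>v u) \<in> vecs V0 b"
    using assms by (auto intro!: vecs_mult_mat[OF Z_mats])
  have "lin (Z l *\<^sub>v (Z m *\<^sub>v u)) - lin (Z m *\<^sub>v (Z l *\<^sub>v u)) \<in> J"
    using J_diff[OF *[OF assms(2,1)] *[OF assms(1,2)]] by (simp add: mult.left_commute)
  then have "lin d \<in> J" unfolding d_def using v by (simp add: lin_diff vecs_carrier)
  moreover have "d \<in> vecs V0 b" unfolding d_def using v by auto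
  ultimately have "d = 0\<^sub>v b" by (intro lin_indep)
  then show ?thesis
    unfolding d_def using v[THEN vecs_carrier] by (rule vec_diff_eq_zeroD)
qed

lemma Y_commute:
  assumes "l < length zs" "m < length zs"
  shows "Y l * Y m = Y m * Y l"
proof (rule mat_eqI_unit[of _ b b])
  fix j assume j: "j < b"
  let ?u = "unit_vec b j :: ('v, 'k) mpoly vec"
  have YY: "Y l *\<^sub>v (Y m *\<^sub>v ?u) = Var (zs ! l) \<cdot>\<^sub>v (Var (zs ! m) \<cdot>\<^sub>v ?u) - Var (zs ! l) \<cdot>\<^sub>v (Z m *\<^sub>v ?u) -
      (Var (zs ! m) \<cdot>\<^sub>v (Z l *\<^sub>v ?u) - Z l *\<^sub>v (Z m *\<^sub>v ?u))" for l m
  proof -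
    define x where "x = Var (zs ! m) \<cdot>\<^sub>v ?u"
    define y where "y = Z m *\<^sub>v ?u"
    have c: "x \<in> carrier_vec b" "y \<in> carrier_vec b" unfolding x_def y_def
      using mult_mat_vec_carrier[OF Z_carrier] by auto
    have "Y l *\<^sub>v (Y m *\<^sub>v ?u) = Var (zs ! l) \<cdot>\<^sub>v (x - y) - Z l *\<^sub>v (x - y)"
      using Y_mult[of ?u m] Y_mult[of "x - y" l] c by (simp add: x_def y_def)
    also have "Z l *\<^sub>v (x - y) = Z l *\<^sub>v x - Z l *\<^sub>v y"
      by (rule mult_minus_distrib_mat_vec[OF Z_carrier c])
    also have "Z l *\<^sub>v x = Var (zs ! m) \<cdot>\<^sub>v (Z l *\<^sub>v ?u)"
      unfolding x_def by (rule mult_mat_vec_smult[OF Z_carrier]) simp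
    also have "Var (zs ! l) \<cdot>\<^sub>v (x - y) = Var (zs ! l) \<cdot>\<^sub>v x - Var (zs ! l) \<cdot>\<^sub>v y"
      using c by (intro eq_vecI) (auto simp: right_diff_distrib)
    finally show ?thesis by (simp add: x_def y_def)
  qed
  \<comment> \<open>Unit vectors have entries in \<open>K[V0]\<close>, so \<open>Z_commute\<close>
    applies; the other terms of the expansion are symmetric in \<open>l\<close> and
    \<open>m\<close>.\<close>
  have com: "Z l *\<^sub>v (Z m *\<^sub>v ?u) = Z m *\<^sub>v (Z l *\<^sub>v ?u)" by (rule Z_commute[OF assms]) simp
  have "Y l *\<^sub>v (Y m *\<^sub>v ?u) = Y m *\<^sub>v (Y l *\<^sub>v ?u)"
    unfolding YY com by (intro eq_vecI) (simp_all add: Z_def mult.left_commute del: index_mult_mat_vec)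
  then show "Y l * Y m *\<^sub>v ?u = Y m * Y l *\<^sub>v ?u"
    using assoc_mult_mat_vec[of "Y l" b b "Y m" b ?u] assoc_mult_mat_vec[of "Y m" b b "Y l" b ?u] by simp
qed (auto intro!: mult_carrier_mat[OF Y_carrier Y_carrier])

section \<open>Regularity of the matrices, by eliminating one variable at a time\<close>

definition W :: "nat \<Rightarrow> 'v set" where
  "W k = V - set (take k zs)"

lemma W_0 [simp]: "W 0 = V"
  by (simp add: W_def)

lemma W_Suc: "k < length zs \<Longrightarrow> W (Suc k) = W k - {zs ! k}"
  by (auto simp: W_def take_Suc_conv_app_nth)

lemma V0_subset_W: "V0 \<subseteq> W k"
  using V0_subset zs(1) set_take_subset[of k zs] by (auto simp: W_def)

lemma W_subset: "W k \<subseteq> V"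
  by (auto simp: W_def)

lemma zs_nth_W: "k < length zs \<Longrightarrow> zs ! k \<in> W k"
  using zs_nth[of k] zs(2) by (auto simp: W_def in_set_conv_nth nth_eq_iff_index_eq)

lemma W_decomp: "W k = V0 \<union> set (drop k zs)" "V0 \<inter> set (drop k zs) = {}"
proof -
  have "set (take k zs) \<union> set (drop k zs) = V - V0" "set (take k zs) \<inter> set (drop k zs) = {}"
    using zs by (metis append_take_drop_id set_append) (use zs in \<open>metis append_take_drop_id distinct_append\<close>)
  then show "W k = V0 \<union> set (drop k zs)" "V0 \<inter> set (drop k zs) = {}"
    using V0_subset by (auto simp: W_def)
qed

abbreviation im :: "nat \<Rightarrow> ('v, 'k) mpoly vec set" where
  "im k \<equiv> kz_image V b Y k"

lemma im_Suc: "k < length zs \<Longrightarrow> im (Suc k) = {x + Y k *\<^sub>v v | x v. x \<in> im k \<and> v \<in> vecs V b}"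
  by (intro kz_image_Suc Y_mats_V) simp

lemma im_vecs:
  assumes "k \<le> length zs" "x \<in> im k" shows "x \<in> vecs V b"
proof -
  have "kz_diff b Y k 0 \<in> mats V (kz_rank b k 0) (kz_rank b k (Suc 0))"
    using assms(1) by (intro kz_diff_mats Y_mats_V) simp
  with assms(2) show ?thesis by (auto simp: kz_image_def)
qed

lemma im_diff:
  assumes "k \<le> length zs" "x \<in> im k" "y \<in> im k" shows "x - y \<in> im k"
proof -
  obtain u v where uv: "u \<in> vecs V (kz_rank b k 1)" "x = kz_diff b Y k 0 *\<^sub>v u"
    "v \<in> vecs V (kz_rank b k 1)" "y = kz_diff b Y k 0 *\<^sub>v v"
    using assms(2,3) by (auto simp: kz_image_def)
  have "x - y = kz_diff b Y k 0 *\<^sub>v (u - v)"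
    unfolding uv(2,4) using uv(1,3)[THEN vecs_carrier]
    by (intro mult_minus_distrib_mat_vec[symmetric]) (auto intro!: kz_diff_carrier[of k Y b 0, simplified])
  moreover have "u - v \<in> vecs V (kz_rank b k 1)" using uv(1,3) by (rule vecs_diff)
  ultimately show ?thesis unfolding kz_image_def by blast
qed

lemma im_Y:
  assumes "k < length zs" "x \<in> im k" shows "Y k *\<^sub>v x \<in> im k"
proof -
  obtain u where u: "u \<in> vecs V (kz_rank b k 1)" "x = kz_diff b Y k 0 *\<^sub>v u"
    using assms(2) by (auto simp: kz_image_def)
  have "kz_diff b Y k 0 *\<^sub>v (kz_lift b (Y k) k (Suc 0) *\<^sub>v u) = kz_lift b (Y k) k 0 *\<^sub>v (kz_diff b Y k 0 *\<^sub>v u)"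
    using assms(1) vecs_carrier[OF u(1)] by (intro kz_diff_lift Y_commute) auto
  moreover have "kz_lift b (Y k) k (Suc 0) *\<^sub>v u \<in> vecs V (kz_rank b k 1)"
    using u(1) kz_lift_mats[OF Y_mats_V[OF assms(1)]] by auto
  ultimately show ?thesis unfolding kz_image_def u(2) kz_lift_0
    by (metis (no_types) imageI)
qed

text \<open>Division by \<open>Y k\<close>: modulo its image the variable \<open>zs ! k\<close> may
  be replaced by the matrix \<open>Z k\<close>, whose entries lie in \<open>K[V0]\<close>, and so it
  disappears.\<close>

lemma reduce_one:
  assumes k: "k < length zs" and u: "u \<in> vecs (W k) b"
  shows "\<exists>s\<in>vecs V b. \<exists>v\<in>vecs (W (Suc k)) b. u = Y k *\<^sub>v s + v"
proof -
  define Q where "Q = {Y k *\<^sub>v s + v | s v. s \<in> vecs V b \<and> v \<in> vecs (W (Suc k)) b}"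
  have WV: "\<And>x. x \<in> W (Suc k) \<Longrightarrow> x \<in> V" using W_subset by blast
  have Yc: "Y k *\<^sub>v s \<in> carrier_vec b" for s :: "('v, 'k) mpoly vec" by (rule carrier_vecI) (simp add: Y_def)
  have Q_add: "x + y \<in> Q" if "x \<in> Q" "y \<in> Q" for x y
  proof -
    from that obtain s v s' v' where *: "s \<in> vecs V b" "v \<in> vecs (W (Suc k)) b"
      "s' \<in> vecs V b" "v' \<in> vecs (W (Suc k)) b" "x = Y k *\<^sub>v s + v" "y = Y k *\<^sub>v s' + v'"
      unfolding Q_def by blast
    have "x + y = (Y k *\<^sub>v s + Y k *\<^sub>v s') + (v + v')"
      unfolding * using Yc[of s] Yc[of s'] *(2,4)[THEN vecs_carrier] by (intro eq_vecI) auto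
    also have "Y k *\<^sub>v s + Y k *\<^sub>v s' = Y k *\<^sub>v (s + s')"
      using *(1,3)[THEN vecs_carrier] by (intro mult_add_distrib_mat_vec[symmetric, OF Y_carrier])
    finally show ?thesis unfolding Q_def using *(1-4) by blast
  qed
  have Q_unit: "p \<cdot>\<^sub>v unit_vec b j \<in> Q" if "p \<in> polys (W k)" for p j
    using that
  proof (induction rule: polys_Var_induct)
    case (const c)
    have "single 0 c \<cdot>\<^sub>v unit_vec b j = Y k *\<^sub>v 0\<^sub>v b + single 0 c \<cdot>\<^sub>v unit_vec b j"
      by (intro eq_vecI) (auto simp: Y_def scalar_prod_def)
    moreover have "single 0 c \<cdot>\<^sub>v unit_vec b j \<in> vecs (W (Suc k)) b" by auto
    ultimately show ?case unfolding Q_def by blast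
  next
    case (add p q)
    have "(p + q) \<cdot>\<^sub>v unit_vec b j = p \<cdot>\<^sub>v unit_vec b j + q \<cdot>\<^sub>v unit_vec b j"
      by (rule add_smult_distrib_vec)
    then show ?case using Q_add add by simp
  next
    case (Var p x)
    then obtain s v where sv: "s \<in> vecs V b" "v \<in> vecs (W (Suc k)) b"
      "p \<cdot>\<^sub>v unit_vec b j = Y k *\<^sub>v s + v" unfolding Q_def by blast
    have xW: "x \<in> W k" using Var by blast
    have xV: "x \<in> V" using xW W_subset by blast
    have xs: "Var x \<cdot>\<^sub>v s \<in> vecs V b" using sv(1) xV by auto
    have "(Var x * p) \<cdot>\<^sub>v unit_vec b j = Var x \<cdot>\<^sub>v (Y k *\<^sub>v s + v)"
      unfolding sv(3)[symmetric] by (simp add: smult_smult_assoc)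
    also have "\<dots> = Var x \<cdot>\<^sub>v (Y k *\<^sub>v s) + Var x \<cdot>\<^sub>v v"
      using Yc vecs_carrier[OF sv(2)] by (intro smult_add_distrib_vec)
    also have "Var x \<cdot>\<^sub>v (Y k *\<^sub>v s) = Y k *\<^sub>v (Var x \<cdot>\<^sub>v s)"
      using vecs_carrier[OF sv(1)] by (intro mult_mat_vec_smult[symmetric, OF Y_carrier])
    finally have e: "(Var x * p) \<cdot>\<^sub>v unit_vec b j = Y k *\<^sub>v (Var x \<cdot>\<^sub>v s) + Var x \<cdot>\<^sub>v v" .
    have "Var x \<cdot>\<^sub>v v \<in> Q"
    proof (cases "x = zs ! k")
      case False
      then have "Var x \<cdot>\<^sub>v v \<in> vecs (W (Suc k)) b" using xW sv(2) W_Suc[OF k] by auto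
      moreover have "Var x \<cdot>\<^sub>v v = Y k *\<^sub>v 0\<^sub>v b + Var x \<cdot>\<^sub>v v"
        using vecs_carrier[OF sv(2)] by (intro eq_vecI) (auto simp: Y_def scalar_prod_def)
      ultimately show ?thesis unfolding Q_def by blast
    next
      case True
      have "Z k *\<^sub>v v \<in> vecs (W (Suc k)) b"
      proof -
        have "Z k \<in> mats (W (Suc k)) b b"
          using Z_mats[OF k] polys_mono[OF V0_subset_W] by (auto simp: mats_def)
        then show ?thesis using sv(2) by auto
      qed
      moreover have "Var x \<cdot>\<^sub>v v = Y k *\<^sub>v v + Z k *\<^sub>v v"
        unfolding Y_mult[OF vecs_carrier[OF sv(2)]] True using vecs_carrier[OF sv(2)]
        by (intro eq_vecI) (auto simp: Z_def)
      moreover have "v \<in> vecs V b" using sv(2) polys_mono[OF W_subset] by (auto simp: vecs_def)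
      ultimately show ?thesis unfolding Q_def by blast
    qed
    moreover have "Y k *\<^sub>v (Var x \<cdot>\<^sub>v s) \<in> Q"
    proof -
      have "Y k *\<^sub>v (Var x \<cdot>\<^sub>v s) = Y k *\<^sub>v (Var x \<cdot>\<^sub>v s) + 0\<^sub>v b" using Yc by simp
      then show ?thesis unfolding Q_def using xs vecs_zero by blast
    qed
    ultimately show ?case unfolding e using Q_add by blast
  qed
  have "0\<^sub>v b \<in> Q"
    using Q_unit[of 0 0] by (simp add: smult_zero_unit)
  then have "u \<in> Q"
    using Q_add Q_unit u by (intro vecs_unit_closed[OF u]) (auto simp: vecs_def)
  then show ?thesis unfolding Q_def by blast
qed

text \<open>With \<open>im_inter_W\<close> this gives a direct sum decomposition
  \<open>S^b = im k + K[W k]^b\<close>: the quotient by \<open>im k\<close> is free over the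
  variables that have not been eliminated.\<close>

lemma reduce:
  assumes "k \<le> length zs" "u \<in> vecs V b"
  shows "\<exists>x\<in>im k. \<exists>v\<in>vecs (W k) b. u = x + v"
  using assms
proof (induction k)
  case 0
  have "u = 0\<^sub>v b + u" using vecs_carrier[OF 0(2)] by simp
  then show ?case using 0 by (auto simp: kz_image_0)
next
  case (Suc k)
  then have k: "k < length zs" by simp
  obtain x v where xv: "x \<in> im k" "v \<in> vecs (W k) b" "u = x + v" using Suc by auto
  obtain s v' where sv: "s \<in> vecs V b" "v' \<in> vecs (W (Suc k)) b" "v = Y k *\<^sub>v s + v'"
    using reduce_one[OF k xv(2)] by blast
  have "x \<in> carrier_vec b" "v' \<in> carrier_vec b" "Y k *\<^sub>v s \<in> carrier_vec b"
    using im_vecs[OF _ xv(1)] k sv(2) by (auto dest: vecs_carrier intro!: carrier_vecI simp: Y_def)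
  then have "u = (x + Y k *\<^sub>v s) + v'" unfolding xv(3) sv(3) by simp
  moreover have "x + Y k *\<^sub>v s \<in> im (Suc k)" using im_Suc[OF k] xv(1) sv(1) by blast
  ultimately show ?case using sv(2) by blast
qed

abbreviation coeff_vec :: "'v set \<Rightarrow> ('v \<Rightarrow>\<^sub>0 nat) \<Rightarrow> ('v, 'k) mpoly vec \<Rightarrow> ('v, 'k) mpoly vec" where
  "coeff_vec U \<mu> \<equiv> map_vec (coeff_in U \<mu>)"

lemma coeff_vec_vecs: "u \<in> vecs V' b \<Longrightarrow> coeff_vec U \<mu> u \<in> vecs (V' - U) b"
  by (auto simp: vecs_def coeff_in_polys)

lemma coeff_vec_Z:
  assumes "l < length zs" "u \<in> carrier_vec b" "V0 \<inter> U = {}" "keys \<mu> \<subseteq> U"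
  shows "coeff_vec U \<mu> (Z l *\<^sub>v u) = Z l *\<^sub>v coeff_vec U \<mu> u"
proof (rule eq_vecI)
  fix i assume "i < dim_vec (Z l *\<^sub>v coeff_vec U \<mu> u)"
  then have i: "i < b" by (simp add: Z_def)
  have "coeff_in U \<mu> (\<Sum>j<b. coef l j i * u $ j) = (\<Sum>j<b. coef l j i * coeff_in U \<mu> (u $ j))"
    unfolding coeff_in_sum
    by (intro sum.cong refl coeff_in_mult[OF _ assms(3,4)] coef(1)[OF assms(1)]) (use i in auto)
  then show "coeff_vec U \<mu> (Z l *\<^sub>v u) $ i = (Z l *\<^sub>v coeff_vec U \<mu> u) $ i"
    using i assms(2) by (simp add: Z_def scalar_prod_def atLeast0LessThan)
qed (simp add: Z_def)

text \<open>The first \<open>k\<close> matrices involve no variable of \<open>U\<close>, so they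
  commute with taking coefficients, and \<open>lin_Z\<close> applies to each of them. The case of
  empty \<open>U\<close> is one half of \<open>im_lin\<close>.\<close>

lemma im_coeff:
  assumes "k \<le> length zs" "x \<in> im k" "U \<inter> (V0 \<union> set (take k zs)) = {}" "keys \<mu> \<subseteq> U"
  shows "lin (coeff_vec U \<mu> x) \<in> J"
  using assms(1-3)
proof (induction k arbitrary: x)
  case 0
  then have "x = 0\<^sub>v b" by (simp add: kz_image_0)
  then have "lin (coeff_vec U \<mu> x) = 0" by (simp add: lin_def)
  then show ?case using J_zero by simp
next
  case (Suc k)
  have k: "k < length zs" using Suc.prems(1) by simp
  obtain x' v where x: "x' \<in> im k" "v \<in> vecs V b" "x = x' + Y k *\<^sub>v v"
    using Suc.prems(2) unfolding im_Suc[OF k] by blast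
  let ?C = "coeff_vec U \<mu>"
  have U: "U \<inter> (V0 \<union> set (take k zs)) = {}" "zs ! k \<notin> U" "V0 \<inter> U = {}"
    using Suc.prems(3) k by (auto simp: take_Suc_conv_app_nth)
  have c: "x' \<in> carrier_vec b" "v \<in> carrier_vec b" using im_vecs[OF _ x(1)] k x(2) by (auto dest: vecs_carrier)
  have Zc: "Z k *\<^sub>v w \<in> carrier_vec b" for w :: "('v, 'k) mpoly vec" by (rule carrier_vecI) (simp add: Z_def)
  define z where "z = Z k *\<^sub>v v"
  have zc: "z \<in> carrier_vec b" unfolding z_def by (rule Zc)
  have "?C x = ?C x' + (Var (zs ! k) \<cdot>\<^sub>v ?C v - ?C z)"
    unfolding x(3) Y_mult[OF c(2)] z_def[symmetric] using c zc
    by (intro eq_vecI) (auto simp: coeff_in_add coeff_in_diff coeff_in_Var_mult[OF U(2) assms(4)])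
  also have "?C z = Z k *\<^sub>v ?C v" unfolding z_def by (rule coeff_vec_Z[OF k c(2) U(3) assms(4)])
  finally have C: "?C x = ?C x' + (Var (zs ! k) \<cdot>\<^sub>v ?C v - Z k *\<^sub>v ?C v)" .
  have cv: "?C v \<in> vecs V b" using coeff_vec_vecs[OF x(2)] polys_mono[of "V - U" V] by (auto simp: vecs_def)
  have "lin (?C x) = lin (?C x') + (Var (zs ! k) * lin (?C v) - lin (Z k *\<^sub>v ?C v))"
    unfolding C using c Zc[of "?C v"]
    by (simp add: lin_add lin_diff lin_def[of "Var _ \<cdot>\<^sub>v _"] lin_def[of "?C v"] sum_distrib_left mult.assoc
        del: index_mult_mat_vec)
  also have "\<dots> \<in> J" by (intro J_add Suc.IH U lin_Z k cv x) (use k in simp)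
  finally show ?case .
qed

text \<open>Coefficients with respect to all remaining variables outside \<open>V0\<close> are
  vectors over \<open>K[V0]\<close>. By \<open>im_coeff\<close> they are relations of the basis,
  hence 0.\<close>

lemma im_inter_W:
  assumes "k \<le> length zs" "x \<in> im k" "x \<in> vecs (W k) b" shows "x = 0\<^sub>v b"
proof (rule eq_vecI)
  fix j assume "j < dim_vec (0\<^sub>v b :: ('v, 'k) mpoly vec)"
  then have j: "j < b" by simp
  define U where "U = set (drop k zs)"
  have U: "U \<inter> (V0 \<union> set (take k zs)) = {}"
    using W_decomp(2)[of k] zs(2) unfolding U_def by (metis append_take_drop_id distinct_append Int_Un_distrib Int_commute Un_empty)
  have "W k - U = V0" using W_decomp[of k] by (auto simp: U_def)
  then have c0: "coeff_vec U \<mu> x = 0\<^sub>v b" if "keys \<mu> \<subseteq> U" for \<mu> :: "'v \<Rightarrow>\<^sub>0 nat"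
    using coeff_vec_vecs[OF assms(3), of U \<mu>] im_coeff[OF assms(1,2) U that] lin_indep by simp
  have "x $ j = 0"
  proof (rule eq_zero_if_coeff_in)
    fix \<mu> :: "'v \<Rightarrow>\<^sub>0 nat" assume "keys \<mu> \<subseteq> U"
    then have "coeff_vec U \<mu> x $ j = 0\<^sub>v b $ j" using c0 by simp
    then show "coeff_in U \<mu> (x $ j) = 0" using j vecs_carrier[OF assms(3)] by simp
  qed
  then show "x $ j = 0\<^sub>v b $ j" using j by simp
qed (use assms(3) in \<open>simp add: vecs_def\<close>)

lemma coeff_in_Var_Suc:
  "coeff_in {z} (single z (Suc e)) (Var z * p) = coeff_in {z} (single z e) (p :: ('v, 'k) mpoly)"
proof (rule poly_mapping_eqI)
  fix m
  have "single z (Suc e) + m = single z 1 + (single z e + m)"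
    by (simp add: add.assoc[symmetric] single_add[symmetric])
  then have "lookup (Var z * p) (single z (Suc e) + m) = lookup p (single z e + m)"
    unfolding Var_def by (simp only: lookup_single_plus_mult mult_1_left)
  then show "lookup (coeff_in {z} (single z (Suc e)) (Var z * p)) m = lookup (coeff_in {z} (single z e) p) m"
    by (simp only: lookup_coeff_in)
qed

lemma coeff_in_vanish:
  assumes "\<And>m. m \<in> keys p \<Longrightarrow> lookup m z < e"
  shows "coeff_in {z} (single z e) (p :: ('v, 'k) mpoly) = 0"
proof (rule poly_mapping_eqI)
  fix m
  have "lookup (single z e + m) z < e" if "single z e + m \<in> keys p" using assms[OF that] .
  then have "single z e + m \<notin> keys p" by (auto simp: lookup_add)
  then show "lookup (coeff_in {z} (single z e) p) m = lookup 0 m"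
    by (simp add: lookup_coeff_in in_keys_iff)
qed

text \<open>Expand \<open>v\<close> in powers of the variable \<open>z\<close>. As
  \<open>Z k\<close> is free of \<open>z\<close>, the equation \<open>z v = Z v\<close> says that
  each coefficient is \<open>Z\<close> applied to the next higher one. The high ones vanish, so all
  of them do.\<close>

lemma Y_injective:
  assumes k: "k < length zs" and v: "v \<in> carrier_vec b" and Yv: "Y k *\<^sub>v v = 0\<^sub>v b"
  shows "v = 0\<^sub>v b"
proof -
  define z where "z = zs ! k"
  have z: "V0 \<inter> {z} = {}" using zs_nth[OF k] by (auto simp: z_def)
  have Zc: "Z k *\<^sub>v w \<in> carrier_vec b" for w :: "('v, 'k) mpoly vec" by (rule carrier_vecI) (simp add: Z_def)
  have zv: "Var z \<cdot>\<^sub>v v = Z k *\<^sub>v v"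
    by (rule vec_diff_eq_zeroD[of _ _ b]) (use Y_mult[OF v, of k] Yv v Zc in \<open>auto simp: z_def\<close>)
  define C where "C e = coeff_vec {z} (single z e) v" for e
  have Cc: "C e \<in> carrier_vec b" for e using v by (simp add: C_def)
  have step: "C e = Z k *\<^sub>v C (Suc e)" for e
  proof -
    have "C e = coeff_vec {z} (single z (Suc e)) (Var z \<cdot>\<^sub>v v)"
      using v by (intro eq_vecI) (auto simp: C_def coeff_in_Var_Suc)
    also have "\<dots> = Z k *\<^sub>v C (Suc e)"
      unfolding zv C_def by (rule coeff_vec_Z[OF k v z]) simp
    finally show ?thesis .
  qed
  \<comment> \<open>Exceeds the exponent of \<open>z\<close> in every monomial of every entry of
    \<open>v\<close>.\<close>
  define E where "E = Suc (\<Sum>j<b. \<Sum>m\<in>keys (v $ j). lookup m z)"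
  have big: "C e = 0\<^sub>v b" if "E \<le> e" for e
  proof (rule eq_vecI)
    fix j assume "j < dim_vec (0\<^sub>v b :: ('v, 'k) mpoly vec)"
    then have j: "j < b" by simp
    have "coeff_in {z} (single z e) (v $ j) = 0"
    proof (rule coeff_in_vanish)
      fix m assume m: "m \<in> keys (v $ j)"
      have "lookup m z \<le> (\<Sum>m\<in>keys (v $ j). lookup m z)" using m by (intro member_le_sum) auto
      also have "\<dots> \<le> (\<Sum>j<b. \<Sum>m\<in>keys (v $ j). lookup m z)"
        using j by (intro member_le_sum[of j]) auto
      also have "\<dots> < e" using that by (simp add: E_def)
      finally show "lookup m z < e" .
    qed
    then show "C e $ j = 0\<^sub>v b $ j" using j v by (simp add: C_def)
  qed (simp add: carrier_vecD[OF Cc])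
  have Z0: "Z k *\<^sub>v 0\<^sub>v b = 0\<^sub>v b" by (intro eq_vecI) (auto simp: Z_def scalar_prod_def)
  have all: "C e = 0\<^sub>v b" if "E \<le> e + d" for d e
    using that
  proof (induction d arbitrary: e)
    case (Suc d)
    then have "C (Suc e) = 0\<^sub>v b" by simp
    then show ?case using step[of e] Z0 by (simp only:)
  qed (simp add: big)
  show ?thesis
  proof (rule eq_vecI)
    fix j assume "j < dim_vec (0\<^sub>v b :: ('v, 'k) mpoly vec)"
    then have j: "j < b" by simp
    have "v $ j = 0"
    proof (rule eq_zero_if_coeff_in)
      fix \<mu> :: "'v \<Rightarrow>\<^sub>0 nat" assume "keys \<mu> \<subseteq> {z}"
      then have "\<mu> = single z (lookup \<mu> z)"
        by (intro poly_mapping_eqI) (auto simp: lookup_single when_def in_keys_iff)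
      moreover have "C (lookup \<mu> z) $ j = 0\<^sub>v b $ j" using all[of "lookup \<mu> z" E] by simp
      ultimately show "coeff_in {z} \<mu> (v $ j) = 0" using j v by (simp add: C_def)
    qed
    then show "v $ j = 0\<^sub>v b $ j" using j by simp
  qed (use v in simp)
qed

text \<open>By \<open>reduce\<close> a class modulo \<open>im l\<close> has a representative free of
  the eliminated variables. \<open>Y l\<close> keeps it free of them, so by
  \<open>im_inter_W\<close> its image is in \<open>im l\<close> only if it is 0, and
  \<open>Y l\<close> is injective.\<close>

lemma im_injective:
  assumes l: "l < length zs" and v: "v \<in> vecs V b" and Yv: "Y l *\<^sub>v v \<in> im l"
  shows "v \<in> im l"
proof -
  obtain x w where x: "x \<in> im l" "w \<in> vecs (W l) b" "v = x + w"
    using reduce[OF less_imp_le[OF l] v] by blast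
  have c: "x \<in> carrier_vec b" "w \<in> carrier_vec b" using im_vecs[OF _ x(1)] l x(2) by (auto dest: vecs_carrier)
  have "Y l *\<^sub>v w = Y l *\<^sub>v v - Y l *\<^sub>v x"
  proof -
    have "Y l *\<^sub>v v = Y l *\<^sub>v x + Y l *\<^sub>v w"
      unfolding x(3) by (rule mult_add_distrib_mat_vec[OF Y_carrier c])
    moreover have "Y l *\<^sub>v x \<in> carrier_vec b" "Y l *\<^sub>v w \<in> carrier_vec b"
      by (auto intro!: carrier_vecI simp: Y_def)
    ultimately show ?thesis by (intro eq_vecI) (simp_all del: index_mult_mat_vec)
  qed
  also have "\<dots> \<in> im l" using l by (intro im_diff Yv im_Y x) auto
  finally have "Y l *\<^sub>v w \<in> im l" .
  moreover have "Y l *\<^sub>v w \<in> vecs (W l) b"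
    using Y_mats[OF l V0_subset_W zs_nth_W[OF l]] x(2) by (rule vecs_mult_mat)
  ultimately have "Y l *\<^sub>v w = 0\<^sub>v b" using l by (intro im_inter_W[of l]) auto
  then have "w = 0\<^sub>v b" by (rule Y_injective[OF l c(2)])
  then show ?thesis using x(1,3) c(1) by simp
qed

text \<open>Once all variables outside \<open>V0\<close> are eliminated, what remains of a relation
  is a relation over \<open>K[V0]\<close>, hence 0. So the complex augmented by \<open>lin\<close>
  resolves \<open>S / J\<close>.\<close>

lemma im_lin:
  assumes "u \<in> vecs V b"
  shows "lin u \<in> J \<longleftrightarrow> u \<in> im (length zs)"
proof
  have "coeff_vec {} 0 x = x" for x :: "('v, 'k) mpoly vec" by (intro eq_vecI) auto
  then have im: "lin x \<in> J" if "x \<in> im (length zs)" for x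
    using im_coeff[OF _ that, of "{}" 0] by simp
  show "u \<in> im (length zs) \<Longrightarrow> lin u \<in> J" by (rule im)
  assume u: "lin u \<in> J"
  obtain x v where x: "x \<in> im (length zs)" "v \<in> vecs (W (length zs)) b" "u = x + v"
    using reduce[OF _ assms] by blast
  have v: "v \<in> vecs V0 b" using x(2) W_decomp(1)[of "length zs"] by simp
  have c: "x \<in> carrier_vec b" "v \<in> carrier_vec b" using im_vecs[OF _ x(1)] x(2) by (auto dest: vecs_carrier)
  have "lin v \<in> J" using J_diff[OF u im[OF x(1)]] c unfolding x(3) by (simp add: lin_add)
  then have "v = 0\<^sub>v b" by (rule lin_indep[OF v])
  then show "u \<in> im (length zs)" using x c by simp
qed

lemma span_all:
  assumes "p \<in> polys V" shows "\<exists>u\<in>vecs V0 b. p - lin u \<in> J"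
  using assms
proof (induction rule: polys_induct)
  case zero
  have "lin (0\<^sub>v b) = 0" by (simp add: lin_def)
  then show ?case using J_zero by (intro bexI[of _ "0\<^sub>v b"]) auto
next
  case (add p q)
  then obtain u v where uv: "u \<in> vecs V0 b" "p - lin u \<in> J" "v \<in> vecs V0 b" "q - lin v \<in> J" by blast
  have "(p + q) - lin (u + v) = (p - lin u) + (q - lin v)"
    using uv(1,3)[THEN vecs_carrier] by (simp add: lin_add)
  also have "\<dots> \<in> J" by (rule J_add[OF uv(2,4)])
  finally show ?case using uv(1,3) by (intro bexI[of _ "u + v"]) auto
next
  case (single m c)
  obtain a where a: "\<forall>j<b. a j \<in> polys V0" "single m c - (\<Sum>j<b. a j * mb j) \<in> J"
    using span[OF polys_single[OF single] homogeneous_single[OF refl]] by blast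
  have "lin (vec b a) = (\<Sum>j<b. a j * mb j)" by (simp add: lin_def)
  then show ?case using a by (intro bexI[of _ "vec b a"]) (auto simp: vecs_def)
qed

definition resln :: "('v, 'k) mpoly resolution" where
  "resln = \<lparr>res_rank = kz_rank b (length zs), res_degree = kz_deg b dg (length zs),
     res_aug = vec b mb, res_diff = kz_diff b Y (length zs)\<rparr>"

lemma aug_scalar_prod: "u \<in> carrier_vec b \<Longrightarrow> vec b mb \<bullet> u = lin u"
  by (simp add: scalar_prod_def lin_def atLeast0LessThan mult.commute)

lemma graded_free_resolution_resln: "graded_free_resolution V J resln"
proof -
  have Ym: "\<And>l. l < length zs \<Longrightarrow> Y l \<in> mats V b b" by (rule Y_mats_V)
  let ?D = "kz_diff b Y (length zs)" and ?r = "kz_rank b (length zs)"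
  have D: "?D i \<in> mats V (?r i) (?r (Suc i))" for i by (rule kz_diff_mats[OF Ym])
  have h: "homogeneous (kz_deg b dg (length zs) (Suc i) q - kz_deg b dg (length zs) i p) (?D i $$ (p, q))"
    if "p < ?r i" "q < ?r (Suc i)" for i p q
    using that by (intro kz_diff_homogeneous Y_homogeneous) auto
  have ex: "{u \<in> vecs V (?r (Suc i)). ?D i *\<^sub>v u = 0\<^sub>v (?r i)} = (\<lambda>w. ?D (Suc i) *\<^sub>v w) ` vecs V (?r (Suc (Suc i)))" for i
  proof (intro equalityI subsetI)
    fix u assume "u \<in> {u \<in> vecs V (?r (Suc i)). ?D i *\<^sub>v u = 0\<^sub>v (?r i)}"
    then have u: "u \<in> vecs V (?r (Suc i))" "?D i *\<^sub>v u = 0\<^sub>v (?r i)" by auto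
    have "\<exists>w \<in> vecs V (?r (Suc (Suc i))). u = ?D (Suc i) *\<^sub>v w"
      by (rule kz_exact[OF Ym Y_commute im_injective u])
    then show "u \<in> (\<lambda>w. ?D (Suc i) *\<^sub>v w) ` vecs V (?r (Suc (Suc i)))" by blast
  next
    fix u assume "u \<in> (\<lambda>w. ?D (Suc i) *\<^sub>v w) ` vecs V (?r (Suc (Suc i)))"
    then obtain w where w: "w \<in> vecs V (?r (Suc (Suc i)))" "u = ?D (Suc i) *\<^sub>v w" by blast
    have "?D i *\<^sub>v u = 0\<^sub>v (?r i)"
      unfolding w(2) by (rule kz_diff_diff[OF Y_carrier Y_commute vecs_carrier[OF w(1)]])
    then show "u \<in> {u \<in> vecs V (?r (Suc i)). ?D i *\<^sub>v u = 0\<^sub>v (?r i)}"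
      using vecs_mult_mat[OF D w(1)] w(2) by blast
  qed
  have aug: "{u \<in> vecs V b. vec b mb \<bullet> u \<in> J} = (\<lambda>w. ?D 0 *\<^sub>v w) ` vecs V (?r 1)"
  proof -
    have "{u \<in> vecs V b. vec b mb \<bullet> u \<in> J} = {u \<in> vecs V b. u \<in> im (length zs)}"
      using im_lin aug_scalar_prod vecs_carrier by fastforce
    also have "\<dots> = im (length zs)" using im_vecs[of "length zs"] by blast
    finally show ?thesis by (simp add: kz_image_def)
  qed
  have surj: "\<exists>u\<in>vecs V b. p - vec b mb \<bullet> u \<in> J" if "p \<in> polys V" for p
    using span_all[OF that] vecs_V0 aug_scalar_prod vecs_carrier by metis
  show ?thesis
    unfolding graded_free_resolution_def resln_def resolution.simps carrier_free_module carrier_mpoly_ring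
    using D h ex aug surj mb_polys mb_homogeneous
    by (simp add: mats_def vecs_def)
qed

end

section \<open>When the dual basis is generated in a single degree\<close>

section \<open>Generators of the dual module\<close>

lemma single_sum: "single k (sum f A) = (\<Sum>i\<in>A. single k (f i :: 'b::comm_monoid_add))"
  by (induction A rule: infinite_finite_induct) (auto simp: single_add)

context free_basis
begin

text \<open>Each monomial of \<open>q\<close> contains a variable of \<open>V0\<close>. Splitting it
  off leaves a cofactor of degree \<open>K - 1\<close>, to which \<open>kill\<close>
  applies.\<close>

lemma vanish_positive_degree:
  fixes \<phi> :: "('v, 'k) mpoly \<Rightarrow> 'k"
  assumes add: "\<And>x y. \<phi> (x + y) = \<phi> x + \<phi> y"
    and kill: "\<And>v x. v \<in> V0 \<Longrightarrow> x \<in> polys V \<Longrightarrow> homogeneous (K - 1) x \<Longrightarrow> \<phi> (Var v * x) = 0"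
    and q: "q \<in> polys V0" "homogeneous d q" "d > 0"
    and x: "x \<in> polys V" "homogeneous (K - d) x"
  shows "\<phi> (q * x) = 0"
proof -
  have \<phi>0: "\<phi> 0 = 0" using add[of 0 0] by (metis add_0_left add_right_cancel)
  have \<phi>sum: "\<phi> (sum f A) = (\<Sum>i\<in>A. \<phi> (f i))" for f :: "('v \<Rightarrow>\<^sub>0 nat) \<Rightarrow> _" and A
    by (induction A rule: infinite_finite_induct) (auto simp: add \<phi>0)
  have "\<phi> (single m (lookup q m) * x) = 0" if m: "m \<in> keys q" for m
  proof -
    have "int (monomial_degree m) = d" "keys m \<subseteq> V0" using m q by (auto simp: homogeneous_def polys_def)
    then have "m \<noteq> 0" using q(3) by auto
    then obtain v where v: "v \<in> keys m" by (metis keys_eq_empty all_not_in_conv)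
    then obtain m' where m': "m = single v (1::nat) + m'" using exponent_split_var by metis
    have d: "d = 1 + int (monomial_degree m')" using \<open>int (monomial_degree m) = d\<close> by (simp add: m')
    have "single m (lookup q m) * x = Var v * (single m' (lookup q m) * x)"
      by (simp add: m' Var_def mult_single mult.assoc[symmetric])
    also have "\<phi> \<dots> = 0"
    proof (rule kill)
      show "v \<in> V0" using v \<open>keys m \<subseteq> V0\<close> by auto
      have "keys m' \<subseteq> V" using \<open>keys m \<subseteq> V0\<close> V0_subset by (auto simp: m' keys_plus_nat)
      then show "single m' (lookup q m) * x \<in> polys V" using x(1) by (intro polys_mult polys_single)
      show "homogeneous (K - 1) (single m' (lookup q m) * x)"
        by (rule homogeneous_mult_eq[OF homogeneous_single[OF refl] x(2)]) (simp add: d)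
    qed
    finally show ?thesis .
  qed
  then have "(\<Sum>m\<in>keys q. \<phi> (single m (lookup q m) * x)) = 0" by (intro sum.neutral) blast
  moreover have "q * x = (\<Sum>m\<in>keys q. single m (lookup q m) * x)"
    by (subst (1) sum_single_keys[of q, symmetric]) (simp add: sum_distrib_right)
  ultimately show ?thesis by (simp add: \<phi>sum)
qed

text \<open>Applied to the matrix of multiplication by \<open>p\<close>, such a \<open>\<phi>\<close> writes the unit vector \<open>j\<close> of the dual
  module as \<open>p\<close> times a combination of unit vectors of degree \<open>K\<close>, up to multiples of unit vectors that
  precede \<open>j\<close>.\<close>

definition pairs_with :: "int \<Rightarrow> (nat \<times> nat) set \<Rightarrow> nat \<Rightarrow> ('v, 'k) mpoly \<Rightarrow> (('v, 'k) mpoly \<Rightarrow> 'k) \<Rightarrow> bool" where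
  "pairs_with K r j p \<phi> \<longleftrightarrow> p \<in> polys V \<and> homogeneous (K - dg j) p \<and>
      (\<forall>x y. \<phi> (x + y) = \<phi> x + \<phi> y) \<and> (\<forall>c x. \<phi> (single 0 c * x) = c * \<phi> x) \<and> (\<forall>x\<in>J. \<phi> x = 0) \<and>
      (\<forall>v\<in>V0. \<forall>x\<in>polys V. homogeneous (K - 1) x \<longrightarrow> \<phi> (Var v * x) = 0) \<and> \<phi> (p * mb j) = 1 \<and>
      (\<forall>l<b. l \<noteq> j \<longrightarrow> dg l < dg j \<or> dg l = dg j \<and> \<phi> (p * mb l) = 0 \<or> (l, j) \<in> r)"

text \<open>Modulo the images of the transposed \<open>Y l\<close>, the module \<open>S^b\<close> is
  the dual of \<open>S / J\<close> over \<open>K[V0]\<close>, and the unit vectors are the dual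
  basis. \<open>H\<close> stands for the preimage of an arbitrary submodule of this dual.\<close>

context
  fixes H :: "('v, 'k) mpoly vec set"
  assumes H_zero: "0\<^sub>v b \<in> H" and H_sub: "H \<subseteq> vecs V b"
    and H_add: "\<And>x y. x \<in> H \<Longrightarrow> y \<in> H \<Longrightarrow> x + y \<in> H"
    and H_smult: "\<And>p x. p \<in> polys V \<Longrightarrow> x \<in> H \<Longrightarrow> p \<cdot>\<^sub>v x \<in> H"
    and H_cob: "\<And>l j. l < length zs \<Longrightarrow> j < b \<Longrightarrow> transpose_mat (Y l) *\<^sub>v unit_vec b j \<in> H"
begin

lemma H_carrier: "x \<in> H \<Longrightarrow> x \<in> carrier_vec b"
  using H_sub vecs_carrier by blast

lemma H_diff: "x \<in> H \<Longrightarrow> y \<in> H \<Longrightarrow> x - y \<in> H"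
proof -
  assume xy: "x \<in> H" "y \<in> H"
  have "x - y = x + (-1) \<cdot>\<^sub>v y" using xy[THEN H_carrier] by (intro eq_vecI) auto
  then show "x - y \<in> H" using xy by (simp add: H_add H_smult polys_uminus)
qed

lemma H_sum:
  fixes n :: nat
  assumes "\<And>m. m < n \<Longrightarrow> f m \<in> H" "\<And>m. m < n \<Longrightarrow> a m \<in> polys V"
  shows "vec b (\<lambda>j. \<Sum>m<n. a m * f m $ j) \<in> H"
  using assms
proof (induction n)
  case 0
  have "vec b (\<lambda>j. \<Sum>m<0. a m * f m $ j) = 0\<^sub>v b" by (intro eq_vecI) auto
  then show ?case using H_zero by simp
next
  case (Suc n)
  have "f n \<in> carrier_vec b" using Suc.prems(1) H_carrier by blast
  then have "vec b (\<lambda>j. \<Sum>m<Suc n. a m * f m $ j) = vec b (\<lambda>j. \<Sum>m<n. a m * f m $ j) + a n \<cdot>\<^sub>v f n"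
    by (intro eq_vecI) auto
  moreover have "vec b (\<lambda>j. \<Sum>m<n. a m * f m $ j) \<in> H" using Suc.prems by (intro Suc.IH) auto
  moreover have "a n \<cdot>\<^sub>v f n \<in> H" using Suc.prems by (intro H_smult) auto
  ultimately show ?case using H_add by simp
qed

text \<open>On the dual module \<open>p\<close> acts through the transpose of its multiplication
  matrix \<open>P\<close>: modulo \<open>H\<close> it sends the \<open>i\<close>-th unit vector to
  the \<open>i\<close>-th row of \<open>P\<close>. For a variable of \<open>V0\<close> this is
  scalar multiplication; for any other one the error term is a combination of columns of the
  transposed \<open>Y l\<close>.\<close>

lemma multiplication_matrix:
  assumes "p \<in> polys V"
  shows "\<exists>P. (\<forall>i<b. \<forall>j<b. P i j \<in> polys V0) \<and> (\<forall>j<b. p * mb j - (\<Sum>i<b. P i j * mb i) \<in> J) \<and>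
    (\<forall>i<b. p \<cdot>\<^sub>v unit_vec b i - vec b (P i) \<in> H)"
  using assms
proof (induction rule: polys_Var_induct)
  case (const c)
  have "single 0 c * mb j - (\<Sum>i<b. (if i = j then single 0 c else 0) * mb i) = 0" if "j < b" for j
    using that by (simp add: if_distrib[of "\<lambda>x. x * _"] cong: if_cong)
  moreover have "(single 0 c :: ('v, 'k) mpoly) \<cdot>\<^sub>v unit_vec b i - vec b (\<lambda>j. if i = j then single 0 c else 0) = 0\<^sub>v b"
    if "i < b" for i
    using that by (intro eq_vecI) (auto simp: unit_vec_def)
  moreover have "(if i = j then single 0 c else 0 :: ('v, 'k) mpoly) \<in> polys V0" for i j :: nat by simp
  ultimately show ?case using J_zero H_zero
    by (intro exI[of _ "\<lambda>i j. if i = j then single 0 c else 0"] conjI allI impI) (simp_all only:)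
next
  case (add p q)
  then obtain P Q where P: "\<forall>i<b. \<forall>j<b. P i j \<in> polys V0" "\<forall>j<b. p * mb j - (\<Sum>i<b. P i j * mb i) \<in> J"
      "\<forall>i<b. p \<cdot>\<^sub>v unit_vec b i - vec b (P i) \<in> H"
    and Q: "\<forall>i<b. \<forall>j<b. Q i j \<in> polys V0" "\<forall>j<b. q * mb j - (\<Sum>i<b. Q i j * mb i) \<in> J"
      "\<forall>i<b. q \<cdot>\<^sub>v unit_vec b i - vec b (Q i) \<in> H" by blast
  have "(p + q) * mb j - (\<Sum>i<b. (P i j + Q i j) * mb i) =
     (p * mb j - (\<Sum>i<b. P i j * mb i)) + (q * mb j - (\<Sum>i<b. Q i j * mb i))" for j
    by (simp add: distrib_right sum.distrib)
  moreover have "(p + q) \<cdot>\<^sub>v unit_vec b i - vec b (\<lambda>j. P i j + Q i j) =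
     (p \<cdot>\<^sub>v unit_vec b i - vec b (P i)) + (q \<cdot>\<^sub>v unit_vec b i - vec b (Q i))" for i
    by (intro eq_vecI) (auto simp: distrib_right)
  moreover have "P i j + Q i j \<in> polys V0" if "i < b" "j < b" for i j using P(1) Q(1) that by auto
  ultimately show ?case using P Q J_add H_add
    by (intro exI[of _ "\<lambda>i j. P i j + Q i j"] conjI allI impI) (simp_all only:)
next
  case (Var p x)
  then obtain P where P: "\<forall>i<b. \<forall>j<b. P i j \<in> polys V0" "\<forall>j<b. p * mb j - (\<Sum>i<b. P i j * mb i) \<in> J"
      "\<forall>i<b. p \<cdot>\<^sub>v unit_vec b i - vec b (P i) \<in> H" by blast
  have x: "x \<in> V" and p: "p \<in> polys V" using Var by blast+
  have P': "P i j \<in> polys V" if "i < b" "j < b" for i j using P(1) that polys_mono[OF V0_subset] by blast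
  show ?case
  proof (cases "x \<in> V0")
    case True
    have "Var x * p * mb j - (\<Sum>i<b. Var x * P i j * mb i) \<in> J" if "j < b" for j
    proof -
      have "Var x * (p * mb j - (\<Sum>i<b. P i j * mb i)) \<in> J" using P(2) that x by (intro J_mult) auto
      then show ?thesis by (simp add: right_diff_distrib sum_distrib_left mult.assoc)
    qed
    moreover have "(Var x * p) \<cdot>\<^sub>v unit_vec b i - vec b (\<lambda>j. Var x * P i j) \<in> H" if "i < b" for i
    proof -
      have "Var x \<cdot>\<^sub>v (p \<cdot>\<^sub>v unit_vec b i - vec b (P i)) \<in> H" using P(3) that x by (intro H_smult) auto
      also have "Var x \<cdot>\<^sub>v (p \<cdot>\<^sub>v unit_vec b i - vec b (P i)) = (Var x * p) \<cdot>\<^sub>v unit_vec b i - vec b (\<lambda>j. Var x * P i j)"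
        by (intro eq_vecI) (auto simp: right_diff_distrib mult.assoc)
      finally show ?thesis .
    qed
    moreover have "Var x * P i j \<in> polys V0" if "i < b" "j < b" for i j using P(1) True that by auto
    ultimately show ?thesis
      by (intro exI[of _ "\<lambda>i j. Var x * P i j"] conjI allI impI) (simp_all only:)
  next
    case False
    then have "x \<in> set zs" using x zs(1) by auto
    then obtain l where l: "l < length zs" "zs ! l = x" by (auto simp: in_set_conv_nth)
    \<comment> \<open>The product of \<open>P\<close> with the matrix of the variable
      \<open>x\<close>.\<close>
    define P2 where "P2 i j = (\<Sum>m<b. P i m * coef l j m)" for i j
    have "P2 i j \<in> polys V0" if "i < b" "j < b" for i j
      unfolding P2_def using P(1) coef(1)[OF l(1) that(2)] that by (intro polys_sum polys_mult) auto
    moreover have "Var x * p * mb j - (\<Sum>i<b. P2 i j * mb i) \<in> J" if j: "j < b" for j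
    proof (rule J_trans)
      have cV: "coef l j m \<in> polys V" if "m < b" for m
        using coef(1)[OF l(1) j that] polys_mono[OF V0_subset] by blast
      have "p * (Var (zs ! l) * mb j - (\<Sum>i<b. coef l j i * mb i)) \<in> J"
        by (intro J_mult p coef(3) l j)
      also have "p * (Var (zs ! l) * mb j - (\<Sum>i<b. coef l j i * mb i)) =
          Var x * p * mb j - (\<Sum>m<b. coef l j m * (p * mb m))"
        by (simp add: l(2) right_diff_distrib sum_distrib_left ac_simps)
      finally show "Var x * p * mb j - (\<Sum>m<b. coef l j m * (p * mb m)) \<in> J" .
      have "(\<Sum>m<b. coef l j m * (p * mb m - (\<Sum>i<b. P i m * mb i))) \<in> J"
        using P(2) by (intro J_sum J_mult) (auto intro: cV)
      also have "(\<Sum>m<b. coef l j m * (p * mb m - (\<Sum>i<b. P i m * mb i))) =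
          (\<Sum>m<b. coef l j m * (p * mb m)) - (\<Sum>m<b. \<Sum>i<b. P i m * coef l j m * mb i)"
        by (simp add: right_diff_distrib sum_subtractf sum_distrib_left mult.assoc mult.left_commute)
      also have "(\<Sum>m<b. \<Sum>i<b. P i m * coef l j m * mb i) = (\<Sum>i<b. P2 i j * mb i)"
        by (subst sum.swap) (simp add: P2_def sum_distrib_right)
      finally show "(\<Sum>m<b. coef l j m * (p * mb m)) - (\<Sum>i<b. P2 i j * mb i) \<in> J" .
    qed
    moreover have "(Var x * p) \<cdot>\<^sub>v unit_vec b i - vec b (P2 i) \<in> H" if i: "i < b" for i
    proof -
      have 1: "Var x \<cdot>\<^sub>v (p \<cdot>\<^sub>v unit_vec b i - vec b (P i)) \<in> H" using P(3) i x by (intro H_smult) auto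
      have 2: "vec b (\<lambda>j. \<Sum>m<b. P i m * (transpose_mat (Y l) *\<^sub>v unit_vec b m) $ j) \<in> H"
        using P' i by (intro H_sum H_cob l) auto
      have Yt: "(transpose_mat (Y l) *\<^sub>v unit_vec b m) $ j = (if m = j then Var x else 0) - coef l j m"
        if "m < b" "j < b" for m j
        using mult_mat_unit_vec[of "transpose_mat (Y l)" b b j m] that by (simp add: Y_def l(2))
      have "Var x * P i j - P2 i j = (\<Sum>m<b. P i m * (transpose_mat (Y l) *\<^sub>v unit_vec b m) $ j)" if j: "j < b" for j
      proof -
        have "(\<Sum>m<b. P i m * (transpose_mat (Y l) *\<^sub>v unit_vec b m) $ j) =
          (\<Sum>m<b. (if m = j then P i m * Var x else 0) - P i m * coef l j m)"
          using j by (intro sum.cong) (auto simp: Yt right_diff_distrib simp del: index_mult_mat_vec)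
        also have "\<dots> = Var x * P i j - P2 i j"
          using j by (simp add: sum_subtractf P2_def mult.commute)
        finally show ?thesis by simp
      qed
      then have "vec b (\<lambda>j. \<Sum>m<b. P i m * (transpose_mat (Y l) *\<^sub>v unit_vec b m) $ j) =
          vec b (\<lambda>j. Var x * P i j - P2 i j)"
        by (intro eq_vecI) (simp_all only: index_vec dim_vec)
      moreover have "(Var x * p) \<cdot>\<^sub>v unit_vec b i - vec b (P2 i) = Var x \<cdot>\<^sub>v (p \<cdot>\<^sub>v unit_vec b i - vec b (P i)) +
          vec b (\<lambda>j. Var x * P i j - P2 i j)"
        by (intro eq_vecI) (auto simp: algebra_simps)
      ultimately show ?thesis using H_add[OF 1 2] by (simp only:)
    qed
    ultimately show ?thesis by (intro exI[of _ P2] conjI allI impI) (simp_all only:)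
  qed
qed

text \<open>The values of \<phi> prescribe a combination of unit vectors of degree \<open>K\<close>.
  Multiplied by \<open>p\<close> it becomes \<open>vec b c\<close>, where \<open>c l\<close> is 0
  below the degree of \<open>j\<close>, the scalar \<open>\<phi> (p * mb l)\<close> in that degree,
  and uncontrolled above it. So the unit vector \<open>j\<close> remains after subtracting multiples
  of unit vectors that \<open>r\<close> places before \<open>j\<close>.\<close>

lemma dual_generated:
  assumes top: "\<And>j. j < b \<Longrightarrow> dg j = K \<Longrightarrow> unit_vec b j \<in> H"
    and dg_le: "\<And>j. j < b \<Longrightarrow> dg j \<le> K"
    and r: "wf r"
    and pairing: "\<And>j. j < b \<Longrightarrow> \<exists>p \<phi>. pairs_with K r j p \<phi>"
  shows "j < b \<Longrightarrow> unit_vec b j \<in> H"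
  using r
proof (induction j rule: wf_induct_rule)
  case (less j)
  note j = less.prems
  obtain p \<phi> where pw: "pairs_with K r j p \<phi>" using pairing[OF j] by blast
  note pw' = pw[unfolded pairs_with_def]
  have p: "p \<in> polys V" "homogeneous (K - dg j) p"
    and \<phi>_add: "\<And>x y. \<phi> (x + y) = \<phi> x + \<phi> y" and \<phi>_const: "\<And>c x. \<phi> (single 0 c * x) = c * \<phi> x"
    and \<phi>_J: "\<And>x. x \<in> J \<Longrightarrow> \<phi> x = 0"
    and \<phi>_V0: "\<And>v x. v \<in> V0 \<Longrightarrow> x \<in> polys V \<Longrightarrow> homogeneous (K - 1) x \<Longrightarrow> \<phi> (Var v * x) = 0"
    and \<phi>_j: "\<phi> (p * mb j) = 1"
    and \<phi>_l: "\<And>l. l < b \<Longrightarrow> l \<noteq> j \<Longrightarrow> dg l < dg j \<or> dg l = dg j \<and> \<phi> (p * mb l) = 0 \<or> (l, j) \<in> r"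
    by (use pw' in \<open>elim conjE, blast\<close>)+
  obtain P where P: "\<And>i j. i < b \<Longrightarrow> j < b \<Longrightarrow> P i j \<in> polys V0"
      "\<And>j. j < b \<Longrightarrow> p * mb j - (\<Sum>i<b. P i j * mb i) \<in> J"
      "\<And>i. i < b \<Longrightarrow> p \<cdot>\<^sub>v unit_vec b i - vec b (P i) \<in> H"
    using multiplication_matrix[OF p(1)] by blast
  \<comment> \<open>Uniqueness of coordinates transfers the degrees of a homogeneous representation
    to \<open>P\<close>.\<close>
  have Phom: "homogeneous (K - dg j + dg l - dg i) (P i l)" if l: "l < b" "i < b" for i l
  proof -
    have "p * mb l \<in> polys V" "homogeneous (K - dg j + dg l) (p * mb l)"
      using p mb_polys mb_homogeneous l(1) by (auto intro: homogeneous_mult)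
    then obtain a where a: "\<forall>i<b. a i \<in> polys V0 \<and> homogeneous (K - dg j + dg l - dg i) (a i)"
      "p * mb l - (\<Sum>i<b. a i * mb i) \<in> J" using span by blast
    have "(\<Sum>i<b. (P i l - a i) * mb i) \<in> J"
      using J_diff[OF a(2) P(2)[OF l(1)]] by (simp add: left_diff_distrib sum_subtractf)
    then have "P i l - a i = 0" using a(1) P(1) l by (intro indep[of "\<lambda>i. P i l - a i"]) auto
    then show ?thesis using a(1) l(2) by simp
  qed
  \<comment> \<open>The functional enters only through its values on the basis elements of degree
    \<open>K\<close>.\<close>
  define g :: "nat \<Rightarrow> ('v, 'k) mpoly" where "g i = (if dg i = K then single 0 (\<phi> (mb i)) else 0)" for i
  have gV: "g i \<in> polys V" for i by (simp add: g_def)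
  define c where "c l = (\<Sum>i<b. g i * P i l)" for l
  have cH: "vec b c \<in> H"
  proof -
    have 1: "vec b (\<lambda>l. \<Sum>i<b. g i * (p \<cdot>\<^sub>v unit_vec b i - vec b (P i)) $ l) \<in> H"
      using P(3) gV by (intro H_sum)
    have 2: "vec b (\<lambda>l. \<Sum>i<b. g i * (if dg i = K then p \<cdot>\<^sub>v unit_vec b i else 0\<^sub>v b) $ l) \<in> H"
      using gV top H_zero p by (intro H_sum) (auto intro: H_smult)
    have "vec b c = vec b (\<lambda>l. \<Sum>i<b. g i * (if dg i = K then p \<cdot>\<^sub>v unit_vec b i else 0\<^sub>v b) $ l) -
       vec b (\<lambda>l. \<Sum>i<b. g i * (p \<cdot>\<^sub>v unit_vec b i - vec b (P i)) $ l)"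
    proof (rule eq_vecI)
      fix l assume "l < dim_vec (vec b (\<lambda>l. \<Sum>i<b. g i * (if dg i = K then p \<cdot>\<^sub>v unit_vec b i else 0\<^sub>v b) $ l) -
         vec b (\<lambda>l. \<Sum>i<b. g i * (p \<cdot>\<^sub>v unit_vec b i - vec b (P i)) $ l))"
      then have l: "l < b" by simp
      have "c l = (\<Sum>i<b. g i * (if dg i = K then p \<cdot>\<^sub>v unit_vec b i else 0\<^sub>v b) $ l -
          g i * (p \<cdot>\<^sub>v unit_vec b i - vec b (P i)) $ l)"
        unfolding c_def using l by (intro sum.cong refl) (simp add: g_def right_diff_distrib)
      then show "vec b c $ l = (vec b (\<lambda>l. \<Sum>i<b. g i * (if dg i = K then p \<cdot>\<^sub>v unit_vec b i else 0\<^sub>v b) $ l) -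
         vec b (\<lambda>l. \<Sum>i<b. g i * (p \<cdot>\<^sub>v unit_vec b i - vec b (P i)) $ l)) $ l"
        using l by (simp only: sum_subtractf index_minus_vec index_vec dim_vec)
    qed simp
    then show ?thesis using H_diff[OF 2 1] by (simp only:)
  qed
  have \<phi>sum: "\<phi> (sum f A) = (\<Sum>i\<in>A. \<phi> (f i))" for f :: "nat \<Rightarrow> _" and A
    using \<phi>_const[of 0 0] by (induction A rule: infinite_finite_induct) (auto simp: \<phi>_add)
  \<comment> \<open>For \<open>dg i = K\<close> the entry \<open>P i l\<close> has degree
    \<open>dg l - dg j\<close>, which is negative here.\<close>
  have c_lt: "c l = 0" if "l < b" "dg l < dg j" for l
    unfolding c_def
  proof (rule sum.neutral, rule ballI)
    fix i assume "i \<in> {..<b}"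
    then have i: "i < b" by simp
    show "g i * P i l = 0"
      using homogeneous_negative[OF Phom[OF that(1) i]] that(2) by (cases "dg i = K") (auto simp: g_def)
  qed
  have c_eq: "c l = single 0 (\<phi> (p * mb l))" if l: "l < b" "dg l = dg j" for l
  proof -
    have "\<phi> (p * mb l) = \<phi> (\<Sum>i<b. P i l * mb i)"
      using \<phi>_J[OF P(2)[OF l(1)]] \<phi>_add[of "p * mb l - (\<Sum>i<b. P i l * mb i)" "\<Sum>i<b. P i l * mb i"] by simp
    also have "\<dots> = (\<Sum>i<b. \<phi> (P i l * mb i))" by (rule \<phi>sum)
    also have "single 0 \<dots> = (\<Sum>i<b. single 0 (\<phi> (P i l * mb i)))" by (rule single_sum)
    also have "\<dots> = c l"
      unfolding c_def
    proof (rule sum.cong[OF refl])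
      fix i assume "i \<in> {..<b}"
      then have i: "i < b" by simp
      show "single 0 (\<phi> (P i l * mb i)) = g i * P i l"
      proof (cases "dg i = K")
        case True
        then have "P i l = single 0 (lookup (P i l) 0)"
          using Phom[OF l(1) i] l(2) by (intro homogeneous_degree_0) simp
        then obtain x where x: "P i l = single 0 x" by blast
        have "single 0 (\<phi> (P i l * mb i)) = single 0 (x * \<phi> (mb i))"
          unfolding x \<phi>_const by (rule refl)
        then show ?thesis using True by (simp add: x g_def const_mult_const mult.commute)
      next
        \<comment> \<open>Now \<open>dg i < K\<close>, so \<open>P i l\<close> has positive degree
          and \<phi> kills its product with \<open>mb i\<close>.\<close>
        case False
        then have "\<phi> (P i l * mb i) = 0"
          using dg_le[OF i] Phom[OF l(1) i] l(2)
          by (intro vanish_positive_degree[of \<phi> K, OF \<phi>_add \<phi>_V0 P(1)[OF i l(1)], of "K - dg i"])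
            (auto intro: mb_polys mb_homogeneous i)
        then show ?thesis using False by (simp add: g_def)
      qed
    qed
    finally show ?thesis by simp
  qed
  have cj: "c j = 1" using c_eq[OF j refl] \<phi>_j by simp
  define u where "u = vec b (\<lambda>l. if l = j then 0 else c l)"
  have cV: "c l \<in> polys V" if "l < b" for l
    unfolding c_def using P(1) that gV polys_mono[OF V0_subset] by (intro polys_sum polys_mult) auto
  have "u \<in> vecs V b" using cV by (auto simp: u_def vecs_def)
  then have "u \<in> H"
  proof (rule vecs_unit_closed[OF _ H_zero])
    fix l assume l: "l < b" "u $ l \<noteq> 0"
    then have lj: "l \<noteq> j" "c l \<noteq> 0" by (auto simp: u_def split: if_splits)
    have "(l, j) \<in> r" using \<phi>_l[OF l(1) lj(1)] c_lt[OF l(1)] c_eq[OF l(1)] lj(2) by auto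
    then have "unit_vec b l \<in> H" using less.IH l(1) by blast
    then show "u $ l \<cdot>\<^sub>v unit_vec b l \<in> H" using l(1) cV by (intro H_smult) (auto simp: u_def)
  qed (auto intro: H_add)
  then have "vec b c - u \<in> H" by (rule H_diff[OF cH])
  also have "vec b c - u = unit_vec b j" using cj by (intro eq_vecI) (auto simp: u_def unit_vec_def)
  finally show ?case .
qed

end

end

section \<open>The last Ext module as a cokernel\<close>

section \<open>Submodules of Ext\<close>

lemma free_module_simps [simp]:
  "add (free_module V b) = (+)" "smult (free_module V b) = (\<cdot>\<^sub>v)" "zero (free_module V b) = 0\<^sub>v b"
  by (simp_all add: free_module_def module_vec_def)

text \<open>The complex ends in degree \<open>c\<close>, so all vectors of that degree are cocycles
  and Ext is a quotient of the whole free module. Its submodules correspond to submodules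
  \<open>H\<close> containing the coboundaries, which turns generation into the closure statement
  \<open>gen\<close>. The duals of basis elements of degree \<open>D\<close> have degree
  \<open>card V - D\<close>.\<close>

lemma generates_ext_module:
  fixes F :: "('v, 'k::field) mpoly resolution"
  assumes diff: "\<And>i. res_diff F i \<in> mats V (res_rank F i) (res_rank F (Suc i))"
    and last: "res_rank F (Suc c) = 0"
    and gen: "\<And>H. 0\<^sub>v (res_rank F c) \<in> H \<Longrightarrow> H \<subseteq> vecs V (res_rank F c) \<Longrightarrow>
      (\<And>x y. x \<in> H \<Longrightarrow> y \<in> H \<Longrightarrow> x + y \<in> H) \<Longrightarrow> (\<And>p x. p \<in> polys V \<Longrightarrow> x \<in> H \<Longrightarrow> p \<cdot>\<^sub>v x \<in> H) \<Longrightarrow>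
      coboundaries V F c \<subseteq> H \<Longrightarrow>
      (\<And>j. j < res_rank F c \<Longrightarrow> res_degree F c j = D \<Longrightarrow> unit_vec (res_rank F c) j \<in> H) \<Longrightarrow>
      vecs V (res_rank F c) \<subseteq> H"
  shows "generates_module (mpoly_ring V) (ext_module V F c) (ext_component V F c (int (card V) - D))"
proof -
  define N where "N = coboundaries V F c"
  define M where "M = (res_module V F c)\<lparr>carrier := cocycles V F c\<rparr>"
  let ?b = "res_rank F c"
  have coc: "cocycles V F c = vecs V ?b"
  proof -
    have "transpose_mat (res_diff F c) *\<^sub>v u = 0\<^sub>v (res_rank F (Suc c))" for u
      using diff[of c] last by (intro eq_vecI) (auto simp: mats_def)
    then show ?thesis by (auto simp: cocycles_def)
  qed
  have N_zero: "0\<^sub>v ?b \<in> N" and N_sub: "N \<subseteq> vecs V ?b"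
    and N_add: "\<And>x y. x \<in> N \<Longrightarrow> y \<in> N \<Longrightarrow> x + y \<in> N"
    and N_smult: "\<And>p x. p \<in> polys V \<Longrightarrow> x \<in> N \<Longrightarrow> p \<cdot>\<^sub>v x \<in> N"
  proof -
    have "0\<^sub>v ?b \<in> N \<and> N \<subseteq> vecs V ?b \<and> (\<forall>x\<in>N. \<forall>y\<in>N. x + y \<in> N) \<and> (\<forall>p\<in>polys V. \<forall>x\<in>N. p \<cdot>\<^sub>v x \<in> N)"
    proof (cases c)
      case 0
      then have "N = {0\<^sub>v ?b}" by (simp add: N_def coboundaries_def)
      moreover have "p \<cdot>\<^sub>v 0\<^sub>v ?b = 0\<^sub>v ?b" for p :: "('v, 'k) mpoly" by (intro eq_vecI) auto
      ultimately show ?thesis by simp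
    next
      case (Suc h)
      let ?T = "transpose_mat (res_diff F h)"
      have T: "?T \<in> mats V ?b (res_rank F h)" using diff[of h] Suc by auto
      note Tc = mats_carrier[OF T]
      have N: "N = (\<lambda>w. ?T *\<^sub>v w) ` vecs V (res_rank F h)" by (simp add: N_def coboundaries_def Suc)
      have z: "0\<^sub>v ?b = ?T *\<^sub>v 0\<^sub>v (res_rank F h)"
        using Tc by (intro eq_vecI) (auto simp: scalar_prod_def)
      have a: "?T *\<^sub>v u + ?T *\<^sub>v v = ?T *\<^sub>v (u + v)" if "u \<in> vecs V (res_rank F h)" "v \<in> vecs V (res_rank F h)" for u v
        using that[THEN vecs_carrier] by (rule mult_add_distrib_mat_vec[OF Tc, symmetric])
      have s: "p \<cdot>\<^sub>v (?T *\<^sub>v u) = ?T *\<^sub>v (p \<cdot>\<^sub>v u)" if "u \<in> vecs V (res_rank F h)" for p u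
        using that[THEN vecs_carrier] by (rule mult_mat_vec_smult[OF Tc, symmetric])
      show ?thesis unfolding N z using vecs_mult_mat[OF T] by (auto simp: a s)
    qed
    then show "0\<^sub>v ?b \<in> N" "N \<subseteq> vecs V ?b" "\<And>x y. x \<in> N \<Longrightarrow> y \<in> N \<Longrightarrow> x + y \<in> N"
      "\<And>p x. p \<in> polys V \<Longrightarrow> x \<in> N \<Longrightarrow> p \<cdot>\<^sub>v x \<in> N" by blast+
  qed
  have Nc: "x \<in> carrier_vec ?b" if "x \<in> N" for x using that N_sub vecs_carrier by blast
  have N_diff: "x - y \<in> N" if "x \<in> N" "y \<in> N" for x y
  proof -
    have "x - y = x + (-1) \<cdot>\<^sub>v y" using that[THEN Nc] by (intro eq_vecI) auto
    then show ?thesis using that by (simp add: N_add N_smult polys_uminus)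
  qed
  \<comment> \<open>One explicit description of the coset of \<open>u\<close> that serves for the
    cocycle module \<open>M\<close> and for the ambient free module.\<close>
  define q where "q u = (\<lambda>h. h + u) ` N" for u
  have coset: "N +>\<^bsub>M\<^esub> u = q u" "N +>\<^bsub>res_module V F c\<^esub> u = q u" for u
    by (auto simp: a_r_coset_def r_coset_def q_def M_def)
  have q_eq: "q (h + u) = q u" if "h \<in> N" "u \<in> carrier_vec ?b" for h u
  proof -
    have "h' + (h + u) = (h' + h) + u" if "h' \<in> N" for h'
      using Nc[OF that] Nc[OF \<open>h \<in> N\<close>] \<open>u \<in> carrier_vec ?b\<close> by simp
    moreover have "h' + u = (h' - h) + (h + u)" if "h' \<in> N" for h'
      using Nc[OF that] Nc[OF \<open>h \<in> N\<close>] \<open>u \<in> carrier_vec ?b\<close> by (intro eq_vecI) auto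
    ultimately have "x \<in> q (h + u) \<longleftrightarrow> x \<in> q u" for x
      unfolding q_def image_iff using N_add[OF _ that(1)] N_diff[OF _ that(1)] by metis
    then show ?thesis by blast
  qed
  have q_zero: "q (0\<^sub>v ?b) = N"
  proof -
    have "h + 0\<^sub>v ?b = h" if "h \<in> N" for h using Nc[OF that] by simp
    then show ?thesis unfolding q_def by (simp cong: image_cong)
  qed
  have q_add: "set_add M (q u) (q v) = q (u + v)" if uv: "u \<in> carrier_vec ?b" "v \<in> carrier_vec ?b" for u v
  proof -
    have "(h + u) + (h' + v) = (h + h') + (u + v)" if "h \<in> N" "h' \<in> N" for h h'
      using that[THEN Nc] uv by (intro eq_vecI) auto
    moreover have "h + (u + v) = (h + u) + (0\<^sub>v ?b + v)" if "h \<in> N" for h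
      using that[THEN Nc] uv by (intro eq_vecI) auto
    ultimately have "(\<exists>y\<in>q u. \<exists>z\<in>q v. x = y + z) \<longleftrightarrow> x \<in> q (u + v)" for x
      unfolding q_def bex_simps image_iff using N_add N_zero by metis
    then show ?thesis
      unfolding set_add_def set_mult_def M_def by auto
  qed
  have q_smult: "(\<Union>x\<in>q u. q (p \<cdot>\<^sub>v x)) = q (p \<cdot>\<^sub>v u)" if "p \<in> polys V" "u \<in> carrier_vec ?b" for p u
  proof -
    have "q (p \<cdot>\<^sub>v (h + u)) = q (p \<cdot>\<^sub>v u)" if "h \<in> N" for h
      using q_eq[OF N_smult[OF \<open>p \<in> polys V\<close> that], of "p \<cdot>\<^sub>v u"] Nc[OF that] \<open>u \<in> carrier_vec ?b\<close>
      by (simp add: smult_add_distrib_vec)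
    then show ?thesis using N_zero by (auto simp: q_def)
  qed
  have E: "ext_module V F c = factor_module M N" by (simp add: ext_module_def M_def N_def)
  have carr: "carrier (factor_module M N) = q ` vecs V ?b"
  proof -
    have "a_rcosets\<^bsub>M\<^esub> N = (\<Union>u\<in>carrier M. {N +>\<^bsub>M\<^esub> u})"
      by (simp add: A_RCOSETS_def RCOSETS_def a_r_coset_def)
    also have "\<dots> = q ` vecs V ?b" unfolding coset by (auto simp: M_def coc)
    finally show ?thesis by (simp add: factor_module_def)
  qed
  have X: "ext_component V F c (int (card V) - D) = {q u | u. u \<in> vecs V ?b \<and>
      (\<forall>j<?b. homogeneous (res_degree F c j - D) (u $ j))}"
    unfolding ext_component_def coc N_def[symmetric] coset by (simp add: algebra_simps)
  show ?thesis
    unfolding generates_module_def E X carr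
  proof (intro conjI allI impI)
    show "{q u |u. u \<in> vecs V ?b \<and> (\<forall>j<?b. homogeneous (res_degree F c j - D) (u $ j))} \<subseteq> q ` vecs V ?b"
      by blast
    fix H assume H: "submodule H (mpoly_ring V) (factor_module M N) \<and>
      {q u |u. u \<in> vecs V ?b \<and> (\<forall>j<?b. homogeneous (res_degree F c j - D) (u $ j))} \<subseteq> H"
    then interpret submodule H "mpoly_ring V" "factor_module M N" by simp
    have Hsub: "H \<subseteq> q ` vecs V ?b" using subset carr by simp
    have H0: "N \<in> H" using one_closed by (simp add: factor_module_def)
    have Hadd: "set_add M x y \<in> H" if "x \<in> H" "y \<in> H" for x y
      using m_closed[OF that] by (simp add: factor_module_def)
    have Hsm: "q (p \<cdot>\<^sub>v u) \<in> H" if "p \<in> polys V" "q u \<in> H" "u \<in> vecs V ?b" for p u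
    proof -
      have "p \<odot>\<^bsub>factor_module M N\<^esub> q u \<in> H" using that Hsub carr by (intro smult_closed) auto
      also have "p \<odot>\<^bsub>factor_module M N\<^esub> q u = (\<Union>x\<in>q u. q (p \<cdot>\<^sub>v x))"
        by (simp add: factor_module_def coset) (simp add: M_def)
      finally show ?thesis using q_smult[OF that(1) vecs_carrier[OF that(3)]] by simp
    qed
    \<comment> \<open>The set on the right is the preimage of \<open>H\<close> in the free
      module.\<close>
    have "vecs V ?b \<subseteq> {u \<in> vecs V ?b. q u \<in> H}"
    proof (rule gen)
      show "0\<^sub>v ?b \<in> {u \<in> vecs V ?b. q u \<in> H}" using H0 q_zero by simp
      show "coboundaries V F c \<subseteq> {u \<in> vecs V ?b. q u \<in> H}"
      proof
        fix h assume "h \<in> coboundaries V F c"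
        then have h: "h \<in> N" by (simp add: N_def)
        have "q h = N" using q_eq[OF h zero_carrier_vec] Nc[OF h] q_zero by simp
        then show "h \<in> {u \<in> vecs V ?b. q u \<in> H}" using h N_sub H0 by auto
      qed
      show "x + y \<in> {u \<in> vecs V ?b. q u \<in> H}"
        if "x \<in> {u \<in> vecs V ?b. q u \<in> H}" "y \<in> {u \<in> vecs V ?b. q u \<in> H}" for x y
      proof -
        have xy: "x \<in> vecs V ?b" "y \<in> vecs V ?b" "q x \<in> H" "q y \<in> H" using that by auto
        have "q (x + y) \<in> H" using Hadd[OF xy(3,4)] unfolding q_add[OF xy(1,2)[THEN vecs_carrier]] .
        then show ?thesis using xy(1,2) by auto
      qed
      show "p \<cdot>\<^sub>v x \<in> {u \<in> vecs V ?b. q u \<in> H}"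
        if "p \<in> polys V" "x \<in> {u \<in> vecs V ?b. q u \<in> H}" for p x
        using that Hsm[of p x] by auto
      show "unit_vec ?b j \<in> {u \<in> vecs V ?b. q u \<in> H}" if "j < ?b" "res_degree F c j = D" for j
      proof -
        have "homogeneous (res_degree F c i - D) (unit_vec ?b j $ i)" if "i < ?b" for i
          using that \<open>j < ?b\<close> \<open>res_degree F c j = D\<close> by (auto simp: unit_vec_def)
        then have "q (unit_vec ?b j) \<in> H" using H by blast
        then show ?thesis by simp
      qed
    qed blast
    then show "H = q ` vecs V ?b" using Hsub by blast
  qed
qed

section \<open>Carrying resolutions through a linear change of coordinates\<close>

section \<open>Transport along a graded automorphism\<close>

definition map_resolution :: "('a \<Rightarrow> 'a) \<Rightarrow> 'a resolution \<Rightarrow> 'a resolution" where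
  "map_resolution h F = \<lparr>res_rank = res_rank F, res_degree = res_degree F,
     res_aug = map_vec h (res_aug F), res_diff = (\<lambda>i. map_mat h (res_diff F i))\<rparr>"

lemma map_resolution_simps [simp]:
  "res_rank (map_resolution h F) = res_rank F" "res_degree (map_resolution h F) = res_degree F"
  "res_aug (map_resolution h F) = map_vec h (res_aug F)"
  "res_diff (map_resolution h F) i = map_mat h (res_diff F i)"
  by (simp_all add: map_resolution_def)

interpretation psubst: comm_ring_hom "psubst f"
  by unfold_locales simp_all

lemma map_vec_psubst_smult: "map_vec (psubst f) (p \<cdot>\<^sub>v u) = psubst f p \<cdot>\<^sub>v map_vec (psubst f) u"
  by (intro eq_vecI) auto

lemma map_vec_psubst_add:
  "dim_vec u = dim_vec v \<Longrightarrow> map_vec (psubst f) (u + v) = map_vec (psubst f) u + map_vec (psubst f) v"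
  by (intro eq_vecI) auto

lemma map_vec_psubst_unit: "map_vec (psubst f) (unit_vec b j) = unit_vec b j"
  by (intro eq_vecI) (auto simp: unit_vec_def)

locale linear_automorphism =
  fixes V :: "'v set" and f g :: "'v \<Rightarrow> ('v, 'k::field) mpoly"
  assumes f: "\<And>v. v \<in> V \<Longrightarrow> f v \<in> polys V" "\<And>v. v \<in> V \<Longrightarrow> homogeneous 1 (f v)"
    and g: "\<And>v. v \<in> V \<Longrightarrow> g v \<in> polys V" "\<And>v. v \<in> V \<Longrightarrow> homogeneous 1 (g v)"
    and gf: "\<And>v. v \<in> V \<Longrightarrow> psubst g (f v) = Var v"
    and fg: "\<And>v. v \<in> V \<Longrightarrow> psubst f (g v) = Var v"
begin

abbreviation "\<tau> \<equiv> psubst f"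
abbreviation "\<sigma> \<equiv> psubst g"

lemma \<tau>_polys: "p \<in> polys V \<Longrightarrow> \<tau> p \<in> polys V" and \<sigma>_polys: "p \<in> polys V \<Longrightarrow> \<sigma> p \<in> polys V"
  by (auto intro: psubst_polys f g)

lemma \<sigma>_\<tau>: "p \<in> polys V \<Longrightarrow> \<sigma> (\<tau> p) = p" and \<tau>_\<sigma>: "p \<in> polys V \<Longrightarrow> \<tau> (\<sigma> p) = p"
  by (auto intro: psubst_psubst_id gf fg)

lemma \<tau>_homogeneous: "p \<in> polys V \<Longrightarrow> homogeneous d p \<Longrightarrow> homogeneous d (\<tau> p)"
  and \<sigma>_homogeneous: "p \<in> polys V \<Longrightarrow> homogeneous d p \<Longrightarrow> homogeneous d (\<sigma> p)"
  by (auto intro: psubst_homogeneous f g)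

lemma \<tau>_vecs: "u \<in> vecs V b \<Longrightarrow> map_vec \<tau> u \<in> vecs V b" and \<sigma>_vecs: "u \<in> vecs V b \<Longrightarrow> map_vec \<sigma> u \<in> vecs V b"
  by (auto simp: vecs_def \<tau>_polys \<sigma>_polys)

lemma \<tau>_mats: "A \<in> mats V r c \<Longrightarrow> map_mat \<tau> A \<in> mats V r c"
  by (auto simp: mats_def \<tau>_polys)

lemma \<tau>_\<sigma>_vec: "u \<in> vecs V b \<Longrightarrow> map_vec \<tau> (map_vec \<sigma> u) = u"
  by (intro eq_vecI) (auto simp: vecs_def \<tau>_\<sigma>)

lemma \<sigma>_\<tau>_vec: "u \<in> vecs V b \<Longrightarrow> map_vec \<sigma> (map_vec \<tau> u) = u"
  by (intro eq_vecI) (auto simp: vecs_def \<sigma>_\<tau>)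

lemma map_vec_\<tau>_eq_iff: "u \<in> vecs V b \<Longrightarrow> v \<in> vecs V b \<Longrightarrow> map_vec \<tau> u = map_vec \<tau> v \<longleftrightarrow> u = v"
  using \<sigma>_\<tau>_vec by metis

lemma \<tau>_mult_mat_vec:
  "A \<in> mats V r c \<Longrightarrow> u \<in> vecs V c \<Longrightarrow> map_vec \<tau> (A *\<^sub>v u) = map_mat \<tau> A *\<^sub>v map_vec \<tau> u"
  by (rule psubst.mult_mat_vec_hom[OF mats_carrier vecs_carrier])

lemma Collect_\<tau>_vec: "{u \<in> vecs V b. P u} = map_vec \<tau> ` {u \<in> vecs V b. P (map_vec \<tau> u)}"
proof (intro equalityI subsetI)
  fix u assume "u \<in> {u \<in> vecs V b. P u}"
  then have "u = map_vec \<tau> (map_vec \<sigma> u)" "map_vec \<sigma> u \<in> {u \<in> vecs V b. P (map_vec \<tau> u)}"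
    by (auto simp add: \<tau>_\<sigma>_vec \<sigma>_vecs)
  then show "u \<in> map_vec \<tau> ` {u \<in> vecs V b. P (map_vec \<tau> u)}" by blast
qed (auto simp: \<tau>_vecs)

lemma image_\<tau>_mult:
  assumes "A \<in> mats V r c"
  shows "(\<lambda>w. map_mat \<tau> A *\<^sub>v w) ` vecs V c = map_vec \<tau> ` ((\<lambda>w. A *\<^sub>v w) ` vecs V c)"
proof -
  have E: "vecs V c = map_vec \<tau> ` vecs V c" using Collect_\<tau>_vec[of c "\<lambda>_. True"] by simp
  have "(\<lambda>w. map_mat \<tau> A *\<^sub>v w) ` vecs V c = (\<lambda>w. map_mat \<tau> A *\<^sub>v map_vec \<tau> w) ` vecs V c"
    using arg_cong[OF E, of "\<lambda>S. (\<lambda>w. map_mat \<tau> A *\<^sub>v w) ` S"] by (simp only: image_image)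
  also have "\<dots> = map_vec \<tau> ` ((\<lambda>w. A *\<^sub>v w) ` vecs V c)"
    unfolding image_image by (intro image_cong refl \<tau>_mult_mat_vec[OF assms, symmetric])
  finally show ?thesis .
qed

text \<open>Applying \<tau> entrywise is a degree-preserving bijection on vectors that respects
  matrix products, so kernels and images correspond. It is semilinear over \<open>S\<close>, so the
  resolved ideal changes from \<open>J'\<close> to \<open>J\<close>.\<close>

lemma graded_free_resolution_map:
  assumes F: "graded_free_resolution V J' F" and J: "J \<subseteq> polys V"
    and JJ': "\<And>p. p \<in> polys V \<Longrightarrow> p \<in> J' \<longleftrightarrow> \<tau> p \<in> J"
  shows "graded_free_resolution V J (map_resolution \<tau> F)"
proof -
  note F' = F[unfolded graded_free_resolution_def carrier_free_module carrier_mpoly_ring]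
  have aug: "res_aug F \<in> vecs V (res_rank F 0)" by (rule F'[THEN conjunct1])
  have augh: "\<And>j. j < res_rank F 0 \<Longrightarrow> homogeneous (res_degree F 0 j) (res_aug F $ j)"
    using F'[THEN conjunct2, THEN conjunct1] by blast
  note diff = F'[THEN conjunct2, THEN conjunct2, THEN conjunct1]
  have D: "res_diff F i \<in> mats V (res_rank F i) (res_rank F (Suc i))" for i
    using diff unfolding mats_def by blast
  have Dh: "homogeneous (res_degree F (Suc i) k - res_degree F i j) (res_diff F i $$ (j, k))"
    if "j < res_rank F i" "k < res_rank F (Suc i)" for i j k using diff that by blast
  have surj: "\<exists>u \<in> vecs V (res_rank F 0). p - res_aug F \<bullet> u \<in> J'" if "p \<in> polys V" for p
    using F'[THEN conjunct2, THEN conjunct2, THEN conjunct2, THEN conjunct1] that by blast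
  have ker: "{u \<in> vecs V (res_rank F 0). res_aug F \<bullet> u \<in> J'}
       = (\<lambda>w. res_diff F 0 *\<^sub>v w) ` vecs V (res_rank F 1)"
    by (rule F'[THEN conjunct2, THEN conjunct2, THEN conjunct2, THEN conjunct2, THEN conjunct1])
  have ex: "{u \<in> vecs V (res_rank F (Suc i)). res_diff F i *\<^sub>v u = 0\<^sub>v (res_rank F i)}
       = (\<lambda>w. res_diff F (Suc i) *\<^sub>v w) ` vecs V (res_rank F (Suc (Suc i)))" for i
    by (rule F'[THEN conjunct2, THEN conjunct2, THEN conjunct2, THEN conjunct2, THEN conjunct2, THEN spec])
  have sp: "map_vec \<tau> (res_aug F) \<bullet> map_vec \<tau> u = \<tau> (res_aug F \<bullet> u)" if "u \<in> vecs V (res_rank F 0)" for u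
    using vecs_carrier[OF aug] vecs_carrier[OF that] by (simp add: scalar_prod_def)
  have spp: "res_aug F \<bullet> u \<in> polys V" if "u \<in> vecs V (res_rank F 0)" for u
    using aug that by (auto simp: scalar_prod_def vecs_def)
  have surj2: "\<exists>u \<in> vecs V (res_rank F 0). p - map_vec \<tau> (res_aug F) \<bullet> u \<in> J" if p: "p \<in> polys V" for p
  proof -
    obtain u where u: "u \<in> vecs V (res_rank F 0)" "\<sigma> p - res_aug F \<bullet> u \<in> J'" using surj[OF \<sigma>_polys[OF p]] by blast
    then have "\<tau> (\<sigma> p - res_aug F \<bullet> u) \<in> J" using JJ'[of "\<sigma> p - res_aug F \<bullet> u"] \<sigma>_polys[OF p] spp[OF u(1)] by blast
    then have "p - map_vec \<tau> (res_aug F) \<bullet> map_vec \<tau> u \<in> J" using \<tau>_\<sigma>[OF p] sp[OF u(1)] by simp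
    then show ?thesis using \<tau>_vecs[OF u(1)] by blast
  qed
  have ker2: "{u \<in> vecs V (res_rank F 0). map_vec \<tau> (res_aug F) \<bullet> u \<in> J}
       = (\<lambda>w. map_mat \<tau> (res_diff F 0) *\<^sub>v w) ` vecs V (res_rank F 1)"
  proof -
    have "{u \<in> vecs V (res_rank F 0). map_vec \<tau> (res_aug F) \<bullet> u \<in> J} =
        map_vec \<tau> ` {u \<in> vecs V (res_rank F 0). res_aug F \<bullet> u \<in> J'}"
      unfolding Collect_\<tau>_vec[of _ "\<lambda>u. map_vec \<tau> (res_aug F) \<bullet> u \<in> J"]
      by (intro arg_cong[of _ _ "(`) _"] Collect_cong conj_cong refl) (simp add: sp JJ' spp)
    then show ?thesis unfolding ker using image_\<tau>_mult[OF D[of 0]] by simp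
  qed
  have ex2: "{u \<in> vecs V (res_rank F (Suc i)). map_mat \<tau> (res_diff F i) *\<^sub>v u = 0\<^sub>v (res_rank F i)}
       = (\<lambda>w. map_mat \<tau> (res_diff F (Suc i)) *\<^sub>v w) ` vecs V (res_rank F (Suc (Suc i)))" for i
  proof -
    have z: "map_mat \<tau> (res_diff F i) *\<^sub>v map_vec \<tau> u = 0\<^sub>v (res_rank F i) \<longleftrightarrow> res_diff F i *\<^sub>v u = 0\<^sub>v (res_rank F i)"
      if "u \<in> vecs V (res_rank F (Suc i))" for u
      unfolding \<tau>_mult_mat_vec[OF D that, symmetric] psubst.vec_hom_zero[symmetric]
      using map_vec_\<tau>_eq_iff[OF vecs_mult_mat[OF D that] vecs_zero] by (simp only: psubst.vec_hom_zero)
    have "{u \<in> vecs V (res_rank F (Suc i)). map_mat \<tau> (res_diff F i) *\<^sub>v u = 0\<^sub>v (res_rank F i)} =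
        map_vec \<tau> ` {u \<in> vecs V (res_rank F (Suc i)). res_diff F i *\<^sub>v u = 0\<^sub>v (res_rank F i)}"
      unfolding Collect_\<tau>_vec[of _ "\<lambda>u. map_mat \<tau> (res_diff F i) *\<^sub>v u = 0\<^sub>v (res_rank F i)"]
      by (intro arg_cong[of _ _ "(`) _"] Collect_cong conj_cong refl) (simp only: z)
    then show ?thesis unfolding ex using image_\<tau>_mult[OF D[of "Suc i"]] by simp
  qed
  have c: "map_mat \<tau> (res_diff F i) \<in> carrier_mat (res_rank F i) (res_rank F (Suc i))" for i
    using mats_carrier[OF D] by simp
  have e: "map_mat \<tau> (res_diff F i) $$ (j, k) = \<tau> (res_diff F i $$ (j, k))" "res_diff F i $$ (j, k) \<in> polys V"
    if "j < res_rank F i" "k < res_rank F (Suc i)" for i j k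
    using D[of i] that by (auto simp: mats_def)
  show ?thesis
    unfolding graded_free_resolution_def carrier_free_module carrier_mpoly_ring map_resolution_simps
  proof (intro conjI allI impI ballI)
    show "map_vec \<tau> (res_aug F) \<in> vecs V (res_rank F 0)" by (rule \<tau>_vecs[OF aug])
    show "homogeneous (res_degree F 0 j) (map_vec \<tau> (res_aug F) $ j)" if "j < res_rank F 0" for j
      using augh[OF that] vecs_nth[OF aug that] vecs_carrier[OF aug] that by (simp add: \<tau>_homogeneous)
  qed (use c e Dh surj2 ker2 ex2 \<tau>_polys \<tau>_homogeneous in auto)
qed

end

text \<open>The last module of the resolution has its basis in the degrees
  \<open>dg j + length zs\<close>, so the dual basis elements with \<open>dg j = K\<close> fill a
  single degree of Ext. A submodule containing them and the coboundaries is pulled back along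
  \<tau>, and \<open>dual_generated\<close> shows that it is everything.\<close>

lemma (in free_basis) ext_generated:
  assumes "linear_automorphism V f g"
    and dg_le: "\<And>j. j < b \<Longrightarrow> dg j \<le> K"
    and r: "wf r"
    and pairing: "\<And>j. j < b \<Longrightarrow> \<exists>p \<phi>. pairs_with K r j p \<phi>"
  shows "\<exists>e. generates_module (mpoly_ring V) (ext_module V (map_resolution (psubst f) resln) (card (V - V0)))
     (ext_component V (map_resolution (psubst f) resln) (card (V - V0)) e)"
proof -
  interpret linear_automorphism V f g by fact
  let ?F = "map_resolution \<tau> resln" and ?c = "length zs"
  have D: "kz_diff b Y ?c i \<in> mats V (kz_rank b ?c i) (kz_rank b ?c (Suc i))" for i
    by (rule kz_diff_mats[OF Y_mats_V])
  have "generates_module (mpoly_ring V) (ext_module V ?F ?c) (ext_component V ?F ?c (int (card V) - (K + int ?c)))"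
  proof (rule generates_ext_module)
    show "res_diff ?F i \<in> mats V (res_rank ?F i) (res_rank ?F (Suc i))" for i
      using \<tau>_mats[OF D[of i]] by (simp add: resln_def)
    show "res_rank ?F (Suc ?c) = 0" by (simp add: resln_def kz_rank_beyond)
    have rk: "res_rank resln ?c = b" by (simp add: resln_def)
    fix H assume H0: "0\<^sub>v (res_rank ?F ?c) \<in> H" and Hs: "H \<subseteq> vecs V (res_rank ?F ?c)"
      and Ha: "\<And>x y. x \<in> H \<Longrightarrow> y \<in> H \<Longrightarrow> x + y \<in> H"
      and Hm: "\<And>p x. p \<in> polys V \<Longrightarrow> x \<in> H \<Longrightarrow> p \<cdot>\<^sub>v x \<in> H"
      and Hc: "coboundaries V ?F ?c \<subseteq> H"
      and Ht: "\<And>j. j < res_rank ?F ?c \<Longrightarrow> res_degree ?F ?c j = K + int ?c \<Longrightarrow> unit_vec (res_rank ?F ?c) j \<in> H"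
    define H' where "H' = {u \<in> vecs V b. map_vec \<tau> u \<in> H}"
    have "unit_vec b j \<in> H'" if "j < b" for j
    proof (rule dual_generated[OF _ _ _ _ _ _ dg_le r pairing that])
      show "0\<^sub>v b \<in> H'" using H0 by (simp add: H'_def rk psubst.vec_hom_zero)
      show "H' \<subseteq> vecs V b" by (auto simp: H'_def)
      show "x + y \<in> H'" if "x \<in> H'" "y \<in> H'" for x y
      proof -
        have xy: "x \<in> vecs V b" "y \<in> vecs V b" "map_vec \<tau> x \<in> H" "map_vec \<tau> y \<in> H"
          using that by (auto simp: H'_def)
        have "dim_vec x = dim_vec y" using xy(1,2)[THEN vecs_carrier, THEN carrier_vecD] by simp
        then have "map_vec \<tau> (x + y) \<in> H" using Ha[OF xy(3,4)] map_vec_psubst_add[of x y f] by simp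
        then show ?thesis using xy(1,2) by (auto simp: H'_def)
      qed
      show "p \<cdot>\<^sub>v x \<in> H'" if "p \<in> polys V" "x \<in> H'" for p x
        using that Hm \<tau>_polys by (auto simp: H'_def map_vec_psubst_smult)
      show "unit_vec b j \<in> H'" if "j < b" "dg j = K" for j
        using Ht[of j] that by (simp add: H'_def rk map_vec_psubst_unit resln_def kz_deg_top)
      show "transpose_mat (Y l) *\<^sub>v unit_vec b j \<in> H'" if l: "l < ?c" "j < b" for l j
      proof -
        obtain h w where h: "?c = Suc h" "w \<in> vecs V (kz_rank b ?c h)"
          "transpose_mat (kz_diff b Y ?c h) *\<^sub>v w = transpose_mat (Y l) *\<^sub>v unit_vec b j"
          using kz_cobounds[of ?c Y V b l "unit_vec b j"] Y_mats_V l(1) by auto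
        have Dt: "transpose_mat (kz_diff b Y ?c h) \<in> mats V b (kz_rank b ?c h)" using D[of h] h(1) by (auto simp del: kz_diff.simps)
        have "map_vec \<tau> (transpose_mat (kz_diff b Y ?c h) *\<^sub>v w) =
           map_mat \<tau> (transpose_mat (kz_diff b Y ?c h)) *\<^sub>v map_vec \<tau> w"
          by (rule \<tau>_mult_mat_vec[OF Dt h(2)])
        also have "map_mat \<tau> (transpose_mat (kz_diff b Y ?c h)) = transpose_mat (map_mat \<tau> (kz_diff b Y ?c h))"
          by (intro eq_matI) auto
        also have "\<dots> *\<^sub>v map_vec \<tau> w \<in> coboundaries V ?F ?c"
          using \<tau>_vecs[OF h(2)] h(1) by (auto simp: coboundaries_def resln_def simp del: kz_diff.simps kz_rank.simps)
        finally have "map_vec \<tau> (transpose_mat (Y l) *\<^sub>v unit_vec b j) \<in> H" using Hc h(3) by auto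
        moreover have "transpose_mat (Y l) *\<^sub>v unit_vec b j \<in> vecs V b"
          using Y_mats_V[OF l(1)] by auto
        ultimately show ?thesis by (simp add: H'_def)
      qed
    qed
    then have u: "unit_vec b j \<in> H" if "j < b" for j using that by (simp add: H'_def map_vec_psubst_unit)
    show "vecs V (res_rank ?F ?c) \<subseteq> H"
    proof
      fix u :: "('v, 'k) mpoly vec" assume "u \<in> vecs V (res_rank ?F ?c)"
      then have v: "u \<in> vecs V b" by (simp add: rk)
      show "u \<in> H"
        using H0 Ha Hm u vecs_nth[OF v] by (intro vecs_unit_closed[OF v]) (auto simp: rk)
    qed
  qed
  then show ?thesis unfolding length_zs by blast
qed

section \<open>Depth is bounded by dimension\<close>

section \<open>Depth and dimension\<close>

text \<open>An ideal that is maximal among those containing \<open>I\<close> and disjoint from the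
  multiplicative set \<open>M\<close> is prime; Zorn's lemma provides one.\<close>

lemma (in cring) exists_prime_avoiding:
  assumes I: "ideal I R" and M: "M \<subseteq> carrier R" "\<one> \<in> M" "\<And>a b. a \<in> M \<Longrightarrow> b \<in> M \<Longrightarrow> a \<otimes> b \<in> M"
    and disj: "I \<inter> M = {}"
  shows "\<exists>P. primeideal P R \<and> I \<subseteq> P \<and> P \<inter> M = {}"
proof -
  define A where "A = {K. ideal K R \<and> I \<subseteq> K \<and> K \<inter> M = {}}"
  have "\<exists>P\<in>A. \<forall>X\<in>A. P \<subseteq> X \<longrightarrow> X = P"
  proof (rule subset_Zorn_nonempty)
    show "A \<noteq> {}" using I disj by (auto simp: A_def)
    fix C assume C: "C \<noteq> {}" "subset.chain A C"
    then have CA: "C \<subseteq> A" by (simp add: subset.chain_def)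
    have "subset.chain {I. ideal I R} C" using C(2) by (auto simp: subset.chain_def A_def)
    from chain_Union_is_ideal[OF this] have "ideal (\<Union>C) R" using C(1) by simp
    moreover have "I \<subseteq> \<Union>C" using C(1) CA by (fastforce simp: A_def)
    moreover have "\<Union>C \<inter> M = {}" using CA by (auto simp: A_def)
    ultimately show "\<Union>C \<in> A" by (simp add: A_def)
  qed
  then obtain P where P: "P \<in> A" and max: "\<And>X. X \<in> A \<Longrightarrow> P \<subseteq> X \<Longrightarrow> X = P" by blast
  have Pi: "ideal P R" and IP: "I \<subseteq> P" and PM: "P \<inter> M = {}" using P by (auto simp: A_def)
  interpret P: ideal P R by fact
  have meet: "\<exists>p\<in>P. \<exists>r\<in>carrier R. p \<oplus> r \<otimes> a \<in> M" if a: "a \<in> carrier R" "a \<notin> P" for a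
  proof -
    have X: "ideal (P <+> PIdl a) R" by (rule add_ideals[OF Pi cgenideal_ideal[OF a(1)]])
    have PX: "P \<subseteq> P <+> PIdl a"
    proof
      fix p assume p: "p \<in> P"
      have "\<zero> \<in> PIdl a" using additive_subgroup.zero_closed[OF ideal.axioms(1)[OF cgenideal_ideal[OF a(1)]]] .
      moreover have "p = p \<oplus> \<zero>" using p P.Icarr by simp
      ultimately show "p \<in> P <+> PIdl a" using p unfolding set_add_def' by blast
    qed
    have "a \<in> P <+> PIdl a"
    proof -
      have "a = \<zero> \<oplus> a" using a(1) by simp
      then show ?thesis unfolding set_add_def' using P.zero_closed cgenideal_self[OF a(1)] by blast
    qed
    then have "P <+> PIdl a \<notin> A" using max[OF _ PX] a(2) by blast
    then have "(P <+> PIdl a) \<inter> M \<noteq> {}" using X PX IP by (auto simp: A_def)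
    then show ?thesis unfolding set_add_def' cgenideal_def by blast
  qed
  have "primeideal P R"
  proof (rule primeidealI[OF Pi is_cring])
    show "carrier R \<noteq> P" using PM M(2) by blast
    fix a b assume ab: "a \<in> carrier R" "b \<in> carrier R" "a \<otimes> b \<in> P"
    show "a \<in> P \<or> b \<in> P"
    proof (rule ccontr)
      assume "\<not> (a \<in> P \<or> b \<in> P)"
      then have "a \<notin> P" "b \<notin> P" by blast+
      obtain p r where *: "p \<in> P" "r \<in> carrier R" "p \<oplus> r \<otimes> a \<in> M"
        using meet[OF ab(1) \<open>a \<notin> P\<close>] by blast
      obtain q s where **: "q \<in> P" "s \<in> carrier R" "q \<oplus> s \<otimes> b \<in> M"
        using meet[OF ab(2) \<open>b \<notin> P\<close>] by blast
      have c: "p \<in> carrier R" "q \<in> carrier R" using *(1) **(1) P.Icarr by auto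
      \<comment> \<open>A product of two elements of \<open>M\<close> would lie in \<open>P\<close>,
        which is disjoint from \<open>M\<close>.\<close>
      have "(p \<oplus> r \<otimes> a) \<otimes> (q \<oplus> s \<otimes> b) =
          p \<otimes> (q \<oplus> s \<otimes> b) \<oplus> ((r \<otimes> a) \<otimes> q \<oplus> (r \<otimes> s) \<otimes> (a \<otimes> b))"
        using c *(2) **(2) ab(1,2) by (simp add: l_distr r_distr m_ac a_ac)
      also have "\<dots> \<in> P"
      proof -
        have "p \<otimes> (q \<oplus> s \<otimes> b) \<in> P" using c(2) **(2) ab(2) by (intro P.I_r_closed[OF *(1)]) simp
        moreover have "(r \<otimes> a) \<otimes> q \<in> P" using *(2) ab(1) by (intro P.I_l_closed[OF **(1)]) simp
        moreover have "(r \<otimes> s) \<otimes> (a \<otimes> b) \<in> P" using *(2) **(2) by (intro P.I_l_closed[OF ab(3)]) simp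
        ultimately show ?thesis by (intro P.a_closed)
      qed
      finally show False using M(3)[OF *(3) **(3)] PM by blast
    qed
  qed
  then show ?thesis using IP PM by blast
qed

text \<open>Avoid the products \<open>x ^ i * s\<close> with \<open>s\<close> outside
  \<open>q\<close>. Regularity of \<open>x\<close> modulo \<open>I\<close> keeps them out of
  \<open>I\<close>. The case \<open>i = 0\<close> puts the new prime inside \<open>q\<close>, and
  \<open>s = 1\<close> keeps \<open>x\<close> out of it, so the inclusion is strict.\<close>

lemma (in cring) exists_smaller_prime:
  assumes q: "primeideal q R" and I: "ideal I R" "I \<subseteq> q" and x: "x \<in> q"
    and reg: "\<And>a. a \<in> carrier R \<Longrightarrow> x \<otimes> a \<in> I \<Longrightarrow> a \<in> I"
  shows "\<exists>p. primeideal p R \<and> I \<subseteq> p \<and> p \<subset> q"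
proof -
  interpret q: primeideal q R by fact
  have xc: "x \<in> carrier R" using x q.Icarr by blast
  define M where "M = {x [^] (i::nat) \<otimes> s | i s. s \<in> carrier R \<and> s \<notin> q}"
  have one: "\<one> \<notin> q" using q.one_imp_carrier q.I_notcarr by blast
  have "\<exists>p. primeideal p R \<and> I \<subseteq> p \<and> p \<inter> M = {}"
  proof (rule exists_prime_avoiding[OF I(1)])
    show "M \<subseteq> carrier R" using xc by (auto simp: M_def)
    show "\<one> \<in> M" unfolding M_def using one xc by (auto intro!: exI[of _ "0::nat"] exI[of _ \<one>])
    show "a \<otimes> b \<in> M" if ab: "a \<in> M" "b \<in> M" for a b
    proof -
      obtain i s j t where *: "a = x [^] (i::nat) \<otimes> s" "s \<in> carrier R" "s \<notin> q"
        "b = x [^] (j::nat) \<otimes> t" "t \<in> carrier R" "t \<notin> q" using ab by (auto simp: M_def)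
      have pc: "x [^] i \<in> carrier R" "x [^] j \<in> carrier R" using xc by auto
      have "a \<otimes> b = (x [^] i \<otimes> x [^] j) \<otimes> (s \<otimes> t)" unfolding *(1,4) using pc *(2,5) by (simp add: m_ac)
      also have "x [^] i \<otimes> x [^] j = x [^] (i + j)" using xc by (rule nat_pow_mult)
      finally show ?thesis using * q.I_prime[of s t] unfolding M_def by blast
    qed
    have "s \<in> I" if "x [^] (i::nat) \<otimes> s \<in> I" "s \<in> carrier R" for i s
      using that
    proof (induction i)
      case (Suc i)
      have "x [^] Suc i \<otimes> s = x \<otimes> (x [^] i \<otimes> s)" using xc Suc.prems(2) by (simp add: m_ac)
      then have "x [^] i \<otimes> s \<in> I" using Suc.prems reg[of "x [^] i \<otimes> s"] xc by simp
      then show ?case using Suc by blast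
    qed simp
    then show "I \<inter> M = {}" using I(2) by (auto simp: M_def)
  qed
  then obtain p where p: "primeideal p R" "I \<subseteq> p" "p \<inter> M = {}" by blast
  interpret p: primeideal p R by fact
  have "a \<in> q" if "a \<in> p" for a
  proof (rule ccontr)
    assume "a \<notin> q"
    then have "x [^] (0::nat) \<otimes> a \<in> M" using that p.Icarr unfolding M_def by blast
    then show False using p(3) that p.Icarr by auto
  qed
  moreover have "x \<notin> p"
  proof -
    have "x [^] (1::nat) \<otimes> \<one> \<in> M" using one unfolding M_def by blast
    then show ?thesis using p(3) xc by auto
  qed
  ultimately show ?thesis using p x by blast
qed

text \<open>The chain is built downwards from a prime containing the whole sequence;
  \<open>exists_smaller_prime\<close> drops one element of the sequence at each step.\<close>

lemma (in cring) regular_sequence_prime_chain: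
  assumes "regular_sequence R xs"
  shows "\<exists>p. (\<forall>i\<le>length xs. primeideal (p i) R) \<and> (\<forall>i<length xs. p i \<subset> p (Suc i))"
proof -
  have xs: "set xs \<subseteq> carrier R" "Idl (set xs) \<noteq> carrier R"
    and reg: "\<And>i a. i < length xs \<Longrightarrow> a \<in> carrier R \<Longrightarrow> xs ! i \<otimes> a \<in> Idl (set (take i xs)) \<Longrightarrow> a \<in> Idl (set (take i xs))"
    using assms unfolding regular_sequence_def by blast+
  have tc: "set (take i xs) \<subseteq> carrier R" for i using set_take_subset[of i xs] xs(1) by (rule subset_trans)
  \<comment> \<open>After \<open>j\<close> steps the chain is known at the last \<open>j + 1\<close>
    indices.\<close>
  have "\<exists>p. (\<forall>i. length xs - j \<le> i \<and> i \<le> length xs \<longrightarrow> primeideal (p i) R \<and> Idl (set (take i xs)) \<subseteq> p i) \<and>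
      (\<forall>i. length xs - j \<le> i \<and> i < length xs \<longrightarrow> p i \<subset> p (Suc i))" if "j \<le> length xs" for j
    using that
  proof (induction j)
    case 0
    have "\<one> \<notin> Idl (set xs)" using ideal.one_imp_carrier[OF genideal_ideal[OF xs(1)]] xs(2) by blast
    then obtain P where "primeideal P R" "Idl (set xs) \<subseteq> P"
      using exists_prime_avoiding[OF genideal_ideal[OF xs(1)], of "{\<one>}"] by auto
    then show ?case by (intro exI[of _ "\<lambda>_. P"]) auto
  next
    case (Suc j)
    have j: "j \<le> length xs" using Suc.prems by simp
    obtain p where p0: "\<forall>i. length xs - j \<le> i \<and> i \<le> length xs \<longrightarrow> primeideal (p i) R \<and> Idl (set (take i xs)) \<subseteq> p i"
      "\<forall>i. length xs - j \<le> i \<and> i < length xs \<longrightarrow> p i \<subset> p (Suc i)"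
      using Suc.IH[OF j] by (elim exE conjE)
    have p: "\<And>i. length xs - j \<le> i \<Longrightarrow> i \<le> length xs \<Longrightarrow> primeideal (p i) R \<and> Idl (set (take i xs)) \<subseteq> p i"
      "\<And>i. length xs - j \<le> i \<Longrightarrow> i < length xs \<Longrightarrow> p i \<subset> p (Suc i)" using p0 by simp_all
    define i where "i = length xs - Suc j"
    have i: "i < length xs" "Suc i = length xs - j" using Suc.prems by (auto simp: i_def)
    have pi: "primeideal (p (Suc i)) R" "Idl (set (take (Suc i) xs)) \<subseteq> p (Suc i)" using p(1)[of "Suc i"] i by auto
    have "set (take i xs) \<subseteq> set (take (Suc i) xs)" by (simp add: set_take_subset_set_take)
    then have 1: "Idl (set (take i xs)) \<subseteq> p (Suc i)" using subset_Idl_subset[OF tc] pi(2) by blast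
    have "xs ! i \<in> set (take (Suc i) xs)" using i(1) by (simp add: take_Suc_conv_app_nth)
    then have 2: "xs ! i \<in> p (Suc i)" using genideal_self[OF tc] pi(2) by blast
    obtain q where q: "primeideal q R" "Idl (set (take i xs)) \<subseteq> q" "q \<subset> p (Suc i)"
      using exists_smaller_prime[OF pi(1) genideal_ideal[OF tc] 1 2 reg[OF i(1)]] by blast
    have eq: "length xs - Suc j \<le> k \<longleftrightarrow> k = i \<or> length xs - j \<le> k" for k using i by (auto simp: i_def)
    show ?case
    proof (intro exI[of _ "p(i := q)"] conjI allI impI)
      fix k assume k: "length xs - Suc j \<le> k \<and> k \<le> length xs"
      show "primeideal ((p(i := q)) k) R" "Idl (set (take k xs)) \<subseteq> (p(i := q)) k"
        using k q p(1)[of k] eq[of k] by auto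
    next
      fix k assume k: "length xs - Suc j \<le> k \<and> k < length xs"
      show "(p(i := q)) k \<subset> (p(i := q)) (Suc k)"
      proof (cases "k = i")
        case True then show ?thesis using q(3) by simp
      next
        case False
        then have "length xs - j \<le> k" "Suc k \<noteq> i" using k eq[of k] i by auto
        then show ?thesis using False p(2)[of k] k by simp
      qed
    qed
  qed
  from this[of "length xs"] show ?thesis by auto
qed

lemma (in cring) ideal_depth_le_krull_dim: "ideal_depth R M \<le> krull_dim R"
  unfolding ideal_depth_def
proof (rule Sup_least)
  fix d assume "d \<in> {enat (length xs) | xs. regular_sequence R xs \<and> set xs \<subseteq> M}"
  then obtain xs where "d = enat (length xs)" "regular_sequence R xs" by blast
  then show "d \<le> krull_dim R"
    unfolding krull_dim_def using regular_sequence_prime_chain by (intro Sup_upper) blast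
qed

section \<open>Dimension is bounded by the number of parameters\<close>

lemma exists_linear_dependence:
  fixes f :: "'x \<Rightarrow> 'y \<Rightarrow> 'k::field"
  assumes "finite Y" "finite X" "card Y < card X"
  shows "\<exists>c. (\<exists>x\<in>X. c x \<noteq> 0) \<and> (\<forall>y\<in>Y. (\<Sum>x\<in>X. c x * f x y) = 0)"
  using assms
proof (induction Y arbitrary: X f rule: finite_induct)
  case empty
  then obtain x where "x \<in> X" by fastforce
  then show ?case by (intro exI[of _ "\<lambda>_. 1"]) auto
next
  case (insert y Y)
  show ?case
  proof (cases "\<forall>x\<in>X. f x y = 0")
    case True
    obtain c where "\<exists>x\<in>X. c x \<noteq> 0" "\<forall>z\<in>Y. (\<Sum>x\<in>X. c x * f x z) = 0"
      using insert.IH[of X f] insert.prems insert.hyps by auto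
    then show ?thesis using True by (intro exI[of _ c]) auto
  next
    case False
    then obtain x0 where x0: "x0 \<in> X" "f x0 y \<noteq> 0" by blast
    \<comment> \<open>Gaussian elimination of the equation \<open>y\<close> with pivot
      \<open>f x0 y\<close>.\<close>
    define f' where "f' x z = f x z - f x y / f x0 y * f x0 z" for x z
    have "card Y < card (X - {x0})" using insert.prems insert.hyps x0(1) by simp
    then obtain c where c: "\<exists>x\<in>X - {x0}. c x \<noteq> 0" "\<And>z. z \<in> Y \<Longrightarrow> (\<Sum>x\<in>X - {x0}. c x * f' x z) = 0"
      using insert.IH[of "X - {x0}" f'] insert.prems by auto
    define s where "s = (\<Sum>x\<in>X - {x0}. c x * f x y) / f x0 y"
    define c' where "c' = c(x0 := - s)"
    have sum: "(\<Sum>x\<in>X. c' x * f x z) = (\<Sum>x\<in>X - {x0}. c x * f x z) - s * f x0 z" for z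
    proof -
      have "(\<Sum>x\<in>X. c' x * f x z) = c' x0 * f x0 z + (\<Sum>x\<in>X - {x0}. c' x * f x z)"
        using insert.prems(1) x0(1) by (rule sum.remove)
      also have "(\<Sum>x\<in>X - {x0}. c' x * f x z) = (\<Sum>x\<in>X - {x0}. c x * f x z)"
        by (intro sum.cong) (auto simp: c'_def)
      finally show ?thesis by (simp add: c'_def)
    qed
    have "(\<Sum>x\<in>X. c' x * f x z) = 0" if "z \<in> insert y Y" for z
    proof (cases "z = y")
      case True then show ?thesis unfolding sum s_def using x0(2) by simp
    next
      case False
      then have "(\<Sum>x\<in>X - {x0}. c x * f' x z) = 0" using c(2) that by simp
      also have "(\<Sum>x\<in>X - {x0}. c x * f' x z) = (\<Sum>x\<in>X - {x0}. c x * f x z) - s * f x0 z"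
        by (simp add: f'_def s_def right_diff_distrib sum_subtractf sum_distrib_right sum_divide_distrib mult.assoc)
      finally show ?thesis by (simp add: sum)
    qed
    moreover have "\<exists>x\<in>X. c' x \<noteq> 0" using c(1) by (auto simp: c'_def)
    ultimately show ?thesis by blast
  qed
qed

fun mon :: "'a::comm_ring_1 list \<Rightarrow> nat list \<Rightarrow> 'a" where
  "mon (x # xs) (a # as) = x ^ a * mon xs as"
| "mon _ _ = 1"

definition exps :: "nat \<Rightarrow> nat \<Rightarrow> nat list set" where
  "exps n M = {\<alpha>. length \<alpha> = n \<and> set \<alpha> \<subseteq> {..<M}}"

lemma exps_Suc: "exps (Suc n) M = (\<lambda>(a, \<alpha>). a # \<alpha>) ` ({..<M} \<times> exps n M)"
  by (auto simp: exps_def length_Suc_conv image_iff)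

lemma finite_exps [simp]: "finite (exps n M)" and card_exps: "card (exps n M) = M ^ n"
  using finite_lists_length_eq[of "{..<M}" n] card_lists_length_eq[of "{..<M}" n]
  by (simp_all add: exps_def conj_commute)

lemma mon_polys: "set xs \<subseteq> polys V \<Longrightarrow> mon xs \<alpha> \<in> polys V"
  by (induction xs \<alpha> rule: mon.induct) (auto intro: polys_power)

text \<open>Along a strict chain of primes, choosing an element of each difference yields algebraically
  independent elements modulo the smallest prime.\<close>

lemma chain_independent:
  fixes Q :: "nat \<Rightarrow> ('v, 'k::field) mpoly set"
  assumes "\<And>i p q. i \<le> length xs \<Longrightarrow> p \<in> Q i \<Longrightarrow> q \<in> Q i \<Longrightarrow> p - q \<in> Q i"
    and "\<And>i p q. i \<le> length xs \<Longrightarrow> p \<in> polys V \<Longrightarrow> q \<in> Q i \<Longrightarrow> p * q \<in> Q i"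
    and "\<And>i p q. i \<le> length xs \<Longrightarrow> p \<in> polys V \<Longrightarrow> q \<in> polys V \<Longrightarrow> p * q \<in> Q i \<Longrightarrow> p \<in> Q i \<or> q \<in> Q i"
    and "\<And>i. i \<le> length xs \<Longrightarrow> 1 \<notin> Q i"
    and "\<And>i. i < length xs \<Longrightarrow> Q i \<subseteq> Q (Suc i) \<and> xs ! i \<in> Q (Suc i) \<and> xs ! i \<notin> Q i \<and> xs ! i \<in> polys V"
    and "(\<Sum>\<alpha>\<in>exps (length xs) M. single 0 (c \<alpha>) * mon xs \<alpha>) \<in> Q 0"
    and "\<alpha> \<in> exps (length xs) M"
  shows "c \<alpha> = 0"
  using assms
proof (induction xs arbitrary: Q c \<alpha>)
  case Nil
  have e: "exps 0 M = {[]}" by (auto simp: exps_def)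
  have "single 0 (c []) \<in> Q 0" using Nil.prems(6) by (simp add: e)
  show ?case
  proof (rule ccontr)
    assume "c \<alpha> \<noteq> 0"
    then have "c [] \<noteq> 0" using Nil.prems(7) by (simp add: e)
    have "single 0 (1 / c []) * single 0 (c []) \<in> Q 0"
      using Nil.prems(2)[of 0 "single 0 (1 / c [])" "single 0 (c [])"] \<open>single 0 (c []) \<in> Q 0\<close> by simp
    then have "1 \<in> Q 0" using \<open>c [] \<noteq> 0\<close> by (simp add: const_mult_const)
    then show False using Nil.prems(4)[of 0] by simp
  qed
next
  case (Cons x xs)
  note diff = Cons.prems(1) and mult = Cons.prems(2) and prime = Cons.prems(3) and chain = Cons.prems(5)
  have x: "Q 0 \<subseteq> Q 1" "x \<in> Q 1" "x \<notin> Q 0" "x \<in> polys V" using chain[of 0] by auto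
  have xs: "set xs \<subseteq> polys V"
  proof
    fix y assume "y \<in> set xs"
    then obtain i where "i < length xs" "y = xs ! i" by (auto simp: in_set_conv_nth)
    then show "y \<in> polys V" using chain[of "Suc i"] by auto
  qed
  \<comment> \<open>The sum is read as a polynomial in \<open>x\<close>; \<open>g a\<close> is the
    coefficient of its \<open>a\<close>-th power.\<close>
  define g where "g a = (\<Sum>\<alpha>\<in>exps (length xs) M. single 0 (c (a # \<alpha>)) * mon xs \<alpha>)" for a
  have gV: "g a \<in> polys V" for a unfolding g_def using mon_polys[OF xs] by (intro polys_sum) auto
  have IH: "c (a # \<alpha>) = 0" if "g a \<in> Q 1" "\<alpha> \<in> exps (length xs) M" for a \<alpha>
  proof (rule Cons.IH[of "\<lambda>i. Q (Suc i)" "\<lambda>\<alpha>. c (a # \<alpha>)"])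
    show "(\<Sum>\<alpha>\<in>exps (length xs) M. single 0 (c (a # \<alpha>)) * mon xs \<alpha>) \<in> Q (Suc 0)"
      using that(1) by (simp add: g_def)
    show "p - q \<in> Q (Suc i)" if "i \<le> length xs" "p \<in> Q (Suc i)" "q \<in> Q (Suc i)" for i p q
      using diff[of "Suc i"] that by simp
    show "p * q \<in> Q (Suc i)" if "i \<le> length xs" "p \<in> polys V" "q \<in> Q (Suc i)" for i p q
      using mult[of "Suc i"] that by simp
    show "p \<in> Q (Suc i) \<or> q \<in> Q (Suc i)" if "i \<le> length xs" "p \<in> polys V" "q \<in> polys V" "p * q \<in> Q (Suc i)" for i p q
      using prime[of "Suc i"] that by simp
    show "1 \<notin> Q (Suc i)" if "i \<le> length xs" for i using Cons.prems(4)[of "Suc i"] that by simp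
    show "Q (Suc i) \<subseteq> Q (Suc (Suc i)) \<and> xs ! i \<in> Q (Suc (Suc i)) \<and> xs ! i \<notin> Q (Suc i) \<and> xs ! i \<in> polys V"
      if "i < length xs" for i using chain[of "Suc i"] that by simp
  qed (use that in simp)
  \<comment> \<open>What is left of the polynomial in \<open>x\<close> after dropping the lowest
    \<open>n\<close> terms and dividing by the \<open>n\<close>-th power of \<open>x\<close>. If it
    lies in \<open>Q 0\<close>, then \<open>g n\<close> lies in \<open>Q 1\<close> and vanishes by
    induction, and the prime \<open>Q 0\<close> allows one more division by
    \<open>x\<close>.\<close>
  define T where "T n = (\<Sum>a=n..<M. x ^ (a - n) * g a)" for n
  have TV: "T n \<in> polys V" for n unfolding T_def using x(4) gV by (intro polys_sum) (auto intro: polys_power)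
  have T: "T n = g n + x * T (Suc n)" if "n < M" for n
  proof -
    have "T n = g n + (\<Sum>a=Suc n..<M. x ^ (a - n) * g a)"
      unfolding T_def using that by (simp add: sum.atLeast_Suc_lessThan)
    also have "(\<Sum>a=Suc n..<M. x ^ (a - n) * g a) = x * T (Suc n)"
      unfolding T_def sum_distrib_left
      by (intro sum.cong) (auto simp: Suc_diff_Suc simp flip: mult.assoc power_Suc)
    finally show ?thesis .
  qed
  have g1: "g n \<in> Q 1" if "n < M" "T n \<in> Q 0" for n
  proof -
    have "T (Suc n) * x \<in> Q 1" using mult[of 1 "T (Suc n)" x] TV x(2) by simp
    moreover have "T n \<in> Q 1" using that(2) x(1) by blast
    ultimately have "T n - T (Suc n) * x \<in> Q 1" using diff[of 1] by simp
    then show ?thesis using T[OF that(1)] by (simp add: mult.commute)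
  qed
  have g0: "g n = 0" if "n < M" "T n \<in> Q 0" for n
    unfolding g_def by (intro sum.neutral ballI) (simp add: IH[OF g1[OF that]])
  have T0: "T n \<in> Q 0" if "n \<le> M" for n
    using that
  proof (induction n)
    case 0
    have "(\<Sum>\<alpha>\<in>exps (length (x # xs)) M. single 0 (c \<alpha>) * mon (x # xs) \<alpha>) =
        (\<Sum>(a, \<alpha>)\<in>{..<M} \<times> exps (length xs) M. single 0 (c (a # \<alpha>)) * mon (x # xs) (a # \<alpha>))"
      unfolding length_Cons exps_Suc by (subst sum.reindex) (auto simp: inj_on_def intro!: sum.cong)
    also have "\<dots> = (\<Sum>a<M. \<Sum>\<alpha>\<in>exps (length xs) M. single 0 (c (a # \<alpha>)) * mon (x # xs) (a # \<alpha>))"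
      by (rule sum.cartesian_product[symmetric])
    also have "\<dots> = T 0"
      unfolding T_def g_def by (intro sum.cong) (auto simp: sum_distrib_left ac_simps atLeast0LessThan)
    finally show ?case using Cons.prems(6) by simp
  next
    case (Suc n)
    then have n: "n < M" "T n \<in> Q 0" by auto
    have "x * T (Suc n) \<in> Q 0" using T[OF n(1)] g0[OF n] n(2) by simp
    then show ?case using prime[of 0 x "T (Suc n)"] x(3,4) TV by auto
  qed
  obtain a \<beta> where \<alpha>: "\<alpha> = a # \<beta>" "a < M" "\<beta> \<in> exps (length xs) M"
    using Cons.prems(7) by (auto simp: exps_Suc)
  show ?case unfolding \<alpha>(1) using \<alpha> T0[of a] by (intro IH g1) auto
qed

definition deg_le :: "nat \<Rightarrow> ('v, 'k::field) mpoly \<Rightarrow> bool" where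
  "deg_le s p \<longleftrightarrow> (\<forall>m\<in>keys p. monomial_degree m \<le> s)"

lemma deg_le_one: "deg_le s 1"
  by (simp add: deg_le_def)

lemma deg_le_mult: "deg_le s p \<Longrightarrow> deg_le t q \<Longrightarrow> deg_le (s + t) (p * q)"
  unfolding deg_le_def by (auto elim!: keys_multE intro!: add_mono)

lemma deg_le_mono: "deg_le s p \<Longrightarrow> s \<le> t \<Longrightarrow> deg_le t p"
  unfolding deg_le_def by (meson le_trans)

lemma deg_le_power: "deg_le s p \<Longrightarrow> deg_le (i * s) (p ^ i)"
  by (induction i) (auto simp: deg_le_one intro: deg_le_mult)

lemma deg_le_mon:
  "\<forall>x\<in>set xs. deg_le s x \<Longrightarrow> set \<alpha> \<subseteq> {..<M} \<Longrightarrow> deg_le (length xs * (M * s)) (mon xs \<alpha>)"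
proof (induction xs \<alpha> rule: mon.induct)
  case (1 x xs a as)
  have "deg_le (a * s) (x ^ a)" using 1(2) by (intro deg_le_power) simp
  then have "deg_le (M * s) (x ^ a)" using 1(3) by (elim deg_le_mono) (simp add: mult_right_mono)
  then have "deg_le (M * s + length xs * (M * s)) (mon (x # xs) (a # as))"
    using 1 by (auto intro: deg_le_mult)
  then show ?case by simp
qed (auto simp: deg_le_one)

lemma exists_deg_le: "finite X \<Longrightarrow> \<exists>s. \<forall>p\<in>X. deg_le s p"
proof (induction X rule: finite_induct)
  case (insert p X)
  then obtain s where s: "\<forall>p\<in>X. deg_le s p" by blast
  define t where "t = (\<Sum>m\<in>keys p. monomial_degree m)"
  have "deg_le t p" unfolding deg_le_def t_def by (auto intro: member_le_sum)
  then have "\<forall>q\<in>insert p X. deg_le (s + t) q" using s by (auto elim!: deg_le_mono)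
  then show ?case by blast
qed simp

lemma bounded_exponents:
  fixes U :: "'v set"
  assumes "finite U"
  shows "finite {e :: 'v \<Rightarrow>\<^sub>0 nat. keys e \<subseteq> U \<and> (\<forall>v\<in>U. lookup e v \<le> s)}"
    "card {e :: 'v \<Rightarrow>\<^sub>0 nat. keys e \<subseteq> U \<and> (\<forall>v\<in>U. lookup e v \<le> s)} \<le> (s + 1) ^ card U"
proof -
  let ?E = "{e :: 'v \<Rightarrow>\<^sub>0 nat. keys e \<subseteq> U \<and> (\<forall>v\<in>U. lookup e v \<le> s)}"
  let ?r = "\<lambda>e. restrict (lookup e) U"
  have inj: "inj_on ?r ?E"
  proof (rule inj_onI, rule poly_mapping_eqI)
    fix e e' v assume *: "e \<in> ?E" "e' \<in> ?E" "?r e = ?r e'"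
    show "lookup e v = lookup e' v"
    proof (cases "v \<in> U")
      case True then show ?thesis using fun_cong[OF *(3), of v] by simp
    next
      case False
      then have "v \<notin> keys e" "v \<notin> keys e'" using * by auto
      then show ?thesis by (simp add: in_keys_iff)
    qed
  qed
  have sub: "?r ` ?E \<subseteq> (\<Pi>\<^sub>E v\<in>U. {..s})" by auto
  have fin: "finite (\<Pi>\<^sub>E v\<in>U. {..s})" using assms by (intro finite_PiE) auto
  show "finite ?E" using finite_subset[OF sub fin] inj by (rule finite_imageD)
  have "card ?E = card (?r ` ?E)" using inj by (simp add: card_image)
  also have "\<dots> \<le> card (\<Pi>\<^sub>E v\<in>U. {..s})" by (rule card_mono[OF fin sub])
  also have "\<dots> = (s + 1) ^ card U" using assms by (simp add: card_PiE)
  finally show "card ?E \<le> (s + 1) ^ card U" .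
qed

lemma cring_mpoly_ring: "cring (mpoly_ring V :: ('v, 'k::field) mpoly ring)"
proof (rule cringI)
  show "abelian_group (mpoly_ring V :: ('v, 'k) mpoly ring)"
  proof (rule abelian_groupI)
    fix x :: "('v, 'k) mpoly" assume "x \<in> carrier (mpoly_ring V)"
    then show "\<exists>y\<in>carrier (mpoly_ring V). y \<oplus>\<^bsub>mpoly_ring V\<^esub> x = \<zero>\<^bsub>mpoly_ring V\<^esub>"
      by (intro bexI[of _ "- x"]) auto
  qed (auto simp: add.assoc add.commute)
  show "comm_monoid (mpoly_ring V :: ('v, 'k) mpoly ring)"
    by (rule comm_monoidI) (auto simp: mult.assoc mult.commute)
qed (auto simp: distrib_right)

context free_basis
begin

text \<open>As the basis elements have nonnegative degree, the coordinates of a monomial have at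
  most its degree.\<close>

lemma span_bounded:
  assumes dg0: "\<And>j. j < b \<Longrightarrow> 0 \<le> dg j" and p: "p \<in> polys V" "deg_le s p"
  shows "\<exists>u\<in>vecs V0 b. p - lin u \<in> J \<and> (\<forall>j<b. deg_le s (u $ j))"
proof -
  have "\<exists>a. (\<forall>j<b. a j \<in> polys V0 \<and> deg_le s (a j)) \<and> single m (lookup p m) - (\<Sum>j<b. a j * mb j) \<in> J"
    if m: "m \<in> keys p" for m
  proof -
    have "single m (lookup p m) \<in> polys V" using p(1) m by (intro polys_single) (auto simp: polys_def)
    from span[OF this homogeneous_single[OF refl]] obtain a where
      a: "\<forall>j<b. a j \<in> polys V0 \<and> homogeneous (int (monomial_degree m) - dg j) (a j)"
        "single m (lookup p m) - (\<Sum>j<b. a j * mb j) \<in> J" by blast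
    have "deg_le s (a j)" if "j < b" for j
      unfolding deg_le_def
    proof
      fix e assume "e \<in> keys (a j)"
      then have "int (monomial_degree e) = int (monomial_degree m) - dg j" using a(1) that by (auto simp: homogeneous_def)
      then show "monomial_degree e \<le> s" using dg0[OF that] p(2) m unfolding deg_le_def by fastforce
    qed
    then show ?thesis using a by blast
  qed
  then have "\<forall>m\<in>keys p. \<exists>a. (\<forall>j<b. a j \<in> polys V0 \<and> deg_le s (a j)) \<and>
      single m (lookup p m) - (\<Sum>j<b. a j * mb j) \<in> J" by blast
  from bchoice[OF this] obtain a where a0: "\<forall>m\<in>keys p. (\<forall>j<b. a m j \<in> polys V0 \<and> deg_le s (a m j)) \<and>
      single m (lookup p m) - (\<Sum>j<b. a m j * mb j) \<in> J" by blast
  have a: "\<And>m j. m \<in> keys p \<Longrightarrow> j < b \<Longrightarrow> a m j \<in> polys V0 \<and> deg_le s (a m j)"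
    "\<And>m. m \<in> keys p \<Longrightarrow> single m (lookup p m) - (\<Sum>j<b. a m j * mb j) \<in> J" using a0 by simp_all
  define u where "u = vec b (\<lambda>j. \<Sum>m\<in>keys p. a m j)"
  have "u \<in> vecs V0 b" using a(1) by (auto simp: u_def vecs_def intro!: polys_sum)
  moreover have "p - lin u \<in> J"
  proof -
    have "lin u = (\<Sum>m\<in>keys p. \<Sum>j<b. a m j * mb j)"
      by (subst sum.swap) (simp add: lin_def u_def sum_distrib_right)
    then have "p - lin u = (\<Sum>m\<in>keys p. single m (lookup p m) - (\<Sum>j<b. a m j * mb j))"
      by (simp add: sum_subtractf sum_single_keys)
    then show ?thesis using a(2) by (simp add: J_sum)
  qed
  moreover have "deg_le s (u $ j)" if "j < b" for j
    unfolding deg_le_def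
  proof
    fix e assume "e \<in> keys (u $ j)"
    then have "e \<in> keys (\<Sum>m\<in>keys p. a m j)" using that by (simp add: u_def)
    then obtain m where "m \<in> keys p" "e \<in> keys (a m j)" by (rule keys_sumE)
    then show "monomial_degree e \<le> s" using a(1) that by (auto simp: deg_le_def)
  qed
  ultimately show ?thesis by blast
qed

lemma lin_smult: "u \<in> carrier_vec b \<Longrightarrow> lin (p \<cdot>\<^sub>v u) = p * lin u"
  by (simp add: lin_def sum_distrib_left mult.assoc)

text \<open>Counting: the monomials with exponents below \<open>M\<close> number
  \<open>M ^ (card V0 + 1)\<close>, while their coordinates have degree linear in \<open>M\<close>
  and thus involve only on the order of \<open>M ^ card V0\<close> scalars.\<close>

lemma exists_dependence:
  assumes dg0: "\<And>j. j < b \<Longrightarrow> 0 \<le> dg j" and xs: "set xs \<subseteq> polys V" "length xs = Suc (card V0)"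
  shows "\<exists>M c. (\<exists>\<alpha>\<in>exps (length xs) M. c \<alpha> \<noteq> 0) \<and> (\<Sum>\<alpha>\<in>exps (length xs) M. single 0 (c \<alpha>) * mon xs \<alpha>) \<in> J"
proof -
  obtain s where s: "\<forall>x\<in>set xs. deg_le s x" using exists_deg_le[of "set xs"] by blast
  define k where "k = length xs"
  define D where "D = card V0"
  \<comment> \<open>Chosen to give \<open>b * (t + 1) ^ D < M ^ k\<close>: the estimate
    \<open>t + 1 \<le> M * (k * s + 1)\<close> leaves the factor \<open>b * (k * s + 1) ^ D\<close>,
    which is below \<open>M\<close>.\<close>
  define M where "M = b * (k * s + 1) ^ D + 1"
  define t where "t = k * (M * s)"
  have finV0: "finite V0" using finite_subset[OF V0_subset finite_V] .
  define E where "E = {e :: 'v \<Rightarrow>\<^sub>0 nat. keys e \<subseteq> V0 \<and> (\<forall>v\<in>V0. lookup e v \<le> t)}"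
  have E: "finite E" "card E \<le> (t + 1) ^ D" using bounded_exponents[OF finV0] by (simp_all add: E_def D_def)
  have "\<exists>u\<in>vecs V0 b. mon xs \<alpha> - lin u \<in> J \<and> (\<forall>j<b. deg_le t (u $ j))" if "\<alpha> \<in> exps k M" for \<alpha>
    using that unfolding t_def k_def
    by (intro span_bounded dg0 mon_polys xs deg_le_mon s) (auto simp: exps_def)
  then obtain U where U: "\<And>\<alpha>. \<alpha> \<in> exps k M \<Longrightarrow> U \<alpha> \<in> vecs V0 b"
     "\<And>\<alpha>. \<alpha> \<in> exps k M \<Longrightarrow> mon xs \<alpha> - lin (U \<alpha>) \<in> J"
     "\<And>\<alpha> j. \<alpha> \<in> exps k M \<Longrightarrow> j < b \<Longrightarrow> deg_le t (U \<alpha> $ j)" by metis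
  have "card ({..<b} \<times> E) < card (exps k M :: nat list set)"
  proof -
    have "t + 1 \<le> M * (k * s + 1)" by (simp add: t_def M_def algebra_simps)
    then have "(t + 1) ^ D \<le> M ^ D * (k * s + 1) ^ D" by (metis power_mono power_mult_distrib zero_le)
    then have "card ({..<b} \<times> E) \<le> b * (M ^ D * (k * s + 1) ^ D)"
      using E(2) by (simp add: card_cartesian_product)
    also have "\<dots> = M ^ D * (b * (k * s + 1) ^ D)" by (simp add: mult.left_commute)
    also have "\<dots> < M ^ D * M" by (simp add: M_def)
    also have "\<dots> = M ^ k" using xs(2) by (simp add: k_def D_def)
    finally show ?thesis by (simp add: card_exps)
  qed
  from exists_linear_dependence[OF _ finite_exps this, of "\<lambda>\<alpha> y. lookup (U \<alpha> $ fst y) (snd y)"]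
  obtain c where c0: "\<exists>\<alpha>\<in>exps k M. c \<alpha> \<noteq> 0"
    "\<forall>y\<in>{..<b} \<times> E. (\<Sum>\<alpha>\<in>exps k M. c \<alpha> * lookup (U \<alpha> $ fst y) (snd y)) = 0"
    using E(1) by blast
  note c = c0(1) c0(2)[rule_format]
  have zero: "(\<Sum>\<alpha>\<in>exps k M. single 0 (c \<alpha>) * U \<alpha> $ j) = 0" if j: "j < b" for j
  proof (rule poly_mapping_eqI)
    fix e
    have eq: "lookup (\<Sum>\<alpha>\<in>exps k M. single 0 (c \<alpha>) * U \<alpha> $ j) e = (\<Sum>\<alpha>\<in>exps k M. c \<alpha> * lookup (U \<alpha> $ j) e)"
      by (simp add: lookup_sum lookup_const_mult)
    show "lookup (\<Sum>\<alpha>\<in>exps k M. single 0 (c \<alpha>) * U \<alpha> $ j) e = lookup 0 e"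
    proof (cases "e \<in> E")
      case True then show ?thesis unfolding eq using c(2)[of "(j, e)"] j by simp
    next
      case False
      have "lookup (U \<alpha> $ j) e = 0" if "\<alpha> \<in> exps k M" for \<alpha>
      proof (rule ccontr)
        assume "lookup (U \<alpha> $ j) e \<noteq> 0"
        then have "e \<in> keys (U \<alpha> $ j)" by (simp add: in_keys_iff)
        then have "keys e \<subseteq> V0" "monomial_degree e \<le> t"
          using vecs_nth[OF U(1)[OF that] j] U(3)[OF that j] by (auto simp: polys_def deg_le_def)
        then have "e \<in> E" using lookup_le_monomial_degree[of e] by (auto simp: E_def intro: le_trans)
        then show False using False by simp
      qed
      then show ?thesis unfolding eq by simp
    qed
  qed
  have "(\<Sum>\<alpha>\<in>exps k M. single 0 (c \<alpha>) * lin (U \<alpha>)) = (\<Sum>j<b. (\<Sum>\<alpha>\<in>exps k M. single 0 (c \<alpha>) * U \<alpha> $ j) * mb j)"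
    by (simp add: lin_def sum_distrib_left sum_distrib_right mult.assoc) (rule sum.swap)
  then have "(\<Sum>\<alpha>\<in>exps k M. single 0 (c \<alpha>) * lin (U \<alpha>)) = 0" by (simp add: zero)
  then have "(\<Sum>\<alpha>\<in>exps k M. single 0 (c \<alpha>) * mon xs \<alpha>) =
      (\<Sum>\<alpha>\<in>exps k M. single 0 (c \<alpha>) * (mon xs \<alpha> - lin (U \<alpha>)))"
    by (simp add: right_diff_distrib sum_subtractf)
  also have "\<dots> \<in> J" using U(2) by (intro J_sum J_mult) auto
  finally show ?thesis using c(1) unfolding k_def by blast
qed

text \<open>The ring is given by a surjection \<open>h\<close> with kernel \<open>J\<close> and not
  as \<open>S / J\<close> itself: \<open>h\<close> will be a change of coordinates followed by the
  projection modulo another ideal.\<close>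

context
  fixes R :: "('r, 's) ring_scheme" and h :: "('v, 'k) mpoly \<Rightarrow> 'r"
  assumes R: "cring R" and hom: "h \<in> ring_hom (mpoly_ring V) R" and surj: "h ` polys V = carrier R"
    and ker: "\<And>p. p \<in> polys V \<Longrightarrow> h p = \<zero>\<^bsub>R\<^esub> \<longleftrightarrow> p \<in> J"
    and dg0: "\<And>j. j < b \<Longrightarrow> 0 \<le> dg j" and b0: "b > 0"
begin

interpretation R: cring R by (rule R)
interpretation S: cring "mpoly_ring V :: ('v, 'k) mpoly ring" by (rule cring_mpoly_ring)
interpretation h: ring_hom_cring "mpoly_ring V" R h
  by (intro ring_hom_cring.intro ring_hom_cring_axioms.intro hom R cring_mpoly_ring)

lemma h_add: "p \<in> polys V \<Longrightarrow> q \<in> polys V \<Longrightarrow> h (p + q) = h p \<oplus>\<^bsub>R\<^esub> h q"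
  and h_mult: "p \<in> polys V \<Longrightarrow> q \<in> polys V \<Longrightarrow> h (p * q) = h p \<otimes>\<^bsub>R\<^esub> h q"
  and h_carrier: "p \<in> polys V \<Longrightarrow> h p \<in> carrier R"
  and h_one: "h 1 = \<one>\<^bsub>R\<^esub>" and h_zero: "h 0 = \<zero>\<^bsub>R\<^esub>"
  using h.hom_add[of p q] h.hom_mult[of p q] h.hom_closed[of p] h.hom_one h.hom_zero by simp_all

lemma h_diff: "p \<in> polys V \<Longrightarrow> q \<in> polys V \<Longrightarrow> h (p - q) = h p \<ominus>\<^bsub>R\<^esub> h q"
proof -
  assume p: "p \<in> polys V" and q: "q \<in> polys V"
  have "h (p - q) \<oplus>\<^bsub>R\<^esub> h q = h p" using h_add[of "p - q" q] p q by auto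
  then show ?thesis using p q h_carrier by (metis R.add.inv_solve_right a_minus_def polys_diff)
qed

lemma h_eq_iff: "p \<in> polys V \<Longrightarrow> q \<in> polys V \<Longrightarrow> h p = h q \<longleftrightarrow> p - q \<in> J"
  using ker[of "p - q"] h_diff[of p q] h_carrier R.r_right_minus_eq by auto

text \<open>A longer chain would give \<open>card V0 + 1\<close> elements independent modulo its
  smallest prime, hence modulo \<open>J\<close>, against \<open>exists_dependence\<close>.\<close>

lemma krull_dim_le: "krull_dim R \<le> enat (card V0)"
  unfolding krull_dim_def
proof (rule Sup_least, safe)
  fix k and P :: "nat \<Rightarrow> 'r set"
  assume P: "\<forall>i\<le>k. primeideal (P i) R" "\<forall>i<k. P i \<subset> P (Suc i)"
  show "enat k \<le> enat (card V0)"
  proof (rule ccontr)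
    assume "\<not> enat k \<le> enat (card V0)"
    then have k: "Suc (card V0) \<le> k" by simp
    define Q where "Q i = {p \<in> polys V. h p \<in> P i}" for i
    have "\<exists>x. x \<in> Q (Suc i) \<and> x \<notin> Q i" if "i < k" for i
    proof -
      have "P i \<subset> P (Suc i)" using P(2) that by simp
      then obtain y where y: "y \<in> P (Suc i)" "y \<notin> P i" by (auto dest: psubset_imp_ex_mem)
      moreover have "primeideal (P (Suc i)) R" using P(1) that by simp
      ultimately have "y \<in> carrier R" using ideal.Icarr[OF primeideal.axioms(1), of "P (Suc i)" R y] by simp
      then have "y \<in> h ` polys V" unfolding surj .
      then obtain x where "x \<in> polys V" "h x = y" by blast
      then show ?thesis using y by (auto simp: Q_def)
    qed
    then obtain x where x: "\<And>i. i < k \<Longrightarrow> x i \<in> Q (Suc i) \<and> x i \<notin> Q i" by metis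
    define xs where "xs = map x [0..<Suc (card V0)]"
    have len: "length xs = Suc (card V0)" by (simp add: xs_def)
    have nth: "xs ! i = x i" if "i < length xs" for i using that by (simp add: xs_def del: upt_Suc)
    have xsV: "set xs \<subseteq> polys V" using x k by (fastforce simp: xs_def Q_def)
    obtain M c where c: "\<exists>\<alpha>\<in>exps (length xs) M. c \<alpha> \<noteq> 0"
      "(\<Sum>\<alpha>\<in>exps (length xs) M. single 0 (c \<alpha>) * mon xs \<alpha>) \<in> J"
      using exists_dependence[OF dg0 xsV len] by blast
    have pr: "primeideal (P i) R" if "i \<le> length xs" for i using P(1) that k len by simp
    have "c \<alpha> = 0" if "\<alpha> \<in> exps (length xs) M" for \<alpha>
    proof (rule chain_independent[OF _ _ _ _ _ _ that, of Q V])
      fix i assume i: "i \<le> length xs"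
      interpret P: primeideal "P i" R by (rule pr[OF i])
      show "p - q \<in> Q i" if "p \<in> Q i" "q \<in> Q i" for p q
        using that P.a_subgroup by (auto simp: Q_def h_diff intro!: additive_subgroup.a_closed R.minus_closed)
          (metis P.a_closed P.a_inv_closed a_minus_def)
      show "p * q \<in> Q i" if "p \<in> polys V" "q \<in> Q i" for p q
        using that by (auto simp: Q_def h_mult h_carrier intro: P.I_l_closed)
      show "p \<in> Q i \<or> q \<in> Q i" if "p \<in> polys V" "q \<in> polys V" "p * q \<in> Q i" for p q
        using that P.I_prime[of "h p" "h q"] by (auto simp: Q_def h_mult h_carrier)
      show "1 \<notin> Q i" using P.one_imp_carrier P.I_notcarr by (auto simp: Q_def h_one)
    next
      fix i assume i: "i < length xs"
      show "Q i \<subseteq> Q (Suc i) \<and> xs ! i \<in> Q (Suc i) \<and> xs ! i \<notin> Q i \<and> xs ! i \<in> polys V"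
      proof -
        have ik: "i < k" using i len k by simp
        then have "P i \<subset> P (Suc i)" using P(2) by simp
        then have "Q i \<subseteq> Q (Suc i)" by (auto simp: Q_def)
        then show ?thesis using x[OF ik] nth[OF i] by (simp add: Q_def)
      qed
    next
      let ?d = "\<Sum>\<alpha>\<in>exps (length xs) M. single 0 (c \<alpha>) * mon xs \<alpha>"
      have d: "?d \<in> polys V" using c(2) J_subset by blast
      have "h ?d = \<zero>\<^bsub>R\<^esub>" using ker[OF d] c(2) by blast
      moreover have "\<zero>\<^bsub>R\<^esub> \<in> P 0"
        using pr[of 0] by (intro additive_subgroup.zero_closed ideal.axioms(1) primeideal.axioms(1)) simp
      ultimately show "?d \<in> Q 0" using d unfolding Q_def by simp
    qed
    then show False using c(1) by blast
  qed
qed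

section \<open>The parameters form a regular sequence\<close>

definition meeting :: "'v set \<Rightarrow> ('v, 'k) mpoly set" where
  "meeting N = {q \<in> polys V0. \<forall>m\<in>keys q. keys m \<inter> N \<noteq> {}}"

text \<open>The ideal generated by \<open>J\<close> and the variables in \<open>N\<close>, described
  by coordinates: they have to lie in \<open>meeting N\<close>, the ideal of \<open>K[V0]\<close>
  generated by \<open>N\<close>. For \<open>N \<subseteq> V0\<close> this is confirmed by
  \<open>Idl_h_Var\<close>.\<close>

definition L :: "'v set \<Rightarrow> ('v, 'k) mpoly set" where
  "L N = {p \<in> polys V. \<exists>u\<in>vecs V0 b. p - lin u \<in> J \<and> (\<forall>j<b. u $ j \<in> meeting N)}"

lemma meeting_add: "p \<in> meeting N \<Longrightarrow> q \<in> meeting N \<Longrightarrow> p + q \<in> meeting N"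
  using keys_add[of p q] unfolding meeting_def by fast

lemma meeting_zero: "0 \<in> meeting N"
  by (simp add: meeting_def)

lemma meeting_sum: "(\<And>i. i \<in> A \<Longrightarrow> f i \<in> meeting N) \<Longrightarrow> sum f A \<in> meeting N"
  by (induction A rule: infinite_finite_induct) (auto simp: meeting_zero meeting_add)

lemma meeting_mult: "p \<in> polys V0 \<Longrightarrow> q \<in> meeting N \<Longrightarrow> p * q \<in> meeting N"
  unfolding meeting_def by (auto elim!: keys_multE simp: keys_plus_nat Int_Un_distrib2)

lemma L_zero: "0 \<in> L N"
  using J_zero meeting_zero by (auto simp: L_def lin_def intro!: bexI[of _ "0\<^sub>v b"])

lemma L_add: "p \<in> L N \<Longrightarrow> q \<in> L N \<Longrightarrow> p + q \<in> L N"
proof -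
  assume "p \<in> L N" "q \<in> L N"
  then obtain u v where *: "p \<in> polys V" "u \<in> vecs V0 b" "p - lin u \<in> J" "\<forall>j<b. u $ j \<in> meeting N"
    "q \<in> polys V" "v \<in> vecs V0 b" "q - lin v \<in> J" "\<forall>j<b. v $ j \<in> meeting N" by (auto simp: L_def)
  have "p + q - lin (u + v) = (p - lin u) + (q - lin v)" using *(2,6)[THEN vecs_carrier] by (simp add: lin_add)
  also have "\<dots> \<in> J" using *(3,7) by (rule J_add)
  finally have "p + q - lin (u + v) \<in> J" .
  moreover have "(u + v) $ j \<in> meeting N" if "j < b" for j
    using that * vecs_carrier[OF *(6)] by (simp add: meeting_add)
  ultimately show "p + q \<in> L N" using * by (auto simp: L_def)
qed

text \<open>Multiplication by \<open>q\<close> acts on coordinates through a matrix over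
  \<open>K[V0]\<close>, and such a matrix preserves the ideal \<open>meeting N\<close>.\<close>

lemma L_mult: "q \<in> polys V \<Longrightarrow> p \<in> L N \<Longrightarrow> q * p \<in> L N"
proof -
  assume q: "q \<in> polys V" and p: "p \<in> L N"
  obtain u where u: "p \<in> polys V" "u \<in> vecs V0 b" "p - lin u \<in> J" "\<And>j. j < b \<Longrightarrow> u $ j \<in> meeting N"
    using p by (auto simp: L_def)
  have "\<exists>w\<in>vecs V0 b. q * mb j - lin w \<in> J" if "j < b" for j
    using q mb_polys[OF that] by (intro span_all) auto
  then obtain w where w: "\<And>j. j < b \<Longrightarrow> w j \<in> vecs V0 b" "\<And>j. j < b \<Longrightarrow> q * mb j - lin (w j) \<in> J" by metis
  define v where "v = vec b (\<lambda>i. \<Sum>j<b. w j $ i * u $ j)"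
  have vm: "v $ i \<in> meeting N" if "i < b" for i
    using that vecs_nth[OF w(1) that] u(4) by (auto simp: v_def intro!: meeting_sum meeting_mult)
  have "lin v = (\<Sum>j<b. u $ j * lin (w j))"
    by (simp add: lin_def v_def sum_distrib_left sum_distrib_right ac_simps) (rule sum.swap)
  then have "q * p - lin v = q * (p - lin u) + (\<Sum>j<b. u $ j * (q * mb j - lin (w j)))"
    by (simp add: lin_def[of u] right_diff_distrib sum_subtractf sum_distrib_left ac_simps)
  also have "\<dots> \<in> J"
    using q u w vecs_V0[OF u(2)] by (intro J_add J_mult J_sum) (auto simp: vecs_def)
  finally have "q * p - lin v \<in> J" .
  moreover have "v \<in> vecs V0 b" using vm by (auto simp: vecs_def v_def meeting_def)
  ultimately show "q * p \<in> L N" using q u(1) vm by (auto simp: L_def)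
qed

lemma L_J: "p \<in> J \<Longrightarrow> p \<in> L N"
  using J_subset meeting_zero by (auto simp: L_def lin_def intro!: bexI[of _ "0\<^sub>v b"])

lemma L_congruent: "p - q \<in> J \<Longrightarrow> q \<in> L N \<Longrightarrow> p \<in> L N"
  using L_add[of "p - q" N q] L_J by simp

lemma Var_L:
  assumes "v \<in> N" "N \<subseteq> V0" shows "Var v \<in> L N"
proof -
  obtain w where w: "w \<in> vecs V0 b" "1 - lin w \<in> J" using span_all[of 1] by auto
  have v: "v \<in> V0" "v \<in> V" using assms V0_subset by auto
  have "Var v * (1 - lin w) \<in> J" using v w by (intro J_mult) auto
  then have "Var v - lin (Var v \<cdot>\<^sub>v w) \<in> J" using vecs_carrier[OF w(1)] by (simp add: right_diff_distrib lin_smult)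
  moreover have "Var v \<in> meeting N" using assms(1) v by (auto simp: meeting_def Var_def intro: polys_single)
  then have "(Var v \<cdot>\<^sub>v w) $ j \<in> meeting N" if "j < b" for j
    using meeting_mult[of "w $ j" "Var v" N] vecs_nth[OF w(1) that] vecs_carrier[OF w(1)] that
    by (simp add: mult.commute)
  moreover have "Var v \<cdot>\<^sub>v w \<in> vecs V0 b" using w(1) v(1) by auto
  ultimately show ?thesis using v by (auto simp: L_def)
qed

lemma ideal_h_L: "ideal (h ` L N) R"
proof (rule idealI)
  show "ring R" by (rule R.ring_axioms)
  have sub: "L N \<subseteq> polys V" by (auto simp: L_def)
  show "subgroup (h ` L N) (add_monoid R)"
  proof (rule R.add.subgroupI)
    show "h ` L N \<subseteq> carrier R" using sub h_carrier by auto
    show "h ` L N \<noteq> {}" using L_zero by blast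
    fix x assume "x \<in> h ` L N"
    then obtain p where p: "p \<in> L N" "x = h p" by blast
    have "- p \<in> L N" using L_mult[of "-1" p N] p(1) by (simp add: polys_uminus)
    moreover have "\<ominus>\<^bsub>R\<^esub> h p = h (- p)"
      using h_diff[of 0 p] p(1) sub h_zero h_carrier by (auto simp: a_minus_def)
    ultimately show "\<ominus>\<^bsub>R\<^esub> x \<in> h ` L N" using p(2) by auto
    fix y assume "y \<in> h ` L N"
    then obtain q where q: "q \<in> L N" "y = h q" by blast
    have "h (p + q) = x \<oplus>\<^bsub>R\<^esub> y" using p q sub h_add by auto
    then show "x \<oplus>\<^bsub>R\<^esub> y \<in> h ` L N" using L_add[OF p(1) q(1)] by (metis imageI)
  qed
  fix a x assume "a \<in> h ` L N" "x \<in> carrier R"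
  then obtain p q where p: "p \<in> L N" "a = h p" "q \<in> polys V" "x = h q" using surj by blast
  have "h (q * p) = x \<otimes>\<^bsub>R\<^esub> a" using p sub h_mult by auto
  then show "x \<otimes>\<^bsub>R\<^esub> a \<in> h ` L N" using L_mult[OF p(3,1)] by (metis imageI)
  moreover have "a \<otimes>\<^bsub>R\<^esub> x = x \<otimes>\<^bsub>R\<^esub> a" using p sub h_carrier by (intro R.m_comm) auto
  ultimately show "a \<otimes>\<^bsub>R\<^esub> x \<in> h ` L N" by simp
qed

lemma Idl_h_Var:
  assumes N: "N \<subseteq> V0"
  shows "Idl\<^bsub>R\<^esub> (h ` Var ` N) = h ` L N"
proof
  have gens: "h ` Var ` N \<subseteq> carrier R" using N V0_subset h_carrier by auto
  show "Idl\<^bsub>R\<^esub> (h ` Var ` N) \<subseteq> h ` L N"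
    using Var_L[OF _ N] by (intro R.genideal_minimal ideal_h_L) auto
  interpret I: ideal "Idl\<^bsub>R\<^esub> (h ` Var ` N)" R by (rule R.genideal_ideal[OF gens])
  have mono: "h (single m c * x) \<in> Idl\<^bsub>R\<^esub> (h ` Var ` N)"
    if m: "keys m \<inter> N \<noteq> {}" "keys m \<subseteq> V0" and x: "x \<in> polys V" for m c x
  proof -
    obtain v where v: "v \<in> keys m" "v \<in> N" using m by blast
    then obtain m' where m': "m = single v (1::nat) + m'" using exponent_split_var by metis
    have "keys m' \<subseteq> V" using m(2) V0_subset by (auto simp: m' keys_plus_nat)
    then have x': "single m' c * x \<in> polys V" using x by (intro polys_mult polys_single)
    have e: "single m c * x = Var v * (single m' c * x)"
      by (simp add: m' Var_def mult_single mult.assoc[symmetric])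
    have hv: "h (Var v) \<in> Idl\<^bsub>R\<^esub> (h ` Var ` N)" using R.genideal_self[OF gens] v(2) by blast
    have vV: "Var v \<in> polys V" using v(2) N V0_subset by auto
    show ?thesis unfolding e h_mult[OF vV x'] by (rule I.I_r_closed[OF hv h_carrier[OF x']])
  qed
  have sum_closed: "h (sum f A) \<in> Idl\<^bsub>R\<^esub> (h ` Var ` N)"
    if "\<And>i. i \<in> A \<Longrightarrow> f i \<in> polys V \<and> h (f i) \<in> Idl\<^bsub>R\<^esub> (h ` Var ` N)" for f :: "'i \<Rightarrow> ('v, 'k) mpoly" and A
    using that
  proof (induction A rule: infinite_finite_induct)
    case (insert i A)
    have "sum f A \<in> polys V" using insert.prems by (intro polys_sum) auto
    then have "h (sum f (insert i A)) = h (f i) \<oplus>\<^bsub>R\<^esub> h (sum f A)"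
      using insert by (simp add: h_add)
    also have "\<dots> \<in> Idl\<^bsub>R\<^esub> (h ` Var ` N)" using insert by (intro I.a_closed) auto
    finally show ?case .
  qed (auto simp: h_zero)
  show "h ` L N \<subseteq> Idl\<^bsub>R\<^esub> (h ` Var ` N)"
  proof
    fix y assume "y \<in> h ` L N"
    then obtain p u where p: "y = h p" "p \<in> polys V" "u \<in> vecs V0 b" "p - lin u \<in> J" "\<And>j. j < b \<Longrightarrow> u $ j \<in> meeting N"
      by (auto simp: L_def)
    have "u $ j * mb j \<in> polys V \<and> h (u $ j * mb j) \<in> Idl\<^bsub>R\<^esub> (h ` Var ` N)" if j: "j < b" for j
    proof
      show "u $ j * mb j \<in> polys V" using vecs_nth[OF vecs_V0[OF p(3)] j] mb_polys[OF j] by auto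
      have k: "keys m \<inter> N \<noteq> {}" "keys m \<subseteq> V0" if "m \<in> keys (u $ j)" for m
        using p(5)[OF j] that by (auto simp: meeting_def polys_def)
      have "u $ j * mb j = (\<Sum>m\<in>keys (u $ j). single m (lookup (u $ j) m) * mb j)"
        by (subst (1) sum_single_keys[of "u $ j", symmetric]) (simp add: sum_distrib_right)
      also have "h \<dots> \<in> Idl\<^bsub>R\<^esub> (h ` Var ` N)"
        using subset_trans[OF k(2) V0_subset] mono[OF k mb_polys[OF j]] mb_polys[OF j]
        by (intro sum_closed conjI polys_mult polys_single) simp_all
      finally show "h (u $ j * mb j) \<in> Idl\<^bsub>R\<^esub> (h ` Var ` N)" .
    qed
    then have "h (lin u) \<in> Idl\<^bsub>R\<^esub> (h ` Var ` N)" unfolding lin_def by (intro sum_closed) auto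
    moreover have "h p = h (lin u)" using h_eq_iff[OF p(2) lin_polys[OF vecs_V0[OF p(3)]]] p(4) by simp
    ultimately show "y \<in> Idl\<^bsub>R\<^esub> (h ` Var ` N)" using p(1) by simp
  qed
qed

text \<open>The coordinates of 1 have degree at most 0, so in \<open>meeting N\<close> they can only
  be 0. But 1 is not in \<open>J\<close>, as the basis is nonempty and independent.\<close>

lemma one_not_L: "1 \<notin> L N"
proof
  assume "1 \<in> L N"
  then obtain u where u: "u \<in> vecs V0 b" "1 - lin u \<in> J" "\<And>j. j < b \<Longrightarrow> u $ j \<in> meeting N" by (auto simp: L_def)
  obtain a where a: "\<And>j. j < b \<Longrightarrow> a j \<in> polys V0" "\<And>j. j < b \<Longrightarrow> homogeneous (0 - dg j) (a j)"
    "1 - (\<Sum>j<b. a j * mb j) \<in> J" using span[OF polys_one homogeneous_one] by blast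
  have "(\<Sum>j<b. (u $ j - a j) * mb j) \<in> J"
    using J_diff[OF a(3) u(2)] by (simp add: lin_def left_diff_distrib sum_subtractf)
  then have ua: "u $ j - a j = 0" if "j < b" for j
    using a(1) vecs_nth[OF u(1)] that by (intro indep[of "\<lambda>j. u $ j - a j"]) auto
  have "a j = 0" if j: "j < b" for j
  proof (cases "dg j = 0")
    case True
    then have "a j = single 0 (lookup (a j) 0)" using a(2)[OF j] homogeneous_degree_0 by simp
    moreover have "0 \<notin> keys (a j)" using u(3)[OF j] ua[OF j] by (auto simp: meeting_def)
    ultimately show ?thesis by (metis in_keys_iff single_zero)
  next
    case False
    then show ?thesis using a(2)[OF j] dg0[OF j] by (intro homogeneous_negative[of "0 - dg j"]) auto
  qed
  then have "1 \<in> J" using a(3) by simp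
  then have "mb 0 * 1 \<in> J" by (rule J_mult[OF mb_polys[OF b0]])
  then have "(\<Sum>j<b. (if j = 0 then 1 else 0) * mb j) \<in> J" using b0 by (simp add: if_distrib[of "\<lambda>x. x * _"] cong: if_cong)
  then have "(if 0 = (0::nat) then 1 else 0 :: ('v, 'k) mpoly) = 0"
    using b0 by (intro indep[of "\<lambda>j. if j = 0 then 1 else 0" 0]) auto
  then show False by simp
qed

text \<open>By freeness it suffices to look at coordinates: if every monomial of
  \<open>v * w\<close> contains a variable of \<open>N\<close>, and \<open>v\<close> is not in
  \<open>N\<close>, then every monomial of \<open>w\<close> does.\<close>

lemma regular_sequence_Var:
  assumes vs: "set vs = V0" "distinct vs"
  shows "regular_sequence R (map (h \<circ> Var) vs)"
  unfolding regular_sequence_def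
proof (intro conjI allI impI ballI)
  have set_take: "set (take i (map (h \<circ> Var) vs)) = h ` Var ` set (take i vs)" for i
    by (simp add: take_map image_comp)
  have sub: "set (take i vs) \<subseteq> V0" for i using vs(1) set_take_subset[of i vs] by simp
  show "set (map (h \<circ> Var) vs) \<subseteq> carrier R" using vs V0_subset h_carrier by auto
  show "Idl\<^bsub>R\<^esub> (set (map (h \<circ> Var) vs)) \<noteq> carrier R"
  proof
    assume "Idl\<^bsub>R\<^esub> (set (map (h \<circ> Var) vs)) = carrier R"
    moreover have "set (map (h \<circ> Var) vs) = h ` Var ` V0" using vs(1) by (simp add: image_comp)
    ultimately have "h ` L V0 = carrier R" using Idl_h_Var[of V0] by simp
    then have "\<one>\<^bsub>R\<^esub> \<in> h ` L V0" using R.one_closed by simp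
    then obtain p where p: "p \<in> L V0" "h p = h 1" using h_one by fastforce
    have "1 - p \<in> J" using h_eq_iff[of 1 p] p by (auto simp: L_def)
    then show False using L_congruent[OF _ p(1)] one_not_L by blast
  qed
  fix i a assume i: "i < length (map (h \<circ> Var) vs)" and a: "a \<in> carrier R"
    and mem: "map (h \<circ> Var) vs ! i \<otimes>\<^bsub>R\<^esub> a \<in> Idl\<^bsub>R\<^esub> (set (take i (map (h \<circ> Var) vs)))"
  define N where "N = set (take i vs)"
  define v where "v = vs ! i"
  have NV: "N \<subseteq> V0" using sub by (simp add: N_def)
  have v: "v \<in> V0" "v \<in> V" using i vs(1) V0_subset by (auto simp: v_def)
  have vN: "v \<notin> N" using i vs(2) by (auto simp: v_def N_def in_set_conv_nth nth_eq_iff_index_eq)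
  obtain p where p: "p \<in> polys V" "a = h p" using a surj by blast
  have "h (Var v * p) \<in> h ` L N"
    using mem i v p unfolding set_take Idl_h_Var[OF sub] by (simp add: h_mult v_def N_def)
  then obtain q where q: "q \<in> L N" "h (Var v * p) = h q" by blast
  have "Var v * p - q \<in> J" using h_eq_iff[of "Var v * p" q] q p(1) v by (auto simp: L_def)
  then have "Var v * p \<in> L N" using L_congruent q(1) by blast
  then obtain u where u: "u \<in> vecs V0 b" "Var v * p - lin u \<in> J" "\<And>j. j < b \<Longrightarrow> u $ j \<in> meeting N" by (auto simp: L_def)
  obtain w where w: "w \<in> vecs V0 b" "p - lin w \<in> J" using span_all[OF p(1)] by blast
  have "Var v * (p - lin w) \<in> J" using w v by (intro J_mult) auto
  then have "lin (u - Var v \<cdot>\<^sub>v w) \<in> J"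
    using J_diff[OF _ u(2), of "Var v * (p - lin w)"] vecs_carrier[OF u(1)] vecs_carrier[OF w(1)]
    by (simp add: lin_diff lin_smult right_diff_distrib)
  moreover have "u - Var v \<cdot>\<^sub>v w \<in> vecs V0 b" using u(1) w(1) v by auto
  ultimately have "u - Var v \<cdot>\<^sub>v w = 0\<^sub>v b" by (intro lin_indep)
  then have "u = Var v \<cdot>\<^sub>v w"
    by (rule vec_diff_eq_zeroD) (use vecs_carrier[OF u(1)] vecs_carrier[OF w(1)] in simp_all)
  then have uw: "u $ j = Var v * w $ j" if "j < b" for j using that vecs_carrier[OF w(1)] by simp
  have "w $ j \<in> meeting N" if j: "j < b" for j
  proof -
    have "keys m \<inter> N \<noteq> {}" if m: "m \<in> keys (w $ j)" for m
    proof -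
      have "lookup (u $ j) (single v 1 + m) = lookup (w $ j) m"
        unfolding uw[OF j] Var_def lookup_single_plus_mult by simp
      then have "single v 1 + m \<in> keys (u $ j)" using m by (simp add: in_keys_iff)
      then have "keys (single v (1::nat) + m) \<inter> N \<noteq> {}" using u(3)[OF j] by (auto simp: meeting_def)
      then show ?thesis using vN by (auto simp: keys_plus_nat)
    qed
    then show ?thesis using vecs_nth[OF w(1) j] by (simp add: meeting_def)
  qed
  then have "p \<in> L N" using p(1) w by (auto simp: L_def)
  then show "a \<in> Idl\<^bsub>R\<^esub> (set (take i (map (h \<circ> Var) vs)))"
    unfolding set_take Idl_h_Var[OF sub] using p(2) by (simp add: N_def)
qed

text \<open>The inequalities \<open>card V0 <= depth <= dim <= card V0\<close> close up.\<close>

lemma depth_eq_krull_dim: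
  assumes "h ` Var ` V0 \<subseteq> M"
  shows "krull_dim R = enat (card V0)" "ideal_depth R M = enat (card V0)"
proof -
  have "finite V0" using finite_subset[OF V0_subset finite_V] .
  then obtain vs where vs: "set vs = V0" "distinct vs" using finite_distinct_list by blast
  have "set (map (h \<circ> Var) vs) \<subseteq> M" using assms vs(1) by auto
  moreover have "length (map (h \<circ> Var) vs) = card V0" using vs distinct_card by fastforce
  ultimately have "enat (card V0) \<le> ideal_depth R M"
    unfolding ideal_depth_def using regular_sequence_Var[OF vs] by (intro Sup_upper CollectI) metis
  then show "krull_dim R = enat (card V0)" "ideal_depth R M = enat (card V0)"
    using R.ideal_depth_le_krull_dim[of M] krull_dim_le by (auto intro: antisym order_trans)
qed

end

end

section \<open>The ring as a quotient of a monomial subring\<close>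

section \<open>The ring of a truncated boolean lattice\<close>

definition ind :: "nat set \<Rightarrow> (nat \<Rightarrow>\<^sub>0 nat)" where
  "ind A = (\<Sum>i\<in>A. single i 1)"

lemma lookup_ind: "finite A \<Longrightarrow> lookup (ind A) i = (if i \<in> A then 1 else 0)"
  by (simp add: ind_def lookup_sum lookup_single when_def)

lemma keys_ind: "finite A \<Longrightarrow> keys (ind A) = A"
  by (auto simp: in_keys_iff lookup_ind split: if_splits)

locale truncated_boolean =
  fixes n D :: nat
  assumes n_pos: "n \<ge> 1" and D_le: "D \<le> n + 1"
begin

definition P :: "nat set set" where
  "P = {A. A \<subseteq> {1..n} \<and> card A < D}"

text \<open>The variable of \<open>A\<close> is sent to the monomial \<open>y\<^sub>0 \<Prod>\<^sub>i\<^sub>\<in>\<^sub>A y\<^sub>i\<close>; the index \<open>0\<close> records the degree.\<close>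

definition y :: "nat set \<Rightarrow> (nat, 'k::field) mpoly" where
  "y A = single (ind (insert 0 A)) 1"

abbreviation \<Phi> :: "(nat set, 'k::field) mpoly \<Rightarrow> (nat, 'k) mpoly" where
  "\<Phi> \<equiv> psubst y"

text \<open>Exponents of the monomials that are not killed. Those without \<open>y_0\<close> always
  survive, so that for \<open>D = 0\<close>, where there are no variables, the quotient is still the
  field.\<close>

definition good :: "(nat \<Rightarrow>\<^sub>0 nat) \<Rightarrow> bool" where
  "good s \<longleftrightarrow> lookup s 0 = 0 \<or> card (keys s - {0}) < D"

definition Bd :: "(nat, 'k::field) mpoly set" where
  "Bd = {q. \<forall>s\<in>keys q. \<not> good s}"

definition J :: "(nat set, 'k::field) mpoly set" where
  "J = {p \<in> polys P. \<Phi> p \<in> Bd}"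

text \<open>Satisfied by all exponents in the image of \<Phi>: an index occurs in at most as many
  sets as there are factors.\<close>

definition reg :: "(nat \<Rightarrow>\<^sub>0 nat) \<Rightarrow> bool" where
  "reg s \<longleftrightarrow> keys s \<subseteq> {0..n} \<and> (\<forall>j. lookup s j \<le> lookup s 0)"

lemma finite_P [simp]: "finite P"
  by (rule finite_subset[of _ "Pow {1..n}"]) (auto simp: P_def)

lemma P_finite: "A \<in> P \<Longrightarrow> finite A"
  by (auto simp: P_def intro: finite_subset)

lemma P_subset: "A \<in> P \<Longrightarrow> A \<subseteq> {1..n}"
  by (simp add: P_def)

lemma P_mono: "A \<in> P \<Longrightarrow> B \<subseteq> A \<Longrightarrow> B \<in> P"
proof -
  assume A: "A \<in> P" and "B \<subseteq> A"
  then have "card B \<le> card A" by (intro card_mono P_finite)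
  then show "B \<in> P" using A \<open>B \<subseteq> A\<close> by (auto simp: P_def)
qed

lemma Bd_zero: "0 \<in> Bd" and Bd_add: "p \<in> Bd \<Longrightarrow> q \<in> Bd \<Longrightarrow> p + q \<in> Bd"
  and Bd_uminus: "p \<in> Bd \<Longrightarrow> - p \<in> Bd"
  using keys_add[of p q] by (auto simp: Bd_def)

lemma Bd_sum: "(\<And>i. i \<in> A \<Longrightarrow> f i \<in> Bd) \<Longrightarrow> sum f A \<in> Bd"
  by (induction A rule: infinite_finite_induct) (auto simp: Bd_zero Bd_add)

lemma bad_plus: "\<not> good b \<Longrightarrow> \<not> good (a + b)"
proof -
  assume "\<not> good b"
  moreover have "card (keys b - {0}) \<le> card (keys a \<union> keys b - {0})" by (intro card_mono) auto
  ultimately show ?thesis by (simp add: good_def lookup_add keys_plus_nat)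
qed

lemma Bd_mult: "q \<in> Bd \<Longrightarrow> p * q \<in> Bd"
  unfolding Bd_def using bad_plus by (blast elim: keys_multE)

lemma J_zero: "0 \<in> J" and J_add: "p \<in> J \<Longrightarrow> q \<in> J \<Longrightarrow> p + q \<in> J"
  and J_mult: "r \<in> polys P \<Longrightarrow> p \<in> J \<Longrightarrow> r * p \<in> J"
  by (auto simp: J_def Bd_zero Bd_add Bd_mult)

lemma y_times_y: "y A * y B = single (ind (insert 0 A) + ind (insert 0 B)) (1 :: 'k::field)"
  by (simp add: y_def mult_single)

lemma reg_zero: "reg 0"
  by (simp add: reg_def)

lemma reg_plus: "reg s \<Longrightarrow> A \<subseteq> {1..n} \<Longrightarrow> reg (s + ind (insert 0 A))"
  using finite_subset[of A "{1..n}"]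
  by (auto simp: reg_def keys_plus_nat keys_ind lookup_add lookup_ind intro: le_SucI)

lemma keys_y_mult:
  assumes "m \<in> keys (y A * q)" obtains b where "b \<in> keys q" "m = b + ind (insert 0 A)"
  using assms by (elim keys_multE) (auto simp: y_def add.commute split: if_splits)

lemma keys_\<Phi>_reg:
  assumes "p \<in> polys P" shows "\<forall>s\<in>keys (\<Phi> p). reg s"
  using assms
proof (induction rule: polys_Var_induct)
  case (add p q)
  then show ?case using keys_add[of "\<Phi> p" "\<Phi> q"] by auto
next
  case (Var p A)
  then have "A \<subseteq> {1..n}" using P_subset by blast
  with Var show ?case using reg_plus by (auto elim!: keys_y_mult)
qed (auto simp: reg_zero)

lemma homogeneous_\<Phi>:
  assumes "p \<in> polys P" "homogeneous d p" "s \<in> keys (\<Phi> p)"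
  shows "int (lookup s 0) = d"
proof -
  have mv: "\<forall>s\<in>keys (monomial_value y m :: (nat, 'k::field) mpoly). lookup s 0 = monomial_degree m"
    if "keys m \<subseteq> P" for m
    using that
  proof (induction rule: exponent_induct)
    case (plus m A)
    then have "A \<in> P" by blast
    then have "finite (insert 0 A)" using P_finite by simp
    moreover have "monomial_value y (m + single A 1) = y A * (monomial_value y m :: (nat, 'k) mpoly)"
      by (simp add: monomial_value_plus mult.commute)
    ultimately show ?case using plus by (auto elim!: keys_y_mult simp: lookup_add lookup_ind)
  qed simp
  obtain m where m: "m \<in> keys p" "s \<in> keys (single 0 (lookup p m) * monomial_value y m)"
    using assms(3) unfolding psubst_def by (rule keys_sumE)
  then have "s \<in> keys (monomial_value y m :: (nat, 'a) mpoly)" by (auto simp: in_keys_iff lookup_const_mult)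
  then have "lookup s 0 = monomial_degree m" using mv[of m] m(1) assms(1)
    by (auto simp: polys_def in_keys_iff)
  then show ?thesis using assms(2) m(1) by (simp add: homogeneous_def)
qed

section \<open>Straightening into products along chains\<close>

subsection \<open>Straightening\<close>

lemma poset_relation_P:
  assumes "A \<in> P" "B \<in> P"
  shows "poset_relation P A B = (if card (A \<union> B) < D then Var A * Var B - Var (A \<inter> B) * Var (A \<union> B)
     else (Var A * Var B :: (nat set, 'k::field) mpoly))"
proof -
  have sub: "A \<union> B \<subseteq> {1..n}" using assms by (auto simp: P_def)
  have ub: "upper_bounds P A B = {C \<in> P. A \<union> B \<subseteq> C}" by (auto simp: upper_bounds_def)
  have meet: "poset_meet P A B = A \<inter> B"
    unfolding poset_meet_def by (rule Greatest_equality) (use P_mono[OF assms(1), of "A \<inter> B"] in auto)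
  show ?thesis
  proof (cases "card (A \<union> B) < D")
    case True
    then have "A \<union> B \<in> P" using sub by (simp add: P_def)
    then have "minimal_elements (upper_bounds P A B) = {A \<union> B}" "upper_bounds P A B \<noteq> {}"
      unfolding ub minimal_elements_def by auto
    then show ?thesis using True by (simp add: poset_relation_def meet)
  next
    case False
    have "upper_bounds P A B = {}"
    proof (rule ccontr)
      assume "upper_bounds P A B \<noteq> {}"
      then obtain C where "C \<in> P" "A \<union> B \<subseteq> C" unfolding ub by blast
      then have "A \<union> B \<in> P" by (rule P_mono)
      then show False using False by (simp add: P_def)
    qed
    then show ?thesis using False by (simp add: poset_relation_def)
  qed
qed

text \<open>\<open>A\<close> and \<open>B\<close> contain each index as often as
  \<open>A \<inter> B\<close> and \<open>A \<union> B\<close> do together. If the union is too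
  large, the image of the product is a killed monomial.\<close>

lemma poset_relation_in_J:
  assumes "A \<in> P" "B \<in> P" shows "poset_relation P A B \<in> (J :: (nat set, 'k::field) mpoly set)"
proof (cases "card (A \<union> B) < D")
  case True
  then have AB: "A \<union> B \<in> P" using assms by (auto simp: P_def)
  have AB': "A \<inter> B \<in> P" using P_mono[OF assms(1)] by auto
  have f: "finite A" "finite B" using assms P_finite by auto
  have "ind (insert 0 A) + ind (insert 0 B) = ind (insert 0 (A \<inter> B)) + ind (insert 0 (A \<union> B))"
    using f by (intro poly_mapping_eqI) (auto simp: lookup_add lookup_ind)
  then have "\<Phi> (Var A * Var B - Var (A \<inter> B) * Var (A \<union> B) :: (nat set, 'k) mpoly) = 0"
    by (simp add: y_times_y)
  then show ?thesis using True assms AB AB' by (simp add: poset_relation_P J_def Bd_zero polys_mult polys_diff)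
next
  case False
  have f: "finite A" "finite B" "0 \<notin> A" "0 \<notin> B" using assms P_finite P_subset by force+
  have "keys (ind (insert 0 A) + ind (insert 0 B)) - {0} = A \<union> B"
    using f by (auto simp: keys_plus_nat keys_ind)
  then have "\<not> good (ind (insert 0 A) + ind (insert 0 B))"
    using False f by (simp add: good_def lookup_add lookup_ind)
  then have "\<Phi> (Var A * Var B :: (nat set, 'k) mpoly) \<in> Bd" by (simp add: y_times_y Bd_def)
  then show ?thesis using False assms by (simp add: poset_relation_P J_def polys_mult)
qed

text \<open>The chain monomial with exponent \<open>s\<close>: the product of the variables of the
  level sets \<open>{i. t \<le> s i}\<close> for \<open>t = 1, ..., m\<close>. Levels above the
  maximum of \<open>s\<close> contribute the variable of the empty set.\<close>

fun chp :: "nat \<Rightarrow> (nat \<Rightarrow> nat) \<Rightarrow> (nat set, 'k::field) mpoly" where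
  "chp 0 s = 1"
| "chp (Suc m) s = Var {i\<in>{1..n}. 1 \<le> s i} * chp m (\<lambda>i. s i - 1)"

lemma chp_cong:
  "(\<And>i. i \<in> {1..n} \<Longrightarrow> s i = t i) \<Longrightarrow> chp k s = (chp k t :: (nat set, 'k::field) mpoly)"
proof (induction k arbitrary: s t)
  case (Suc k)
  have "{i\<in>{1..n}. 1 \<le> s i} = {i\<in>{1..n}. 1 \<le> t i}" using Suc.prems by auto
  moreover have "chp k (\<lambda>i. s i - 1) = (chp k (\<lambda>i. t i - 1) :: (nat set, 'k) mpoly)"
    using Suc.prems by (intro Suc.IH) auto
  ultimately show ?case by (simp only: chp.simps)
qed simp

lemma chp_polys: "card {i\<in>{1..n}. 1 \<le> s i} < D \<Longrightarrow> chp m s \<in> polys P"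
proof (induction m arbitrary: s)
  case (Suc m)
  have "card {i\<in>{1..n}. 1 \<le> s i - 1} \<le> card {i\<in>{1..n}. 1 \<le> s i}" by (intro card_mono) auto
  then show ?case using Suc by (auto intro!: polys_mult polys_Var simp: P_def)
qed simp

context
  fixes I :: "(nat set, 'k::field) mpoly set"
  assumes I_zero: "0 \<in> I" and I_add: "\<And>p q. p \<in> I \<Longrightarrow> q \<in> I \<Longrightarrow> p + q \<in> I"
    and I_mult: "\<And>p q. p \<in> polys P \<Longrightarrow> q \<in> I \<Longrightarrow> p * q \<in> I"
    and I_rel: "\<And>A B. A \<in> P \<Longrightarrow> B \<in> P \<Longrightarrow> poset_relation P A B \<in> I"
begin

text \<open>One relation merges \<open>B\<close> with the largest set \<open>A\<close> of the chain.
  The leftover \<open>A \<inter> B\<close> is inserted into the rest of the chain, which lies inside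
  \<open>A\<close>. If \<open>A \<union> B\<close> is too large, the product is already in
  \<open>I\<close>.\<close>

lemma chp_insert:
  assumes "B \<in> P" "\<And>i. i \<in> {1..n} \<Longrightarrow> s i \<le> m" "card {i\<in>{1..n}. 1 \<le> s i} < D"
  shows "if card {i\<in>{1..n}. 1 \<le> s i + (if i \<in> B then 1 else 0)} < D
    then Var B * chp m s - chp (Suc m) (\<lambda>i. s i + (if i \<in> B then 1 else 0)) \<in> I
    else Var B * chp m s \<in> I"
  using assms
proof (induction m arbitrary: B s)
  case 0
  have "{i\<in>{1..n}. 1 \<le> s i + (if i \<in> B then 1 else 0)} = B" using 0(2) P_subset[OF 0(1)] by auto
  then show ?case using 0 I_zero by (simp add: P_def)
next
  case (Suc m)
  define A where "A = {i\<in>{1..n}. 1 \<le> s i}"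
  define t where "t = (\<lambda>i. s i - 1)"
  have "A \<subseteq> {1..n}" by (auto simp: A_def)
  then have A: "A \<in> P" using Suc.prems(3) by (simp add: A_def P_def)
  have AB: "{i\<in>{1..n}. 1 \<le> s i + (if i \<in> B then 1 else 0)} = A \<union> B"
    using P_subset[OF Suc.prems(1)] by (auto simp: A_def)
  have cs: "chp (Suc m) s = Var A * chp m t" by (simp add: A_def t_def)
  have tA: "{i\<in>{1..n}. 1 \<le> t i} \<subseteq> A" by (auto simp: t_def A_def)
  then have ct: "card {i\<in>{1..n}. 1 \<le> t i} < D" using card_mono[OF P_finite[OF A] tA] A by (simp add: P_def)
  have tV: "chp m t \<in> polys P" by (rule chp_polys[OF ct])
  show ?case
  proof (cases "card (A \<union> B) < D")
    case False
    have "poset_relation P B A = (Var B * Var A :: (nat set, 'k) mpoly)"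
      using poset_relation_P[OF Suc.prems(1) A] False by (simp add: Un_commute)
    then have "Var B * Var A \<in> I" using I_rel[OF Suc.prems(1) A] by (simp only:)
    then have "chp m t * (Var B * Var A) \<in> I" by (rule I_mult[OF tV])
    then show ?thesis unfolding AB cs using False by (simp add: ac_simps)
  next
    case True
    have AB_P: "A \<union> B \<in> P" using True A Suc.prems(1) by (auto simp: P_def)
    have ABi: "A \<inter> B \<in> P" using P_mono[OF A] by auto
    have "poset_relation P B A = (Var B * Var A - Var (A \<inter> B) * Var (A \<union> B) :: (nat set, 'k) mpoly)"
      using poset_relation_P[OF Suc.prems(1) A] True by (simp add: Un_commute Int_commute)
    then have 1: "Var B * Var A - Var (A \<inter> B) * Var (A \<union> B) \<in> I"
      using I_rel[OF Suc.prems(1) A] by (simp only:)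
    \<comment> \<open>The exponent of the chain below \<open>A \<union> B\<close>;
      \<open>t'_eq\<close> recognises it as the new exponent lowered by one level.\<close>
    define t' where "t' = (\<lambda>i. t i + (if i \<in> A \<inter> B then 1 else 0))"
    have "{i\<in>{1..n}. 1 \<le> t' i} \<subseteq> A" using tA by (auto simp: t'_def)
    from card_mono[OF P_finite[OF A] this] have ct': "card {i\<in>{1..n}. 1 \<le> t' i} < D"
      using A by (simp add: P_def)
    have "t i \<le> m" if "i \<in> {1..n}" for i using Suc.prems(2)[OF that] by (simp add: t_def)
    then have 2: "Var (A \<inter> B) * chp m t - chp (Suc m) t' \<in> I"
      using Suc.IH[OF ABi _ ct] ct' unfolding t'_def by simp
    have t'_eq: "t' = (\<lambda>i. s i + (if i \<in> B then 1 else 0) - 1)"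
      by (intro ext) (use P_subset[OF Suc.prems(1)] in \<open>auto simp: t'_def t_def A_def\<close>)
    have "Var B * (Var A * chp m t) - Var (A \<union> B) * chp (Suc m) t' =
      chp m t * (Var B * Var A - Var (A \<inter> B) * Var (A \<union> B)) +
      Var (A \<union> B) * (Var (A \<inter> B) * chp m t - chp (Suc m) t')"
      by (simp add: algebra_simps del: chp.simps)
    also have "\<dots> \<in> I" using 1 2 tV AB_P by (intro I_add I_mult) auto
    finally have "Var B * chp (Suc m) s - chp (Suc (Suc m)) (\<lambda>i. s i + (if i \<in> B then 1 else 0)) \<in> I"
      unfolding cs chp.simps(2)[of "Suc m"] AB t'_eq[symmetric] .
    then show ?thesis unfolding AB using True by simp
  qed
qed

definition standard :: "(nat \<Rightarrow>\<^sub>0 nat) \<Rightarrow> (nat set, 'k) mpoly" where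
  "standard s = (if good s then chp (lookup s 0) (lookup s) else 0)"

lemma supp_reg: "reg s \<Longrightarrow> keys s - {0} = {i\<in>{1..n}. 1 \<le> lookup s i}"
proof -
  assume "reg s"
  then have s: "keys s \<subseteq> {0..n}" by (simp add: reg_def)
  show ?thesis
  proof (intro equalityI subsetI)
    fix i assume "i \<in> keys s - {0}"
    then have i: "i \<in> keys s" "i \<noteq> 0" by auto
    have "lookup s i \<noteq> 0" using i(1) by (simp add: in_keys_iff)
    moreover have "i \<in> {0..n}" using i(1) s by blast
    ultimately show "i \<in> {i\<in>{1..n}. 1 \<le> lookup s i}" using i(2) by simp
  qed (auto simp: in_keys_iff)
qed

text \<open>Variables are inserted one by one with \<open>chp_insert\<close>; once the support has
  become too large, the monomial stays in \<open>I\<close>.\<close>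

lemma monomial_straighten:
  assumes "keys m \<subseteq> P"
  shows "\<exists>s. monomial_value y m = (single s 1 :: (nat, 'k) mpoly) \<and> reg s \<and> single m 1 - standard s \<in> I"
  using assms
proof (induction rule: exponent_induct)
  case zero
  have "good 0" by (simp add: good_def)
  then show ?case using I_zero reg_zero by (intro exI[of _ 0]) (simp add: standard_def)
next
  case (plus m B)
  then obtain s where s: "monomial_value y m = (single s 1 :: (nat, 'k) mpoly)" "reg s"
      "single m 1 - standard s \<in> I" by blast
  have BP: "B \<in> P" using plus by blast
  let ?s = "s + ind (insert 0 B)"
  have B: "finite B" "B \<subseteq> {1..n}" "0 \<notin> B" using P_finite[OF BP] P_subset[OF BP] by auto
  have mv: "monomial_value y (m + single B 1) = (single ?s 1 :: (nat, 'k) mpoly)"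
    by (simp add: monomial_value_plus s(1) y_def mult_single)
  have rs: "reg ?s" by (rule reg_plus[OF s(2) B(2)])
  have lk: "lookup ?s 0 = Suc (lookup s 0)" "lookup ?s i = lookup s i + (if i \<in> B then 1 else 0)" if "i \<noteq> 0" for i
    using B that by (auto simp: lookup_add lookup_ind)
  have lk0: "lookup ?s 0 = Suc (lookup s 0)" using B by (simp add: lookup_add lookup_ind)
  have supp: "keys ?s - {0} = {i\<in>{1..n}. 1 \<le> lookup s i + (if i \<in> B then 1 else 0)}"
    unfolding supp_reg[OF rs] by (auto simp: lookup_add lookup_ind B(1))
  have gs: "good ?s \<longleftrightarrow> card {i\<in>{1..n}. 1 \<le> lookup s i + (if i \<in> B then 1 else 0)} < D"
    unfolding good_def supp lk0 by simp
  have VB: "Var B * single m 1 - Var B * standard s \<in> I"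
    unfolding right_diff_distrib[symmetric] using s(3) BP by (intro I_mult) auto
  have "Var B * standard s - standard ?s \<in> I"
  proof (cases "good s")
    case False
    then have "\<not> good ?s" using bad_plus[of s "ind (insert 0 B)"] by (simp add: add.commute)
    then show ?thesis using False I_zero by (simp add: standard_def)
  next
    case True
    have c: "card {i\<in>{1..n}. 1 \<le> lookup s i} < D"
    proof (cases "lookup s 0 = 0")
      case True
      then have "{i\<in>{1..n}. 1 \<le> lookup s i} = {}" using s(2) by (auto simp: reg_def)
      then show ?thesis using BP by (metis P_def card.empty less_nat_zero_code mem_Collect_eq not_gr_zero)
    next
      case False
      then show ?thesis using True supp_reg[OF s(2)] by (simp add: good_def)
    qed
    have "lookup s i \<le> lookup s 0" for i using s(2) by (simp add: reg_def)
    note ins = chp_insert[OF BP, of "lookup s" "lookup s 0", OF this c]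
    show ?thesis
    proof (cases "good ?s")
      case True
      have "standard ?s = chp (Suc (lookup s 0)) (lookup ?s)"
        unfolding standard_def lk0 using True by (simp only: if_True)
      also have "\<dots> = chp (Suc (lookup s 0)) (\<lambda>i. lookup s i + (if i \<in> B then 1 else 0))"
        by (rule chp_cong) (rule lk(2), simp)
      finally have "standard ?s = chp (Suc (lookup s 0)) (\<lambda>i. lookup s i + (if i \<in> B then 1 else 0))" .
      moreover have "standard s = chp (lookup s 0) (lookup s)" using \<open>good s\<close> by (simp add: standard_def)
      ultimately show ?thesis using ins gs True by (simp only: if_True)
    next
      case False
      then show ?thesis using ins gs \<open>good s\<close> by (simp add: standard_def)
    qed
  qed
  from I_add[OF VB this] have "single (m + single B 1) 1 - standard ?s \<in> I"
    unfolding single_plus_exponent by simp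
  then show ?case using mv rs by blast
qed

text \<open>Modulo \<open>I\<close> a polynomial depends only on the surviving part of its image
  under \<Phi>. This is what places \<open>J\<close> inside every ideal that contains the
  relations.\<close>

lemma straighten:
  assumes "p \<in> polys P"
  shows "p - (\<Sum>s\<in>{s. s \<in> keys (\<Phi> p) \<and> good s}. single 0 (lookup (\<Phi> p) s) * standard s) \<in> I"
proof -
  define \<rho> where "\<rho> q = (\<Sum>s\<in>keys q. single 0 (lookup q s) * standard s)" for q :: "(nat, 'k) mpoly"
  have sup: "\<rho> q = (\<Sum>s\<in>X. single 0 (lookup q s) * standard s)" if "finite X" "keys q \<subseteq> X" for q X
    unfolding \<rho>_def using that by (intro sum.mono_neutral_left) (auto simp: in_keys_iff)
  have \<rho>_add: "\<rho> (p + q) = \<rho> p + \<rho> q" for p q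
    using keys_add[of p q] by (simp add: sup[of "keys p \<union> keys q"] lookup_add single_add distrib_right sum.distrib)
  have "p - \<rho> (\<Phi> p) \<in> I" using assms
  proof (induction rule: polys_induct)
    case zero then show ?case using I_zero by (simp add: \<rho>_def)
  next
    case (add p q)
    have "p + q - \<rho> (\<Phi> (p + q)) = (p - \<rho> (\<Phi> p)) + (q - \<rho> (\<Phi> q))" by (simp add: \<rho>_add)
    also have "\<dots> \<in> I" by (rule I_add[OF add.IH])
    finally show ?case .
  next
    case (single m c)
    obtain s where s: "monomial_value y m = (single s 1 :: (nat, 'k) mpoly)" "single m 1 - standard s \<in> I"
      using monomial_straighten[OF single] by blast
    have "\<Phi> (single m c) = single s c" by (simp add: psubst_single s(1) mult_single)
    then have "single m c - \<rho> (\<Phi> (single m c)) = single 0 c * (single m 1 - standard s)"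
      by (simp add: \<rho>_def right_diff_distrib mult_single)
    then show ?case using I_mult[OF polys_const s(2)] by simp
  qed
  moreover have "\<rho> (\<Phi> p) = (\<Sum>s\<in>{s. s \<in> keys (\<Phi> p) \<and> good s}. single 0 (lookup (\<Phi> p) s) * standard s)"
    unfolding \<rho>_def by (rule sum.mono_neutral_right) (auto simp: standard_def)
  ultimately show ?thesis by auto
qed

lemma J_subset_ideal: "J \<subseteq> I"
proof
  fix p :: "(nat set, 'k) mpoly" assume p: "p \<in> J"
  then have e: "{s. s \<in> keys (\<Phi> p) \<and> good s} = {}" and pV: "p \<in> polys P" by (auto simp: J_def Bd_def)
  from straighten[OF pV] show "p \<in> I" unfolding e by simp
qed

end

end

section \<open>Words that sort a function, and their initial segments\<close>

section \<open>Sorted words\<close>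

definition top :: "'a list \<Rightarrow> nat \<Rightarrow> 'a set" where
  "top w i = set (take i w)"

definition decr :: "'a list \<Rightarrow> ('a \<Rightarrow> nat) \<Rightarrow> bool" where
  "decr w f \<longleftrightarrow> (\<forall>p q. p < q \<longrightarrow> q < length w \<longrightarrow> f (w ! q) < f (w ! p))"

lemma finite_top [simp]: "finite (top w i)"
  by (simp add: top_def)

lemma top_subset: "top w i \<subseteq> set w"
  by (simp add: top_def set_take_subset)

lemma top_mono: "i \<le> j \<Longrightarrow> top w i \<subseteq> top w j"
  by (simp add: top_def set_take_subset_set_take)

lemma card_top: "distinct w \<Longrightarrow> i \<le> length w \<Longrightarrow> card (top w i) = i"
  by (simp add: top_def distinct_card)

lemma nth_in_top: "distinct w \<Longrightarrow> p < length w \<Longrightarrow> w ! p \<in> top w i \<longleftrightarrow> p < i"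
  by (auto simp: top_def in_set_conv_nth nth_eq_iff_index_eq)

lemma card_top_Int: "distinct w \<Longrightarrow> i \<le> length w \<Longrightarrow> j \<le> length w \<Longrightarrow> card (top w i \<inter> top w j) = min i j"
  using top_mono[of i j w] top_mono[of j i w] by (cases "i \<le> j") (auto simp: card_top inf.absorb1 inf.absorb2)

lemma top_Suc: "p < length w \<Longrightarrow> top w (Suc p) = insert (w ! p) (top w p)"
  by (simp add: top_def take_Suc_conv_app_nth)

lemma top_eq_imp_take_eq:
  assumes "distinct w" "distinct w'" "length w = length w'" "k \<le> length w"
    and "\<And>i. i \<le> k \<Longrightarrow> top w i = top w' i"
  shows "take k w = take k w'"
  using assms(4,5)
proof (induction k)
  case (Suc k)
  then have k: "k < length w" "k < length w'" using assms(3) by auto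
  have "insert (w ! k) (top w k) = insert (w' ! k) (top w' k)"
    using Suc.prems(2)[of "Suc k"] k by (simp add: top_Suc)
  moreover have "top w k = top w' k" using Suc.prems(2)[of k] by simp
  moreover have "w ! k \<notin> top w k" "w' ! k \<notin> top w' k" using assms(1,2) k by (simp_all add: nth_in_top)
  ultimately have "w ! k = w' ! k" by blast
  then show ?case using Suc k by (simp add: take_Suc_conv_app_nth)
qed simp

text \<open>Exchange argument: the elements of \<open>X\<close> outside the initial segment are
  matched with those of the segment outside \<open>X\<close>, and each partner has a strictly larger
  value.\<close>

lemma sum_top:
  assumes "distinct w" "decr w f" "X \<subseteq> set w"
  shows "sum f X \<le> sum f (top w (card X))"
    and "sum f X = sum f (top w (card X)) \<Longrightarrow> X = top w (card X)"
proof -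
  define U where "U = top w (card X)"
  have fin: "finite X" "finite U" using assms(3) by (auto simp: U_def intro: finite_subset)
  have "card X \<le> length w" using card_mono[OF _ assms(3)] assms(1) by (simp add: distinct_card)
  then have "card U = card X" using assms(1) by (simp add: U_def card_top)
  then have c: "card (X - U) = card (U - X)" using fin
    by (metis card_Diff_subset_Int Int_commute finite_Int)
  then obtain g where g: "bij_betw g (X - U) (U - X)" using fin finite_same_card_bij by (metis finite_Diff)
  have lt: "f x < f (g x)" if x: "x \<in> X - U" for x
  proof -
    have "g x \<in> U" using g x by (auto simp: bij_betw_def)
    then obtain p where p: "w ! p = g x" "p < card X" "p < length w" by (auto simp: U_def top_def in_set_conv_nth)
    have "x \<in> set w" using x assms(3) by blast
    then obtain q where q: "x = w ! q" "q < length w" unfolding in_set_conv_nth by blast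
    have "\<not> q < card X" using x q nth_in_top[OF assms(1) q(2), of "card X"] by (auto simp: U_def)
    then have "f (w ! q) < f (w ! p)" using assms(2) p(2,3) q(2) by (simp add: decr_def)
    then show ?thesis using p(1) q(1) by simp
  qed
  have sX: "sum f X = sum f (X \<inter> U) + sum f (X - U)" using fin by (simp add: sum.Int_Diff)
  have sU: "sum f U = sum f (X \<inter> U) + sum f (U - X)" using fin sum.Int_Diff[of U f X] by (simp add: Int_commute)
  have sg: "sum f (U - X) = (\<Sum>x\<in>X - U. f (g x))" using sum.reindex_bij_betw[OF g, of f] by simp
  have "sum f (X - U) \<le> sum f (U - X)" unfolding sg by (rule sum_mono) (use lt in force)
  then show "sum f X \<le> sum f (top w (card X))" using sX sU by (simp add: U_def)
  assume "sum f X = sum f (top w (card X))"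
  then have e: "sum f (X - U) = sum f (U - X)" using sX sU by (simp add: U_def)
  have "X - U = {}"
  proof (rule ccontr)
    assume "X - U \<noteq> {}"
    then have "sum f (X - U) < sum f (U - X)" unfolding sg using fin lt by (intro sum_strict_mono) auto
    then show False using e by simp
  qed
  moreover have "U - X = {}" using c \<open>X - U = {}\<close> fin by (metis card_0_eq card.empty finite_Diff)
  ultimately show "X = top w (card X)" by (auto simp: U_def)
qed

lemma decr_adjacentI:
  assumes "\<And>p. Suc p < length w \<Longrightarrow> f (w ! Suc p) < f (w ! p)" shows "decr w f"
  unfolding decr_def
proof (intro allI impI)
  fix p q assume "p < q" "q < length w"
  then show "f (w ! q) < f (w ! p)"
  proof (induction q)
    case (Suc q)
    have "f (w ! Suc q) < f (w ! q)" using assms Suc.prems by simp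
    then show ?case using Suc by (cases "p = q") auto
  qed simp
qed

lemma exists_decr:
  assumes "finite A" "inj_on f A" shows "\<exists>w. distinct w \<and> set w = A \<and> decr w f"
  using assms
proof (induction "card A" arbitrary: A)
  case 0
  then show ?case by (intro exI[of _ "[]"]) (simp add: decr_def)
next
  case (Suc k)
  then have "A \<noteq> {}" by auto
  define a where "a = (SOME a. a \<in> A \<and> f a = Max (f ` A))"
  have "Max (f ` A) \<in> f ` A" using Suc.prems \<open>A \<noteq> {}\<close> by (intro Max_in) auto
  then have "\<exists>a. a \<in> A \<and> f a = Max (f ` A)" by auto
  from someI_ex[OF this] have a: "a \<in> A" "f a = Max (f ` A)" by (auto simp: a_def)
  obtain w where w: "distinct w" "set w = A - {a}" "decr w f"
  proof -
    have "k = card (A - {a})" using Suc.hyps(2) a(1) Suc.prems(1) by simp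
    from Suc.hyps(1)[OF this] show ?thesis using that Suc.prems by (auto simp: inj_on_diff)
  qed
  have "f x < f a" if "x \<in> A - {a}" for x
  proof -
    have "f x \<le> f a" unfolding a(2) using that Suc.prems by (intro Max_ge) auto
    moreover have "f x \<noteq> f a" using that a(1) Suc.prems(2) by (auto dest: inj_onD)
    ultimately show ?thesis by simp
  qed
  then have "f (w ! q) < f a" if "q < length w" for q using that nth_mem[of q w] w(2) by simp
  then have "decr (a # w) f"
    using w unfolding decr_def by (auto simp: nth_Cons split: nat.splits)
  then show ?case using w a(1) by (intro exI[of _ "a # w"]) auto
qed

text \<open>The initial segments of both words maximise the same sums, and by \<open>sum_top\<close>
  the maximiser is unique.\<close>

lemma decr_unique:
  assumes "distinct w" "distinct w'" "set w = set w'" "decr w f" "decr w' f"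
  shows "w = w'"
proof -
  have len: "length w = length w'" using assms by (metis distinct_card)
  have "top w i = top w' i" if "i \<le> length w" for i
  proof -
    have 1: "sum f (top w i) \<le> sum f (top w' i)"
      using sum_top(1)[OF assms(2,5), of "top w i"] top_subset[of w i] assms(1,3) that by (simp add: card_top)
    have 2: "sum f (top w' i) \<le> sum f (top w i)"
      using sum_top(1)[OF assms(1,4), of "top w' i"] top_subset[of w' i] assms(2,3) that len by (simp add: card_top)
    show ?thesis
      using sum_top(2)[OF assms(2,5), of "top w i"] top_subset[of w i] assms(1,3) that 1 2 by (simp add: card_top)
  qed
  then have "take (length w) w = take (length w) w'"
    using assms len by (intro top_eq_imp_take_eq) auto
  then show ?thesis using len by simp
qed

section \<open>Leading monomials for a dominance order\<close>

section \<open>Descent monomials\<close>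

context truncated_boolean
begin

text \<open>Ordering indices by \<open>hat b\<close> sorts them by decreasing exponent, with ties broken by increasing
  index; so distinct indices have distinct values.\<close>

definition hat :: "(nat \<Rightarrow>\<^sub>0 nat) \<Rightarrow> nat \<Rightarrow> nat" where
  "hat b j = (n + 1) * lookup b j + (n - j)"

text \<open>Dominance: any \<open>r\<close> values of \<open>hat b\<close> have at most the sum of
  the values of \<open>hat s\<close> at the first \<open>r\<close> letters of \<open>w\<close>.
  Ranging over all sets \<open>X\<close> avoids choosing a sorting word for
  \<open>b\<close>.\<close>

definition dom :: "nat list \<Rightarrow> (nat \<Rightarrow>\<^sub>0 nat) \<Rightarrow> (nat \<Rightarrow>\<^sub>0 nat) \<Rightarrow> bool" where
  "dom w s b \<longleftrightarrow> (\<forall>X\<subseteq>{1..n}. sum (hat b) X \<le> sum (hat s) (top w (card X)))"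

definition perms :: "nat list set" where
  "perms = {w. distinct w \<and> set w = {1..n}}"

text \<open>A descent is named by the size of the initial segment that ends there, so
  \<open>top w i\<close> is the set that it contributes to \<open>Dm w\<close>.\<close>

definition Des :: "nat list \<Rightarrow> nat set" where
  "Des w = {i. 1 \<le> i \<and> i < n \<and> w ! i < w ! (i - 1)}"

definition W :: "nat list set" where
  "W = {w \<in> perms. \<forall>i\<in>Des w. i < D}"

definition Dm :: "nat list \<Rightarrow> (nat set, 'k::field) mpoly" where
  "Dm w = (\<Prod>i\<in>Des w. Var (top w i))"

definition \<theta> :: "nat \<Rightarrow> (nat set, 'k::field) mpoly" where
  "\<theta> i = (\<Sum>A\<in>{A\<in>P. card A = i}. Var A)"

definition E :: "nat list \<Rightarrow> nat \<Rightarrow> (nat \<Rightarrow>\<^sub>0 nat)" where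
  "E w i = ind (insert 0 (top w i))"

text \<open>The exponent of the image under \<open>\<Phi>\<close> of \<open>\<Prod>\<^sub>i Var (top w i) ^ g i\<close>.\<close>

definition ld :: "nat list \<Rightarrow> (nat \<Rightarrow> nat) \<Rightarrow> (nat \<Rightarrow>\<^sub>0 nat)" where
  "ld w g = (\<Sum>i\<le>n. \<Sum>_<g i. E w i)"

lemma perms_length: "w \<in> perms \<Longrightarrow> length w = n"
  using distinct_card[of w] by (simp add: perms_def)

lemma perms_nth: "w \<in> perms \<Longrightarrow> p < n \<Longrightarrow> w ! p \<in> {1..n}"
  using perms_length nth_mem[of p w] by (simp add: perms_def)

lemma perms_top: "w \<in> perms \<Longrightarrow> top w i \<subseteq> {1..n}"
  using top_subset[of w i] by (simp add: perms_def)

lemma perms_card_top: "w \<in> perms \<Longrightarrow> i \<le> n \<Longrightarrow> card (top w i) = i"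
  using card_top[of w i] perms_length by (simp add: perms_def)

lemma perms_nth_top: "w \<in> perms \<Longrightarrow> p < n \<Longrightarrow> w ! p \<in> top w i \<longleftrightarrow> p < i"
  using nth_in_top[of w p i] perms_length by (simp add: perms_def)

lemma perms_exE: "w \<in> perms \<Longrightarrow> j \<in> {1..n} \<Longrightarrow> \<exists>p<n. j = w ! p"
proof -
  assume w: "w \<in> perms" and "j \<in> {1..n}"
  then have "j \<in> set w" by (simp add: perms_def)
  then show "\<exists>p<n. j = w ! p" unfolding in_set_conv_nth perms_length[OF w] by auto
qed

lemma finite_perms: "finite perms"
  by (rule finite_subset[OF _ finite_lists_length_eq[of "{1..n}" n]]) (auto simp: perms_def distinct_card[symmetric])

lemma finite_W [simp]: "finite W"
  using finite_perms by (simp add: W_def)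

lemma W_perms: "w \<in> W \<Longrightarrow> w \<in> perms"
  by (simp add: W_def)

lemma finite_Des [simp]: "finite (Des w)"
  by (rule finite_subset[of _ "{..n}"]) (auto simp: Des_def)

lemma top_P: "w \<in> perms \<Longrightarrow> i \<le> n \<Longrightarrow> i < D \<Longrightarrow> top w i \<in> P"
  using perms_top perms_card_top by (simp add: P_def)

lemma Des_P: "w \<in> W \<Longrightarrow> i \<in> Des w \<Longrightarrow> top w i \<in> P"
  by (intro top_P) (auto simp: W_def Des_def)

lemma Dm_polys: "w \<in> W \<Longrightarrow> Dm w \<in> polys P"
  unfolding Dm_def by (intro polys_prod polys_Var Des_P)

lemma Dm_homogeneous: "homogeneous (int (card (Des w))) (Dm w)"
  unfolding Dm_def using homogeneous_prod[of "Des w" "\<lambda>_. 1" "\<lambda>i. Var (top w i)"] by simp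

lemma \<theta>_polys: "\<theta> i \<in> polys P"
  unfolding \<theta>_def by (intro polys_sum polys_Var) auto

lemma \<theta>_homogeneous: "homogeneous 1 (\<theta> i)"
  unfolding \<theta>_def by (intro homogeneous_sum homogeneous_Var)

lemma lookup_E: "lookup (E w i) j = (if j = 0 \<or> j \<in> top w i then 1 else 0)"
  by (auto simp: E_def lookup_ind)

lemma lookup_ld: "lookup (ld w g) j = (\<Sum>i\<le>n. g i * (if j = 0 \<or> j \<in> top w i then 1 else 0))"
  unfolding ld_def lookup_sum lookup_E by simp

lemma lookup_ld_0: "lookup (ld w g) 0 = (\<Sum>i\<le>n. g i)"
  by (simp add: lookup_ld)

lemma lookup_ld_nth: "w \<in> perms \<Longrightarrow> p < n \<Longrightarrow> lookup (ld w g) (w ! p) = (\<Sum>i\<in>{Suc p..n}. g i)"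
proof -
  assume w: "w \<in> perms" "p < n"
  have "w ! p \<noteq> 0" using perms_nth[OF w] by auto
  then have "lookup (ld w g) (w ! p) = (\<Sum>i\<le>n. if p < i then g i else 0)"
    unfolding lookup_ld by (intro sum.cong) (auto simp: perms_nth_top[OF w])
  also have "\<dots> = sum g {Suc p..n}" by (intro sum.mono_neutral_cong_right) auto
  finally show ?thesis .
qed

lemma keys_ld: "w \<in> perms \<Longrightarrow> keys (ld w g) \<subseteq> {0..n}"
proof
  fix j assume w: "w \<in> perms" "j \<in> keys (ld w g)"
  show "j \<in> {0..n}"
  proof (rule ccontr)
    assume "j \<notin> {0..n}"
    then have "j \<noteq> 0" "j \<notin> top w i" for i using perms_top[OF w(1), of i] by auto
    then have "lookup (ld w g) j = 0" by (simp add: lookup_ld)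
    then show False using w(2) by (simp add: in_keys_iff)
  qed
qed

lemma ld_add: "w \<in> perms \<Longrightarrow> ld w (\<lambda>i. g i + h i) = ld w g + ld w h"
  by (intro poly_mapping_eqI) (simp add: lookup_ld lookup_add add_mult_distrib sum.distrib)

lemma ld_indicator: "S \<subseteq> {..n} \<Longrightarrow> ld w (\<lambda>i. if i \<in> S then 1 else 0) = (\<Sum>i\<in>S. E w i)"
proof (rule poly_mapping_eqI)
  fix j assume S: "S \<subseteq> {..n}"
  have "lookup (ld w (\<lambda>i. if i \<in> S then 1 else 0)) j = (\<Sum>i\<le>n. if i \<in> S then (if j = 0 \<or> j \<in> top w i then 1 else 0) else 0)"
    unfolding lookup_ld by (intro sum.cong) auto
  also have "\<dots> = (\<Sum>i\<in>S. if j = 0 \<or> j \<in> top w i then 1 else 0)"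
    using S by (intro sum.mono_neutral_cong_right) auto
  finally show "lookup (ld w (\<lambda>i. if i \<in> S then 1 else 0)) j = lookup (\<Sum>i\<in>S. E w i) j"
    by (simp add: lookup_sum lookup_E)
qed

text \<open>The exponents along \<open>w\<close> are the tail sums of \<open>g\<close>, whose
  differences recover \<open>g\<close>.\<close>

lemma ld_eq_iff:
  assumes "w \<in> perms" "ld w g = ld w h" "i \<le> n" shows "g i = h i"
proof -
  have S: "sum g {k..n} = sum h {k..n}" if "k \<le> n" for k
  proof (cases k)
    case 0
    then show ?thesis using arg_cong[OF assms(2), of "\<lambda>s. lookup s 0"] by (simp add: lookup_ld_0 atMost_atLeast0)
  next
    case (Suc p)
    then have "p < n" using that by simp
    then show ?thesis using arg_cong[OF assms(2), of "\<lambda>s. lookup s (w ! p)"] Suc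
      by (simp add: lookup_ld_nth[OF assms(1)])
  qed
  show ?thesis
  proof (cases "i = n")
    case True then show ?thesis using S[of n] by simp
  next
    case False
    then have "{i..n} = insert i {Suc i..n}" "Suc i \<le> n" using assms(3) by auto
    then show ?thesis using S[of i] S[of "Suc i"] assms(3) by simp
  qed
qed

lemma hat_less: "i \<in> {1..n} \<Longrightarrow> j \<in> {1..n} \<Longrightarrow>
  hat s i < hat s j \<longleftrightarrow> lookup s i < lookup s j \<or> lookup s i = lookup s j \<and> j < i"
proof -
  assume ij: "i \<in> {1..n}" "j \<in> {1..n}"
  have lt: "hat s k < hat s l" if "lookup s k < lookup s l" "k \<in> {1..n}" for k l
  proof -
    have "(n + 1) * (lookup s k + 1) \<le> (n + 1) * lookup s l" using that(1) by (intro mult_left_mono) auto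
    then show ?thesis using that(2) by (simp add: hat_def)
  qed
  consider "lookup s i < lookup s j" | "lookup s j < lookup s i" | "lookup s i = lookup s j" by linarith
  then show ?thesis
  proof cases
    case 1 then show ?thesis using lt[of i j] ij by simp
  next
    case 2 then show ?thesis using lt[of j i] ij by force
  next
    case 3 then show ?thesis using ij by (auto simp: hat_def)
  qed
qed

lemma hat_inj: "inj_on (hat s) {1..n}"
proof (rule inj_onI)
  fix i j assume "i \<in> {1..n}" "j \<in> {1..n}" "hat s i = hat s j"
  then show "i = j" using hat_less[of i j s] hat_less[of j i s] by (metis less_irrefl linorder_less_linear)
qed

lemma hat_eqD:
  assumes "hat b i = hat s j" "i \<in> {1..n}" "j \<in> {1..n}" shows "i = j \<and> lookup b i = lookup s j"
proof -
  have dm: "((n + 1) * a + r) mod (n + 1) = r" "((n + 1) * a + r) div (n + 1) = a" if "r < n + 1" for a r :: nat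
    using that by (simp_all only: mod_mult_self4 mod_less) (rule div_nat_eqI, simp_all)
  have "n - i = n - j" "lookup b i = lookup s j"
    using dm[of "n - i" "lookup b i"] dm[of "n - j" "lookup s j"] assms(1) unfolding hat_def by simp_all
  then show ?thesis using assms(2,3) by auto
qed

lemma decr_hat_adjacent:
  assumes w: "w \<in> perms" and anti: "\<And>p. Suc p < n \<Longrightarrow> lookup s (w ! Suc p) \<le> lookup s (w ! p)"
    and strict: "\<And>p. Suc p < n \<Longrightarrow> w ! Suc p < w ! p \<Longrightarrow> lookup s (w ! Suc p) < lookup s (w ! p)"
  shows "decr w (hat s)"
proof (rule decr_adjacentI)
  fix p assume "Suc p < length w"
  then have p: "Suc p < n" "p < n" using perms_length[OF w] by auto
  have "w ! p \<noteq> w ! Suc p" using w p perms_length[OF w] by (simp add: perms_def nth_eq_iff_index_eq)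
  then show "hat s (w ! Suc p) < hat s (w ! p)"
    unfolding hat_less[OF perms_nth[OF w p(1)] perms_nth[OF w p(2)]]
    using strict[OF p(1)] anti[OF p(1)] by linarith
qed

text \<open>Consecutive exponents along \<open>w\<close> differ by values of \<open>g\<close>. Where
  they agree there is no descent, so \<open>hat\<close> breaks the tie in the order of
  \<open>w\<close>.\<close>

lemma decr_ld:
  assumes w: "w \<in> perms" and g: "\<And>i. i \<in> Des w \<Longrightarrow> 1 \<le> g i"
  shows "decr w (hat (ld w g))"
proof (rule decr_hat_adjacent[OF w])
  fix p assume p: "Suc p < n"
  have e: "lookup (ld w g) (w ! p) = g (Suc p) + lookup (ld w g) (w ! Suc p)"
    using p by (simp add: lookup_ld_nth[OF w] sum.atLeast_Suc_atMost)
  then show "lookup (ld w g) (w ! Suc p) \<le> lookup (ld w g) (w ! p)" by simp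
  assume "w ! Suc p < w ! p"
  then have "Suc p \<in> Des w" using p by (simp add: Des_def)
  then show "lookup (ld w g) (w ! Suc p) < lookup (ld w g) (w ! p)" using e g by fastforce
qed

lemma sum_hat_plus:
  assumes "A \<subseteq> {1..n}" "X \<subseteq> {1..n}"
  shows "sum (hat (b + ind (insert 0 A))) X = sum (hat b) X + (n + 1) * card (X \<inter> A)"
proof -
  have fin: "finite A" "finite X" using assms finite_subset by auto
  have "sum (hat (b + ind (insert 0 A))) X = (\<Sum>j\<in>X. hat b j + (if j \<in> A then n + 1 else 0))"
    using assms(2) fin(1) by (intro sum.cong) (auto simp: hat_def lookup_add lookup_ind)
  also have "\<dots> = sum (hat b) X + (\<Sum>j\<in>X. if j \<in> A then n + 1 else 0)" by (rule sum.distrib)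
  also have "(\<Sum>j\<in>X. if j \<in> A then n + 1 else 0) = (\<Sum>j\<in>X \<inter> A. n + 1)"
    by (rule sum.inter_restrict[symmetric, OF fin(2)])
  finally show ?thesis by simp
qed

text \<open>A set of size \<open>i\<close> meets \<open>X\<close> in at most
  \<open>min (card X) i\<close> elements, and initial segments of \<open>w\<close> attain this
  bound.\<close>

lemma dom_plus:
  assumes w: "w \<in> perms" and d: "dom w s b" and A: "A \<subseteq> {1..n}" "card A = i" and i: "i \<le> n"
  shows "dom w (s + E w i) (b + ind (insert 0 A))"
  unfolding dom_def
proof (intro allI impI)
  fix X assume X: "X \<subseteq> {1..n}"
  have cX: "card X \<le> n" using card_mono[OF _ X] by simp
  have fin: "finite A" "finite X" using A X finite_subset by auto
  have "card (X \<inter> A) \<le> min (card X) i" using card_mono[of X "X \<inter> A"] card_mono[of A "X \<inter> A"] fin A(2) by auto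
  also have "\<dots> = card (top w (card X) \<inter> top w i)"
    using card_top_Int[of w "card X" i] w perms_length[OF w] cX i by (simp add: perms_def)
  finally have c: "card (X \<inter> A) \<le> card (top w (card X) \<inter> top w i)" .
  have "sum (hat b) X \<le> sum (hat s) (top w (card X))" using d X by (simp add: dom_def)
  then show "sum (hat (b + ind (insert 0 A))) X \<le> sum (hat (s + E w i)) (top w (card X))"
    unfolding E_def sum_hat_plus[OF A(1) X] sum_hat_plus[OF perms_top[OF w] perms_top[OF w]]
    using mult_left_mono[OF c, of "n + 1"] by linarith
qed

text \<open>Comparison on the initial segment of size \<open>i\<close> forces \<open>A\<close> to
  contain it. Hence only one summand of \<open>\<theta> i\<close> contributes to the leading
  monomial, and its coefficient stays 1.\<close>

lemma dom_plus_eq: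
  assumes w: "w \<in> perms" and d: "dom w s b" and A: "A \<subseteq> {1..n}" "card A = i" and i: "i \<le> n"
    and eq: "b + ind (insert 0 A) = s + E w i"
  shows "A = top w i"
proof -
  let ?X = "top w i"
  have X: "?X \<subseteq> {1..n}" by (rule perms_top[OF w])
  have cX: "card ?X = i" by (rule perms_card_top[OF w i])
  have "sum (hat b) ?X + (n + 1) * card (?X \<inter> A) = sum (hat s) ?X + (n + 1) * card (?X \<inter> ?X)"
    using sum_hat_plus[OF A(1) X, of b] sum_hat_plus[OF X X, of s] eq by (simp add: E_def)
  moreover have "sum (hat b) ?X \<le> sum (hat s) ?X" using d X cX by (auto simp: dom_def)
  ultimately have "(n + 1) * i \<le> (n + 1) * card (?X \<inter> A)" using cX by simp
  then have "i \<le> card (?X \<inter> A)" by (rule nat_mult_le_cancel1[THEN iffD1, rotated]) simp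
  then have "?X \<inter> A = ?X" using cX card_mono[of ?X "?X \<inter> A"] by (intro card_seteq) auto
  then have "?X \<subseteq> A" by auto
  then show ?thesis using A cX finite_subset[OF A(1)] card_subset_eq[of A ?X] by simp
qed

text \<open>Multiplying by \<open>\<theta> i\<close> multiplies the leading monomial for the order \<open>dom w\<close> by the image of
  \<open>Var (top w i)\<close>.\<close>

definition LT :: "nat list \<Rightarrow> (nat \<Rightarrow>\<^sub>0 nat) \<Rightarrow> (nat, 'k::field) mpoly \<Rightarrow> bool" where
  "LT w s q \<longleftrightarrow> lookup q s = 1 \<and> (\<forall>b\<in>keys q. dom w s b \<and> lookup b 0 = lookup s 0)"

lemma \<Phi>_\<theta>: "\<Phi> (\<theta> i) = (\<Sum>A\<in>{A\<in>P. card A = i}. single (ind (insert 0 A)) 1)"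
  by (simp add: \<theta>_def y_def)

lemma LT_mult_\<theta>:
  assumes w: "w \<in> perms" and q: "LT w s q" and i: "i < D"
  shows "LT w (s + E w i) (q * \<Phi> (\<theta> i))"
proof -
  have iN: "i \<le> n" using i D_le by simp
  let ?C = "{A\<in>P. card A = i}"
  have tC: "top w i \<in> ?C" using top_P[OF w iN i] perms_card_top[OF w iN] by simp
  have exp: "q * \<Phi> (\<theta> i) = (\<Sum>A\<in>?C. single (ind (insert 0 A)) 1 * q)"
    by (simp add: \<Phi>_\<theta> sum_distrib_left mult.commute)
  have C: "A \<subseteq> {1..n}" "card A = i" "finite A" if "A \<in> ?C" for A using that P_subset P_finite by auto
  have ne: "lookup (single (ind (insert 0 A)) 1 * q) (s + E w i) = 0" if A: "A \<in> ?C" "A \<noteq> top w i" for A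
  proof (rule ccontr)
    assume "lookup (single (ind (insert 0 A)) 1 * q) (s + E w i) \<noteq> 0"
    then have "s + E w i \<in> keys (single (ind (insert 0 A)) 1 * q)" by (simp add: in_keys_iff)
    then obtain b where b: "b \<in> keys q" "s + E w i = ind (insert 0 A) + b"
      by (elim keys_multE) (auto split: if_splits)
    have "A = top w i"
      using dom_plus_eq[OF w _ C(1,2)[OF A(1)] iN, of s b] q b by (auto simp: LT_def add.commute)
    then show False using A(2) by simp
  qed
  have "lookup (q * \<Phi> (\<theta> i)) (s + E w i) = (\<Sum>A\<in>?C. lookup (single (ind (insert 0 A)) 1 * q) (s + E w i))"
    unfolding exp lookup_sum ..
  also have "\<dots> = lookup (single (E w i) 1 * q) (E w i + s)"
    using sum.remove[OF _ tC, of "\<lambda>A. lookup (single (ind (insert 0 A)) 1 * q) (s + E w i)"] ne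
    by (simp add: E_def add.commute)
  also have "\<dots> = 1" unfolding lookup_single_plus_mult using q by (simp add: LT_def)
  finally have 1: "lookup (q * \<Phi> (\<theta> i)) (s + E w i) = 1" .
  have "dom w (s + E w i) b \<and> lookup b 0 = lookup (s + E w i) 0" if b: "b \<in> keys (q * \<Phi> (\<theta> i))" for b
  proof -
    obtain A where A: "A \<in> ?C" "b \<in> keys (single (ind (insert 0 A)) 1 * q)"
      using b unfolding exp by (rule keys_sumE)
    then obtain b' where b': "b' \<in> keys q" "b = ind (insert 0 A) + b'"
      by (elim keys_multE) (auto split: if_splits)
    have d: "dom w s b'" "lookup b' 0 = lookup s 0" using q b'(1) by (auto simp: LT_def)
    show ?thesis using dom_plus[OF w d(1) C(1,2)[OF A(1)] iN] b'(2) d(2) C(3)[OF A(1)]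
      by (simp add: add.commute lookup_add lookup_ind lookup_E)
  qed
  then show ?thesis using 1 by (simp add: LT_def)
qed

text \<open>One set of each rank \<open>i < D\<close>, whose variable will stand for
  \<open>\<theta> i\<close>; the intervals are a choice of representatives.\<close>

definition V0 :: "nat set set" where
  "V0 = (\<lambda>i. {1..i}) ` {..<D}"

definition tf :: "nat set \<Rightarrow> (nat set, 'k::field) mpoly" where
  "tf A = (if A \<in> V0 then \<theta> (card A) else Var A)"

abbreviation \<tau> :: "(nat set, 'k::field) mpoly \<Rightarrow> (nat set, 'k) mpoly" where
  "\<tau> \<equiv> psubst tf"

text \<open>How often the variable of \<open>top w i\<close> enters the leading monomial of
  \<open>\<tau> (single e 1) * Dm w\<close>: once for a descent, and once for each factor
  \<open>\<theta> i\<close>.\<close>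

definition gfun :: "nat list \<Rightarrow> (nat set \<Rightarrow>\<^sub>0 nat) \<Rightarrow> nat \<Rightarrow> nat" where
  "gfun w e i = (if i \<in> Des w then 1 else 0) + (if i < D then lookup e {1..i} else 0)"

abbreviation lead :: "nat list \<Rightarrow> (nat set \<Rightarrow>\<^sub>0 nat) \<Rightarrow> (nat \<Rightarrow>\<^sub>0 nat)" where
  "lead w e \<equiv> ld w (gfun w e)"

lemma V0_P: "V0 \<subseteq> P"
  using D_le by (auto simp: V0_def P_def)

lemma tf_V0: "i < D \<Longrightarrow> tf {1..i} = \<theta> i"
  by (auto simp: tf_def V0_def)

lemma tf_polys: "A \<in> P \<Longrightarrow> tf A \<in> polys P"
  by (auto simp: tf_def \<theta>_polys)

lemma tf_homogeneous: "homogeneous 1 (tf A)"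
  by (auto simp: tf_def \<theta>_homogeneous)

lemma Des_le_n: "Des w \<subseteq> {..n}"
  by (auto simp: Des_def)

lemma \<Phi>_prod_top:
  assumes "S \<subseteq> {..n}"
  shows "\<Phi> (\<Prod>i\<in>S. Var (top w i)) = single (ld w (\<lambda>i. if i \<in> S then 1 else 0)) (1 :: 'k::field)"
proof -
  have "(\<Prod>i\<in>S. y (top w i)) = single (\<Sum>i\<in>S. E w i) (1 :: 'k)" if "finite S" for S
    using that by (induction S rule: finite_induct) (auto simp: y_def E_def mult_single)
  then show ?thesis using finite_subset[OF assms] by (simp add: ld_indicator[OF assms])
qed

lemma \<Phi>_Dm: "\<Phi> (Dm w) = single (ld w (\<lambda>i. if i \<in> Des w then 1 else 0)) (1 :: 'k::field)"
  unfolding Dm_def by (rule \<Phi>_prod_top[OF Des_le_n])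

lemma dom_refl: "w \<in> perms \<Longrightarrow> decr w (hat s) \<Longrightarrow> dom w s s"
  using sum_top(1)[of w "hat s"] by (simp add: dom_def perms_def)

lemma LT_lead:
  assumes w: "w \<in> W" and e: "keys e \<subseteq> V0"
  shows "LT w (lead w e) (\<Phi> (\<tau> (single e 1) * Dm w) :: (nat, 'k::field) mpoly)"
  using e
proof (induction rule: exponent_induct)
  case zero
  have "gfun w 0 = (\<lambda>i. if i \<in> Des w then 1 else 0)" by (intro ext) (simp add: gfun_def)
  moreover have "decr w (hat (ld w (\<lambda>i. if i \<in> Des w then 1 else 0)))"
    using W_perms[OF w] by (intro decr_ld) auto
  ultimately show ?case using dom_refl[OF W_perms[OF w]] by (simp add: \<Phi>_Dm LT_def)
next
  case (plus e v)
  then obtain i where i: "i < D" "v = {1..i}" by (auto simp: V0_def)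
  have iN: "i \<le> n" using i D_le by simp
  have inj: "{1..k} = {1..i} \<longleftrightarrow> k = i" for k :: nat by (metis card_atLeastAtMost diff_Suc_1)
  have "gfun w (e + single v 1) = (\<lambda>k. gfun w e k + (if k \<in> {i} then 1 else 0))"
    using i inj by (intro ext) (auto simp: gfun_def lookup_add lookup_single when_def)
  then have l: "lead w (e + single v 1) = lead w e + E w i"
    using ld_add[OF W_perms[OF w], of "gfun w e" "\<lambda>k. if k \<in> {i} then 1 else 0"] ld_indicator[of "{i}" w] iN by simp
  have "\<tau> (single (e + single v 1) 1) = (\<theta> i * \<tau> (single e 1) :: (nat set, 'k) mpoly)"
    unfolding single_plus_exponent i(2) psubst_mult psubst_Var tf_V0[OF i(1)] by (rule refl)
  then have q: "(\<Phi> (\<tau> (single (e + single v 1) 1) * Dm w) :: (nat, 'k) mpoly) = \<Phi> (\<tau> (single e 1) * Dm w) * \<Phi> (\<theta> i)"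
    by (simp only: psubst_mult ac_simps)
  show ?case unfolding l q by (rule LT_mult_\<theta>[OF W_perms[OF w] plus.IH i(1)])
qed

text \<open>Only initial segments of size below \<open>D\<close> occur, so the support lies in
  \<open>top w (D - 1)\<close>.\<close>

lemma lead_reg:
  assumes "w \<in> W" shows "reg (lead w e)" and "keys e \<subseteq> V0 \<Longrightarrow> good (lead w e)"
proof -
  note w = W_perms[OF assms]
  have "lookup (ld w g) j \<le> lookup (ld w g) 0" for g j
    unfolding lookup_ld by (intro sum_mono) auto
  then show "reg (lead w e)" using keys_ld[OF w] by (simp add: reg_def)
  assume e: "keys e \<subseteq> V0"
  have g0: "gfun w e i = 0" if "i \<ge> D" for i using assms that by (auto simp: gfun_def W_def)
  show "good (lead w e)"
  proof (cases "D = 0")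
    case True
    then have "lookup (lead w e) 0 = 0" using g0 by (simp add: lookup_ld_0)
    then show ?thesis by (simp add: good_def)
  next
    case False
    have "keys (lead w e) - {0} \<subseteq> top w (D - 1)"
    proof
      fix j assume j: "j \<in> keys (lead w e) - {0}"
      have "lookup (lead w e) j = 0" if "j \<notin> top w (D - 1)"
        unfolding lookup_ld
      proof (intro sum.neutral ballI)
        fix i assume "i \<in> {..n}"
        show "gfun w e i * (if j = 0 \<or> j \<in> top w i then 1 else 0) = 0"
        proof (cases "i < D")
          case True
          then have "top w i \<subseteq> top w (D - 1)" by (intro top_mono) simp
          then show ?thesis using that j by auto
        qed (simp add: g0)
      qed
      then show "j \<in> top w (D - 1)" using j by (auto simp: in_keys_iff)
    qed
    then have "card (keys (lead w e) - {0}) \<le> card (top w (D - 1))" by (intro card_mono) auto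
    also have "\<dots> = D - 1" using D_le by (intro perms_card_top[OF w]) simp
    finally have "card (keys (lead w e) - {0}) < D" using False by linarith
    then show ?thesis by (simp add: good_def)
  qed
qed

lemma decr_lead: "w \<in> W \<Longrightarrow> decr w (hat (lead w e))"
  by (intro decr_ld W_perms) (auto simp: gfun_def)

text \<open>The word is recovered as the one that sorts the exponent, and then \<open>e\<close> from
  the differences of consecutive exponents.\<close>

lemma lead_inject:
  assumes "w \<in> W" "w' \<in> W" "keys e \<subseteq> V0" "keys e' \<subseteq> V0" "lead w e = lead w' e'"
  shows "w = w' \<and> e = e'"
proof -
  have ww: "w = w'"
    using decr_unique[of w w' "hat (lead w e)"] decr_lead[OF assms(1), of e] decr_lead[OF assms(2), of e'] assms(5)
      W_perms[OF assms(1)] W_perms[OF assms(2)] by (simp add: perms_def)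
  have g: "gfun w e i = gfun w e' i" if "i \<le> n" for i
    using ld_eq_iff[OF W_perms[OF assms(1)] _ that] assms(5) ww by simp
  have "e = e'"
  proof (rule poly_mapping_eqI)
    fix A
    show "lookup e A = lookup e' A"
    proof (cases "A \<in> V0")
      case True
      then obtain i where i: "i < D" "A = {1..i}" by (auto simp: V0_def)
      then show ?thesis using g[of i] D_le by (simp add: gfun_def)
    next
      case False
      then have "A \<notin> keys e" "A \<notin> keys e'" using assms(3,4) by auto
      then show ?thesis by (simp add: in_keys_iff)
    qed
  qed
  then show ?thesis using ww by simp
qed

text \<open>Sort the indices by decreasing exponent, ties by increasing index. The differences of
  consecutive sorted exponents are the required multiplicities; a descent of the sorting word forces
  a strict drop, which makes room for the factor of \<open>Dm w\<close>.\<close>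

lemma exists_lead:
  assumes "reg s" "good s"
  shows "\<exists>w\<in>W. \<exists>e. keys e \<subseteq> V0 \<and> lead w e = s"
proof -
  obtain w where w: "distinct w" "set w = {1..n}" "decr w (hat s)"
    using exists_decr[OF _ hat_inj] by blast
  then have wp: "w \<in> perms" by (simp add: perms_def)
  note len = perms_length[OF wp]
  \<comment> \<open>The sorted exponents, preceded by the degree and followed by zeros.\<close>
  define h where "h i = (if i = 0 then lookup s 0 else if i \<le> n then lookup s (w ! (i - 1)) else 0)" for i
  have lt: "hat s (w ! Suc p) < hat s (w ! p)" if "Suc p < n" for p
    using w(3) that len by (simp add: decr_def)
  have anti: "h (Suc i) \<le> h i" for i
  proof (cases "i = 0 \<or> Suc i > n")
    case True
    then show ?thesis using assms(1) by (auto simp: h_def reg_def)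
  next
    case False
    then have p: "Suc (i - 1) < n" "i - 1 < n" "Suc (i - 1) = i" by auto
    then show ?thesis using lt[OF p(1)] hat_less[OF perms_nth[OF wp p(1)] perms_nth[OF wp p(2)], of s] False
      by (auto simp: h_def)
  qed
  have antimono: "h j \<le> h i" if "i \<le> j" for i j using lift_Suc_antimono_le[of h, OF anti that] .
  \<comment> \<open>A nonzero \<open>h i\<close> means at least \<open>i\<close> indices in the
    support, so \<open>good s\<close> gives \<open>i < D\<close>.\<close>
  have h0: "h i = 0" if i: "i \<ge> D" for i
  proof (rule ccontr)
    assume hi: "h i \<noteq> 0"
    then have "h 0 \<noteq> 0" using antimono[of 0 i] by simp
    then have c: "card (keys s - {0}) < D" using assms(2) by (simp add: good_def h_def)
    have "i \<le> n" using hi by (cases "i \<le> n") (auto simp: h_def)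
    have "top w i \<subseteq> keys s - {0}"
    proof
      fix j assume "j \<in> top w i"
      then have "j \<in> {1..n}" using perms_top[OF wp] by blast
      then obtain p where p: "p < n" "j = w ! p" using perms_exE[OF wp] by blast
      then have "p < i" using \<open>j \<in> top w i\<close> perms_nth_top[OF wp p(1)] by simp
      then have "h (Suc p) \<noteq> 0" using antimono[of "Suc p" i] hi by simp
      then show "j \<in> keys s - {0}" using p \<open>j \<in> {1..n}\<close> by (simp add: h_def in_keys_iff)
    qed
    then have "card (top w i) \<le> card (keys s - {0})" by (intro card_mono) auto
    then show False using c i perms_card_top[OF wp \<open>i \<le> n\<close>] by simp
  qed
  have Des: "h (Suc i) < h i" if "i \<in> Des w" for i
  proof -
    have p: "Suc (i - 1) < n" "i - 1 < n" "Suc (i - 1) = i" "w ! i < w ! (i - 1)" using that by (auto simp: Des_def)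
    then show ?thesis using lt[OF p(1)] hat_less[OF perms_nth[OF wp p(1)] perms_nth[OF wp p(2)], of s]
      by (auto simp: h_def)
  qed
  have wW: "w \<in> W"
    using wp Des h0 by (fastforce simp: W_def not_less[symmetric])
  define g where "g i = h i - h (Suc i)" for i
  define e where "e = (\<Sum>i<D. single {1..i} (g i - (if i \<in> Des w then 1 else 0)))"
  have inj: "{1..k} = {1..i} \<longleftrightarrow> k = i" for k i :: nat by (metis card_atLeastAtMost diff_Suc_1)
  have le: "lookup e {1..i} = g i - (if i \<in> Des w then 1 else 0)" if "i < D" for i
    using that unfolding e_def lookup_sum lookup_single when_def inj by simp
  have keV: "keys e \<subseteq> V0"
  proof
    fix A assume "A \<in> keys e"
    then obtain i where "i \<in> {..<D}" "A \<in> keys (single {1..i} (g i - (if i \<in> Des w then 1 else 0)))"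
      unfolding e_def by (rule keys_sumE)
    then show "A \<in> V0" by (auto simp: V0_def split: if_splits)
  qed
  have gg: "gfun w e i = g i" for i
  proof (cases "i < D")
    case True
    have "i \<in> Des w \<Longrightarrow> 1 \<le> g i" using Des[of i] by (simp add: g_def)
    then show ?thesis using True le[OF True] by (cases "i \<in> Des w") (simp_all add: gfun_def del: One_nat_def)
  next
    case False
    then have "i \<notin> Des w" using wW by (auto simp: W_def)
    then show ?thesis using False h0[of i] by (simp add: gfun_def g_def)
  qed
  have tele: "(\<Sum>i=k..n. g i) = h k" if "k \<le> Suc n" for k
  proof -
    have "(\<Sum>i=k..n. g i) = h k - h (Suc n)" using that
    proof (induction "Suc n - k" arbitrary: k)
      case 0 then show ?case by simp
    next
      case (Suc d)
      then have "k \<le> n" by simp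
      then have "(\<Sum>i=k..n. g i) = g k + (\<Sum>i=Suc k..n. g i)" by (simp add: sum.atLeast_Suc_atMost)
      also have "(\<Sum>i=Suc k..n. g i) = h (Suc k) - h (Suc n)" using Suc.hyps \<open>k \<le> n\<close> by (intro Suc.hyps(1)) auto
      finally show ?case using antimono[of k "Suc k"] antimono[of "Suc k" "Suc n"] \<open>k \<le> n\<close> by (simp add: g_def)
    qed
    then show ?thesis by (simp add: h_def)
  qed
  have "lead w e = ld w g" using gg by presburger
  also have "ld w g = s"
  proof (rule poly_mapping_eqI)
    fix j
    consider "j = 0" | "j \<in> {1..n}" | "j > n" by fastforce
    then show "lookup (ld w g) j = lookup s j"
    proof cases
      case 1
      then show ?thesis using tele[of 0] by (simp add: lookup_ld_0 atMost_atLeast0 h_def)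
    next
      case 2
      then obtain p where p: "p < n" "j = w ! p" using perms_exE[OF wp] by blast
      then show ?thesis using tele[of "Suc p"] by (simp add: lookup_ld_nth[OF wp] h_def)
    next
      case 3
      then have "j \<notin> keys s" "j \<notin> keys (ld w g)" using assms(1) keys_ld[OF wp, of g] by (auto simp: reg_def)
      then show ?thesis by (simp add: in_keys_iff)
    qed
  qed
  finally show ?thesis using wW keV by blast
qed

section \<open>The descent monomials form a basis over the parameters\<close>

definition sw :: "(nat \<Rightarrow>\<^sub>0 nat) \<Rightarrow> nat list" where
  "sw s = (SOME w. w \<in> perms \<and> decr w (hat s))"

text \<open>The sum over \<open>r\<close> of the sums of the \<open>r\<close> largest values of
  \<open>hat s\<close>. It turns dominance into a comparison of numbers, for induction and for the
  choice of a maximal term.\<close>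

definition weight :: "(nat \<Rightarrow>\<^sub>0 nat) \<Rightarrow> nat" where
  "weight s = (\<Sum>r\<le>n. sum (hat s) (top (sw s) r))"

lemma sw: "sw s \<in> perms" "decr (sw s) (hat s)"
proof -
  have "\<exists>w. w \<in> perms \<and> decr w (hat s)" using exists_decr[OF _ hat_inj[of s]] by (auto simp: perms_def)
  from someI_ex[OF this] show "sw s \<in> perms" "decr (sw s) (hat s)" by (auto simp: sw_def)
qed

lemma sw_eq: "w \<in> perms \<Longrightarrow> decr w (hat s) \<Longrightarrow> sw s = w"
  using decr_unique[of "sw s" w "hat s"] sw[of s] by (simp add: perms_def)

text \<open>Equal weights force all partial sums to agree, hence the sorted values of
  \<open>hat\<close>. Such a value encodes both the index and its exponent, so the exponents
  agree.\<close>

lemma weight_dom: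
  assumes w: "w \<in> perms" "decr w (hat s)" and d: "dom w s b"
  shows "weight b \<le> weight s"
    and "weight b = weight s \<Longrightarrow> reg b \<Longrightarrow> reg s \<Longrightarrow> lookup b 0 = lookup s 0 \<Longrightarrow> b = s"
proof -
  let ?v = "sw b"
  note v = sw[of b]
  have le: "sum (hat b) (top ?v r) \<le> sum (hat s) (top w r)" if "r \<le> n" for r
    using d perms_top[OF v(1), of r] perms_card_top[OF v(1) that] by (auto simp: dom_def)
  have ws: "weight s = (\<Sum>r\<le>n. sum (hat s) (top w r))" by (simp add: weight_def sw_eq[OF w])
  show "weight b \<le> weight s" unfolding ws weight_def[of b] by (rule sum_mono) (use le in auto)
  assume eq: "weight b = weight s" and rb: "reg b" and rs: "reg s" and z: "lookup b 0 = lookup s 0"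
  have e: "sum (hat b) (top ?v r) = sum (hat s) (top w r)" if "r \<le> n" for r
  proof (rule ccontr)
    assume "sum (hat b) (top ?v r) \<noteq> sum (hat s) (top w r)"
    then have "sum (hat b) (top ?v r) < sum (hat s) (top w r)" using le[OF that] by simp
    then have "(\<Sum>r\<le>n. sum (hat b) (top ?v r)) < (\<Sum>r\<le>n. sum (hat s) (top w r))"
      using le that by (intro sum_strict_mono_ex1) auto
    then show False using eq unfolding ws weight_def[of b] by simp
  qed
  have nth: "hat b (?v ! p) = hat s (w ! p)" if "p < n" for p
  proof -
    have "sum (hat b) (top ?v (Suc p)) = hat b (?v ! p) + sum (hat b) (top ?v p)"
      using that perms_length[OF v(1)] perms_nth_top[OF v(1) that, of p] by (simp add: top_Suc)
    moreover have "sum (hat s) (top w (Suc p)) = hat s (w ! p) + sum (hat s) (top w p)"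
      using that perms_length[OF w(1)] perms_nth_top[OF w(1) that, of p] by (simp add: top_Suc)
    ultimately show ?thesis using e[of p] e[of "Suc p"] that by simp
  qed
  show "b = s"
  proof (rule poly_mapping_eqI)
    fix j
    consider "j = 0" | "j \<in> {1..n}" | "j > n" by fastforce
    then show "lookup b j = lookup s j"
    proof cases
      case 1 then show ?thesis using z by simp
    next
      case 2
      then obtain p where p: "p < n" "j = w ! p" using perms_exE[OF w(1)] by blast
      then show ?thesis
        using hat_eqD[OF nth[OF p(1)] perms_nth[OF v(1) p(1)] perms_nth[OF w(1) p(1)]] by metis
    next
      case 3
      then have "j \<notin> keys s" "j \<notin> keys b" using rb rs by (auto simp: reg_def)
      then show ?thesis by (simp add: in_keys_iff)
    qed
  qed
qed

definition comb :: "(nat list \<Rightarrow> (nat set, 'k::field) mpoly) \<Rightarrow> (nat set, 'k) mpoly" where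
  "comb a = (\<Sum>w\<in>W. \<tau> (a w) * Dm w)"

lemma comb_add: "comb (\<lambda>w. a w + c w) = comb a + comb c"
  by (simp add: comb_def distrib_right sum.distrib)

lemma comb_diff: "comb (\<lambda>w. a w - c w) = comb a - comb c"
  by (simp add: comb_def left_diff_distrib sum_subtractf)

lemma comb_smult: "comb (\<lambda>w. single 0 x * a w) = single 0 x * comb a"
  by (simp add: comb_def sum_distrib_left mult.assoc)

lemma comb_sum: "comb (\<lambda>w. \<Sum>i\<in>A. a i w) = (\<Sum>i\<in>A. comb (a i))"
  by (induction A rule: infinite_finite_induct) (auto simp: comb_add, auto simp: comb_def)

lemma comb_single: "w0 \<in> W \<Longrightarrow> comb (\<lambda>w. if w = w0 then p else 0) = \<tau> p * Dm w0"
  by (simp add: comb_def if_distrib[of \<tau>] if_distrib[of "\<lambda>x. x * _"] cong: if_cong)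

lemma \<tau>_polys: "p \<in> polys P \<Longrightarrow> \<tau> p \<in> polys P"
  by (rule psubst_polys[of p P]) (auto intro: tf_polys)

lemma comb_polys: "(\<And>w. w \<in> W \<Longrightarrow> a w \<in> polys V0) \<Longrightarrow> comb a \<in> polys P"
  unfolding comb_def using polys_mono[OF V0_P] by (intro polys_sum polys_mult \<tau>_polys Dm_polys) auto

lemma lead_degree:
  assumes "keys e \<subseteq> V0"
  shows "lookup (lead w e) 0 = card (Des w) + monomial_degree e"
proof -
  have inj: "inj_on (\<lambda>i. {1..i}) {..<D}" by (rule inj_onI) (metis card_atLeastAtMost diff_Suc_1)
  have "lookup (lead w e) 0 = (\<Sum>i\<le>n. if i \<in> Des w then 1 else 0) + (\<Sum>i\<le>n. if i < D then lookup e {1..i} else 0)"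
    by (simp add: lookup_ld_0 gfun_def sum.distrib)
  also have "(\<Sum>i\<le>n. if i \<in> Des w then 1 else 0) = card (Des w)"
  proof -
    have "(\<Sum>i\<le>n. if i \<in> Des w then 1 else 0 :: nat) = (\<Sum>i\<in>Des w. 1)"
      using Des_le_n[of w] by (intro sum.mono_neutral_cong_right) auto
    then show ?thesis by simp
  qed
  also have "(\<Sum>i\<le>n. if i < D then lookup e {1..i} else 0) = (\<Sum>i<D. lookup e {1..i})"
    using D_le by (intro sum.mono_neutral_cong_right) auto
  also have "\<dots> = (\<Sum>A\<in>V0. lookup e A)" unfolding V0_def sum.reindex[OF inj] comp_def by (rule refl)
  also have "\<dots> = monomial_degree e"
    using finite_subset[OF V0_P finite_P] assms by (simp add: monomial_degree_superset)
  finally show ?thesis .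
qed

text \<open>\<open>s\<close> is the leading exponent of some
  \<open>\<tau> (single e 1) * Dm w0\<close>. The other monomials of that product are killed or have
  smaller weight.\<close>

lemma span_monomial:
  assumes "reg s" "good s"
  shows "\<exists>a. (\<forall>w\<in>W. a w \<in> polys V0 \<and> homogeneous (int (lookup s 0) - int (card (Des w))) (a w)) \<and>
    single s (1 :: 'k::field) - \<Phi> (comb a) \<in> Bd"
  using assms
proof (induction "weight s" arbitrary: s rule: less_induct)
  case less
  obtain w0 e where w0: "w0 \<in> W" "keys e \<subseteq> V0" "lead w0 e = s" using exists_lead[OF less.prems] by blast
  define p0 where "p0 = (\<tau> (single e 1) * Dm w0 :: (nat set, 'k) mpoly)"
  define q where "q = \<Phi> p0"
  have p0: "p0 \<in> polys P"
    unfolding p0_def using w0 V0_P by (intro polys_mult \<tau>_polys Dm_polys polys_single) auto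
  have lt: "LT w0 s q" using LT_lead[OF w0(1,2)] w0(3) by (simp add: q_def p0_def)
  have dec: "decr w0 (hat s)" using decr_lead[OF w0(1), of e] w0(3) by simp
  have "\<exists>a. (\<forall>w\<in>W. a w \<in> polys V0 \<and> homogeneous (int (lookup s 0) - int (card (Des w))) (a w)) \<and>
      single t (1 :: 'k) - \<Phi> (comb a) \<in> Bd" if t: "t \<in> keys q - {s}" for t
  proof (cases "good t")
    case False
    then have "single t (1 :: 'k) - \<Phi> (comb (\<lambda>_. 0)) \<in> Bd" by (simp add: Bd_def comb_def)
    then show ?thesis by (intro exI[of _ "\<lambda>_. 0"]) simp
  next
    case True
    have d: "dom w0 s t" "lookup t 0 = lookup s 0" using lt t by (auto simp: LT_def)
    have rt: "reg t" using keys_\<Phi>_reg[OF p0] t by (simp add: q_def)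
    have "weight t < weight s"
      using weight_dom[OF W_perms[OF w0(1)] dec d(1)] rt less.prems(1) d(2) t by fastforce
    from less.hyps[OF this rt True] show ?thesis using d(2) by simp
  qed
  then have "\<forall>t\<in>keys q - {s}. \<exists>a. (\<forall>w\<in>W. a w \<in> polys V0 \<and> homogeneous (int (lookup s 0) - int (card (Des w))) (a w)) \<and>
      single t (1 :: 'k) - \<Phi> (comb a) \<in> Bd" by blast
  from bchoice[OF this] obtain a where a: "\<forall>t\<in>keys q - {s}. (\<forall>w\<in>W. a t w \<in> polys V0 \<and>
      homogeneous (int (lookup s 0) - int (card (Des w))) (a t w)) \<and> single t (1 :: 'k) - \<Phi> (comb (a t)) \<in> Bd" by blast
  define c where "c w = (if w = w0 then single e 1 else 0) - (\<Sum>t\<in>keys q - {s}. single 0 (lookup q t) * a t w)" for w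
  have sk: "s \<in> keys q" using lt by (simp add: LT_def in_keys_iff)
  have "comb c = p0 - (\<Sum>t\<in>keys q - {s}. single 0 (lookup q t) * comb (a t))"
    unfolding c_def comb_diff comb_single[OF w0(1)] p0_def comb_sum comb_smult ..
  then have Ac: "\<Phi> (comb c) = q - (\<Sum>t\<in>keys q - {s}. single 0 (lookup q t) * \<Phi> (comb (a t)))"
    by (simp add: q_def)
  have qs: "q - single s 1 = (\<Sum>t\<in>keys q - {s}. single 0 (lookup q t) * single t 1)"
  proof -
    have "lookup q s = 1" using lt by (simp add: LT_def)
    then show ?thesis
      using sum_single_keys[of q] sum.remove[OF finite_keys sk, of "\<lambda>t. single t (lookup q t)"]
      by (simp add: mult_single algebra_simps)
  qed
  have "single s 1 - \<Phi> (comb c) = - (\<Sum>t\<in>keys q - {s}. single 0 (lookup q t) * (single t 1 - \<Phi> (comb (a t))))"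
    unfolding right_diff_distrib sum_subtractf Ac qs[symmetric] by simp
  also have "\<dots> \<in> Bd" using a by (intro Bd_uminus Bd_sum Bd_mult) blast
  finally have 1: "single s 1 - \<Phi> (comb c) \<in> Bd" .
  have 2: "c w \<in> polys V0" "homogeneous (int (lookup s 0) - int (card (Des w))) (c w)" if "w \<in> W" for w
  proof -
    have h: "homogeneous (int (lookup s 0) - int (card (Des w))) (if w = w0 then single e 1 else 0 :: (nat set, 'k) mpoly)"
      using lead_degree[OF w0(2), of w0] w0(3) by (auto intro!: homogeneous_single)
    show "homogeneous (int (lookup s 0) - int (card (Des w))) (c w)"
      unfolding c_def using a that
      by (intro homogeneous_diff h homogeneous_sum homogeneous_mult_eq[OF homogeneous_const]) auto
    show "c w \<in> polys V0"
      unfolding c_def using a that w0(2) by (intro polys_diff polys_sum polys_mult) (auto intro: polys_single)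
  qed
  show ?case using 1 2 by blast
qed

lemma J_span:
  assumes "p \<in> polys P" "homogeneous d (p :: (nat set, 'k::field) mpoly)"
  shows "\<exists>a. (\<forall>w\<in>W. a w \<in> polys V0 \<and> homogeneous (d - int (card (Des w))) (a w)) \<and> p - comb a \<in> J"
proof -
  have "\<exists>a. (\<forall>w\<in>W. a w \<in> polys V0 \<and> homogeneous (d - int (card (Des w))) (a w)) \<and>
      single s (1 :: 'k) - \<Phi> (comb a) \<in> Bd" if s: "s \<in> keys (\<Phi> p)" for s
  proof (cases "good s")
    case False
    then have "single s (1 :: 'k) - \<Phi> (comb (\<lambda>_. 0)) \<in> Bd" by (simp add: Bd_def comb_def)
    then show ?thesis by (intro exI[of _ "\<lambda>_. 0"]) simp
  next
    case True
    have "reg s" using keys_\<Phi>_reg[OF assms(1)] s by blast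
    moreover have "int (lookup s 0) = d" by (rule homogeneous_\<Phi>[OF assms s])
    ultimately show ?thesis using span_monomial[OF _ True, where 'k = 'k] by simp
  qed
  then have "\<forall>s\<in>keys (\<Phi> p). \<exists>a. (\<forall>w\<in>W. a w \<in> polys V0 \<and> homogeneous (d - int (card (Des w))) (a w)) \<and>
      single s (1 :: 'k) - \<Phi> (comb a) \<in> Bd" by blast
  from bchoice[OF this] obtain a where a: "\<forall>s\<in>keys (\<Phi> p). (\<forall>w\<in>W. a s w \<in> polys V0 \<and>
      homogeneous (d - int (card (Des w))) (a s w)) \<and> single s (1 :: 'k) - \<Phi> (comb (a s)) \<in> Bd" by blast
  define c where "c w = (\<Sum>s\<in>keys (\<Phi> p). single 0 (lookup (\<Phi> p) s) * a s w)" for w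
  have 2: "c w \<in> polys V0" "homogeneous (d - int (card (Des w))) (c w)" if "w \<in> W" for w
    unfolding c_def using a that
    by (auto intro!: polys_sum polys_mult homogeneous_sum homogeneous_mult_eq[OF homogeneous_const])
  have "comb c = (\<Sum>s\<in>keys (\<Phi> p). single 0 (lookup (\<Phi> p) s) * comb (a s))"
    unfolding c_def comb_sum comb_smult ..
  then have "\<Phi> (p - comb c) = \<Phi> p - (\<Sum>s\<in>keys (\<Phi> p). single 0 (lookup (\<Phi> p) s) * \<Phi> (comb (a s)))"
    by simp
  moreover have "(\<Sum>s\<in>keys (\<Phi> p). single 0 (lookup (\<Phi> p) s) * single s 1) = \<Phi> p"
    using sum_single_keys[of "\<Phi> p"] by (simp add: mult_single)
  ultimately have "\<Phi> (p - comb c) =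
      (\<Sum>s\<in>keys (\<Phi> p). single 0 (lookup (\<Phi> p) s) * (single s 1 - \<Phi> (comb (a s))))"
    by (simp add: right_diff_distrib sum_subtractf)
  also have "\<dots> \<in> Bd" using a by (intro Bd_sum Bd_mult) blast
  finally have "p - comb c \<in> J" using assms(1) comb_polys[of c] 2(1) by (simp add: J_def polys_diff)
  then show ?thesis using 2 by blast
qed

text \<open>Take a term whose leading exponent has maximal weight. No other term contains this
  exponent, so it cannot cancel, and it is not among the killed ones.\<close>

lemma J_indep:
  assumes a: "\<And>w. w \<in> W \<Longrightarrow> a w \<in> polys V0" and J: "comb a \<in> (J :: (nat set, 'k::field) mpoly set)" and w1: "w1 \<in> W"
  shows "a w1 = 0"
proof (rule ccontr)
  assume "a w1 \<noteq> 0"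
  define S where "S = {(w, e). w \<in> W \<and> e \<in> keys (a w)}"
  have S: "finite S" "S \<noteq> {}"
  proof -
    have "S = (SIGMA w:W. keys (a w))" by (auto simp: S_def)
    then show "finite S" by simp
    show "S \<noteq> {}" using \<open>a w1 \<noteq> 0\<close> w1 by (auto simp: S_def simp flip: keys_eq_empty)
  qed
  have keV: "keys e \<subseteq> V0" if "(w, e) \<in> S" for w e using that a by (auto simp: S_def polys_def)
  define f where "f x = weight (lead (fst x) (snd x))" for x
  have "Max (f ` S) \<in> f ` S" using S by (intro Max_in) auto
  then obtain x where x: "x \<in> S" "f x = Max (f ` S)" by auto
  obtain w0 e0 where x0: "x = (w0, e0)" by (cases x)
  have max: "weight (lead w e) \<le> weight (lead w0 e0)" if "(w, e) \<in> S" for w e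
  proof -
    have "f (w, e) \<le> Max (f ` S)" using S(1) that by (intro Max_ge) auto
    also have "\<dots> = f x" using x(2) by simp
    finally show ?thesis by (simp add: f_def x0)
  qed
  let ?s = "lead w0 e0"
  have w0: "w0 \<in> W" "e0 \<in> keys (a w0)" using x(1) by (auto simp: x0 S_def)
  have e0: "keys e0 \<subseteq> V0" using keV x(1) x0 by blast
  define Q where "Q w e = (\<Phi> (\<tau> (single e 1) * Dm w) :: (nat, 'k) mpoly)" for w e
  have Q: "lookup (Q w e) ?s = (if w = w0 \<and> e = e0 then 1 else 0)" if we: "(w, e) \<in> S" for w e
  proof -
    have wW: "w \<in> W" using we by (simp add: S_def)
    have lt: "LT w (lead w e) (Q w e)" unfolding Q_def by (rule LT_lead[OF wW keV[OF we]])
    show ?thesis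
    proof (cases "lookup (Q w e) ?s = 0")
      case True
      then show ?thesis using lt by (auto simp: LT_def)
    next
      case False
      then have "?s \<in> keys (Q w e)" by (simp add: in_keys_iff)
      then have d: "dom w (lead w e) ?s" "lookup ?s 0 = lookup (lead w e) 0" using lt by (auto simp: LT_def)
      note wd = weight_dom[OF W_perms[OF wW] decr_lead[OF wW] d(1)]
      have "?s = lead w e"
        using wd(1) max[OF we] lead_reg(1)[OF w0(1)] lead_reg(1)[OF wW] d(2) by (intro wd(2)) auto
      then have "w = w0 \<and> e = e0" using lead_inject[OF w0(1) wW e0 keV[OF we]] by simp
      then show ?thesis using lt by (auto simp: LT_def)
    qed
  qed
  have "\<Phi> (comb a) = (\<Sum>w\<in>W. \<Sum>e\<in>keys (a w). single 0 (lookup (a w) e) * Q w e)"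
  proof -
    have "\<tau> (a w) * Dm w = (\<Sum>e\<in>keys (a w). single 0 (lookup (a w) e) * (\<tau> (single e 1) * Dm w))" for w
      unfolding psubst_def[of tf "a w"] by (simp add: psubst_single sum_distrib_right mult.assoc)
    then show ?thesis by (simp add: comb_def Q_def)
  qed
  then have "lookup (\<Phi> (comb a)) ?s = (\<Sum>w\<in>W. \<Sum>e\<in>keys (a w). lookup (a w) e * lookup (Q w e) ?s)"
    by (simp add: lookup_sum lookup_const_mult)
  also have "\<dots> = (\<Sum>w\<in>W. \<Sum>e\<in>keys (a w). if w = w0 \<and> e = e0 then lookup (a w) e else 0)"
    using Q by (intro sum.cong refl) (auto simp: S_def)
  also have "\<dots> = (\<Sum>w\<in>W. if w = w0 then lookup (a w0) e0 else 0)"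
    using w0(2) by (intro sum.cong refl) (auto simp: if_distrib cong: if_cong)
  also have "\<dots> = lookup (a w0) e0" using w0(1) by simp
  finally have "?s \<in> keys (\<Phi> (comb a))" using w0(2) by (simp add: in_keys_iff)
  then show False using J lead_reg(2)[OF w0(1) e0] by (auto simp: J_def Bd_def)
qed

end

section \<open>The alternating functional on the top degree\<close>

section \<open>An alternating form detecting the socle\<close>

lemma sum_count:
  fixes c :: "'a \<Rightarrow> nat"
  assumes "finite Y" "\<And>j. j \<in> Y \<Longrightarrow> c j = (\<Sum>i\<in>I. if j \<in> X i then 1 else 0)"
  shows "sum c Y = (\<Sum>i\<in>I. card (Y \<inter> X i))"
proof -
  have "sum c Y = (\<Sum>j\<in>Y. \<Sum>i\<in>I. if j \<in> X i then 1 else 0)" using assms(2) by (intro sum.cong) auto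
  also have "\<dots> = (\<Sum>i\<in>I. \<Sum>j\<in>Y. if j \<in> X i then 1 else 0)" by (rule sum.swap)
  also have "\<dots> = (\<Sum>i\<in>I. card (Y \<inter> X i))" using assms(1) by (simp add: sum.If_cases)
  finally show ?thesis .
qed

text \<open>Double counting; it computes a sum of squares both through level sets and through the
  factors of a monomial.\<close>

lemma sum_mult_count:
  fixes f c :: "'a \<Rightarrow> nat"
  assumes "finite A" "\<And>i. i \<in> I \<Longrightarrow> X i \<subseteq> A" "\<And>j. j \<in> A \<Longrightarrow> c j = (\<Sum>i\<in>I. if j \<in> X i then 1 else 0)"
  shows "(\<Sum>j\<in>A. f j * c j) = (\<Sum>i\<in>I. sum f (X i))"
proof -
  have "(\<Sum>j\<in>A. f j * c j) = (\<Sum>j\<in>A. \<Sum>i\<in>I. if j \<in> X i then f j else 0)"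
    using assms(3) by (intro sum.cong refl) (simp add: sum_distrib_left if_distrib cong: if_cong)
  also have "\<dots> = (\<Sum>i\<in>I. \<Sum>j\<in>A. if j \<in> X i then f j else 0)" by (rule sum.swap)
  also have "\<dots> = (\<Sum>i\<in>I. sum f (X i))"
    using assms(1,2) by (intro sum.cong refl sum.mono_neutral_cong_right) auto
  finally show ?thesis .
qed

lemma sum_indicator_diff:
  fixes S :: "nat set"
  assumes "finite S"
  shows "(\<Sum>l\<in>S. if i \<le> l then 1 else 0 :: nat) = (\<Sum>l\<in>S. if i < l then 1 else 0) + (if i \<in> S then 1 else 0)"
proof -
  have "(\<Sum>l\<in>S. if i \<le> l then 1 else 0 :: nat) = (\<Sum>l\<in>S. (if i < l then 1 else 0) + (if l = i then 1 else 0))"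
    by (intro sum.cong) auto
  also have "\<dots> = (\<Sum>l\<in>S. if i < l then 1 else 0) + (if i \<in> S then 1 else 0)"
    using assms unfolding sum.distrib by simp
  finally show ?thesis .
qed

context truncated_boolean
begin

text \<open>The degree of the socle of the quotient by the \<open>\<theta> i\<close>.\<close>

definition kk :: nat where "kk = min (D - 1) (n - 1)"

text \<open>The exponents along the first letters of \<open>w\<close>, continued by the identity so
  that they can form a permutation with a sign.\<close>

definition pos :: "nat list \<Rightarrow> (nat \<Rightarrow>\<^sub>0 nat) \<Rightarrow> nat \<Rightarrow> nat" where
  "pos w s p = (if p \<le> kk then lookup s (w ! p) else p)"

text \<open>The orbit of \<open>full w\<close> under permutations of the first \<open>kk + 1\<close>
  letters of \<open>w\<close>; the form is supported there.\<close>

definition alternating :: "nat list \<Rightarrow> (nat \<Rightarrow>\<^sub>0 nat) \<Rightarrow> bool" where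
  "alternating w s \<longleftrightarrow>
     lookup s 0 = kk \<and> keys s \<subseteq> insert 0 (top w (Suc kk)) \<and> pos w s permutes {..kk}"

definition full :: "nat list \<Rightarrow> (nat \<Rightarrow>\<^sub>0 nat)" where
  "full w = ld w (\<lambda>i. if i \<in> {1..kk} then 1 else 0)"

text \<open>The factor \<open>sign (pos w (full w))\<close> normalises the value on \<open>Cm w * Dm w\<close> to \<open>1\<close>.\<close>

definition alt :: "nat list \<Rightarrow> (nat \<Rightarrow>\<^sub>0 nat) \<Rightarrow> 'k::field" where
  "alt w s = (if alternating w s then of_int (sign (pos w s) * sign (pos w (full w))) else 0)"

definition pairing :: "nat list \<Rightarrow> (nat, 'k::field) mpoly \<Rightarrow> 'k" where
  "pairing w q = (\<Sum>s\<in>keys q. lookup q s * alt w s)"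

definition Cm :: "nat list \<Rightarrow> (nat set, 'k::field) mpoly" where
  "Cm w = (\<Prod>i\<in>{1..kk} - Des w. Var (top w i))"

lemma kk_less_n: "kk < n"
  using n_pos by (simp add: kk_def)

lemma kk_less_D: "0 < i \<Longrightarrow> i \<le> kk \<Longrightarrow> i < D"
  by (auto simp: kk_def)

lemma Des_W: "w \<in> W \<Longrightarrow> Des w \<subseteq> {1..kk}"
proof
  fix i assume "w \<in> W" "i \<in> Des w"
  then have "1 \<le> i" "i < n" "i < D" by (auto simp: W_def Des_def)
  then show "i \<in> {1..kk}" by (auto simp: kk_def)
qed

lemma pairing_superset: "finite X \<Longrightarrow> keys q \<subseteq> X \<Longrightarrow> pairing w q = (\<Sum>s\<in>X. lookup q s * alt w s)"
  unfolding pairing_def by (intro sum.mono_neutral_left) (auto simp: in_keys_iff)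

lemma pairing_add: "pairing w (p + q) = pairing w p + pairing w q"
proof -
  let ?X = "keys p \<union> keys q"
  have "keys (p + q) \<subseteq> ?X" by (rule keys_add)
  then show ?thesis
    using pairing_superset[of ?X p w] pairing_superset[of ?X q w] pairing_superset[of ?X "p + q" w]
    by (simp add: lookup_add distrib_right sum.distrib)
qed

lemma pairing_const_mult: "pairing w (single 0 c * q) = c * pairing w q"
proof -
  have "keys (single 0 c * q) \<subseteq> keys q" by (auto simp: in_keys_iff lookup_const_mult)
  then show ?thesis
    using pairing_superset[of "keys q" "single 0 c * q" w]
    by (simp add: lookup_const_mult pairing_def sum_distrib_left mult.assoc)
qed

lemma pairing_zero: "pairing w 0 = 0"
  by (simp add: pairing_def)

lemma pairing_sum: "pairing w (sum f A) = (\<Sum>i\<in>A. pairing w (f i))"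
  by (induction A rule: infinite_finite_induct) (simp_all add: pairing_add pairing_zero)

lemma pairing_single: "pairing w (single s c) = c * alt w s"
  by (simp add: pairing_def)

lemma alternating_inj:
  assumes "alternating w s" "p \<le> kk" "q \<le> kk" "lookup s (w ! p) = lookup s (w ! q)" shows "p = q"
proof -
  have "pos w s p = pos w s q" using assms(2-4) by (simp add: pos_def)
  moreover have "inj (pos w s)" using assms(1) permutes_inj by (auto simp: alternating_def)
  ultimately show ?thesis by (simp add: inj_eq)
qed

text \<open>One of the \<open>kk + 1\<close> letters has exponent 0, so the support has at most
  \<open>kk\<close> elements. This is less than \<open>D\<close> unless \<open>D = 0\<close>, and
  then the degree \<open>kk\<close> is 0.\<close>

lemma alternating_good:
  assumes w: "w \<in> perms" and s: "alternating w s" shows "good s"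
proof (cases "D = 0")
  case True
  then have "kk = 0" unfolding kk_def by simp
  then show ?thesis using s unfolding alternating_def good_def by simp
next
  case False
  have "pos w s ` {..kk} = {..kk}" using s permutes_image by (auto simp: alternating_def)
  then have "0 \<in> pos w s ` {..kk}" by simp
  then obtain p where p: "p \<le> kk" "lookup s (w ! p) = 0" by (auto simp: pos_def)
  have pn: "p < n" using p(1) kk_less_n by simp
  have "keys s - {0} \<subseteq> top w (Suc kk) - {w ! p}"
    using s p(2) by (auto simp: alternating_def in_keys_iff)
  then have "card (keys s - {0}) \<le> card (top w (Suc kk) - {w ! p})" by (intro card_mono) auto
  also have "\<dots> = kk"
    using perms_nth_top[OF w pn, of "Suc kk"] p(1) perms_card_top[OF w, of "Suc kk"] kk_less_n by simp
  finally have "card (keys s - {0}) \<le> kk" .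
  then have "card (keys s - {0}) < D" using False unfolding kk_def by linarith
  then show ?thesis by (simp add: good_def)
qed

lemma pairing_Bd: "w \<in> perms \<Longrightarrow> q \<in> Bd \<Longrightarrow> pairing w q = 0"
  unfolding pairing_def
proof (intro sum.neutral ballI)
  fix s assume "w \<in> perms" "q \<in> Bd" "s \<in> keys q"
  then have "\<not> alternating w s" using alternating_good by (auto simp: Bd_def)
  then show "lookup q s * alt w s = 0" by (simp add: alt_def)
qed

lemma perms_nth_neq: "w \<in> perms \<Longrightarrow> p < n \<Longrightarrow> q < n \<Longrightarrow> w ! p = w ! q \<longleftrightarrow> p = q"
  using perms_length[of w] by (simp add: perms_def nth_eq_iff_index_eq)

lemma alternating_transpose:
  assumes w: "w \<in> perms" and pq: "p \<le> kk" "q \<le> kk"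
    and s': "\<And>j. lookup s' j = lookup s (transpose (w ! p) (w ! q) j)"
  shows "pos w s' = pos w s \<circ> transpose p q" and "alternating w s \<Longrightarrow> alternating w s'"
proof -
  have n: "p < n" "q < n" using pq kk_less_n by auto
  have nz: "w ! p \<noteq> 0" "w ! q \<noteq> 0" using perms_nth[OF w n(1)] perms_nth[OF w n(2)] by auto
  show pos: "pos w s' = pos w s \<circ> transpose p q"
  proof
    fix r
    show "pos w s' r = (pos w s \<circ> transpose p q) r"
    proof (cases "r \<le> kk")
      case True
      then have "r < n" using kk_less_n by simp
      then have "transpose (w ! p) (w ! q) (w ! r) = w ! transpose p q r"
        using perms_nth_neq[OF w] n by (auto simp: transpose_def)
      moreover have "transpose p q r \<le> kk" using True pq by (simp add: transpose_def)
      ultimately show ?thesis using True by (simp add: pos_def s')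
    next
      case False
      then show ?thesis using pq by (auto simp: pos_def transpose_def)
    qed
  qed
  assume s: "alternating w s"
  have "pos w s' permutes {..kk}"
    unfolding pos using s pq by (intro permutes_compose permutes_swap_id) (auto simp: alternating_def)
  moreover have "keys s' \<subseteq> insert 0 (top w (Suc kk))"
  proof
    fix j assume "j \<in> keys s'"
    then have "transpose (w ! p) (w ! q) j \<in> keys s" by (simp add: in_keys_iff s')
    then have "transpose (w ! p) (w ! q) j \<in> insert 0 (top w (Suc kk))" using s by (auto simp: alternating_def)
    moreover have "w ! p \<in> top w (Suc kk)" "w ! q \<in> top w (Suc kk)"
      using perms_nth_top[OF w n(1)] perms_nth_top[OF w n(2)] pq by simp_all
    ultimately show "j \<in> insert 0 (top w (Suc kk))" by (auto simp: transpose_def split: if_splits)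
  qed
  moreover have "lookup s' 0 = kk" using s nz by (simp add: s' alternating_def transpose_def)
  ultimately show "alternating w s'" by (simp add: alternating_def)
qed

lemma alt_transpose:
  assumes w: "w \<in> perms" and pq: "p \<le> kk" "q \<le> kk" "p \<noteq> q"
    and s': "\<And>j. lookup s' j = lookup s (transpose (w ! p) (w ! q) j)"
  shows "alt w s' = - (alt w s :: 'k::field)"
proof -
  have s: "lookup s j = lookup s' (transpose (w ! p) (w ! q) j)" for j by (simp add: s')
  have iff: "alternating w s' \<longleftrightarrow> alternating w s"
    using alternating_transpose(2)[OF w pq(1,2), of s' s, OF s'] alternating_transpose(2)[OF w pq(1,2), of s s', OF s] by blast
  have "sign (pos w s') = - sign (pos w s)" if "alternating w s"
  proof -
    have "permutation (pos w s)" using that permutation_permutes by (auto simp: alternating_def)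
    then show ?thesis
      unfolding alternating_transpose(1)[OF w pq(1,2), of s' s, OF s']
      using pq(3) by (simp add: sign_compose permutation_swap_id sign_swap_id)
  qed
  then show ?thesis by (simp add: alt_def iff)
qed

text \<open>Two of the \<open>kk + 1\<close> exponents of \<open>b\<close>, all below \<open>kk\<close>, agree. The sets containing both or none of
  the two indices contribute \<open>0\<close>, and swapping the indices pairs off the others with opposite signs.\<close>

lemma alt_sum_eq_0:
  assumes w: "w \<in> perms" and b: "\<And>p. p \<le> kk \<Longrightarrow> lookup b (w ! p) < kk"
  shows "(\<Sum>A\<in>{A\<in>P. card A = i}. alt w (ind (insert 0 A) + b)) = (0 :: 'k::field)"
proof -
  let ?C = "{A\<in>P. card A = i}"
  let ?a = "\<lambda>A. alt w (ind (insert 0 A) + b) :: 'k"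
  have "(\<lambda>p. lookup b (w ! p)) ` {..kk} \<subseteq> {..<kk}" using b by auto
  then have "card ((\<lambda>p. lookup b (w ! p)) ` {..kk}) \<le> card {..<kk}" by (intro card_mono) auto
  then have "\<not> inj_on (\<lambda>p. lookup b (w ! p)) {..kk}" by (intro pigeonhole) simp
  then obtain p q where pq: "p \<le> kk" "q \<le> kk" "p \<noteq> q" and bpq: "lookup b (w ! p) = lookup b (w ! q)"
    by (auto simp: inj_on_def)
  have n: "p < n" "q < n" using pq kk_less_n by auto
  define x y where "x = w ! p" "y = w ! q"
  have xy: "x \<in> {1..n}" "y \<in> {1..n}" "x \<noteq> y"
    using perms_nth[OF w n(1)] perms_nth[OF w n(2)] perms_nth_neq[OF w n] pq(3) by (auto simp: x_y_def)
  let ?t = "transpose x y"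
  let ?C1 = "{A\<in>?C. x \<in> A \<and> y \<notin> A}" and ?C2 = "{A\<in>?C. y \<in> A \<and> x \<notin> A}"
  have tC: "?t ` A \<in> ?C" if A: "A \<in> ?C" for A
  proof -
    have "?t ` A \<subseteq> {1..n}" using A xy P_subset[of A] by (auto simp: transpose_def)
    moreover have "card (?t ` A) = card A" by (intro card_image inj_on_subset[OF inj_transpose]) auto
    ultimately show ?thesis using A by (simp add: P_def)
  qed
  have tmem: "j \<in> ?t ` A \<longleftrightarrow> ?t j \<in> A" for j A
    by (metis (no_types, lifting) image_iff transpose_involutory)
  have a0: "?a A = 0" if A: "A \<in> ?C" "(x \<in> A) = (y \<in> A)" for A
  proof -
    have "finite A" using A(1) P_finite by blast
    then have "lookup (ind (insert 0 A) + b) x = lookup (ind (insert 0 A) + b) y"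
      using A(2) xy bpq by (auto simp: lookup_add lookup_ind x_y_def)
    then have "\<not> alternating w (ind (insert 0 A) + b)"
      using alternating_inj[of w _ p q] pq by (auto simp: x_y_def)
    then show ?thesis by (simp add: alt_def)
  qed
  have at: "?a (?t ` A) = - ?a A" if A: "A \<in> ?C" for A
  proof (rule alt_transpose[OF w pq])
    fix j
    have "finite A" using A P_finite by blast
    moreover have "j \<in> insert 0 (?t ` A) \<longleftrightarrow> ?t j \<in> insert 0 A"
      using xy by (auto simp: tmem transpose_def)
    moreover have "lookup b (?t j) = lookup b j" using bpq by (simp add: transpose_def x_y_def)
    ultimately show "lookup (ind (insert 0 (?t ` A)) + b) j = lookup (ind (insert 0 A) + b) (transpose (w ! p) (w ! q) j)"
      unfolding x_y_def[symmetric] by (simp only: lookup_add lookup_ind finite_insert finite_imageI)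
  qed
  have "sum ?a ?C = sum ?a (?C1 \<union> ?C2)" using a0 by (intro sum.mono_neutral_right) auto
  also have "\<dots> = sum ?a ?C1 + sum ?a ?C2" by (intro sum.union_disjoint) auto
  also have "sum ?a ?C2 = (\<Sum>A\<in>?C1. - ?a A)"
  proof (rule sum.reindex_bij_witness[where i = "image ?t" and j = "image ?t"])
    fix A assume A: "A \<in> ?C2"
    show "?t ` ?t ` A = A" by (simp add: image_image)
    have "?t ` A \<in> ?C" using tC A by blast
    then show "?t ` A \<in> ?C1" using A by (simp add: tmem)
    have "A \<in> ?C" using A by blast
    then show "- ?a (?t ` A) = ?a A" using at[of A] by simp
  next
    fix A assume A: "A \<in> ?C1"
    show "?t ` ?t ` A = A" by (simp add: image_image)
    have "?t ` A \<in> ?C" using tC A by blast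
    then show "?t ` A \<in> ?C2" using A by (simp add: tmem)
  qed
  also have "sum ?a ?C1 + (\<Sum>A\<in>?C1. - ?a A) = 0" by (simp add: sum_negf)
  finally show ?thesis .
qed

text \<open>In degree \<open>kk - 1\<close> all exponents are below \<open>kk\<close>, as
  \<open>alt_sum_eq_0\<close> requires.\<close>

lemma pairing_\<theta>:
  assumes w: "w \<in> perms" and r: "r \<in> polys P" "homogeneous (int kk - 1) (r :: (nat set, 'k::field) mpoly)"
  shows "pairing w (\<Phi> (\<theta> i) * \<Phi> r) = 0"
proof -
  let ?C = "{A\<in>P. card A = i}"
  have "\<Phi> (\<theta> i) * \<Phi> r = (\<Sum>A\<in>?C. single (ind (insert 0 A)) 1) * (\<Sum>b\<in>keys (\<Phi> r). single b (lookup (\<Phi> r) b))"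
    unfolding \<Phi>_\<theta> sum_single_keys ..
  also have "\<dots> = (\<Sum>A\<in>?C. \<Sum>b\<in>keys (\<Phi> r). single (ind (insert 0 A) + b) (lookup (\<Phi> r) b))"
    unfolding sum_product by (simp add: mult_single)
  also have "\<dots> = (\<Sum>b\<in>keys (\<Phi> r). \<Sum>A\<in>?C. single (ind (insert 0 A) + b) (lookup (\<Phi> r) b))"
    by (rule sum.swap)
  finally have "pairing w (\<Phi> (\<theta> i) * \<Phi> r) =
      (\<Sum>b\<in>keys (\<Phi> r). lookup (\<Phi> r) b * (\<Sum>A\<in>?C. alt w (ind (insert 0 A) + b)))"
    by (simp only: pairing_sum pairing_single sum_distrib_left)
  also have "\<dots> = 0"
  proof (intro sum.neutral ballI)
    fix b assume b: "b \<in> keys (\<Phi> r)"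
    have "int (lookup b 0) = int kk - 1" by (rule homogeneous_\<Phi>[OF r b])
    moreover have "reg b" using keys_\<Phi>_reg[OF r(1)] b by blast
    ultimately have "lookup b j < kk" for j by (auto simp: reg_def intro: le_less_trans)
    then show "lookup (\<Phi> r) b * (\<Sum>A\<in>?C. alt w (ind (insert 0 A) + b)) = 0"
      using alt_sum_eq_0[OF w, where 'k = 'k] by simp
  qed
  finally show ?thesis .
qed

lemma Cm_polys: "w \<in> W \<Longrightarrow> Cm w \<in> polys P"
  unfolding Cm_def using kk_less_D kk_less_n by (intro polys_prod polys_Var top_P W_perms) auto

lemma Cm_homogeneous: "w \<in> W \<Longrightarrow> homogeneous (int kk - int (card (Des w))) (Cm w)"
proof -
  assume w: "w \<in> W"
  have "card ({1..kk} - Des w) = kk - card (Des w)" "card (Des w) \<le> kk"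
    using card_mono[OF _ Des_W[OF w]] by (simp_all add: card_Diff_subset[OF finite_Des Des_W[OF w], simplified])
  then show ?thesis
    unfolding Cm_def using homogeneous_prod[of "{1..kk} - Des w" "\<lambda>_. 1" "\<lambda>i. Var (top w i)"] by simp
qed

lemma \<Phi>_Cm_Dm:
  "\<Phi> (Cm w * Dm w') = single (ld w (\<lambda>i. if i \<in> {1..kk} - Des w then 1 else 0) +
     ld w' (\<lambda>i. if i \<in> Des w' then 1 else 0)) (1 :: 'k::field)"
proof -
  have "{1..kk} - Des w \<subseteq> {..n}" using kk_less_n by auto
  then show ?thesis unfolding psubst_mult \<Phi>_Dm Cm_def by (simp only: \<Phi>_prod_top mult_single mult_1)
qed

lemma alternating_full: "w \<in> perms \<Longrightarrow> alternating w (full w)"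
proof -
  assume w: "w \<in> perms"
  have nth: "lookup (full w) (w ! p) = kk - p" if "p < n" for p
  proof -
    have "lookup (full w) (w ! p) = (\<Sum>i\<in>{Suc p..kk}. 1)"
      unfolding full_def lookup_ld_nth[OF w that] using kk_less_n by (intro sum.mono_neutral_cong_right) auto
    then show ?thesis by simp
  qed
  have "lookup (full w) 0 = (\<Sum>i\<in>{1..kk}. 1)"
    unfolding full_def lookup_ld_0 using kk_less_n by (intro sum.mono_neutral_cong_right) auto
  then have 0: "lookup (full w) 0 = kk" by simp
  have k: "keys (full w) \<subseteq> insert 0 (top w (Suc kk))"
  proof
    fix j assume j: "j \<in> keys (full w)"
    show "j \<in> insert 0 (top w (Suc kk))"
    proof (cases "j = 0")
      case False
      then have "j \<in> {1..n}" using keys_ld[OF w] j by (fastforce simp: full_def)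
      then obtain p where p: "p < n" "j = w ! p" using perms_exE[OF w] by blast
      then have "p < kk" using j nth[OF p(1)] by (simp add: in_keys_iff)
      then show ?thesis using p perms_nth_top[OF w p(1)] by simp
    qed simp
  qed
  have pos: "pos w (full w) = (\<lambda>p. if p \<le> kk then kk - p else p)"
    using nth kk_less_n by (intro ext) (simp add: pos_def)
  have "bij_betw (pos w (full w)) {..kk} {..kk}"
    by (rule bij_betw_byWitness[where f' = "pos w (full w)"]) (auto simp: pos)
  then have "pos w (full w) permutes {..kk}" by (rule bij_imp_permutes) (simp add: pos)
  then show ?thesis using 0 k by (simp add: alternating_def)
qed

text \<open>The descents and the non-descents up to \<open>kk\<close> together use every initial
  segment of size 1, ..., \<open>kk\<close> once, which gives the exponent
  \<open>full w\<close>.\<close>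

lemma pairing_Cm_Dm: "w \<in> W \<Longrightarrow> pairing w (\<Phi> (Cm w * Dm w)) = (1 :: 'k::field)"
proof -
  assume w: "w \<in> W"
  have "(\<lambda>i. (if i \<in> {1..kk} - Des w then 1 else 0 :: nat) + (if i \<in> Des w then 1 else 0)) =
      (\<lambda>i. if i \<in> {1..kk} then 1 else 0)"
    using Des_W[OF w] by (intro ext) auto
  then have "\<Phi> (Cm w * Dm w) = single (full w) (1 :: 'k)"
    unfolding \<Phi>_Cm_Dm full_def ld_add[OF W_perms[OF w], symmetric] by simp
  moreover have "alt w (full w) = (1 :: 'k)"
    using alternating_full[OF W_perms[OF w]] by (simp add: alt_def)
  ultimately show ?thesis by (simp add: pairing_single)
qed

section \<open>Unitriangularity of the pairings\<close>

lemma W_eqI: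
  assumes w: "w \<in> W" "w' \<in> W" and t: "take kk w = take kk w'" shows "w = w'"
proof -
  \<comment> \<open>All descents of a word in \<open>W\<close> are at most \<open>kk\<close>, so its
    letters from position \<open>kk\<close> on are increasing.\<close>
  have s: "sorted (drop kk v)" "distinct v" "set (drop kk v) = {1..n} - set (take kk v)" if v: "v \<in> W" for v
  proof -
    note vp = W_perms[OF v]
    show d: "distinct v" using vp by (simp add: perms_def)
    show "sorted (drop kk v)" unfolding sorted_iff_nth_Suc
    proof (intro allI impI)
      fix i assume i: "Suc i < length (drop kk v)"
      then have "Suc (kk + i) < n" by (simp add: perms_length[OF vp])
      moreover have "Suc (kk + i) \<notin> Des v" using Des_W[OF v] by auto
      ultimately have "v ! (kk + i) \<le> v ! Suc (kk + i)" by (simp add: Des_def)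
      then show "drop kk v ! i \<le> drop kk v ! Suc i" using i by simp
    qed
    have "set v = set (take kk v) \<union> set (drop kk v)" by (metis append_take_drop_id set_append)
    moreover have "set (take kk v) \<inter> set (drop kk v) = {}" using d by (simp add: set_take_disj_set_drop_if_distinct)
    ultimately show "set (drop kk v) = {1..n} - set (take kk v)" using vp by (auto simp: perms_def)
  qed
  have "drop kk w = drop kk w'"
    using s[OF w(1)] s[OF w(2)] t by (intro sorted_distinct_set_unique) auto
  then show ?thesis using t by (metis append_take_drop_id)
qed

text \<open>For \<open>i \<le> kk\<close> this is the largest sum of \<open>i\<close> exponents when
  the exponents are 0, ..., \<open>kk\<close>, namely \<open>kk + (kk - 1) + ...\<close> with
  \<open>i\<close> terms, counted by level sets.\<close>

definition G :: "nat \<Rightarrow> nat" where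
  "G i = (\<Sum>l\<in>{1..kk}. min i l)"

text \<open>The tie-breaker among words whose descents have equal sums of \<open>G\<close>.\<close>

definition Q :: "nat list \<Rightarrow> nat" where
  "Q w = (\<Sum>i\<in>{1..kk}. \<Sum>j\<in>top w i. j)"

lemma sum_hat: "sum (hat s) X = (n + 1) * sum (lookup s) X + (\<Sum>j\<in>X. n - j)"
  by (simp add: hat_def sum.distrib sum_distrib_left)

lemma lookup_ld_indicator:
  assumes "S \<subseteq> {..n}" "j \<noteq> 0"
  shows "lookup (ld w (\<lambda>i. if i \<in> S then 1 else 0)) j = (\<Sum>i\<in>S. if j \<in> top w i then 1 else 0)"
  unfolding ld_indicator[OF assms(1)] lookup_sum lookup_E using assms(2) by simp

text \<open>The level sets \<open>U i\<close> of the exponent \<open>s\<close> maximise \<open>\<Sum>\<^sub>j\<^sub>\<in>\<^sub>X s\<^sub>j\<close> among sets \<open>X\<close> of size \<open>i\<close>. Summing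
  over the sets occurring in \<open>Cm w * Dm w'\<close> computes \<open>\<Sum>\<^sub>j s\<^sub>j\<^sup>2\<close>, which is as large as possible.\<close>

lemma alternating_Cm_Dm:
  assumes w: "w \<in> W" "w' \<in> W"
    and s: "s = ld w (\<lambda>i. if i \<in> {1..kk} - Des w then 1 else 0) + ld w' (\<lambda>i. if i \<in> Des w' then 1 else 0)"
    and alt: "alternating w s"
  shows "sum G (Des w) \<le> sum G (Des w')"
    and "sum G (Des w) = sum G (Des w') \<Longrightarrow> Q w' \<le> Q w \<and> (Q w' = Q w \<longrightarrow> w' = w)"
proof -
  note wp = W_perms[OF w(1)] and wp' = W_perms[OF w(2)]
  \<comment> \<open>The factors of \<open>Cm w\<close> are indexed by \<open>S\<close>, those of
    \<open>Dm w'\<close> by \<open>T\<close>.\<close>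
  define S T where "S = {1..kk} - Des w" "T = Des w'"
  have S: "S \<subseteq> {1..kk}" "finite S" and T: "T \<subseteq> {1..kk}" "finite T" using Des_W[OF w(2)] by (auto simp: S_T_def)
  have ST: "S \<subseteq> {..n}" "T \<subseteq> {..n}" using S T kk_less_n by auto
  define v where "v j = lookup s j" for j
  let ?N = "{1..n}" and ?B = "top w (Suc kk)"
  have B: "?B \<subseteq> ?N" "card ?B = Suc kk" using perms_top[OF wp] perms_card_top[OF wp, of "Suc kk"] kk_less_n by auto
  have v_out: "v j = 0" if "j \<in> ?N" "j \<notin> ?B" for j
    using that alt by (auto simp: v_def alternating_def in_keys_iff)
  have vB: "v ` ?B = {..kk}"
  proof -
    have "?B = (!) w ` {..kk}"
      using nth_image[of "Suc kk" w] kk_less_n perms_length[OF wp]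
      by (simp add: top_def atLeast0LessThan lessThan_Suc_atMost)
    then have "v ` ?B = pos w s ` {..kk}" by (auto simp: v_def pos_def image_image)
    also have "\<dots> = {..kk}" using alt permutes_image by (auto simp: alternating_def)
    finally show ?thesis .
  qed
  have vinj: "inj_on v ?B" by (rule eq_card_imp_inj_on) (simp_all add: vB B)
  have v_le: "v j \<le> kk" if "j \<in> ?N" for j using vB v_out[OF that] by (cases "j \<in> ?B") auto
  \<comment> \<open>For \<open>i \<le> kk\<close>, the indices of the \<open>i\<close> largest
    exponents.\<close>
  define U where "U i = {j \<in> ?N. kk - i < v j}" for i
  have U_N: "U i \<subseteq> ?N" for i by (auto simp: U_def)
  have U_B: "U i \<subseteq> ?B" for i using v_out by (force simp: U_def)
  have U_mono: "U i \<subseteq> U j" if "i \<le> j" for i j using that by (auto simp: U_def)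
  have U_card: "card (U i) = i" if "i \<le> kk" for i
  proof -
    have "v ` U i = {kk - i<..kk}"
    proof
      show "v ` U i \<subseteq> {kk - i<..kk}" using v_le by (auto simp: U_def)
      show "{kk - i<..kk} \<subseteq> v ` U i"
      proof
        fix m assume m: "m \<in> {kk - i<..kk}"
        then have "m \<in> v ` ?B" by (simp add: vB)
        then obtain j where "j \<in> ?B" "v j = m" by blast
        then show "m \<in> v ` U i" using m B(1) by (auto simp: U_def)
      qed
    qed
    moreover have "card (v ` U i) = card (U i)" by (rule card_image[OF inj_on_subset[OF vinj U_B]])
    ultimately show ?thesis using that by simp
  qed
  have U_Int: "card (U i \<inter> U l) = min i l" if "i \<le> kk" "l \<le> kk" for i l
    using U_mono[of i l] U_mono[of l i] U_card[OF that(1)] U_card[OF that(2)]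
    by (cases "i \<le> l") (auto simp: inf.absorb1 inf.absorb2)
  have v_U: "v j = (\<Sum>l\<in>{1..kk}. if j \<in> U l then 1 else 0)" if j: "j \<in> ?N" for j
  proof -
    have "(\<Sum>l\<in>{1..kk}. if j \<in> U l then 1 else 0) = card ({1..kk} \<inter> {l. j \<in> U l})" by (simp add: sum.If_cases)
    also have "{1..kk} \<inter> {l. j \<in> U l} = {Suc (kk - v j)..kk}"
      using j v_le[OF j] by (auto simp: U_def)
    finally show ?thesis using v_le[OF j] by simp
  qed
  \<comment> \<open>The sum over \<open>X\<close> counts the elements of \<open>X\<close> in each
    level set, and equality at level \<open>i\<close> forces \<open>X = U i\<close>.\<close>
  have bound: "sum v X \<le> G i" and bound_eq: "sum v X = G i \<Longrightarrow> X = U i"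
    if X: "X \<subseteq> ?N" "card X = i" "i \<le> kk" for X i
  proof -
    have fX: "finite X" using X(1) finite_subset by blast
    have sv: "sum v X = (\<Sum>l\<in>{1..kk}. card (X \<inter> U l))"
      using v_U X(1) by (intro sum_count[OF fX]) auto
    have fU: "finite (U l)" for l by (simp add: U_def)
    have le: "card (X \<inter> U l) \<le> min i l" if "l \<in> {1..kk}" for l
      using card_mono[OF fX, of "X \<inter> U l"] card_mono[OF fU[of l], of "X \<inter> U l"] U_card[of l] that X(2) by simp
    show "sum v X \<le> G i" unfolding sv G_def by (rule sum_mono) (rule le)
    assume "sum v X = G i"
    then have eq: "(\<Sum>l\<in>{1..kk}. card (X \<inter> U l)) = (\<Sum>l\<in>{1..kk}. min i l)" by (simp add: sv G_def)
    show "X = U i"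
    proof (cases "i = 0")
      case True
      then show ?thesis using X(2) fX U_card[of 0] fU[of 0] by simp
    next
      case False
      then have "i \<in> {1..kk}" using X(3) by simp
      from sum_mono_inv[OF eq le this] have c: "card (X \<inter> U i) = i" by simp
      have "X \<inter> U i = X" by (rule card_subset_eq[OF fX]) (use c X(2) in auto)
      moreover have "X \<inter> U i = U i" by (rule card_subset_eq[OF fU]) (use c U_card[OF X(3)] in auto)
      ultimately show ?thesis by simp
    qed
  qed
  have G_U: "sum v (U i) = G i" if "i \<le> kk" for i
  proof -
    have "sum v (U i) = (\<Sum>l\<in>{1..kk}. card (U i \<inter> U l))"
    proof (rule sum_count)
      show "finite (U i)" using finite_subset[OF U_N] by simp
      fix j assume "j \<in> U i"
      then have "j \<in> ?N" using U_N by blast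
      then show "v j = (\<Sum>l\<in>{1..kk}. if j \<in> U l then 1 else 0)" by (rule v_U)
    qed
    then show ?thesis using U_Int[OF that] by (simp add: G_def)
  qed
  have v_eq: "v j = (\<Sum>i\<in>S. if j \<in> top w i then 1 else 0) + (\<Sum>i\<in>T. if j \<in> top w' i then 1 else 0)"
    if "j \<in> ?N" for j
    using lookup_ld_indicator[OF ST(1), of j w] lookup_ld_indicator[OF ST(2), of j w'] that
    by (simp add: v_def s S_T_def lookup_add)
  have top_N: "top w i \<subseteq> ?N" "top w' i \<subseteq> ?N" for i using perms_top[OF wp] perms_top[OF wp'] by auto
  have top_card: "card (top w i) = i" "card (top w' i) = i" if "i \<le> kk" for i
    using perms_card_top[OF wp, of i] perms_card_top[OF wp', of i] that kk_less_n by auto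
  \<comment> \<open>The sum of squares, here from the level sets and next from the factors of
    \<open>Cm w * Dm w'\<close>, each of which contributes at most \<open>G\<close>.\<close>
  have "(\<Sum>j\<in>?N. v j * v j) = sum G {1..kk}"
    using sum_mult_count[of ?N "{1..kk}" U v v] U_N v_U G_U by (simp del: One_nat_def)
  moreover have "(\<Sum>j\<in>?N. v j * v j) = (\<Sum>i\<in>S. sum v (top w i)) + (\<Sum>i\<in>T. sum v (top w' i))"
  proof -
    have "(\<Sum>j\<in>?N. v j * v j) = (\<Sum>j\<in>?N. v j * (\<Sum>i\<in>S. if j \<in> top w i then 1 else 0) +
        v j * (\<Sum>i\<in>T. if j \<in> top w' i then 1 else 0))"
      by (intro sum.cong refl) (metis v_eq distrib_left)
    also have "\<dots> = (\<Sum>i\<in>S. sum v (top w i)) + (\<Sum>i\<in>T. sum v (top w' i))"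
      unfolding sum.distrib using top_N by (intro arg_cong2[where f = "(+)"] sum_mult_count) auto
    finally show ?thesis .
  qed
  moreover have "sum G {1..kk} = sum G S + sum G (Des w)"
    unfolding S_T_def using sum.subset_diff[OF Des_W[OF w(1)], of G] by simp
  ultimately have tot: "sum G S + sum G (Des w) = (\<Sum>i\<in>S. sum v (top w i)) + (\<Sum>i\<in>T. sum v (top w' i))" by simp
  have bS: "sum v (top w i) \<le> G i" if "i \<in> S" for i
    using bound[OF top_N(1) top_card(1)] that S(1) by auto
  have bT: "sum v (top w' i) \<le> G i" if "i \<in> T" for i
    using bound[OF top_N(2) top_card(2)] that T(1) by auto
  have leS: "(\<Sum>i\<in>S. sum v (top w i)) \<le> sum G S" using bS by (rule sum_mono)
  have leT: "(\<Sum>i\<in>T. sum v (top w' i)) \<le> sum G T" using bT by (rule sum_mono)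
  show "sum G (Des w) \<le> sum G (Des w')" using tot leS leT by (simp add: S_T_def)
  assume E: "sum G (Des w) = sum G (Des w')"
  \<comment> \<open>Equal sums of \<open>G\<close> leave no slack in either estimate, so every
    factor comes from a level set.\<close>
  have eS: "(\<Sum>i\<in>S. sum v (top w i)) = sum G S" and eT: "(\<Sum>i\<in>T. sum v (top w' i)) = sum G T"
    using tot leS leT E by (simp_all add: S_T_def)
  have topS: "top w i = U i" if "i \<in> S" for i
    using bound_eq[OF top_N(1) top_card(1)] sum_mono_inv[OF eS bS that S(2)] that S(1) by auto
  have topT: "top w' i = U i" if "i \<in> T" for i
    using bound_eq[OF top_N(2) top_card(2)] sum_mono_inv[OF eT bT that T(2)] that T(1) by auto
  have v_eq': "v j = (\<Sum>i\<in>S. if j \<in> U i then 1 else 0) + (\<Sum>i\<in>T. if j \<in> U i then 1 else 0)" if "j \<in> ?N" for j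
    unfolding v_eq[OF that] using topS topT by (intro arg_cong2[where f = "(+)"] sum.cong) auto
  \<comment> \<open>Two indices with exponents \<open>kk - i + 1\<close> and \<open>kk - i\<close>
    are separated by the level set \<open>U i\<close> alone. Their exponents differ by one, so
    exactly one factor is indexed by \<open>i\<close>.\<close>
  have "i \<in> T \<longleftrightarrow> i \<notin> S" if i: "i \<in> {1..kk}" for i
  proof -
    have "Suc (kk - i) \<in> v ` ?B" "kk - i \<in> v ` ?B" using i by (auto simp: vB)
    then obtain j j' where j: "j \<in> ?B" "v j = Suc (kk - i)" and j': "j' \<in> ?B" "v j' = kk - i" by force
    have N: "j \<in> ?N" "j' \<in> ?N" using j j' B(1) by auto
    have m: "j \<in> U l \<longleftrightarrow> i \<le> l" "j' \<in> U l \<longleftrightarrow> i < l" if "l \<in> {1..kk}" for l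
      using N i that j(2) j'(2) by (auto simp: U_def)
    have "Suc (kk - i) = (\<Sum>l\<in>S. if i \<le> l then 1 else 0) + (\<Sum>l\<in>T. if i \<le> l then 1 else 0)"
      unfolding j(2)[symmetric] v_eq'[OF N(1)] using m(1) S T
      by (intro arg_cong2[where f = "(+)"] sum.cong) auto
    moreover have "kk - i = (\<Sum>l\<in>S. if i < l then 1 else 0) + (\<Sum>l\<in>T. if i < l then 1 else 0)"
      unfolding j'(2)[symmetric] v_eq'[OF N(2)] using m(2) S T
      by (intro arg_cong2[where f = "(+)"] sum.cong) auto
    ultimately have "(if i \<in> S then 1 else 0 :: nat) + (if i \<in> T then 1 else 0) = 1"
      using sum_indicator_diff[OF S(2), of i] sum_indicator_diff[OF T(2), of i] by linarith
    then show ?thesis by (cases "i \<in> S"; cases "i \<in> T") simp_all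
  qed
  then have TD: "T = Des w" using T(1) Des_W[OF w(1)] by (auto simp: S_T_def)
  have compl: "(\<Sum>j\<in>X. n - j) + (\<Sum>j\<in>X. j) = n * card X" if "X \<subseteq> ?N" for X
  proof -
    have "(\<Sum>j\<in>X. n - j) + (\<Sum>j\<in>X. j) = (\<Sum>j\<in>X. n)"
      unfolding sum.distrib[symmetric] using that by (intro sum.cong) auto
    then show ?thesis by simp
  qed
  \<comment> \<open>For \<open>i\<close> in \<open>S\<close> the set \<open>top w i\<close> is
    \<open>U i\<close>. The word \<open>w'\<close> sorts the exponent of \<open>Dm w'\<close>, on
    which \<open>U i\<close> and \<open>top w' i\<close> have equal sums, so the tie-break in
    \<open>hat\<close> compares the sums of \<open>n - j\<close>.\<close>
  have A: "(\<Sum>j\<in>top w' i. j) \<le> (\<Sum>j\<in>top w i. j)"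
      and A_eq: "(\<Sum>j\<in>top w' i. j) = (\<Sum>j\<in>top w i. j) \<Longrightarrow> top w i = top w' i" if i: "i \<in> S" for i
  proof -
    have ik: "i \<le> kk" using i S by auto
    let ?s = "ld w' (\<lambda>i. if i \<in> T then 1 else 0)"
    have dec: "decr w' (hat ?s)" using wp' by (intro decr_ld) (auto simp: S_T_def)
    have dw: "distinct w'" and sw: "set w' = ?N" using wp' by (auto simp: perms_def)
    have look: "sum (lookup ?s) X = (\<Sum>l\<in>T. card (X \<inter> top w' l))" if "X \<subseteq> ?N" for X
      using that finite_subset[OF that] lookup_ld_indicator[OF ST(2), of _ w'] by (intro sum_count) auto
    have "sum (lookup ?s) (U i) = (\<Sum>l\<in>T. min i l)"
      unfolding look[OF U_N] using topT U_Int[OF ik] T(1) by (intro sum.cong) auto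
    moreover have "sum (lookup ?s) (top w' i) = (\<Sum>l\<in>T. min i l)"
      unfolding look[OF top_N(2)] using card_top_Int[OF dw, of i] ik T(1) kk_less_n perms_length[OF wp']
      by (intro sum.cong) auto
    moreover note st = sum_top[OF dw dec, of "U i", unfolded sw U_card[OF ik], OF U_N]
    ultimately have 1: "(\<Sum>j\<in>U i. n - j) \<le> (\<Sum>j\<in>top w' i. n - j)"
      and 2: "(\<Sum>j\<in>U i. n - j) = (\<Sum>j\<in>top w' i. n - j) \<Longrightarrow> U i = top w' i"
      by (simp_all add: sum_hat)
    note c = compl[OF U_N, of i, unfolded U_card[OF ik]] compl[OF top_N(2), of i, unfolded top_card(2)[OF ik]]
    show "(\<Sum>j\<in>top w' i. j) \<le> (\<Sum>j\<in>top w i. j)" unfolding topS[OF i] using 1 c by linarith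
    assume "(\<Sum>j\<in>top w' i. j) = (\<Sum>j\<in>top w i. j)"
    then have "(\<Sum>j\<in>U i. n - j) = (\<Sum>j\<in>top w' i. n - j)" unfolding topS[OF i] using c by linarith
    from 2[OF this] show "top w i = top w' i" unfolding topS[OF i] .
  qed
  \<comment> \<open>For \<open>i\<close> in \<open>T\<close> the set \<open>top w' i\<close> is
    \<open>U i\<close>. Along the first \<open>kk + 1\<close> letters of \<open>w\<close>, the
    exponent of \<open>Cm w\<close> drops at non-descents and the letters themselves drop at
    descents. So \<open>w\<close> sorts \<open>f\<close>, which breaks ties in favour of larger
    letters.\<close>
  have A': "(\<Sum>j\<in>top w' i. j) \<le> (\<Sum>j\<in>top w i. j)"
      and A'_eq: "(\<Sum>j\<in>top w' i. j) = (\<Sum>j\<in>top w i. j) \<Longrightarrow> top w i = top w' i" if i: "i \<in> T" for i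
  proof -
    have ik: "i \<le> kk" using i T by auto
    define c where "c j = (\<Sum>l\<in>S. if j \<in> top w l then 1 else 0 :: nat)" for j
    define f where "f j = (n + 1) * c j + j" for j
    let ?w = "take (Suc kk) w"
    have len: "length ?w = Suc kk" using perms_length[OF wp] kk_less_n by simp
    have dw: "distinct ?w" "distinct w" using wp by (auto simp: perms_def)
    have sumf: "sum f X = (n + 1) * (\<Sum>l\<in>S. card (X \<inter> top w l)) + (\<Sum>j\<in>X. j)" if "X \<subseteq> ?N" for X
    proof -
      have "sum c X = (\<Sum>l\<in>S. card (X \<inter> top w l))"
        using finite_subset[OF that] by (intro sum_count) (auto simp: c_def)
      then show ?thesis unfolding f_def sum.distrib sum_distrib_left[symmetric] by simp
    qed
    have "decr ?w f"
    proof (rule decr_adjacentI)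
      fix p assume "Suc p < length ?w"
      then have p: "Suc p \<le> kk" "Suc p < n" "p < n" using len kk_less_n by auto
      have c1: "c (w ! p) = c (w ! Suc p) + (if Suc p \<in> S then 1 else 0)"
        unfolding c_def perms_nth_top[OF wp p(2)] perms_nth_top[OF wp p(3)] Suc_le_eq[symmetric]
        using sum_indicator_diff[OF S(2), of "Suc p"] by (simp add: Suc_le_eq)
      have "f (w ! Suc p) < f (w ! p)"
      proof (cases "Suc p \<in> S")
        case True
        have "w ! Suc p \<le> n" using perms_nth[OF wp p(2)] by simp
        then show ?thesis using True c1 by (simp add: f_def)
      next
        case False
        then have "Suc p \<in> Des w" using p(1) by (auto simp: S_T_def)
        then show ?thesis using False c1 by (simp add: f_def Des_def)
      qed
      then show "f (?w ! Suc p) < f (?w ! p)" using p by simp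
    qed
    moreover have "top ?w i = top w i" using ik by (simp add: top_def min_def)
    moreover have "U i \<subseteq> set ?w" using U_B by (simp add: top_def)
    ultimately have st: "sum f (U i) \<le> sum f (top w i)" "sum f (U i) = sum f (top w i) \<Longrightarrow> U i = top w i"
      using sum_top[OF dw(1), of f "U i"] U_card[OF ik] by auto
    have "(\<Sum>l\<in>S. card (U i \<inter> top w l)) = (\<Sum>l\<in>S. min i l)"
      using topS U_Int[OF ik] S(1) by (intro sum.cong) auto
    moreover have "(\<Sum>l\<in>S. card (top w i \<inter> top w l)) = (\<Sum>l\<in>S. min i l)"
      using card_top_Int[OF dw(2), of i] ik S(1) kk_less_n perms_length[OF wp] by (intro sum.cong) auto
    ultimately have 1: "(\<Sum>j\<in>U i. j) \<le> (\<Sum>j\<in>top w i. j)"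
      and 2: "(\<Sum>j\<in>U i. j) = (\<Sum>j\<in>top w i. j) \<Longrightarrow> U i = top w i"
      using st sumf[OF U_N, of i] sumf[OF top_N(1), of i] by simp_all
    show "(\<Sum>j\<in>top w' i. j) \<le> (\<Sum>j\<in>top w i. j)" unfolding topT[OF i] by (rule 1)
    assume "(\<Sum>j\<in>top w' i. j) = (\<Sum>j\<in>top w i. j)"
    from 2[OF this[unfolded topT[OF i]]] show "top w i = top w' i" unfolding topT[OF i] by (rule sym)
  qed
  have ST_cover: "i \<in> S \<or> i \<in> T" if "i \<in> {1..kk}" for i using that TD by (auto simp: S_T_def)
  have le: "(\<Sum>j\<in>top w' i. j) \<le> (\<Sum>j\<in>top w i. j)" if "i \<in> {1..kk}" for i
    using ST_cover[OF that] A A' by blast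
  have "w' = w" if "Q w' = Q w"
  proof (rule W_eqI[OF w(2,1)])
    have "top w i = top w' i" if "i \<le> kk" for i
    proof (cases "i = 0")
      case True then show ?thesis by (simp add: top_def)
    next
      case False
      then have i: "i \<in> {1..kk}" using that by simp
      have "(\<Sum>j\<in>top w' i. j) = (\<Sum>j\<in>top w i. j)"
        using sum_mono_inv[OF \<open>Q w' = Q w\<close>[unfolded Q_def] le i] by simp
      then show ?thesis using ST_cover[OF i] A_eq A'_eq by blast
    qed
    then show "take kk w' = take kk w"
      using wp wp' perms_length kk_less_n by (intro top_eq_imp_take_eq) (auto simp: perms_def)
  qed
  moreover have "Q w' \<le> Q w" unfolding Q_def by (rule sum_mono) (rule le)
  ultimately show "Q w' \<le> Q w \<and> (Q w' = Q w \<longrightarrow> w' = w)" by blast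
qed

lemma pairing_triangular:
  assumes w: "w \<in> W" "w' \<in> W" "w' \<noteq> w" and ne: "pairing w (\<Phi> (Cm w * Dm w')) \<noteq> (0 :: 'k::field)"
  shows "sum G (Des w) < sum G (Des w') \<or> sum G (Des w) = sum G (Des w') \<and> Q w' < Q w"
proof -
  let ?s = "ld w (\<lambda>i. if i \<in> {1..kk} - Des w then 1 else 0) + ld w' (\<lambda>i. if i \<in> Des w' then 1 else 0)"
  have "alt w ?s \<noteq> (0 :: 'k)" using ne unfolding \<Phi>_Cm_Dm pairing_single by simp
  then have "alternating w ?s" unfolding alt_def by meson
  from alternating_Cm_Dm[OF w(1,2) refl this] show ?thesis using w(3) by linarith
qed

end

section \<open>Rank-fixed ideals and the level property\<close>

section \<open>Level rings\<close>

text \<open>Adding one element at a time gives a chain of this length, and along any chain the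
  cardinality grows at each step.\<close>

lemma poset_rank_boolean_lattice:
  assumes "A \<subseteq> {1..n}" shows "poset_rank (boolean_lattice n) A = card A"
  unfolding poset_rank_def
proof (rule Greatest_equality)
  have "finite A" using assms finite_subset by blast
  then obtain w where w: "set w = A" "distinct w" using finite_distinct_list by blast
  have len: "length w = card A" using w distinct_card by fastforce
  show "\<exists>c. (\<forall>i\<le>card A. c i \<in> boolean_lattice n) \<and> (\<forall>i<card A. c i < c (Suc i)) \<and> c (card A) = A"
  proof (intro exI[of _ "top w"] conjI allI impI)
    fix i
    show "top w i \<in> boolean_lattice n" using top_subset[of w i] w(1) assms by (auto simp: boolean_lattice_def)
    assume "i < card A"
    then have "card (top w i) \<noteq> card (top w (Suc i))" using w(2) len by (simp add: card_top)
    then have "top w i \<noteq> top w (Suc i)" by metis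
    then show "top w i < top w (Suc i)" using top_mono[of i "Suc i" w] by auto
  qed (simp add: top_def w flip: len)
  fix r assume "\<exists>c. (\<forall>i\<le>r. c i \<in> boolean_lattice n) \<and> (\<forall>i<r. c i < c (Suc i)) \<and> c r = A"
  then obtain c where c: "\<And>i. i \<le> r \<Longrightarrow> c i \<subseteq> {1..n}" "\<And>i. i < r \<Longrightarrow> c i \<subset> c (Suc i)" "c r = A"
    by (auto simp: boolean_lattice_def)
  have "i \<le> card (c i)" if "i \<le> r" for i
    using that
  proof (induction i)
    case (Suc i)
    have "finite (c (Suc i))" using c(1)[OF Suc.prems] finite_subset by blast
    then have "card (c i) < card (c (Suc i))" using c(2)[of i] Suc.prems by (intro psubset_card_mono) auto
    then show ?case using Suc by simp
  qed simp
  from this[of r] show "r \<le> card A" by (simp add: c(3))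
qed

text \<open>Every element of \<open>I\<close> lies above a minimal one, so \<open>I\<close> consists
  of the sets with at least \<open>r\<close> elements. The minimum of \<open>r\<close> and
  \<open>n + 1\<close> covers empty \<open>I\<close>.\<close>

lemma rank_fixed_boolean_lattice:
  assumes "rank_fixed (boolean_lattice n) I"
  obtains D where "D \<le> n + 1" "boolean_lattice n - I = {A. A \<subseteq> {1..n} \<and> card A < D}"
proof -
  obtain r where doi: "dual_order_ideal (boolean_lattice n) I"
      and r: "minimal_elements I = {A \<in> boolean_lattice n. poset_rank (boolean_lattice n) A = r}"
    using assms by (auto simp: rank_fixed_def)
  have sub: "I \<subseteq> Pow {1..n}" using doi by (simp add: dual_order_ideal_def boolean_lattice_def)
  have r': "minimal_elements I = {A. A \<subseteq> {1..n} \<and> card A = r}"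
    unfolding r using poset_rank_boolean_lattice[of _ n] by (auto simp: boolean_lattice_def)
  have "A \<in> I \<longleftrightarrow> r \<le> card A" if A: "A \<subseteq> {1..n}" for A
  proof
    assume "A \<in> I"
    moreover have "finite I" using sub finite_subset by blast
    ultimately obtain B where B: "B \<in> I" "B \<subseteq> A" "\<forall>C\<in>I. C \<le> B \<longrightarrow> B = C"
      using finite_has_minimal2[of I A] by blast
    then have "B \<in> minimal_elements I" by (auto simp: minimal_elements_def)
    then have "card B = r" by (simp add: r')
    then show "r \<le> card A" using card_mono[OF finite_subset[OF A] B(2)] by simp
  next
    assume "r \<le> card A"
    then obtain B where B: "B \<subseteq> A" "card B = r" using obtain_subset_with_card_n by metis
    then have "B \<in> minimal_elements I" using A by (auto simp: r')
    then have "B \<in> I" by (simp add: minimal_elements_def)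
    then show "A \<in> I" using doi A B(1) by (auto simp: dual_order_ideal_def boolean_lattice_def)
  qed
  moreover have "card A \<le> n" if "A \<subseteq> {1..n}" for A using card_mono[OF _ that] by simp
  ultimately have "boolean_lattice n - I = {A. A \<subseteq> {1..n} \<and> card A < min r (n + 1)}"
    unfolding boolean_lattice_def by (auto simp: less_Suc_eq_le not_le)
  then show ?thesis using that[of "min r (n + 1)"] by simp
qed

context truncated_boolean
begin

lemma ideal_J: "ideal (J :: (nat set, 'k::field) mpoly set) (mpoly_ring P)"
proof -
  interpret S: cring "mpoly_ring P :: (nat set, 'k) mpoly ring" by (rule cring_mpoly_ring)
  have sub: "J \<subseteq> (polys P :: (nat set, 'k) mpoly set)" by (auto simp: J_def)
  show ?thesis
  proof (rule idealI)
    show "ring (mpoly_ring P :: (nat set, 'k) mpoly ring)" by (rule S.ring_axioms)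
    show "subgroup (J :: (nat set, 'k) mpoly set) (add_monoid (mpoly_ring P))"
    proof (rule S.add.subgroupI)
      show "(J :: (nat set, 'k) mpoly set) \<subseteq> carrier (mpoly_ring P)" using sub by simp
      show "(J :: (nat set, 'k) mpoly set) \<noteq> {}" using J_zero by blast
      fix p :: "(nat set, 'k) mpoly" assume p: "p \<in> J"
      then have "- p \<in> J" using Bd_uminus by (auto simp: J_def)
      moreover have "\<ominus>\<^bsub>mpoly_ring P\<^esub> p = - p"
        using p sub by (intro S.minus_equality) auto
      ultimately show "\<ominus>\<^bsub>mpoly_ring P\<^esub> p \<in> J" by simp
      fix q :: "(nat set, 'k) mpoly" assume "q \<in> J"
      then show "p \<oplus>\<^bsub>mpoly_ring P\<^esub> q \<in> J" using J_add[OF p] by simp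
    qed
    fix a x :: "(nat set, 'k) mpoly" assume "a \<in> J" "x \<in> carrier (mpoly_ring P)"
    then show "x \<otimes>\<^bsub>mpoly_ring P\<^esub> a \<in> J" "a \<otimes>\<^bsub>mpoly_ring P\<^esub> x \<in> J"
      using J_mult[of x a] by (simp_all add: mult.commute)
  qed
qed

text \<open>The relations lie in \<open>J\<close>; conversely straightening is applied with the
  ideal of the relations as \<open>I\<close>.\<close>

lemma poset_ideal_P: "poset_ideal P = (J :: (nat set, 'k::field) mpoly set)"
proof -
  interpret S: cring "mpoly_ring P :: (nat set, 'k) mpoly ring" by (rule cring_mpoly_ring)
  let ?G = "{poset_relation P A B | A B. A \<in> P \<and> B \<in> P} :: (nat set, 'k) mpoly set"
  have GJ: "?G \<subseteq> J" using poset_relation_in_J by auto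
  have GS: "?G \<subseteq> carrier (mpoly_ring P)" using GJ by (auto simp: J_def)
  interpret I: ideal "poset_ideal P" "mpoly_ring P :: (nat set, 'k) mpoly ring"
    unfolding poset_ideal_def by (rule S.genideal_ideal[OF GS])
  have rel: "poset_relation P A B \<in> (poset_ideal P :: (nat set, 'k) mpoly set)" if "A \<in> P" "B \<in> P" for A B
    using S.genideal_self[OF GS] that unfolding poset_ideal_def by blast
  have "J \<subseteq> (poset_ideal P :: (nat set, 'k) mpoly set)"
  proof (rule J_subset_ideal)
    show "0 \<in> (poset_ideal P :: (nat set, 'k) mpoly set)" using I.zero_closed by simp
    show "p + q \<in> poset_ideal P" if "p \<in> poset_ideal P" "q \<in> poset_ideal P" for p q :: "(nat set, 'k) mpoly"
      using I.a_closed[OF that] by simp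
    show "p * q \<in> poset_ideal P" if "p \<in> polys P" "q \<in> poset_ideal P" for p q :: "(nat set, 'k) mpoly"
      using I.I_l_closed[of q p] that by simp
  qed (rule rel)
  moreover have "poset_ideal P \<subseteq> (J :: (nat set, 'k) mpoly set)"
    unfolding poset_ideal_def by (rule S.genideal_minimal[OF ideal_J GJ])
  ultimately show ?thesis by blast
qed

lemma poset_relation_homogeneous:
  "A \<in> P \<Longrightarrow> B \<in> P \<Longrightarrow> homogeneous 2 (poset_relation P A B :: (nat set, 'k::field) mpoly)"
  by (auto simp: poset_relation_P intro!: homogeneous_diff homogeneous_mult_eq[OF homogeneous_Var homogeneous_Var])

lemma standard_graded_presentation_P:
  "standard_graded_presentation P (poset_ideal P :: (nat set, 'k::field) mpoly set)"
proof -
  let ?G = "{poset_relation P A B | A B. A \<in> P \<and> B \<in> P} :: (nat set, 'k) mpoly set"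
  have "\<Phi> 1 \<notin> (Bd :: (nat, 'k) mpoly set)" by (simp add: Bd_def good_def)
  then have "1 \<notin> (J :: (nat set, 'k) mpoly set)" unfolding J_def by blast
  moreover have "1 \<in> (polys P :: (nat set, 'k) mpoly set)" by simp
  ultimately have "poset_ideal P \<noteq> carrier (mpoly_ring P :: (nat set, 'k) mpoly ring)"
    unfolding poset_ideal_P carrier_mpoly_ring by blast
  moreover have "?G \<subseteq> carrier (mpoly_ring P)" using poset_relation_in_J by (auto simp: J_def)
  moreover have "\<forall>g\<in>?G. \<exists>d. homogeneous d g" using poset_relation_homogeneous by blast
  ultimately show ?thesis 
    unfolding standard_graded_presentation_def
    by (intro conjI exI[of _ ?G]) (simp_all only: finite_P poset_ideal_def not_False_eq_True)
qed

text \<open>The inverse substitution: each \<open>\<theta> i\<close> with \<open>i < D\<close>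
  contains exactly one variable of \<open>V0\<close>, with coefficient 1, and is solved for
  it.\<close>

definition gf :: "nat set \<Rightarrow> (nat set, 'k::field) mpoly" where
  "gf A = (if A \<in> V0 then Var A - (\<Sum>B\<in>{B\<in>P. card B = card A} - {A}. Var B) else Var A)"

lemma V0_card_eq: "A \<in> V0 \<Longrightarrow> B \<in> V0 \<Longrightarrow> card A = card B \<Longrightarrow> A = B"
  by (auto simp: V0_def)

lemma \<theta>_remove:
  assumes "A \<in> P" shows "\<theta> (card A) = Var A + (\<Sum>B\<in>{B\<in>P. card B = card A} - {A}. Var B)"
  unfolding \<theta>_def using assms by (intro sum.remove) auto

lemma linear_automorphism_P: "linear_automorphism P tf (gf :: nat set \<Rightarrow> (nat set, 'k::field) mpoly)"
proof
  fix A assume A: "A \<in> P"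
  show "tf A \<in> (polys P :: (nat set, 'k) mpoly set)" by (rule tf_polys[OF A])
  show "homogeneous 1 (tf A :: (nat set, 'k) mpoly)" by (rule tf_homogeneous)
  show "gf A \<in> (polys P :: (nat set, 'k) mpoly set)" unfolding gf_def using A by (auto intro!: polys_diff polys_sum)
  show "homogeneous 1 (gf A :: (nat set, 'k) mpoly)"
    unfolding gf_def by (auto intro!: homogeneous_diff homogeneous_sum)
  let ?C = "{B\<in>P. card B = card A} - {A}"
  have out: "B \<notin> V0" if "A \<in> V0" "B \<in> ?C" for B using V0_card_eq[OF that(1), of B] that(2) by auto
  show "psubst gf (tf A) = (Var A :: (nat set, 'k) mpoly)"
  proof (cases "A \<in> V0")
    case True
    have "(\<Sum>B\<in>?C. gf B) = (\<Sum>B\<in>?C. Var B :: (nat set, 'k) mpoly)"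
      using out[OF True] by (intro sum.cong) (auto simp: gf_def)
    then show ?thesis using True unfolding tf_def by (simp add: \<theta>_remove[OF A]) (simp add: gf_def)
  qed (simp add: tf_def gf_def)
  show "\<tau> (gf A) = (Var A :: (nat set, 'k) mpoly)"
  proof (cases "A \<in> V0")
    case True
    have "(\<Sum>B\<in>?C. tf B) = (\<Sum>B\<in>?C. Var B :: (nat set, 'k) mpoly)"
      using out[OF True] by (intro sum.cong) (auto simp: tf_def)
    moreover have "tf A = Var A + (\<Sum>B\<in>?C. Var B :: (nat set, 'k) mpoly)"
      using True by (simp add: tf_def \<theta>_remove[OF A])
    ultimately show ?thesis using True by (simp add: gf_def)
  qed (simp add: tf_def gf_def)
qed

text \<open>The increasing word has no descents; it contributes the basis element 1.\<close>

lemma W_nonempty: "W \<noteq> {}"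
proof -
  have "Des [1..<n + 1] = {}" by (auto simp: Des_def nth_append)
  moreover have "[1..<n + 1] \<in> perms" by (auto simp: perms_def)
  ultimately have "[1..<n + 1] \<in> W" by (simp add: W_def)
  then show ?thesis by blast
qed

text \<open>The defining ideal in coordinates where the parameters are the variables in
  \<open>V0\<close>.\<close>

definition J' :: "(nat set, 'k::field) mpoly set" where
  "J' = {p \<in> polys P. \<tau> p \<in> J}"

text \<open>\<open>J_span\<close> and \<open>J_indep\<close>, read in the new coordinates and with
  the words enumerated by a list.\<close>

lemma free_basis_P:
  assumes ws: "distinct ws" "set ws = W"
  shows "free_basis P V0 (J' :: (nat set, 'k::field) mpoly set) (length ws)
    (\<lambda>j. psubst gf (Dm (ws ! j))) (\<lambda>j. int (card (Des (ws ! j))))"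
proof -
  interpret la: linear_automorphism P tf "gf :: nat set \<Rightarrow> (nat set, 'k) mpoly" by (rule linear_automorphism_P)
  have wsW: "ws ! j \<in> W" if "j < length ws" for j using that nth_mem ws(2) by blast
  have bij: "bij_betw ((!) ws) {..<length ws} W" using bij_betw_nth[OF ws(1) refl ws(2)[symmetric]] .
  have \<tau>mb: "\<tau> (psubst gf (Dm (ws ! j))) = (Dm (ws ! j) :: (nat set, 'k) mpoly)" if "j < length ws" for j
    by (rule la.\<tau>_\<sigma>[OF Dm_polys[OF wsW[OF that]]])
  have comb_eq: "\<tau> (\<Sum>j<length ws. a (ws ! j) * psubst gf (Dm (ws ! j))) = comb a" for a :: "nat list \<Rightarrow> (nat set, 'k) mpoly"
  proof -
    have "\<tau> (\<Sum>j<length ws. a (ws ! j) * psubst gf (Dm (ws ! j))) = (\<Sum>j<length ws. \<tau> (a (ws ! j)) * Dm (ws ! j))"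
      using \<tau>mb by simp
    also have "\<dots> = comb a" unfolding comb_def by (rule sum.reindex_bij_betw[OF bij])
    finally show ?thesis .
  qed
  show ?thesis
  proof
    show "finite P" "V0 \<subseteq> P" by (simp_all add: V0_P)
    show "J' \<subseteq> (polys P :: (nat set, 'k) mpoly set)" by (auto simp: J'_def)
    show "0 \<in> (J' :: (nat set, 'k) mpoly set)" by (simp add: J'_def J_zero)
    show "p + q \<in> J'" if "p \<in> J'" "q \<in> J'" for p q :: "(nat set, 'k) mpoly"
      using that by (simp add: J'_def J_add)
    show "p * q \<in> J'" if "p \<in> polys P" "q \<in> J'" for p q :: "(nat set, 'k) mpoly"
      using that by (simp add: J'_def J_mult \<tau>_polys)
    show "psubst gf (Dm (ws ! j)) \<in> (polys P :: (nat set, 'k) mpoly set)" if "j < length ws" for j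
      by (rule la.\<sigma>_polys[OF Dm_polys[OF wsW[OF that]]])
    show "homogeneous (int (card (Des (ws ! j)))) (psubst gf (Dm (ws ! j)) :: (nat set, 'k) mpoly)" if "j < length ws" for j
      by (rule la.\<sigma>_homogeneous[OF Dm_polys[OF wsW[OF that]] Dm_homogeneous])
  next
    fix p :: "(nat set, 'k) mpoly" and m assume p: "p \<in> polys P" "homogeneous m p"
    obtain a where a: "\<And>w. w \<in> W \<Longrightarrow> a w \<in> polys V0 \<and> homogeneous (m - int (card (Des w))) (a w)"
        and aJ: "\<tau> p - comb a \<in> J"
      using J_span[OF \<tau>_polys[OF p(1)] la.\<tau>_homogeneous[OF p]] by blast
    have aP: "a w \<in> polys P" if "w \<in> W" for w using a[OF that] polys_mono[OF V0_P] by blast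
    have "(\<Sum>j<length ws. a (ws ! j) * psubst gf (Dm (ws ! j))) \<in> polys P"
      using aP wsW la.\<sigma>_polys Dm_polys by (intro polys_sum polys_mult) auto
    then have "p - (\<Sum>j<length ws. a (ws ! j) * psubst gf (Dm (ws ! j))) \<in> J'"
      using p(1) aJ unfolding J'_def by (simp only: mem_Collect_eq psubst_diff comb_eq polys_diff simp_thms)
    then show "\<exists>a. (\<forall>j<length ws. a j \<in> polys V0 \<and> homogeneous (m - int (card (Des (ws ! j)))) (a j)) \<and>
        p - (\<Sum>j<length ws. a j * psubst gf (Dm (ws ! j))) \<in> J'"
      using a wsW by (intro exI[of _ "\<lambda>j. a (ws ! j)"]) blast
  next
    fix a :: "nat \<Rightarrow> (nat set, 'k) mpoly" and j
    assume a: "\<And>j. j < length ws \<Longrightarrow> a j \<in> polys V0" and aJ: "(\<Sum>j<length ws. a j * psubst gf (Dm (ws ! j))) \<in> J'"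
      and j: "j < length ws"
    \<comment> \<open>Coefficients are indexed by positions here but by words in
      \<open>J_indep\<close>.\<close>
    define ix where "ix = inv_into {..<length ws} ((!) ws)"
    have ix: "ix (ws ! i) = i" if "i < length ws" for i
      unfolding ix_def using bij that by (intro inv_into_f_f) (auto simp: bij_betw_def)
    have ixW: "ix w < length ws" if "w \<in> W" for w
    proof -
      have "w \<in> set ws" using that ws(2) by simp
      then obtain i where i: "i < length ws" "ws ! i = w" unfolding in_set_conv_nth by blast
      show ?thesis using ix[OF i(1)] i by simp
    qed
    have "(\<Sum>j<length ws. a j * psubst gf (Dm (ws ! j))) = (\<Sum>j<length ws. a (ix (ws ! j)) * psubst gf (Dm (ws ! j)))"
      using ix by (intro sum.cong) auto
    then have "comb (\<lambda>w. a (ix w)) \<in> J" using aJ comb_eq[of "\<lambda>w. a (ix w)"] by (simp add: J'_def)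
    from J_indep[OF _ this wsW[OF j]] show "a j = 0" using a ixW ix[OF j] by simp
  qed
qed

lemma lookup_\<theta>_0: "lookup (\<theta> i :: (nat set, 'k::field) mpoly) 0 = 0"
proof (rule ccontr)
  assume "lookup (\<theta> i :: (nat set, 'k) mpoly) 0 \<noteq> 0"
  then have "0 \<in> keys (\<theta> i :: (nat set, 'k) mpoly)" by (simp add: in_keys_iff)
  moreover have "homogeneous 1 (\<theta> i :: (nat set, 'k) mpoly)" by (rule \<theta>_homogeneous)
  ultimately show False by (force simp: homogeneous_def)
qed

lemma level_algebra_P: "level_algebra P (poset_ideal P :: (nat set, 'k::field) mpoly set)"
proof -
  obtain ws where ws: "distinct ws" "set ws = W" using finite_distinct_list[OF finite_W] by blast
  let ?dg = "\<lambda>j. int (card (Des (ws ! j)))"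
  let ?b = "length ws"
  have la: "linear_automorphism P tf (gf :: nat set \<Rightarrow> (nat set, 'k) mpoly)" by (rule linear_automorphism_P)
  interpret la: linear_automorphism P tf "gf :: nat set \<Rightarrow> (nat set, 'k) mpoly" by (rule la)
  let ?mb = "\<lambda>j. psubst gf (Dm (ws ! j)) :: (nat set, 'k) mpoly"
  interpret fb: free_basis P V0 "J' :: (nat set, 'k) mpoly set" ?b ?mb ?dg
    by (rule free_basis_P[OF ws])
  interpret S: cring "mpoly_ring P :: (nat set, 'k) mpoly ring" by (rule cring_mpoly_ring)
  interpret J: ideal J "mpoly_ring P :: (nat set, 'k) mpoly ring" by (rule ideal_J)
  have b: "?b > 0" using W_nonempty ws(2) by auto
  have wsW: "ws ! j \<in> W" if "j < ?b" for j using that nth_mem ws(2) by blast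
  let ?R = "mpoly_ring P Quot (J :: (nat set, 'k) mpoly set)"
  \<comment> \<open>Composed with \<tau>, the projection has kernel \<open>J'\<close> and sends the
    variables in \<open>V0\<close> to the classes of the parameters.\<close>
  define h where "h p = J +>\<^bsub>mpoly_ring P\<^esub> \<tau> p" for p :: "(nat set, 'k) mpoly"
  have J_sub: "J \<subseteq> (polys P :: (nat set, 'k) mpoly set)" by (auto simp: J_def)
  have "\<tau> \<in> ring_hom (mpoly_ring P) (mpoly_ring P :: (nat set, 'k) mpoly ring)"
    by (rule ring_hom_memI) (auto simp: \<tau>_polys)
  moreover have "h = (+>\<^bsub>mpoly_ring P\<^esub>) J \<circ> \<tau>" by (simp add: fun_eq_iff h_def)
  ultimately have hom: "h \<in> ring_hom (mpoly_ring P) ?R" using ring_hom_trans[OF _ J.rcos_ring_hom] by blast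
  have surj: "h ` polys P = carrier ?R"
  proof -
    have "\<tau> ` polys P = (polys P :: (nat set, 'k) mpoly set)"
    proof
      show "\<tau> ` polys P \<subseteq> (polys P :: (nat set, 'k) mpoly set)" using \<tau>_polys by auto
      show "polys P \<subseteq> \<tau> ` (polys P :: (nat set, 'k) mpoly set)"
        using la.\<sigma>_polys la.\<tau>_\<sigma> by (metis image_eqI subsetI)
    qed
    then have "h ` polys P = (\<lambda>p. J +>\<^bsub>mpoly_ring P\<^esub> p) ` polys P" unfolding h_def by (metis image_image)
    then show ?thesis by (auto simp: FactRing_def A_RCOSETS_def')
  qed
  have ker: "h p = \<zero>\<^bsub>?R\<^esub> \<longleftrightarrow> p \<in> J'" if p: "p \<in> polys P" for p :: "(nat set, 'k) mpoly"
  proof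
    assume "h p = \<zero>\<^bsub>?R\<^esub>"
    then have "J +>\<^bsub>mpoly_ring P\<^esub> \<tau> p = J" by (simp add: h_def FactRing_def)
    then have "\<tau> p \<in> J" by (rule J.rcos_const_imp_mem[rotated]) (simp add: \<tau>_polys p)
    then show "p \<in> J'" using p by (simp add: J'_def)
  next
    assume "p \<in> J'"
    then have "\<tau> p \<in> J" by (simp add: J'_def)
    then show "h p = \<zero>\<^bsub>?R\<^esub>" by (simp add: h_def FactRing_def J.a_rcos_const)
  qed
  have irr: "h ` Var ` V0 \<subseteq> irrelevant_ideal P J"
  proof
    fix x assume "x \<in> h ` Var ` V0"
    then obtain i where i: "i < D" "x = h (Var {1..i})" unfolding V0_def by blast
    have "x = J +>\<^bsub>mpoly_ring P\<^esub> \<theta> i" unfolding i(2) h_def psubst_Var tf_V0[OF i(1)] ..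
    then show "x \<in> irrelevant_ideal P J"
      unfolding irrelevant_ideal_def carrier_mpoly_ring using \<theta>_polys[of i] lookup_\<theta>_0[of i] by blast
  qed
  note dim = fb.depth_eq_krull_dim[OF J.quotient_is_cring[OF S.cring_axioms] hom surj ker _ b irr]
  have cm: "cohen_macaulay P (J :: (nat set, 'k) mpoly set)"
    unfolding cohen_macaulay_def by (simp add: dim)
  \<comment> \<open>This number is also the length of the Koszul complex, so its last module is the
    one that computes the canonical module.\<close>
  have codim: "codim P (J :: (nat set, 'k) mpoly set) = card (P - V0)"
    unfolding codim_def using dim(1) V0_P by (simp add: card_Diff_subset finite_subset[OF V0_P])
  let ?F = "map_resolution \<tau> fb.resln"
  have res: "graded_free_resolution P J ?F"
    by (rule la.graded_free_resolution_map[OF fb.graded_free_resolution_resln J_sub]) (simp add: J'_def)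
  \<comment> \<open>Words with more descents come first, because \<open>dual_generated\<close> does
    not control coordinates of higher degree. Then come larger sums of \<open>G\<close> and smaller
    \<open>Q\<close>, as in \<open>pairing_triangular\<close>; the subtractions turn "larger first"
    into a decreasing measure.\<close>
  define r where "r = measures [\<lambda>j. kk - card (Des (ws ! j)), \<lambda>j. sum G {1..kk} - sum G (Des (ws ! j)), \<lambda>j. Q (ws ! j)]"
  have card_le: "card (Des (ws ! j)) \<le> kk" and G_le: "sum G (Des (ws ! j)) \<le> sum G {1..kk}" if "j < ?b" for j
    using card_mono[OF _ Des_W[OF wsW[OF that]]] sum_mono2[OF _ Des_W[OF wsW[OF that]], of G] by auto
  have "\<exists>p \<phi>. fb.pairs_with (int kk) r j p \<phi>" if j: "j < ?b" for j
  proof (intro exI)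
    let ?w = "ws ! j"
    let ?p = "psubst gf (Cm ?w) :: (nat set, 'k) mpoly" and ?\<phi> = "\<lambda>x. pairing ?w (\<Phi> (\<tau> x)) :: 'k"
    note w = wsW[OF j] W_perms[OF wsW[OF j]]
    have prod: "\<tau> (?p * ?mb l) = Cm ?w * Dm (ws ! l)" if "l < ?b" for l
      using la.\<tau>_\<sigma>[OF Cm_polys[OF w(1)]] la.\<tau>_\<sigma>[OF Dm_polys[OF wsW[OF that]]] by simp
    show "fb.pairs_with (int kk) r j ?p ?\<phi>"
      unfolding fb.pairs_with_def
    proof (intro conjI allI ballI impI)
      show "?p \<in> polys P" by (rule la.\<sigma>_polys[OF Cm_polys[OF w(1)]])
      show "homogeneous (int kk - int (card (Des ?w))) ?p"
        by (rule la.\<sigma>_homogeneous[OF Cm_polys[OF w(1)] Cm_homogeneous[OF w(1)]])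
      show "?\<phi> (x + y) = ?\<phi> x + ?\<phi> y" for x y by (simp only: psubst_add pairing_add)
      show "?\<phi> (single 0 c * x) = c * ?\<phi> x" for c x by (simp only: psubst_mult psubst_const pairing_const_mult)
      show "?\<phi> x = 0" if "x \<in> J'" for x
        using that by (intro pairing_Bd[OF w(2)]) (auto simp: J'_def J_def)
      show "?\<phi> (Var v * x) = 0" if v: "v \<in> V0" and x: "x \<in> polys P" "homogeneous (int kk - 1) x" for v x
      proof -
        obtain i where i: "i < D" "v = {1..i}" using v by (auto simp: V0_def)
        show ?thesis unfolding i(2) psubst_mult psubst_Var tf_V0[OF i(1)]
          by (rule pairing_\<theta>[OF w(2) \<tau>_polys[OF x(1)] la.\<tau>_homogeneous[OF x]])
      qed
      show "?\<phi> (?p * ?mb j) = 1" unfolding prod[OF j] by (rule pairing_Cm_Dm[OF w(1)])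
      fix l assume l: "l < ?b" "l \<noteq> j"
      have ne: "ws ! l \<noteq> ?w" using l j ws(1) by (simp add: nth_eq_iff_index_eq)
      consider "?dg l < ?dg j" | "card (Des ?w) < card (Des (ws ! l))" | "?dg l = ?dg j" "?\<phi> (?p * ?mb l) = 0"
        | "card (Des ?w) = card (Des (ws ! l))" "?\<phi> (?p * ?mb l) \<noteq> 0" by linarith
      then show "?dg l < ?dg j \<or> ?dg l = ?dg j \<and> ?\<phi> (?p * ?mb l) = 0 \<or> (l, j) \<in> r"
      proof cases
        case 2
        then have "kk - card (Des (ws ! l)) < kk - card (Des ?w)" using card_le[OF l(1)] by linarith
        then show ?thesis by (simp add: r_def)
      next
        case 4
        then have "pairing ?w (\<Phi> (Cm ?w * Dm (ws ! l))) \<noteq> (0 :: 'k)" unfolding prod[OF l(1)] by simp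
        from pairing_triangular[OF w(1) wsW[OF l(1)] ne this] show ?thesis
          using 4(1) G_le[OF l(1)] by (auto simp: r_def)
      qed simp_all
    qed
  qed
  moreover have "wf r" by (simp add: r_def)
  moreover have "?dg j \<le> int kk" if "j < ?b" for j using card_le[OF that] by simp
  ultimately have "\<exists>e. generates_module (mpoly_ring P) (ext_module P ?F (card (P - V0)))
      (ext_component P ?F (card (P - V0)) e)"
    by (intro fb.ext_generated[OF la]) auto
  then show ?thesis
    unfolding level_algebra_def canonical_module_def canonical_component_def poset_ideal_P codim
    using standard_graded_presentation_P[where 'k = 'k] cm res unfolding poset_ideal_P by blast
qed

end

theorem theorem6p5:
  fixes n :: nat and I :: "nat set set"
  assumes "n \<ge> 1"
    and "rank_fixed (boolean_lattice n) I"
  shows "level_algebra (boolean_lattice n - I)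
           (poset_ideal (boolean_lattice n - I) :: (nat set, 'k::field) mpoly set)"
proof -
  obtain D where D: "D \<le> n + 1" "boolean_lattice n - I = {A. A \<subseteq> {1..n} \<and> card A < D}"
    by (rule rank_fixed_boolean_lattice[OF assms(2)])
  interpret truncated_boolean n D using assms(1) D(1) by unfold_locales
  show ?thesis using level_algebra_P[where 'k = 'k] unfolding P_def D(2) .
qed
end
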